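(* Let $\Bbbk$ be a field. (1) Let $W=\Bbbk[t](\mathbf x,\mathbf y,\sigma,h)$ be a quantum generalized Weyl algebra of degree $m>1$, with parameters $q_1,\dots,q_m$. Suppose that each $q_i$ is a root of unity, so $n_i=|\sigma_i|<\infty$, that $\gcd(n_i,n_j)=1$ for all $i\ne j$, and that $n_i>1$ for at least one $i$. Then the $\mathcal R$-discriminant of $W$ over its center $Z(W)$ exists and $\varrho(W/Z(W))=_{Z(W)^\times}t^{n^2(n-1)}$, where $n^2$ is the rank of $W$ over its center. (2) Suppose moreover that $\mathrm{char}\,\Bbbk=0$. Let $A$ be a tensor product over $\Bbbk$ of finitely many algebras, each of which is either a quantum generalized Weyl algebra satisfying the hypotheses in (1), or a degree one quantum generalized Weyl algebra $\Bbbk[t](x,y,\sigma,h)$ with $\sigma(t)=qt$, $q\neq 1$ a root of unity; assume that in every factor all the defining polynomials ($h_i$, resp. $h$) are not in $\Bbbk$. Then $A$ is cancellative.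
   Context: GWAs: let $R$ be a $\Bbbk$-algebra, $\sigma=(\sigma_1,\dots,\sigma_m)$ commuting automorphisms of $R$, and $h=(h_1,\dots,h_m)$ central regular elements of $R$ with $\sigma_i(h_j)=h_j$ for $i\neq j$. The generalized Weyl algebra $R(\mathbf x,\mathbf y,\sigma,h)$ of degree $m$ is the $\Bbbk$-algebra generated over $R$ by $x_1,\dots,x_m,y_1,\dots,y_m$ with relations $x_ir=\sigma_i(r)x_i$, $y_ir=\sigma_i^{-1}(r)y_i$ ($r\in R$), $x_iy_i=h_i$, $y_ix_i=\sigma_i^{-1}(h_i)$ for all $i$, and $[x_i,x_j]=[y_i,y_j]=[x_i,y_j]=0$ for $i\ne j$. It is quantum if $R=\Bbbk[t]$ and $\sigma_i(t)=q_it$ with $q_i\in\Bbbk\setminus\{0,1\}$ for all $i$; $|\sigma_i|$ is the order of $\sigma_i$. An algebra $A$ is cancellative if for any $\Bbbk$-algebra $B$, $A[x]\cong B[x]$ (as $\Bbbk$-algebras) implies $A\cong B$. Discriminants: let $Z$ be the center of a prime algebra $B$, with $B$ a finitely generated $Z$-module. Let $F$ be the fraction field of $Z$, $B_F=B\otimes_ZF$, and $w=\dim_FB_F$ the rank of $B$ over $Z$. The regular trace $\mathrm{tr}:B\to F$ sends $b$ to the trace of left multiplication by $b$ on $B_F$; it is required that $\mathrm{tr}(B)\subseteq Z$. $\mathrm{MD}(B/Z)$ is the ideal of $Z$ generated by all $\det\big(\mathrm{tr}(u_iu_j')\big)_{i,j=1}^w$, where $\{u_i\}_{i=1}^w,\{u_i'\}_{i=1}^w$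 range over all $w$-element subsets of $B$. With $M^\vee=\mathrm{Hom}_Z(M,Z)$, for an ideal $I$ of $Z$ the reflexive hull $I^{\vee\vee}$ is viewed as an ideal of $Z$ containing $I$. $d\in Z$ is an $\mathcal R$-discriminant of $B$ over $Z$, denoted $\varrho(B/Z)$, if $\mathrm{MD}(B/Z)^{\vee\vee}=dZ$; it is unique up to a unit of $Z$. $f=_{Z^\times}g$ means $f=cg$ for some $c\in Z^\times$. *)

theory Defs
  imports "HOL-Algebra.Algebra" "HOL-Combinatorics.Permutations"
begin

section \<open>Associative unital algebras\<close>

text \<open>
  The library locale \<^locale>\<open>algebra\<close> only covers commutative algebras, so the noncommutative
  version is introduced here, on the same record type.
\<close>

locale assoc_algebra = module R M + M?: ring M for R (structure) and M (structure) +
  assumes smult_mult_left: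
      "\<lbrakk>a \<in> carrier R; x \<in> carrier M; y \<in> carrier M\<rbrakk> \<Longrightarrow>
        (a \<odot>\<^bsub>M\<^esub> x) \<otimes>\<^bsub>M\<^esub> y = a \<odot>\<^bsub>M\<^esub> (x \<otimes>\<^bsub>M\<^esub> y)"
    and smult_mult_right:
      "\<lbrakk>a \<in> carrier R; x \<in> carrier M; y \<in> carrier M\<rbrakk> \<Longrightarrow>
        x \<otimes>\<^bsub>M\<^esub> (a \<odot>\<^bsub>M\<^esub> y) = a \<odot>\<^bsub>M\<^esub> (x \<otimes>\<^bsub>M\<^esub> y)"

definition alg_iso ::
    "('k, 'e) ring_scheme \<Rightarrow> ('k, 'a, 'x) module_scheme \<Rightarrow> ('k, 'b, 'y) module_scheme \<Rightarrow> ('a \<Rightarrow> 'b) set"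
  where "alg_iso K A B =
    {f \<in> ring_iso A B. \<forall>c\<in>carrier K. \<forall>a\<in>carrier A. f (c \<odot>\<^bsub>A\<^esub> a) = c \<odot>\<^bsub>B\<^esub> f a}"

definition alg_isomorphic ::
    "('k, 'e) ring_scheme \<Rightarrow> ('k, 'a, 'x) module_scheme \<Rightarrow> ('k, 'b, 'y) module_scheme \<Rightarrow> bool"
  where "alg_isomorphic K A B \<longleftrightarrow> alg_iso K A B \<noteq> {}"

text \<open>
  Automorphisms are taken extensional, as in \<^const>\<open>AutoGroup\<close>; powers, inverses and orders of
  automorphisms are those of this group.
\<close>

definition alg_aut_group ::
    "('k, 'e) ring_scheme \<Rightarrow> ('k, 'a, 'x) module_scheme \<Rightarrow> ('a \<Rightarrow> 'a) monoid"
  where "alg_aut_group K A =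
    BijGroup (carrier A) \<lparr>carrier := alg_iso K A A \<inter> Bij (carrier A)\<rparr>"

text \<open>The ring \<open>A\<close> equipped with the scalar multiplication \<open>s\<close>.\<close>

definition with_smult :: "('a, 'x) ring_scheme \<Rightarrow> ('r \<Rightarrow> 'a \<Rightarrow> 'a) \<Rightarrow> ('r, 'a) module"
  where "with_smult A s =
    \<lparr>carrier = carrier A, monoid.mult = monoid.mult A, one = one A,
     ring.zero = ring.zero A, add = add A, smult = s\<rparr>"

definition quotient_algebra :: "('r, 'a, 'x) module_scheme \<Rightarrow> 'a set \<Rightarrow> ('r, 'a set) module"
  where "quotient_algebra A I =
    with_smult (A Quot I) (\<lambda>c P. \<Union>x\<in>P. I +>\<^bsub>A\<^esub> (c \<odot>\<^bsub>A\<^esub> x))"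

text \<open>
  \<open>A[x]\<close> with \<open>x\<close> central. The ring is the library's \<^const>\<open>UP\<close>; only its scalars are changed from
  \<open>A\<close> to the base ring of \<open>A\<close>.
\<close>

definition poly_algebra :: "('r, 'a, 'x) module_scheme \<Rightarrow> ('r, nat \<Rightarrow> 'a) module"
  where "poly_algebra A = with_smult (UP A) (\<lambda>c p n. c \<odot>\<^bsub>A\<^esub> p n)"

text \<open>
  The algebras \<open>B\<close> range over one type, given by the first argument. A statement about
  \<^term>\<open>cancellative TYPE('b)\<close> with \<open>'b\<close> a free type variable is about all algebras.
\<close>

definition cancellative ::
    "'b itself \<Rightarrow> ('k, 'e) ring_scheme \<Rightarrow> ('k, 'a, 'x) module_scheme \<Rightarrow> bool"
  where "cancellative _ K A \<longleftrightarrow>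
    (\<forall>B :: ('k, 'b) module. assoc_algebra K B \<longrightarrow>
       alg_isomorphic K (poly_algebra A) (poly_algebra B) \<longrightarrow> alg_isomorphic K A B)"

definition char_zero :: "('k, 'e) ring_scheme \<Rightarrow> bool"
  where "char_zero K \<longleftrightarrow> (\<forall>n::nat. n > 0 \<longrightarrow> [n] \<cdot>\<^bsub>K\<^esub> \<one>\<^bsub>K\<^esub> \<noteq> \<zero>\<^bsub>K\<^esub>)"


section \<open>Monoid algebras, free algebras and tensor products\<close>

text \<open>
  Elements of the monoid algebra \<open>R[M]\<close> are finitely supported functions, equal to zero outside
  the carrier of \<open>M\<close>.
\<close>

definition monoid_algebra ::
    "('r, 'e) ring_scheme \<Rightarrow> ('m, 'x) monoid_scheme \<Rightarrow> ('r, 'm \<Rightarrow> 'r) module"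
  where "monoid_algebra R M =
    \<lparr>carrier = {f \<in> UNIV \<rightarrow> carrier R.
                 finite {x. f x \<noteq> \<zero>\<^bsub>R\<^esub>} \<and> {x. f x \<noteq> \<zero>\<^bsub>R\<^esub>} \<subseteq> carrier M},
     monoid.mult = (\<lambda>f g x. \<Oplus>\<^bsub>R\<^esub>p \<in> {(a, b). f a \<noteq> \<zero>\<^bsub>R\<^esub> \<and> g b \<noteq> \<zero>\<^bsub>R\<^esub> \<and> a \<otimes>\<^bsub>M\<^esub> b = x}.
                               f (fst p) \<otimes>\<^bsub>R\<^esub> g (snd p)),
     one = (\<lambda>x. if x = \<one>\<^bsub>M\<^esub> then \<one>\<^bsub>R\<^esub> else \<zero>\<^bsub>R\<^esub>),
     ring.zero = (\<lambda>x. \<zero>\<^bsub>R\<^esub>),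
     add = (\<lambda>f g x. f x \<oplus>\<^bsub>R\<^esub> g x),
     smult = (\<lambda>c f x. c \<otimes>\<^bsub>R\<^esub> f x)\<rparr>"

definition basis_elt :: "('r, 'e) ring_scheme \<Rightarrow> 'm \<Rightarrow> ('m \<Rightarrow> 'r)"
  where "basis_elt R x = (\<lambda>y. if y = x then \<one>\<^bsub>R\<^esub> else \<zero>\<^bsub>R\<^esub>)"

definition free_algebra :: "('r, 'e) ring_scheme \<Rightarrow> 'g set \<Rightarrow> ('r, 'g list \<Rightarrow> 'r) module"
  where "free_algebra R G = monoid_algebra R \<lparr>carrier = lists G, monoid.mult = (@), one = []\<rparr>"

text \<open>
  The tensor product of algebras is the free module on the tuples \<open>(a, b)\<close> modulo the
  multilinearity relations, with multiplication induced by the componentwise product of tuples.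
  The span of these relations is already an ideal of the monoid algebra on the tuples, so the
  quotient by the ideal they generate is the usual tensor product.
\<close>

definition tensor_relations ::
    "('r, 'e) ring_scheme \<Rightarrow> ('r, 'a, 'x) module_scheme \<Rightarrow> ('r, 'b, 'y) module_scheme
      \<Rightarrow> ('a \<times> 'b \<Rightarrow> 'r) set"
  where "tensor_relations R A B =
    (let S = monoid_algebra R (A \<times>\<times> B); e = basis_elt R in
      {e (a \<oplus>\<^bsub>A\<^esub> a', b) \<ominus>\<^bsub>S\<^esub> (e (a, b) \<oplus>\<^bsub>S\<^esub> e (a', b)) | a a' b.
         a \<in> carrier A \<and> a' \<in> carrier A \<and> b \<in> carrier B}
    \<union> {e (a, b \<oplus>\<^bsub>B\<^esub> b') \<ominus>\<^bsub>S\<^esub> (e (a, b) \<oplus>\<^bsub>S\<^esub> e (a, b')) | a b b'.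
         a \<in> carrier A \<and> b \<in> carrier B \<and> b' \<in> carrier B}
    \<union> {e (c \<odot>\<^bsub>A\<^esub> a, b) \<ominus>\<^bsub>S\<^esub> (c \<odot>\<^bsub>S\<^esub> e (a, b)) | c a b.
         c \<in> carrier R \<and> a \<in> carrier A \<and> b \<in> carrier B}
    \<union> {e (a, c \<odot>\<^bsub>B\<^esub> b) \<ominus>\<^bsub>S\<^esub> (c \<odot>\<^bsub>S\<^esub> e (a, b)) | c a b.
         c \<in> carrier R \<and> a \<in> carrier A \<and> b \<in> carrier B})"

definition tensor ::
    "('r, 'e) ring_scheme \<Rightarrow> ('r, 'a, 'x) module_scheme \<Rightarrow> ('r, 'b, 'y) module_scheme
      \<Rightarrow> ('r, ('a \<times> 'b \<Rightarrow> 'r) set) module"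
  where "tensor R A B =
    (let S = monoid_algebra R (A \<times>\<times> B) in quotient_algebra S (Idl\<^bsub>S\<^esub> (tensor_relations R A B)))"

definition pure_tensor ::
    "('r, 'e) ring_scheme \<Rightarrow> ('r, 'a, 'x) module_scheme \<Rightarrow> ('r, 'b, 'y) module_scheme
      \<Rightarrow> 'a \<Rightarrow> 'b \<Rightarrow> ('a \<times> 'b \<Rightarrow> 'r) set"
  where "pure_tensor R A B a b =
    (let S = monoid_algebra R (A \<times>\<times> B)
     in (Idl\<^bsub>S\<^esub> (tensor_relations R A B)) +>\<^bsub>S\<^esub> basis_elt R (a, b))"

definition tensor_family_relations ::
    "('r, 'e) ring_scheme \<Rightarrow> 'i set \<Rightarrow> ('i \<Rightarrow> ('r, 'a, 'x) module_scheme) \<Rightarrow> (('i \<Rightarrow> 'a) \<Rightarrow> 'r) set"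
  where "tensor_family_relations R I A =
    (let S = monoid_algebra R (product_group I A); e = basis_elt R in
      {e (f(i := a \<oplus>\<^bsub>A i\<^esub> b)) \<ominus>\<^bsub>S\<^esub> (e (f(i := a)) \<oplus>\<^bsub>S\<^esub> e (f(i := b))) | f i a b.
         f \<in> (\<Pi>\<^sub>E j\<in>I. carrier (A j)) \<and> i \<in> I \<and> a \<in> carrier (A i) \<and> b \<in> carrier (A i)}
    \<union> {e (f(i := c \<odot>\<^bsub>A i\<^esub> a)) \<ominus>\<^bsub>S\<^esub> (c \<odot>\<^bsub>S\<^esub> e (f(i := a))) | f i c a.
         f \<in> (\<Pi>\<^sub>E j\<in>I. carrier (A j)) \<and> i \<in> I \<and> c \<in> carrier R \<and> a \<in> carrier (A i)})"

definition tensor_family ::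
    "('r, 'e) ring_scheme \<Rightarrow> 'i set \<Rightarrow> ('i \<Rightarrow> ('r, 'a, 'x) module_scheme)
      \<Rightarrow> ('r, (('i \<Rightarrow> 'a) \<Rightarrow> 'r) set) module"
  where "tensor_family R I A =
    (let S = monoid_algebra R (product_group I A)
     in quotient_algebra S (Idl\<^bsub>S\<^esub> (tensor_family_relations R I A)))"


section \<open>Generalized Weyl algebras\<close>

text \<open>The indices \<open>1, \<dots>, m\<close> are shifted to \<open>0, \<dots>, m - 1\<close> throughout.\<close>

definition central_elt :: "('a, 'x) ring_scheme \<Rightarrow> 'a \<Rightarrow> bool"
  where "central_elt B z \<longleftrightarrow> z \<in> carrier B \<and> (\<forall>b\<in>carrier B. z \<otimes>\<^bsub>B\<^esub> b = b \<otimes>\<^bsub>B\<^esub> z)"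

definition regular_elt :: "('a, 'x) ring_scheme \<Rightarrow> 'a \<Rightarrow> bool"
  where "regular_elt B z \<longleftrightarrow> z \<in> carrier B \<and>
    (\<forall>b\<in>carrier B. (z \<otimes>\<^bsub>B\<^esub> b = \<zero>\<^bsub>B\<^esub> \<longrightarrow> b = \<zero>\<^bsub>B\<^esub>) \<and> (b \<otimes>\<^bsub>B\<^esub> z = \<zero>\<^bsub>B\<^esub> \<longrightarrow> b = \<zero>\<^bsub>B\<^esub>))"

definition gwa_data ::
    "('k, 'e) ring_scheme \<Rightarrow> ('k, 'r, 'x) module_scheme \<Rightarrow> nat \<Rightarrow> (nat \<Rightarrow> 'r \<Rightarrow> 'r) \<Rightarrow> (nat \<Rightarrow> 'r) \<Rightarrow> bool"
  where "gwa_data K R m \<sigma> h \<longleftrightarrow>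
    assoc_algebra K R \<and>
    (\<forall>i<m. \<sigma> i \<in> carrier (alg_aut_group K R)) \<and>
    (\<forall>i<m. \<forall>j<m. \<sigma> i \<otimes>\<^bsub>alg_aut_group K R\<^esub> \<sigma> j = \<sigma> j \<otimes>\<^bsub>alg_aut_group K R\<^esub> \<sigma> i) \<and>
    (\<forall>i<m. central_elt R (h i) \<and> regular_elt R (h i)) \<and>
    (\<forall>i<m. \<forall>j<m. i \<noteq> j \<longrightarrow> \<sigma> i (h j) = h j)"

datatype 'r gwa_gen = Coef 'r | GenX nat | GenY nat

definition gwa_free :: "('k, 'e) ring_scheme \<Rightarrow> ('k, 'r, 'x) module_scheme \<Rightarrow> nat
    \<Rightarrow> ('k, 'r gwa_gen list \<Rightarrow> 'k) module"
  where "gwa_free K R m = free_algebra K (Coef ` carrier R \<union> GenX ` {..<m} \<union> GenY ` {..<m})"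

text \<open>
  The first four families present \<open>R\<close> itself (they make \<open>r \<mapsto> Coef r\<close> a homomorphism of algebras);
  the others are the relations of a generalized Weyl algebra over \<open>R\<close>.
\<close>

definition gwa_relations ::
    "('k, 'e) ring_scheme \<Rightarrow> ('k, 'r, 'x) module_scheme \<Rightarrow> nat \<Rightarrow> (nat \<Rightarrow> 'r \<Rightarrow> 'r) \<Rightarrow> (nat \<Rightarrow> 'r)
      \<Rightarrow> ('r gwa_gen list \<Rightarrow> 'k) set"
  where "gwa_relations K R m \<sigma> h =
    (let S = gwa_free K R m;
         e = basis_elt K;
         \<tau> = (\<lambda>i. inv\<^bsub>alg_aut_group K R\<^esub> (\<sigma> i))
     in
      {e [Coef (r \<oplus>\<^bsub>R\<^esub> s)] \<ominus>\<^bsub>S\<^esub> (e [Coef r] \<oplus>\<^bsub>S\<^esub> e [Coef s]) | r s. r \<in> carrier R \<and> s \<in> carrier R}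
    \<union> {e [Coef (r \<otimes>\<^bsub>R\<^esub> s)] \<ominus>\<^bsub>S\<^esub> e [Coef r, Coef s] | r s. r \<in> carrier R \<and> s \<in> carrier R}
    \<union> {e [Coef (c \<odot>\<^bsub>R\<^esub> r)] \<ominus>\<^bsub>S\<^esub> (c \<odot>\<^bsub>S\<^esub> e [Coef r]) | c r. c \<in> carrier K \<and> r \<in> carrier R}
    \<union> {e [Coef \<one>\<^bsub>R\<^esub>] \<ominus>\<^bsub>S\<^esub> \<one>\<^bsub>S\<^esub>}
    \<union> {e [GenX i, Coef r] \<ominus>\<^bsub>S\<^esub> e [Coef (\<sigma> i r), GenX i] | i r. i < m \<and> r \<in> carrier R}
    \<union> {e [GenY i, Coef r] \<ominus>\<^bsub>S\<^esub> e [Coef (\<tau> i r), GenY i] | i r. i < m \<and> r \<in> carrier R}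
    \<union> {e [GenX i, GenY i] \<ominus>\<^bsub>S\<^esub> e [Coef (h i)] | i. i < m}
    \<union> {e [GenY i, GenX i] \<ominus>\<^bsub>S\<^esub> e [Coef (\<tau> i (h i))] | i. i < m}
    \<union> {e [GenX i, GenX j] \<ominus>\<^bsub>S\<^esub> e [GenX j, GenX i] | i j. i < m \<and> j < m \<and> i \<noteq> j}
    \<union> {e [GenY i, GenY j] \<ominus>\<^bsub>S\<^esub> e [GenY j, GenY i] | i j. i < m \<and> j < m \<and> i \<noteq> j}
    \<union> {e [GenX i, GenY j] \<ominus>\<^bsub>S\<^esub> e [GenY j, GenX i] | i j. i < m \<and> j < m \<and> i \<noteq> j})"

definition gwa_ideal ::
    "('k, 'e) ring_scheme \<Rightarrow> ('k, 'r, 'x) module_scheme \<Rightarrow> nat \<Rightarrow> (nat \<Rightarrow> 'r \<Rightarrow> 'r) \<Rightarrow> (nat \<Rightarrow> 'r)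
      \<Rightarrow> ('r gwa_gen list \<Rightarrow> 'k) set"
  where "gwa_ideal K R m \<sigma> h = Idl\<^bsub>gwa_free K R m\<^esub> (gwa_relations K R m \<sigma> h)"

definition gwa ::
    "('k, 'e) ring_scheme \<Rightarrow> ('k, 'r, 'x) module_scheme \<Rightarrow> nat \<Rightarrow> (nat \<Rightarrow> 'r \<Rightarrow> 'r) \<Rightarrow> (nat \<Rightarrow> 'r)
      \<Rightarrow> ('k, ('r gwa_gen list \<Rightarrow> 'k) set) module"
  where "gwa K R m \<sigma> h = quotient_algebra (gwa_free K R m) (gwa_ideal K R m \<sigma> h)"

text \<open>The structure map \<open>R \<rightarrow> R(x, y, \<sigma>, h)\<close>.\<close>

definition gwa_coef ::
    "('k, 'e) ring_scheme \<Rightarrow> ('k, 'r, 'x) module_scheme \<Rightarrow> nat \<Rightarrow> (nat \<Rightarrow> 'r \<Rightarrow> 'r) \<Rightarrow> (nat \<Rightarrow> 'r)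
      \<Rightarrow> 'r \<Rightarrow> ('r gwa_gen list \<Rightarrow> 'k) set"
  where "gwa_coef K R m \<sigma> h r =
    gwa_ideal K R m \<sigma> h +>\<^bsub>gwa_free K R m\<^esub> basis_elt K [Coef r]"

definition var_t :: "('k, 'e) ring_scheme \<Rightarrow> (nat \<Rightarrow> 'k)"
  where "var_t K = monom (UP K) \<one>\<^bsub>K\<^esub> 1"

definition quantum_gwa_data ::
    "('k, 'e) ring_scheme \<Rightarrow> nat \<Rightarrow> (nat \<Rightarrow> 'k) \<Rightarrow> (nat \<Rightarrow> (nat \<Rightarrow> 'k) \<Rightarrow> nat \<Rightarrow> 'k) \<Rightarrow> (nat \<Rightarrow> nat \<Rightarrow> 'k) \<Rightarrow> bool"
  where "quantum_gwa_data K m q \<sigma> h \<longleftrightarrow>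
    gwa_data K (UP K) m \<sigma> h \<and>
    (\<forall>i<m. q i \<in> carrier K - {\<zero>\<^bsub>K\<^esub>, \<one>\<^bsub>K\<^esub>} \<and> \<sigma> i (var_t K) = q i \<odot>\<^bsub>UP K\<^esub> var_t K)"

definition root_of_unity :: "('k, 'e) ring_scheme \<Rightarrow> 'k \<Rightarrow> bool"
  where "root_of_unity K q \<longleftrightarrow> q \<in> carrier K \<and> (\<exists>r::nat. r > 0 \<and> q [^]\<^bsub>K\<^esub> r = \<one>\<^bsub>K\<^esub>)"

abbreviation aut_order ::
    "('k, 'e) ring_scheme \<Rightarrow> ('k, 'a, 'x) module_scheme \<Rightarrow> ('a \<Rightarrow> 'a) \<Rightarrow> nat"
  where "aut_order K A s \<equiv> group.ord (alg_aut_group K A) s"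

text \<open>
  \<^const>\<open>group.ord\<close> is \<open>0\<close> on elements of infinite order, which the root of unity hypothesis
  excludes.
\<close>

definition coprime_quantum_gwa_data ::
    "('k, 'e) ring_scheme \<Rightarrow> nat \<Rightarrow> (nat \<Rightarrow> 'k) \<Rightarrow> (nat \<Rightarrow> (nat \<Rightarrow> 'k) \<Rightarrow> nat \<Rightarrow> 'k) \<Rightarrow> (nat \<Rightarrow> nat \<Rightarrow> 'k) \<Rightarrow> bool"
  where "coprime_quantum_gwa_data K m q \<sigma> h \<longleftrightarrow>
    quantum_gwa_data K m q \<sigma> h \<and> m > 1 \<and>
    (\<forall>i<m. root_of_unity K (q i)) \<and>
    (\<forall>i<m. \<forall>j<m. i \<noteq> j \<longrightarrow> coprime (aut_order K (UP K) (\<sigma> i)) (aut_order K (UP K) (\<sigma> j))) \<and>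
    (\<exists>i<m. aut_order K (UP K) (\<sigma> i) > 1)"


section \<open>Bases, traces and determinants\<close>

definition is_basis ::
    "('f, 'e) ring_scheme \<Rightarrow> ('f, 'v, 'x) module_scheme \<Rightarrow> nat \<Rightarrow> (nat \<Rightarrow> 'v) \<Rightarrow> bool"
  where "is_basis F V w v \<longleftrightarrow>
    v \<in> {..<w} \<rightarrow> carrier V \<and>
    (\<forall>x\<in>carrier V. \<exists>!c. c \<in> {..<w} \<rightarrow>\<^sub>E carrier F \<and> x = (\<Oplus>\<^bsub>V\<^esub>i\<in>{..<w}. c i \<odot>\<^bsub>V\<^esub> v i))"

definition coordinates ::
    "('f, 'e) ring_scheme \<Rightarrow> ('f, 'v, 'x) module_scheme \<Rightarrow> nat \<Rightarrow> (nat \<Rightarrow> 'v) \<Rightarrow> 'v \<Rightarrow> (nat \<Rightarrow> 'f)"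
  where "coordinates F V w v x =
    (THE c. c \<in> {..<w} \<rightarrow>\<^sub>E carrier F \<and> x = (\<Oplus>\<^bsub>V\<^esub>i\<in>{..<w}. c i \<odot>\<^bsub>V\<^esub> v i))"

text \<open>
  Both the dimension and the trace are only meaningful if \<open>V\<close> has a finite basis; they do not
  depend on it when \<open>F\<close> is a field.
\<close>

definition vs_dim :: "('f, 'e) ring_scheme \<Rightarrow> ('f, 'v, 'x) module_scheme \<Rightarrow> nat"
  where "vs_dim F V = (THE w. \<exists>v. is_basis F V w v)"

definition trace ::
    "('f, 'e) ring_scheme \<Rightarrow> ('f, 'v, 'x) module_scheme \<Rightarrow> ('v \<Rightarrow> 'v) \<Rightarrow> 'f"
  where "trace F V f =
    (THE s. \<exists>w v. is_basis F V w v \<and> s = (\<Oplus>\<^bsub>F\<^esub>i\<in>{..<w}. coordinates F V w v (f (v i)) i))"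

definition ring_det :: "('r, 'e) ring_scheme \<Rightarrow> nat \<Rightarrow> (nat \<Rightarrow> nat \<Rightarrow> 'r) \<Rightarrow> 'r"
  where "ring_det R w a =
    (\<Oplus>\<^bsub>R\<^esub>p\<in>{p. p permutes {..<w}}.
       if evenperm p then (\<Otimes>\<^bsub>R\<^esub>i\<in>{..<w}. a i (p i)) else \<ominus>\<^bsub>R\<^esub> (\<Otimes>\<^bsub>R\<^esub>i\<in>{..<w}. a i (p i)))"


section \<open>Fraction fields and reflexive hulls\<close>

definition fraction :: "('a, 'x) ring_scheme \<Rightarrow> 'a \<Rightarrow> 'a \<Rightarrow> ('a \<times> 'a) set"
  where "fraction Z a b =
    {(c, d). c \<in> carrier Z \<and> d \<in> carrier Z - {\<zero>\<^bsub>Z\<^esub>} \<and> a \<otimes>\<^bsub>Z\<^esub> d = c \<otimes>\<^bsub>Z\<^esub> b}"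

definition fraction_ring :: "('a, 'x) ring_scheme \<Rightarrow> ('a \<times> 'a) set ring"
  where "fraction_ring Z =
    \<lparr>carrier = {fraction Z a b | a b. a \<in> carrier Z \<and> b \<in> carrier Z - {\<zero>\<^bsub>Z\<^esub>}},
     monoid.mult = (\<lambda>P Q. \<Union>(a, b)\<in>P. \<Union>(c, d)\<in>Q. fraction Z (a \<otimes>\<^bsub>Z\<^esub> c) (b \<otimes>\<^bsub>Z\<^esub> d)),
     one = fraction Z \<one>\<^bsub>Z\<^esub> \<one>\<^bsub>Z\<^esub>,
     ring.zero = fraction Z \<zero>\<^bsub>Z\<^esub> \<one>\<^bsub>Z\<^esub>,
     add = (\<lambda>P Q. \<Union>(a, b)\<in>P. \<Union>(c, d)\<in>Q.
              fraction Z (a \<otimes>\<^bsub>Z\<^esub> d \<oplus>\<^bsub>Z\<^esub> c \<otimes>\<^bsub>Z\<^esub> b) (b \<otimes>\<^bsub>Z\<^esub> d))\<rparr>"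

definition fraction_field :: "('a, 'x) ring_scheme \<Rightarrow> ('a, ('a \<times> 'a) set) module"
  where "fraction_field Z =
    with_smult (fraction_ring Z) (\<lambda>z P. fraction Z z \<one>\<^bsub>Z\<^esub> \<otimes>\<^bsub>fraction_ring Z\<^esub> P)"

definition module_hom ::
    "('r, 'e) ring_scheme \<Rightarrow> ('r, 'a, 'x) module_scheme \<Rightarrow> ('r, 'b, 'y) module_scheme \<Rightarrow> ('a \<Rightarrow> 'b) set"
  where "module_hom R M N =
    {f \<in> carrier M \<rightarrow>\<^sub>E carrier N.
       (\<forall>x\<in>carrier M. \<forall>y\<in>carrier M. f (x \<oplus>\<^bsub>M\<^esub> y) = f x \<oplus>\<^bsub>N\<^esub> f y) \<and>
       (\<forall>c\<in>carrier R. \<forall>x\<in>carrier M. f (c \<odot>\<^bsub>M\<^esub> x) = c \<odot>\<^bsub>N\<^esub> f x)}"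

text \<open>
  The fields \<^const>\<open>monoid.mult\<close> and \<^const>\<open>one\<close> of a record used only as a module are irrelevant.
\<close>

definition dual_module ::
    "('r, 'e) ring_scheme \<Rightarrow> ('r, 'a, 'x) module_scheme \<Rightarrow> ('r, 'a \<Rightarrow> 'r) module"
  where "dual_module Z M =
    \<lparr>carrier = module_hom Z M (with_smult Z (monoid.mult Z)),
     monoid.mult = undefined, one = undefined,
     ring.zero = (\<lambda>x\<in>carrier M. \<zero>\<^bsub>Z\<^esub>),
     add = (\<lambda>f g. \<lambda>x\<in>carrier M. f x \<oplus>\<^bsub>Z\<^esub> g x),
     smult = (\<lambda>c f. \<lambda>x\<in>carrier M. c \<otimes>\<^bsub>Z\<^esub> f x)\<rparr>"

definition ideal_module :: "('r, 'e) ring_scheme \<Rightarrow> 'r set \<Rightarrow> ('r, 'r) module"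
  where "ideal_module Z I = (with_smult Z (monoid.mult Z)) \<lparr>carrier := I\<rparr>"

text \<open>
  The double dual of the inclusion \<open>I \<subseteq> Z\<close> is a map from the double dual of \<open>I\<close> to the double dual of
  \<open>Z\<close>. Identifying the latter with \<open>Z\<close> (by evaluation at the identity), it sends \<open>\<phi>\<close> to the value of
  \<open>\<phi>\<close> at the inclusion, viewed as a linear form on \<open>I\<close>. The reflexive hull, as an ideal of \<open>Z\<close>, is
  the image of this map.
\<close>

definition reflexive_hull :: "('r, 'e) ring_scheme \<Rightarrow> 'r set \<Rightarrow> 'r set"
  where "reflexive_hull Z I =
    (\<lambda>\<phi>. \<phi> (\<lambda>x\<in>I. x)) ` carrier (dual_module Z (dual_module Z (ideal_module Z I)))"


section \<open>Discriminants over the center\<close>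

definition center :: "('b, 'x) ring_scheme \<Rightarrow> 'b ring"
  where "center B =
    \<lparr>carrier = {z. central_elt B z}, monoid.mult = monoid.mult B, one = one B,
     ring.zero = ring.zero B, add = add B\<rparr>"

definition over_center :: "('b, 'x) ring_scheme \<Rightarrow> ('b, 'b) module"
  where "over_center B = with_smult B (monoid.mult B)"

definition prime_ring :: "('b, 'x) ring_scheme \<Rightarrow> bool"
  where "prime_ring B \<longleftrightarrow> ring B \<and> \<one>\<^bsub>B\<^esub> \<noteq> \<zero>\<^bsub>B\<^esub> \<and>
    (\<forall>a\<in>carrier B. \<forall>b\<in>carrier B.
       (\<forall>r\<in>carrier B. a \<otimes>\<^bsub>B\<^esub> r \<otimes>\<^bsub>B\<^esub> b = \<zero>\<^bsub>B\<^esub>) \<longrightarrow> a = \<zero>\<^bsub>B\<^esub> \<or> b = \<zero>\<^bsub>B\<^esub>)"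

definition fin_gen_module :: "('r, 'e) ring_scheme \<Rightarrow> ('r, 'a, 'x) module_scheme \<Rightarrow> bool"
  where "fin_gen_module R M \<longleftrightarrow>
    (\<exists>S. finite S \<and> S \<subseteq> carrier M \<and>
      (\<forall>x\<in>carrier M. \<exists>c \<in> S \<rightarrow> carrier R. x = (\<Oplus>\<^bsub>M\<^esub>s\<in>S. c s \<odot>\<^bsub>M\<^esub> s)))"

abbreviation center_field :: "('b, 'x) ring_scheme \<Rightarrow> ('b, ('b \<times> 'b) set) module"
  where "center_field B \<equiv> fraction_field (center B)"

text \<open>\<open>B \<otimes>\<^sub>Z F\<close> as an algebra over \<open>F\<close>, the scalar \<open>f\<close> acting as multiplication by \<open>1 \<otimes> f\<close>.\<close>

definition localized ::
    "('b, 'x) ring_scheme \<Rightarrow> (('b \<times> 'b) set, ('b \<times> ('b \<times> 'b) set \<Rightarrow> 'b) set) module"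
  where "localized B =
    (let Z = center B; F = center_field B; T = tensor Z (over_center B) F
     in with_smult T (\<lambda>f x. pure_tensor Z (over_center B) F \<one>\<^bsub>B\<^esub> f \<otimes>\<^bsub>T\<^esub> x))"

definition center_rank :: "('b, 'x) ring_scheme \<Rightarrow> nat"
  where "center_rank B = vs_dim (center_field B) (localized B)"

definition regular_trace :: "('b, 'x) ring_scheme \<Rightarrow> 'b \<Rightarrow> ('b \<times> 'b) set"
  where "regular_trace B b =
    trace (center_field B) (localized B)
      (\<lambda>x. pure_tensor (center B) (over_center B) (center_field B) b \<one>\<^bsub>center_field B\<^esub>
             \<otimes>\<^bsub>localized B\<^esub> x)"

definition center_embedding :: "('b, 'x) ring_scheme \<Rightarrow> 'b \<Rightarrow> ('b \<times> 'b) set"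
  where "center_embedding B z = fraction (center B) z \<one>\<^bsub>B\<^esub>"

definition discriminant_setting :: "('b, 'x) ring_scheme \<Rightarrow> bool"
  where "discriminant_setting B \<longleftrightarrow>
    prime_ring B \<and> fin_gen_module (center B) (over_center B) \<and>
    regular_trace B ` carrier B \<subseteq> center_embedding B ` carrier (center B)"

text \<open>
  A \<open>w\<close>-element subset is given by an injective enumeration; another enumeration only changes the
  sign of the determinant.
\<close>

definition modified_discriminant_ideal :: "('b, 'x) ring_scheme \<Rightarrow> 'b set"
  where "modified_discriminant_ideal B =
    (let w = center_rank B in
      Idl\<^bsub>center B\<^esub> {z \<in> carrier (center B).
        \<exists>u u'. u \<in> {..<w} \<rightarrow> carrier B \<and> inj_on u {..<w} \<and>
               u' \<in> {..<w} \<rightarrow> carrier B \<and> inj_on u' {..<w} \<and>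
               center_embedding B z =
                 ring_det (center_field B) w (\<lambda>i j. regular_trace B (u i \<otimes>\<^bsub>B\<^esub> u' j))})"

definition is_R_discriminant :: "('b, 'x) ring_scheme \<Rightarrow> 'b \<Rightarrow> bool"
  where "is_R_discriminant B d \<longleftrightarrow>
    discriminant_setting B \<and> d \<in> carrier (center B) \<and>
    reflexive_hull (center B) (modified_discriminant_ideal B) = PIdl\<^bsub>center B\<^esub> d"

definition eq_up_to_unit :: "('a, 'x) ring_scheme \<Rightarrow> 'a \<Rightarrow> 'a \<Rightarrow> bool"
  where "eq_up_to_unit Z f g \<longleftrightarrow> (\<exists>c\<in>Units Z. f = c \<otimes>\<^bsub>Z\<^esub> g)"

end

(* A quantum generalized Weyl algebra embeds into a quantum torus: x_i and t go to generators, y_i to h_i x_i^(-1). The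
   least exponents of the images of the monomials t^k x^a y^b are pairwise distinct, so computations can be made with them.
   Cancellation. An isomorphism A[x] -> B[y] can be compared degree by degree in y. The images of the noncentral normal
   elements t of the factors are homogeneous because rescalings of y act on them, and they have degree 0 since
   they q-commute with other elements; then B is obtained from A by specializing the central variable.
   Discriminant. With n the product of the n_i, the center consists of the elements whose exponents lie in the lattice
   n Z x n_1 Z x ... x n_m Z, and the regular trace is n^2 times the projection onto that lattice. For a sign pattern Y the weight
   nu_Y gives the t-degree after replacing the x_i with i in Y by y_i. A determinant expanded along the classes modulo the lattice
   has nu_Y at least n^2 (n - 1) for all Y, hence is divisible by t^(n^2 (n - 1)). Conversely t^(n^2 (n - 1)) z_Y is
   a determinant, where z_Y is a product of powers of x_i (i not in Y) and y_i (i in Y), and an element of the quantum torus all of whose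
   products with the z_Y lie in the algebra lies in the algebra itself, so the reflexive hull is generated by t^(n^2 (n - 1)). *)
theory Submission
  imports Defs "HOL-Library.Poly_Mapping" "HOL-Library.Product_Lexorder" "HOL-Number_Theory.Cong"
begin

\<comment> \<open>The presentation gives spanning by the monomials t^k z^a but not their
  independence. The torus supplies it, and more: below each index of a linear combination some index
  keeps its least exponent uncancelled, so conditions on torus supports become membership in spans
  of monomials, above all divisibility by powers of t. The exponent n^2 (n - 1) counts classes
  modulo the lattice. By the Chinese remainder theorem the x-exponents fall into n classes,
  represented by powers of x_1 ... x_m; with the residue of the t-exponent there are n^2. A class of
  residue 0 pairs with its dual without loss, each of the n (n - 1) others costs t^n. The weight
  nu_Y is sharp for the monomials whose negative x-exponents are those in Y, so all patterns Y are
  needed; and as z_Y need not be a unit, it is the hull and not the ideal itself that is compared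
  with t^(n^2 (n - 1)). For cancellation, multiples of t are recognized by their commutation scalars
  with t and one x_i. Since t-exponents are then 1 modulo an order of at least 2, they cannot be
  0.\<close>
text \<open>Input notation: \<open>\<oplus>.M\<close> stands for \<open>\<oplus>\<^bsub>M\<^esub>\<close>, \<open>x :.M\<close> for \<open>x \<in> carrier M\<close>, and \<open>**\<close>, \<open>*:\<close>, \<open>+:\<close>, \<open>0:\<close>, \<open>1:\<close>, \<open>++i:I.\<close> for
 \<open>\<otimes>\<close>, \<open>\<odot>\<close>, \<open>\<oplus>\<close>, \<open>\<zero>\<close>, \<open>\<one>\<close>, \<open>\<Oplus>i\<in>I.\<close>.\<close>

syntax "_index" :: "logic => index" ("._" [1000])
syntax "_finsum" :: "index => idt => 'a set => 'b => 'b" ("(3++__:_./ _)" [1000, 0, 51, 10] 10)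
notation (input) monoid.mult (infixl "**\<index>" 70) and module.smult (infixl "*:\<index>" 70) and
 ring.add (infixl "+:\<index>" 65) and ring.zero ("0:\<index>") and monoid.one ("1:\<index>") and partial_object.carrier ("car")
abbreviation (input) elt ("(_/ :._)" [51, 1000] 50) where "elt x M == x : carrier M"

section \<open>Twisted monoid algebras\<close>

text \<open>For \<open>c\<close> identically one this is \<open>monoid_algebra\<close>; for a
  bicharacter on a group of exponents it is a quantum torus. The ring axioms are proved once for
  both.\<close>

definition twisted_algebra ::
 "('r, 'e) ring_scheme => ('m, 'x) monoid_scheme => ('m => 'm => 'r) => ('r, 'm => 'r) module"
 where "twisted_algebra R M c =
 \<lparr>carrier = {f : UNIV \<rightarrow> car R.
 finite {x. f x ~= 0:.R} & {x. f x ~= 0:.R} <= car M},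
 monoid.mult = (%f g x. ++.R p:{(a, b). f a ~= 0:.R & g b ~= 0:.R & a**.M b = x}.
 c (fst p) (snd p)**.R (f (fst p)**.R g (snd p))),
 one = (%x. if x = 1:.M then 1:.R else 0:.R),
 ring.zero = (%x. 0:.R),
 add = (%f g x. f x +:.R g x),
 smult = (%c f x. c**.R f x)\<rparr>"

definition single :: "('r, 'e) ring_scheme => 'm => 'r => ('m => 'r)"
 where "single R x r = (%y. if y = x then r else 0:.R)"

text \<open>The identity \<open>c_cocycle\<close> is associativity on basis elements; the two
  normalizations make the basis element at the neutral element the unit.\<close>

locale twist = R?: cring R + M: monoid M
 for R :: "('r, 'e) ring_scheme" (structure) and M :: "('m, 'x) monoid_scheme" +
 fixes c :: "'m => 'm => 'r"
 assumes c_closed: "a :.M ==> b :.M ==> c a b :.R"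
 and c_cocycle: "a :.M ==> b :.M ==> d :.M ==>
 c a b**c (a**.M b) d = c b d**c a (b**.M d)"
 and c_one_left: "a :.M ==> c 1:.M a = 1:"
 and c_one_right: "a :.M ==> c a 1:.M = 1:"
begin

abbreviation L where "L == twisted_algebra R M c"

lemma in_L_iff: "f : car L \<longleftrightarrow>
 (ALL x. f x :.R) & finite {x. f x ~= 0:} & {x. f x ~= 0:} <= car M"
 by (auto simp: twisted_algebra_def)

lemma L_value: "f :.L ==> f x :.R"
 by (simp add: in_L_iff)

lemma L_support: "f :.L ==> f x ~= 0: ==> x :.M"
 by (auto simp: in_L_iff)

lemma L_finite: "f :.L ==> finite {x. f x ~= 0:}"
 by (simp add: in_L_iff)

lemma L_add: "f +:.L g = (%x. f x +: g x)"
 by (simp add: twisted_algebra_def)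

lemma L_zero: "0:.L = (%x. 0:)"
 by (simp add: twisted_algebra_def)

lemma L_one: "1:.L = single R 1:.M 1:"
 by (simp add: twisted_algebra_def single_def)

lemma L_smult: "k *:.L f = (%x. k**f x)"
 by (simp add: twisted_algebra_def)

text \<open>The sum in the definition runs over a set depending on both supports. Over a fixed
  rectangle the index set no longer moves with the factors, so that bilinearity becomes a termwise
  statement.\<close>

lemma L_mult:
 assumes "f :.L" "g :.L" "finite A" "finite B"
 "{x. f x ~= 0:} <= A" "{x. g x ~= 0:} <= B" "A <= car M" "B <= car M"
 shows "(f**.L g) x = (++p:A \<times> B.
 if fst p**.M snd p = x then c (fst p) (snd p)**(f (fst p)**g (snd p)) else 0:)"
proof -
 have "(f**.L g) x = (++p:{(a, b). f a ~= 0: & g b ~= 0: & a**.M b = x}.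
 c (fst p) (snd p)**(f (fst p)**g (snd p)))"
 by (simp add: twisted_algebra_def)
 also have "... = (++p:A \<times> B.
 if fst p**.M snd p = x then c (fst p) (snd p)**(f (fst p)**g (snd p)) else 0:)"
 proof (rule add.finprod_mono_neutral_cong_left)
 show "finite (A \<times> B)" using assms by simp
 show "{(a, b). f a ~= 0: & g b ~= 0: & a**.M b = x} <= A \<times> B" using assms by auto
 show "(if fst p**.M snd p = x then c (fst p) (snd p)**(f (fst p)**g (snd p)) else 0:) = 0:"
 if "p : A \<times> B - {(a, b). f a ~= 0: & g b ~= 0: & a**.M b = x}" for p
 proof -
 have "fst p :.M" "snd p :.M" using that assms by auto
 thus ?thesis using that L_value[OF assms(1)] L_value[OF assms(2)] by (cases p) (auto simp: c_closed)
 qed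
 show "(%p. if fst p**.M snd p = x then c (fst p) (snd p)**(f (fst p)**g (snd p)) else 0:) : A \<times> B \<rightarrow> car R"
 proof
 fix p assume "p : A \<times> B"
 hence "fst p :.M" "snd p :.M" using assms by auto
 thus "(if fst p**.M snd p = x then c (fst p) (snd p)**(f (fst p)**g (snd p)) else 0:) :.R"
 using L_value[OF assms(1)] L_value[OF assms(2)] by (auto simp: c_closed)
 qed
 qed auto
 finally show ?thesis .
qed

lemma L_mult_term_closed:
 assumes "f :.L" "g :.L" "A <= car M" "B <= car M" "p : A \<times> B"
 shows "(if fst p**.M snd p = x then c (fst p) (snd p)**(f (fst p)**g (snd p)) else 0:) :.R"
proof -
 have "fst p :.M" "snd p :.M" using assms by auto
 thus ?thesis using L_value[OF assms(1)] L_value[OF assms(2)] by (auto simp: c_closed)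
qed

lemma L_mult_support:
 assumes "f :.L" "g :.L" "(f**.L g) x ~= 0:"
 obtains a b where "f a ~= 0:" "g b ~= 0:" "x = a**.M b"
proof -
 have "EX a b. f a ~= 0: & g b ~= 0: & a**.M b = x"
 proof (rule ccontr)
 assume "~ ?thesis"
 hence e: "{(a, b). f a ~= 0: & g b ~= 0: & a**.M b = x} = {}" by blast
 have "(f**.L g) x = (++p:{(a, b). f a ~= 0: & g b ~= 0: & a**.M b = x}.
 c (fst p) (snd p)**(f (fst p)**g (snd p)))"
 by (simp add: twisted_algebra_def)
 also have "... = 0:" unfolding e by simp
 finally have "(f**.L g) x = 0:" .
 thus False using assms by simp
 qed
 thus thesis using that by auto
qed

lemma L_mult_closed:
 assumes "f :.L" "g :.L"
 shows "f**.L g :.L"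
 unfolding in_L_iff
proof (intro conjI allI)
 let ?A = "{x. f x ~= 0:}" and ?B = "{x. g x ~= 0:}"
 have AB: "finite ?A" "finite ?B" "?A <= car M" "?B <= car M"
 using assms unfolding in_L_iff by blast+
 show "(f**.L g) x :.R" for x
 unfolding L_mult[OF assms AB(1,2) order_refl order_refl AB(3,4)]
 by (rule finsum_closed) (use L_mult_term_closed[OF assms AB(3,4)] in blast)
 have "{x. (f**.L g) x ~= 0:} <= (%p. fst p**.M snd p) ` (?A \<times> ?B)"
 using L_mult_support[OF assms] by (smt (verit, best) SigmaI fst_conv image_iff mem_Collect_eq snd_conv subsetI)
 thus "finite {x. (f**.L g) x ~= 0:}" using AB by (meson finite_SigmaI finite_imageI finite_subset)
 show "{x. (f**.L g) x ~= 0:} <= car M"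
 proof safe
 fix x assume "(f**.L g) x ~= 0:"
 then obtain a b where "f a ~= 0:" "g b ~= 0:" "x = a**.M b" using L_mult_support[OF assms] by blast
 thus "x :.M" using L_support[OF assms(1)] L_support[OF assms(2)] by blast
 qed
qed

lemma L_add_closed:
 assumes "f :.L" "g :.L"
 shows "f +:.L g :.L"
proof -
 have "{x. f x +: g x ~= 0:} <= {x. f x ~= 0:} \<union> {x. g x ~= 0:}" by auto
 moreover have "finite ({x. f x ~= 0:} \<union> {x. g x ~= 0:})" "{x. f x ~= 0:} \<union> {x. g x ~= 0:} <= car M" "!!x. f x :.R"  "!!x. g x :.R"
 using assms unfolding in_L_iff by blast+
 ultimately show ?thesis unfolding in_L_iff L_add by (meson finite_subset order_trans a_closed)
qed

lemma L_smult_closed: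
 assumes "k :.R" "f :.L"
 shows "k *:.L f :.L"
proof -
 have "{x. k**f x ~= 0:} <= {x. f x ~= 0:}" using assms by auto
 moreover have "finite {x. f x ~= 0:}" "{x. f x ~= 0:} <= car M" "!!x. f x :.R"
 using assms unfolding in_L_iff by blast+
 ultimately show ?thesis using assms(1) unfolding in_L_iff L_smult by (meson finite_subset order_trans m_closed)
qed

lemma L_zero_closed: "0:.L :.L"
 by (simp add: in_L_iff L_zero)

lemma single_closed [simp, intro]:
 assumes "x :.M" "r :.R" shows "single R x r :.L"
proof -
 have "{y. single R x r y ~= 0:} <= {x}" by (auto simp: single_def)
 thus ?thesis using assms finite_subset[of _ "{x}"] unfolding in_L_iff by (auto simp: single_def)
qed

lemma L_one_closed: "1:.L :.L"
 by (simp add: L_one)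

lemma L_induct [consumes 1, case_names zero single add]:
 assumes "f :.L" "P 0:.L"
 "!!x r. x :.M ==> r :.R ==> P (single R x r)"
 "!!f g. f :.L ==> g :.L ==> P f ==> P g ==> P (f +:.L g)"
 shows "P f"
proof -
 have "finite S ==> f :.L ==> {x. f x ~= 0:} <= S ==> P f" for S f
 proof (induction S arbitrary: f rule: finite_induct)
 case empty
 hence "f = 0:.L" by (auto simp: L_zero)
 thus ?case using assms by simp
 next
 case (insert s S)
 show ?case
 proof (cases "s :.M")
 case True
 let ?g = "%x. if x = s then 0: else f x"
 have sub: "{x. ?g x ~= 0:} <= {x. f x ~= 0:}" by auto
 note f = insert.prems(1)[unfolded in_L_iff]
 have g: "?g :.L" unfolding in_L_iff using f finite_subset[OF sub] sub by (metis (lifting) order_trans zero_closed)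
 have Pg: "P ?g" using insert.prems by (intro insert.IH g) auto
 have fs: "f s :.R" using f by blast
 have eq: "f = ?g +:.L single R s (f s)"
 using f by (simp add: L_add single_def fun_eq_iff)
 have "P (?g +:.L single R s (f s))"
 by (rule assms(4)[OF g single_closed[OF True fs] Pg assms(3)[OF True fs]])
 thus ?thesis by (subst eq)
 next
 case False
 hence "{x. f x ~= 0:} <= S" using insert.prems unfolding in_L_iff by blast
 thus ?thesis using insert by blast
 qed
 qed
 thus ?thesis using assms(1) L_finite by blast
qed

lemma L_mult_single:
 assumes "a :.M" "b :.M" "r :.R" "s :.R"
 shows "single R a r**.L single R b s = single R (a**.M b) (c a b**(r**s))"
proof
 fix x
 have "(single R a r**.L single R b s) x = (++p:{a} \<times> {b}.
 if fst p**.M snd p = x then c (fst p) (snd p)**(single R a r (fst p)**single R b s (snd p)) else 0:)"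
 by (rule L_mult) (use assms in auto, auto simp: single_def split: if_splits)
 also have "... = single R (a**.M b) (c a b**(r**s)) x"
 using assms by (auto simp: single_def c_closed)
 finally show "(single R a r**.L single R b s) x = single R (a**.M b) (c a b**(r**s)) x" .
qed

text \<open>One rectangle \<open>?S \<times> ?T\<close> contains all supports involved, and over it
  each identity holds term by term. The separate laws arise by putting zero for the remaining
  functions.\<close>

lemma L_distr_aux:
 assumes "f :.L" "f' :.L" "g :.L" "g' :.L" "k :.R"
 shows "(f +:.L f')**.L g = f**.L g +:.L f'**.L g" (is ?A)
 and "f**.L (g +:.L g') = f**.L g +:.L f**.L g'" (is ?B)
 and "(k *:.L f)**.L g = k *:.L (f**.L g)" (is ?C)
 and "f**.L (k *:.L g) = k *:.L (f**.L g)" (is ?D)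
proof -
 let ?S = "{x. f x ~= 0:} \<union> {x. f' x ~= 0:}" and ?T = "{x. g x ~= 0:} \<union> {x. g' x ~= 0:}"
 have S: "finite ?S" "?S <= car M" "finite ?T" "?T <= car M"
 using assms unfolding in_L_iff by blast+
 have cl: "c (fst p) (snd p) :.R" if "p : ?S \<times> ?T" for p
 proof -
 have "fst p :.M" "snd p :.M" using that S by (auto simp: mem_Times_iff)
 thus ?thesis by (rule c_closed)
 qed
 note v [simp] = L_value[OF assms(1)] L_value[OF assms(2)] L_value[OF assms(3)] L_value[OF assms(4)] assms(5)
 note M = L_mult[OF _ _ S(1,3) _ _ S(2,4)]
 note cls = L_add_closed L_smult_closed assms
 have fg: "(f**.L g) x = (++p:?S \<times> ?T. if fst p**.M snd p = x then c (fst p) (snd p)**(f (fst p)**g (snd p)) else 0:)" for x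
 by (rule M) (use assms in auto)
 have f'g: "(f'**.L g) x = (++p:?S \<times> ?T. if fst p**.M snd p = x then c (fst p) (snd p)**(f' (fst p)**g (snd p)) else 0:)" for x
 by (rule M) (use assms in auto)
 have fg': "(f**.L g') x = (++p:?S \<times> ?T. if fst p**.M snd p = x then c (fst p) (snd p)**(f (fst p)**g' (snd p)) else 0:)" for x
 by (rule M) (use assms in auto)
 show ?A
 proof
 fix x
 have "((f +:.L f')**.L g) x = (++p:?S \<times> ?T. if fst p**.M snd p = x then c (fst p) (snd p)**((f +:.L f') (fst p)**g (snd p)) else 0:)"
 by (rule M) (use assms in \<open>auto simp: L_add_closed\<close>, auto simp: L_add)
 also have "... = (++p:?S \<times> ?T. (if fst p**.M snd p = x then c (fst p) (snd p)**(f (fst p)**g (snd p)) else 0:)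
 +: (if fst p**.M snd p = x then c (fst p) (snd p)**(f' (fst p)**g (snd p)) else 0:))"
 by (rule finsum_cong') (use cl in \<open>auto simp: L_add l_distr r_distr\<close>)
 also have "... = (f**.L g +:.L f'**.L g) x" unfolding L_add fg f'g
 by (rule finsum_addf) (use cl in auto)
 finally show "((f +:.L f')**.L g) x = (f**.L g +:.L f'**.L g) x" .
 qed
 show ?B
 proof
 fix x
 have "(f**.L (g +:.L g')) x = (++p:?S \<times> ?T. if fst p**.M snd p = x then c (fst p) (snd p)**(f (fst p)**(g +:.L g') (snd p)) else 0:)"
 by (rule M) (use assms in \<open>auto simp: L_add_closed\<close>, auto simp: L_add)
 also have "... = (++p:?S \<times> ?T. (if fst p**.M snd p = x then c (fst p) (snd p)**(f (fst p)**g (snd p)) else 0:)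
 +: (if fst p**.M snd p = x then c (fst p) (snd p)**(f (fst p)**g' (snd p)) else 0:))"
 by (rule finsum_cong') (use cl in \<open>auto simp: L_add l_distr r_distr\<close>)
 also have "... = (f**.L g +:.L f**.L g') x" unfolding L_add fg fg'
 by (rule finsum_addf) (use cl in auto)
 finally show "(f**.L (g +:.L g')) x = (f**.L g +:.L f**.L g') x" .
 qed
 have kfg: "(k *:.L (f**.L g)) x = (++p:?S \<times> ?T. k**(if fst p**.M snd p = x then c (fst p) (snd p)**(f (fst p)**g (snd p)) else 0:))" for x
 unfolding L_smult fg by (rule finsum_rdistr) (use S cl in auto)
 show ?C
 proof
 fix x
 have "((k *:.L f)**.L g) x = (++p:?S \<times> ?T. if fst p**.M snd p = x then c (fst p) (snd p)**((k *:.L f) (fst p)**g (snd p)) else 0:)"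
 by (rule M) (use assms in \<open>auto simp: L_smult_closed\<close>, auto simp: L_smult)
 also have "... = (k *:.L (f**.L g)) x" unfolding kfg
 by (rule finsum_cong') (use cl in \<open>auto simp: L_smult m_ac\<close>)
 finally show "((k *:.L f)**.L g) x = (k *:.L (f**.L g)) x" .
 qed
 show ?D
 proof
 fix x
 have "(f**.L (k *:.L g)) x = (++p:?S \<times> ?T. if fst p**.M snd p = x then c (fst p) (snd p)**(f (fst p)**(k *:.L g) (snd p)) else 0:)"
 by (rule M) (use assms in \<open>auto simp: L_smult_closed\<close>, auto simp: L_smult)
 also have "... = (k *:.L (f**.L g)) x" unfolding kfg
 by (rule finsum_cong') (use cl in \<open>auto simp: L_smult m_ac\<close>)
 finally show "(f**.L (k *:.L g)) x = (k *:.L (f**.L g)) x" .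
 qed
qed

lemmas L_l_distr = L_distr_aux(1)[OF _ _ _ L_zero_closed R.zero_closed]
lemmas L_r_distr = L_distr_aux(2)[OF _ L_zero_closed _ _ R.zero_closed]
lemmas L_smult_left = L_distr_aux(3)[OF _ L_zero_closed _ L_zero_closed]
lemmas L_smult_right = L_distr_aux(4)[OF _ L_zero_closed _ L_zero_closed]

lemma L_zero_smult: "f :.L ==> 0: *:.L f = 0:.L"
 using L_value[of f] by (simp add: L_smult L_zero fun_eq_iff)

lemma L_zero_mult: "f :.L ==> 0:.L**.L f = 0:.L"
 and L_mult_zero: "f :.L ==> f**.L 0:.L = 0:.L"
 using L_smult_left[OF L_zero_closed, of f \<zero>] L_smult_right[OF _ L_zero_closed, of f \<zero>]
 by (auto simp: L_zero_smult L_zero_closed L_mult_closed)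

text \<open>Trilinearity reduces the claim to three basis elements, where it is the cocycle
  identity.\<close>

lemma L_assoc:
 assumes "f :.L" "g :.L" "h :.L"
 shows "f**.L g**.L h = f**.L (g**.L h)"
 using assms(1)
proof (induction rule: L_induct)
 case zero
 thus ?case using assms by (simp add: L_zero_mult L_mult_closed)
next
 case (add f f')
 thus ?case using assms by (simp add: L_l_distr L_mult_closed)
next
 case (single a r)
 show ?case using assms(2)
 proof (induction rule: L_induct)
 case zero
 thus ?case using assms single by (simp add: L_zero_mult L_mult_zero)
 next
 case (add f f')
 thus ?case using assms single by (simp add: L_l_distr L_r_distr L_mult_closed)
 next
 case b: (single b s)
 show ?case using assms(3)
 proof (induction rule: L_induct)
 case zero
 thus ?case using b single by (simp add: L_mult_zero L_mult_closed)
 next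
 case (add f f')
 thus ?case using b single by (simp add: L_r_distr L_mult_closed)
 next
 case d: (single d t)
 have e: "c (a**.M b) d**(c a b**(r**s)**t) = (c a b**c (a**.M b) d)**(r**s**t)"
 using single b d by (simp add: m_ac c_closed)
 have e2: "c a (b**.M d)**(r**(c b d**(s**t))) = (c b d**c a (b**.M d))**(r**s**t)"
 using single b d by (simp add: m_ac c_closed)
 show ?case using single b d by (simp add: L_mult_single M.m_assoc e e2 c_cocycle[symmetric] c_closed)
 qed
 qed
qed

lemma L_one_left: "f :.L ==> 1:.L**.L f = f"
 by (induction rule: L_induct)
 (auto simp: L_mult_zero L_r_distr L_one_closed L_mult_single L_one[symmetric], simp add: L_one L_mult_single c_one_left c_one_right)

lemma L_one_right: "f :.L ==> f**.L 1:.L = f"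
 by (induction rule: L_induct)
 (auto simp: L_zero_mult L_l_distr L_one_closed L_mult_single L_one[symmetric], simp add: L_one L_mult_single c_one_left c_one_right)

lemma L_neg_closed: "f :.L ==> (%x. \<ominus> f x) :.L"
proof -
 assume f: "f :.L"
 have "{x. \<ominus> f x ~= 0:} <= {x. f x ~= 0:}" by auto
 moreover have "finite {x. f x ~= 0:}" "{x. f x ~= 0:} <= car M" "!!x. f x :.R"
 using f unfolding in_L_iff by blast+
 ultimately show ?thesis unfolding in_L_iff using finite_subset a_inv_closed by blast
qed

lemma L_abelian_group: "abelian_group L"
proof (rule abelian_groupI)
 show "EX y:car L. y +:.L x = 0:.L" if "x :.L" for x
 by (rule bexI[OF _ L_neg_closed[OF that]]) (use L_value[OF that] in \<open>simp add: L_add L_zero R.l_neg\<close>)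
 show "x +:.L y +:.L z = x +:.L (y +:.L z)" if "x :.L" "y :.L" "z :.L" for x y z
 using L_value[OF that(1)] L_value[OF that(2)] L_value[OF that(3)] by (simp add: L_add a_assoc)
 show "x +:.L y = y +:.L x" if "x :.L" "y :.L" for x y
 using L_value[OF that(1)] L_value[OF that(2)] by (simp add: L_add a_comm)
 show "0:.L +:.L x = x" if "x :.L" for x
 using L_value[OF that(1)] by (simp add: L_add L_zero)
qed (auto simp: L_add_closed L_zero_closed)

lemma L_ring: "ring L"
proof (rule ringI)
 show "abelian_group L" by (rule L_abelian_group)
 show "Group.monoid L"
 by (rule monoidI) (auto simp: L_mult_closed L_one_closed L_assoc L_one_left L_one_right)
qed (auto simp: L_l_distr L_r_distr)

lemma L_assoc_algebra: "assoc_algebra R L"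
proof (intro assoc_algebra.intro module.intro assoc_algebra_axioms.intro module_axioms.intro)
 show "cring R" by (rule R.is_cring)
 show "(a +: b) *:.L x = a *:.L x +:.L b *:.L x" if "a :.R" "b :.R" "x :.L" for a b x
 using that(1,2) L_value[OF that(3)] by (simp add: L_add L_smult l_distr)
 show "a *:.L (x +:.L y) = a *:.L x +:.L a *:.L y" if "a :.R" "x :.L" "y :.L" for a x y
 using that(1) L_value[OF that(2)] L_value[OF that(3)] by (simp add: L_add L_smult r_distr)
 show "(a**b) *:.L x = a *:.L (b *:.L x)" if "a :.R" "b :.R" "x :.L" for a b x
 using that(1,2) L_value[OF that(3)] by (simp add: L_smult m_assoc)
 show "1: *:.L x = x" if "x :.L" for x
 using L_value[OF that] by (simp add: L_smult)
qed (auto simp: L_ring L_abelian_group L_smult_closed L_smult_left L_smult_right)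

end

sublocale twist \<subseteq> L: assoc_algebra R "twisted_algebra R M c"
 by (rule L_assoc_algebra)

section \<open>Homomorphisms, spans and quotients of algebras\<close>

definition alg_hom ::
 "('k, 'e) ring_scheme => ('k, 'a, 'x) module_scheme => ('k, 'b, 'y) module_scheme => ('a => 'b) set"
 where "alg_hom K A B =
 {f : ring_hom A B. ALL c:car K. ALL a:car A. f (c *:.A a) = c *:.B f a}"

lemma alg_hom_closed: "f : alg_hom K A B ==> a :.A ==> f a :.B"
 and alg_hom_mult: "f : alg_hom K A B ==> a :.A ==> b :.A ==> f (a**.A b) = f a**.B f b"
 and alg_hom_add: "f : alg_hom K A B ==> a :.A ==> b :.A ==> f (a +:.A b) = f a +:.B f b"
 and alg_hom_one: "f : alg_hom K A B ==> f 1:.A = 1:.B"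
 and alg_hom_smult: "f : alg_hom K A B ==> c :.K ==> a :.A ==> f (c *:.A a) = c *:.B f a"
 by (auto simp: alg_hom_def ring_hom_def)

lemma alg_hom_ring_hom: "f : alg_hom K A B ==> f : ring_hom A B"
 by (simp add: alg_hom_def)

lemma alg_hom_zero:
 assumes "f : alg_hom K A B" "ring A" "ring B" shows "f 0:.A = 0:.B"
 using ring_hom_zero[OF alg_hom_ring_hom[OF assms(1)] assms(2,3)] .

lemma alg_hom_minus:
 assumes "f : alg_hom K A B" "ring A" "ring B" "a :.A" "b :.A"
 shows "f (a \<ominus>.A b) = f a \<ominus>.B f b"
proof -
 interpret h: ring_hom_ring A B f
 using alg_hom_ring_hom[OF assms(1)] assms(2,3) ring_hom_ringI2 by blast
 show ?thesis using assms by (simp add: a_minus_def)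
qed

lemma alg_hom_comp:
 "f : alg_hom K A B ==> g : alg_hom K B C ==> g \<circ> f : alg_hom K A C"
 unfolding alg_hom_def using ring_hom_trans[of f A B g C] ring_hom_closed[of f A B] by auto

lemma alg_iso_alg_hom: "f : alg_iso K A B ==> f : alg_hom K A B"
 and alg_iso_bij: "f : alg_iso K A B ==> bij_betw f (car A) (car B)"
 and alg_isoI: "f : alg_hom K A B ==> bij_betw f (car A) (car B) ==> f : alg_iso K A B"
 by (auto simp: alg_iso_def alg_hom_def ring_iso_def)

lemma alg_hom_inv:
 assumes f: "f : alg_iso K A B" and A: "assoc_algebra K A"
 shows "inv_into (car A) f : alg_iso K B A"
proof -
 interpret A: assoc_algebra K A by fact
 have b: "bij_betw f (car A) (car B)" using alg_iso_bij[OF f] .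
 have r: "inv_into (car A) f : ring_iso B A"
 using f ring_iso_set_sym[OF A.ring_axioms] by (auto simp: alg_iso_def)
 have "inv_into (car A) f (c *:.B y) = c *:.A inv_into (car A) f y" if "c :.K" "y :.B" for c y
 proof -
 let ?x = "inv_into (car A) f y"
 have x: "?x :.A" "f ?x = y" using b that by (auto simp: bij_betw_def inv_into_into f_inv_into_f)
 hence "c *:.B y = f (c *:.A ?x)" using alg_hom_smult[OF alg_iso_alg_hom[OF f] that(1)] by simp
 thus ?thesis using b x that by (simp add: bij_betw_def)
 qed
 thus ?thesis using r by (simp add: alg_iso_def)
qed

lemma assoc_algebra_cong:
 assumes A: "assoc_algebra K A"
 and eq: "car B = car A" "1:.B = 1:.A" "0:.B = 0:.A"
 "!!x y. x :.A ==> y :.A ==> x +:.B y = x +:.A y"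
 "!!x y. x :.A ==> y :.A ==> x**.B y = x**.A y"
 "!!c x. c :.K ==> x :.A ==> c *:.B x = c *:.A x"
 shows "assoc_algebra K B"
proof -
 interpret A: assoc_algebra K A by fact
 have ab: "abelian_group B"
 proof (rule abelian_groupI)
 show "EX y:car B. y +:.B x = 0:.B" if "x :.B" for x
 using that A.l_neg A.a_inv_closed unfolding eq by (metis eq(4))
 qed (auto simp: eq A.a_ac)
 have r: "ring B"
 by (rule ringI[OF ab monoidI]) (auto simp: eq A.m_assoc A.l_distr A.r_distr)
 show ?thesis
 by (intro assoc_algebra.intro module.intro assoc_algebra_axioms.intro module_axioms.intro A.R.is_cring ab r)
 (auto simp: eq A.smult_l_distr A.smult_r_distr A.smult_assoc1 A.smult_mult_left A.smult_mult_right)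
qed

lemma ring_with_smult: "ring A ==> ring (with_smult A s)"
proof -
 assume "ring A"
 then interpret A: ring A .
 have "abelian_group (with_smult A s)"
 proof (rule abelian_groupI)
 show "EX y:car (with_smult A s). y +:.(with_smult A s) x = 0:.(with_smult A s)"
 if "x :.(with_smult A s)" for x
 using that A.l_neg A.a_inv_closed unfolding with_smult_def by fastforce
 qed (simp_all add: with_smult_def A.a_ac)
 thus ?thesis
 by (rule ringI[OF _ monoidI]) (simp_all add: with_smult_def A.m_assoc A.l_distr A.r_distr)
qed

text \<open>The inductive form turns claims about spans into inductions over one added term.
  Explicit finite sums are recovered by \<open>lspan_finsum\<close> where coefficients
  matter.\<close>

inductive_set lspan :: "('k, 'e) ring_scheme => ('k, 'a, 'x) module_scheme => 'a set => 'a set"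
 for K A S where
 zero: "0:.A : lspan K A S"
| step: "k :.K ==> b : S ==> x : lspan K A S ==> k *:.A b +:.A x : lspan K A S"

lemma lspan_mono: "x : lspan K A S ==> S <= T ==> x : lspan K A T"
 by (induction rule: lspan.induct) (auto intro: lspan.intros)

context
 fixes K :: "('k, 'e) ring_scheme" and A :: "('k, 'a, 'x) module_scheme"
 assumes A: "assoc_algebra K A"
begin

interpretation A: assoc_algebra K A by (rule A)

lemma lspan_closed: "x : lspan K A S ==> S <= car A ==> x :.A"
 by (induction rule: lspan.induct) auto

lemma lspan_base: "b : S ==> S <= car A ==> b : lspan K A S"
 using lspan.step[OF A.R.one_closed _ lspan.zero[of A K S], of b] by (auto simp: subset_eq)

lemma lspan_add: "x : lspan K A S ==> y : lspan K A S ==> S <= car A ==> x +:.A y : lspan K A S"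
proof (induction rule: lspan.induct)
 case zero
 thus ?case using lspan_closed by (metis A.add.l_one)
next
 case (step k b x)
 hence "b :.A" "x :.A" "y :.A" using lspan_closed by blast+
 hence "k *:.A b +:.A x +:.A y = k *:.A b +:.A (x +:.A y)" using step by (simp add: A.a_assoc)
 thus ?case using step by (auto intro: lspan.step)
qed

lemma lspan_smult: "x : lspan K A S ==> c :.K ==> S <= car A ==> c *:.A x : lspan K A S"
proof (induction rule: lspan.induct)
 case zero
 thus ?case by (simp add: A.smult_r_null lspan.zero)
next
 case (step k b x)
 hence "b :.A" "x :.A" using lspan_closed by blast+
 hence "c *:.A (k *:.A b +:.A x) = (c**.K k) *:.A b +:.A c *:.A x"
 using step by (simp add: A.smult_r_distr A.smult_assoc1)
 thus ?case using step by (auto intro: lspan.step)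
qed

lemma lspan_trans:
 assumes "x : lspan K A S" "S <= lspan K A T" "T <= car A"
 shows "x : lspan K A T"
 using assms(1)
proof (induction rule: lspan.induct)
 case (step k b x)
 thus ?case using assms by (auto intro!: lspan_add lspan_smult)
qed (rule lspan.zero)

lemma lspan_mult:
 assumes x: "x : lspan K A S" and y: "y : lspan K A T"
 and sub: "S <= car A" "T <= car A" "U <= car A"
 and ST: "!!s t. s : S ==> t : T ==> s**.A t : lspan K A U"
 shows "x**.A y : lspan K A U"
proof -
 have yc: "y :.A" using y sub lspan_closed by blast
 have b: "b**.A y : lspan K A U" if b: "b : S" for b
 using y
 proof (induction rule: lspan.induct)
 case zero
 thus ?case using b sub by (auto simp: subset_eq intro: lspan.zero)
 next
 case (step k t x)
 have c: "b :.A" "t :.A" "x :.A" using step b sub lspan_closed by blast+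
 hence "b**.A (k *:.A t +:.A x) = k *:.A (b**.A t) +:.A b**.A x"
 using step by (simp add: A.r_distr A.smult_mult_right)
 thus ?case using step c b ST sub by (auto intro!: lspan_add lspan_smult)
 qed
 show ?thesis using x
 proof (induction rule: lspan.induct)
 case zero
 thus ?case using yc by (simp add: lspan.zero)
 next
 case (step k s x)
 have c: "s :.A" "x :.A" using step sub lspan_closed by blast+
 hence "(k *:.A s +:.A x)**.A y = k *:.A (s**.A y) +:.A x**.A y"
 using step yc by (simp add: A.l_distr A.smult_mult_left)
 thus ?case using step c b sub by (auto intro!: lspan_add lspan_smult)
 qed
qed

text \<open>The sum is indexed by \<open>I\<close> and not by the image of \<open>f\<close>, so that
  distinct indices can later be compared through their exponents. A generator that occurs again has
  its coefficients merged, hence the split on \<open>j : S\<close>.\<close>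

lemma lspan_finsum:
 assumes x: "x : lspan K A (f ` I)" and f: "f ` I <= car A"
 obtains S k where "finite S" "S <= I" "k : S \<rightarrow> car K" "x = (++.A i:S. k i *:.A f i)"
proof -
 have "EX S k. finite S & S <= I & k : S \<rightarrow> car K & x = (++.A i:S. k i *:.A f i)"
 using x
 proof (induction rule: lspan.induct)
 case zero
 show ?case by (rule exI[of _ "{}"]) simp
 next
 case (step c b x)
 then obtain S k where S: "finite S" "S <= I" "k : S \<rightarrow> car K" "x = (++.A i:S. k i *:.A f i)" by blast
 obtain j where j: "j : I" "b = f j" using step by blast
 have fI: "!!i. i : I ==> f i :.A" using f by blast
 have ki: "!!i. i : S ==> k i :.K" using S by auto
 have kfi: "!!i. i : S ==> k i *:.A f i :.A" using ki S(2) fI by blast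
 have kf: "!!T. T <= S ==> (%i. k i *:.A f i) : T \<rightarrow> car A" using kfi by blast
 show ?case
 proof (cases "j : S")
 case False
 let ?k = "k(j := c)"
 have e: "(++.A i:S. ?k i *:.A f i) = x" unfolding S(4)
 by (rule A.finsum_cong') (use False kf[OF order_refl] in auto)
 have "(++.A i:insert j S. ?k i *:.A f i) = c *:.A b +:.A x"
 by (subst A.finsum_insert) (use False S(1) fI j step(1) e kfi in auto)
 thus ?thesis using S j step by (intro exI[of _ "insert j S"] exI[of _ ?k]) auto
 next
 case True
 let ?k = "k(j := c +:.K k j)"
 have S': "S = insert j (S - {j})" using True by auto
 have kj: "k j :.K" using S True by auto
 have e: "(++.A i:S - {j}. ?k i *:.A f i) = (++.A i:S - {j}. k i *:.A f i)"
 by (rule A.finsum_cong') (use kf[of "S - {j}"] in auto)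
 have c1: "(++.A i:S - {j}. k i *:.A f i) :.A" using kf[of "S - {j}"] by (auto intro!: A.finsum_closed)
 have x1: "x = k j *:.A f j +:.A (++.A i:S - {j}. k i *:.A f i)" unfolding S(4)
 by (subst S', subst A.finsum_insert) (use S(1) fI kj kfi j in auto)
 have "(++.A i:S. ?k i *:.A f i) = (c +:.K k j) *:.A f j +:.A (++.A i:S - {j}. ?k i *:.A f i)"
 by (subst S', subst A.finsum_insert) (use S(1) fI kj kfi j step(1) in auto)
 also have "... = c *:.A b +:.A x" unfolding e x1 using c1 kj j step fI by (simp add: A.smult_l_distr A.a_assoc)
 finally show ?thesis using S j step kj by (intro exI[of _ S] exI[of _ ?k]) auto
 qed
 qed
 thus thesis using that by blast
qed

end

lemma alg_hom_lspan:
 assumes f: "f : alg_hom K A B" and A: "assoc_algebra K A" and B: "assoc_algebra K B"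
 and x: "x : lspan K A S" and S: "S <= car A"
 shows "f x : lspan K B (f ` S)"
proof -
 interpret A: assoc_algebra K A by fact
 interpret B: assoc_algebra K B by fact
 show ?thesis using x
 proof (induction rule: lspan.induct)
 case zero
 thus ?case by (simp add: alg_hom_zero[OF f A.ring_axioms B.ring_axioms] lspan.zero)
 next
 case (step k b x)
 have c: "b :.A" "x :.A" using step S lspan_closed[OF A] by blast+
 thus ?case using step by (auto simp: alg_hom_add[OF f] alg_hom_smult[OF f] intro: lspan.step)
 qed
qed

lemma alg_hom_finsum:
 assumes f: "f : alg_hom K A B" and A: "assoc_algebra K A" and B: "assoc_algebra K B"
 and g: "g : S \<rightarrow> car A"
 shows "f (++.A i:S. g i) = (++.B i:S. f (g i))"
proof -
 interpret A: assoc_algebra K A by fact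
 interpret B: assoc_algebra K B by fact
 interpret h: ring_hom_ring A B f
 using alg_hom_ring_hom[OF f] A.ring_axioms B.ring_axioms ring_hom_ringI2 by blast
 show ?thesis using h.hom_finsum[OF g] by (simp add: o_def)
qed

subsection \<open>Monoid algebras\<close>

locale monoid_alg = R?: cring R + M: monoid M
 for R :: "('r, 'e) ring_scheme" (structure) and M :: "('m, 'x) monoid_scheme"
begin

sublocale T: twist R M "%_ _. 1:" by unfold_locales auto

lemma carrier_monoid_algebra: "car (monoid_algebra R M) = car T.L"
 by (simp add: monoid_algebra_def twisted_algebra_def)

lemma mult_monoid_algebra:
 assumes "f :.T.L" "g :.T.L"
 shows "f**.(monoid_algebra R M) g = f**.T.L g"
proof
 fix x
 have v: "f y :.R" "g y :.R" for y using assms by (auto intro: T.L_value)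
 have "(f**.(monoid_algebra R M) g) x = (++p:{(a, b). f a ~= 0: & g b ~= 0: & a**.M b = x}. f (fst p)**g (snd p))"
 by (simp add: monoid_algebra_def)
 also have "... = (++p:{(a, b). f a ~= 0: & g b ~= 0: & a**.M b = x}. 1:**(f (fst p)**g (snd p)))"
 by (rule finsum_cong') (use v in auto)
 also have "... = (f**.T.L g) x" by (simp add: twisted_algebra_def)
 finally show "(f**.(monoid_algebra R M) g) x = (f**.T.L g) x" .
qed

lemma monoid_algebra_assoc_algebra: "assoc_algebra R (monoid_algebra R M)"
proof (rule assoc_algebra_cong[OF T.L_assoc_algebra])
 show "x**.(monoid_algebra R M) y = x**.T.L y" if "x :.T.L" "y :.T.L" for x y
 using that by (rule mult_monoid_algebra)
qed (simp_all add: carrier_monoid_algebra, simp_all add: monoid_algebra_def twisted_algebra_def)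

sublocale S: assoc_algebra R "monoid_algebra R M" by (rule monoid_algebra_assoc_algebra)

lemma basis_elt_closed: "x :.M ==> basis_elt R x :.(monoid_algebra R M)"
 using T.single_closed[of x \<one>] by (simp add: carrier_monoid_algebra basis_elt_def single_def)

lemma basis_elt_mult:
 assumes "x :.M" "y :.M"
 shows "basis_elt R x**.(monoid_algebra R M) basis_elt R y = basis_elt R (x**.M y)"
proof -
 have b: "basis_elt R z = single R z 1:" for z by (simp add: basis_elt_def single_def)
 show ?thesis unfolding b using assms by (simp add: mult_monoid_algebra T.L_mult_single)
qed

lemma basis_elt_one: "basis_elt R 1:.M = 1:.(monoid_algebra R M)"
 by (simp add: basis_elt_def monoid_algebra_def)

lemma monoid_algebra_induct [consumes 1, case_names zero smult add]:
 assumes "f :.(monoid_algebra R M)" "P 0:.(monoid_algebra R M)"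
 "!!x r. x :.M ==> r :.R ==> P (r *:.(monoid_algebra R M) basis_elt R x)"
 "!!f g. f :.(monoid_algebra R M) ==> g :.(monoid_algebra R M) ==> P f ==> P g ==> P (f +:.(monoid_algebra R M) g)"
 shows "P f"
proof -
 have f: "f :.T.L" using assms(1) by (simp add: carrier_monoid_algebra)
 have z: "0:.(monoid_algebra R M) = 0:.T.L" "(\<oplus>.(monoid_algebra R M)) = (\<oplus>.T.L)"
 by (simp_all add: monoid_algebra_def twisted_algebra_def)
 show ?thesis using f
 proof (induction rule: T.L_induct)
 case (single x r)
 have "single R x r = r *:.(monoid_algebra R M) basis_elt R x"
 using single by (auto simp: single_def basis_elt_def monoid_algebra_def)
 thus ?case using assms(3)[OF single] by simp
 next
 case (add f g)
 thus ?case using assms(4)[of f g] by (simp add: z carrier_monoid_algebra)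
 qed (use assms z in simp)
qed

text \<open>Linear extension of a monoid homomorphism \<open>mu\<close>. The homomorphisms out of
  polynomial rings, generalized Weyl algebras and tensor products below all start from it.\<close>

definition lift_hom :: "('r, 'b, 'y) module_scheme => ('m => 'b) => ('m => 'r) => 'b"
 where "lift_hom B mu f = (++.B x:{x. f x ~= 0:}. f x *:.B mu x)"

context
 fixes B :: "('r, 'b, 'y) module_scheme" and mu
 assumes B: "assoc_algebra R B" and mu: "mu : hom M B" "mu 1:.M = 1:.B"
begin

interpretation B: assoc_algebra R B by (rule B)

lemma mu_closed: "x :.M ==> mu x :.B" using mu by (auto simp: hom_def)

lemma lift_hom_eq:
 assumes f: "f :.T.L" and A: "finite A" "{x. f x ~= 0:} <= A" "A <= car M"
 shows "lift_hom B mu f = (++.B x:A. f x *:.B mu x)"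
 unfolding lift_hom_def
proof (rule B.add.finprod_mono_neutral_cong_left)
 have v: "f y :.R" for y using f by (rule T.L_value)
 show "(%x. f x *:.B mu x) : A \<rightarrow> car B" using A v mu_closed by (auto simp: subset_eq)
 show "f x *:.B mu x = 0:.B" if "x : A - {x. f x ~= 0:}" for x
 using that A mu_closed[of x] by (auto simp: B.smult_l_null subset_eq)
qed (use A in auto)

lemma lift_hom_add:
 assumes "f :.T.L" "g :.T.L"
 shows "lift_hom B mu (f +:.T.L g) = lift_hom B mu f +:.B lift_hom B mu g"
proof -
 let ?A = "{x. f x ~= 0:} \<union> {x. g x ~= 0:}"
 have A: "finite ?A" "?A <= car M" using assms unfolding T.in_L_iff by blast+
 have v: "f y :.R" "g y :.R" for y using assms by (auto intro: T.L_value)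
 have m: "mu x :.B" if "x : ?A" for x using that A(2) mu_closed by blast
 have "lift_hom B mu (f +:.T.L g) = (++.B x:?A. (f +:.T.L g) x *:.B mu x)"
 by (rule lift_hom_eq[OF T.L_add_closed[OF assms] A(1) _ A(2)]) (auto simp: T.L_add)
 also have "... = (++.B x:?A. f x *:.B mu x +:.B g x *:.B mu x)"
 by (rule B.finsum_cong') (use v m in \<open>auto simp: T.L_add B.smult_l_distr\<close>)
 also have "... = (++.B x:?A. f x *:.B mu x) +:.B (++.B x:?A. g x *:.B mu x)"
 by (rule B.finsum_addf) (use v m in auto)
 finally show ?thesis
 unfolding lift_hom_eq[OF assms(1) A(1) Un_upper1 A(2)] lift_hom_eq[OF assms(2) A(1) Un_upper2 A(2)] .
qed

lemma lift_hom_single: "x :.M ==> r :.R ==> lift_hom B mu (single R x r) = r *:.B mu x"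
 by (subst lift_hom_eq[OF T.single_closed, of x r "{x}"]) (auto simp: mu_closed single_def split: if_splits)

lemma lift_hom_closed: "f :.T.L ==> lift_hom B mu f :.B"
 unfolding lift_hom_def
 using T.L_support T.L_value mu_closed by (intro B.finsum_closed) blast

lemma lift_hom_zero: "lift_hom B mu 0:.T.L = 0:.B"
 by (simp add: lift_hom_def T.L_zero)

lemma lift_hom_smult:
 assumes "f :.T.L" "k :.R"
 shows "lift_hom B mu (k *:.T.L f) = k *:.B lift_hom B mu f"
 using assms(1)
proof (induction rule: T.L_induct)
 case zero
 thus ?case using assms(2) by (simp add: T.L.smult_r_null lift_hom_zero B.smult_r_null)
next
 case (single x r)
 have "k *:.T.L single R x r = single R x (k**r)" using assms(2) by (auto simp: T.L_smult single_def)
 thus ?case using single assms(2) by (simp add: lift_hom_single B.smult_assoc1 mu_closed)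
next
 case (add f g)
 thus ?case using assms(2)
 by (simp add: T.L.smult_r_distr lift_hom_add T.L_smult_closed B.smult_r_distr lift_hom_closed)
qed

lemma lift_hom_mult:
 assumes "f :.T.L" "g :.T.L"
 shows "lift_hom B mu (f**.T.L g) = lift_hom B mu f**.B lift_hom B mu g"
 using assms(1)
proof (induction rule: T.L_induct)
 case zero
 thus ?case using assms(2) by (simp add: lift_hom_zero lift_hom_closed)
next
 case (add f f')
 thus ?case using assms(2)
 by (simp add: T.L_l_distr lift_hom_add T.L_mult_closed B.l_distr lift_hom_closed)
next
 case (single x r)
 show ?case using assms(2)
 proof (induction rule: T.L_induct)
 case zero
 thus ?case using single by (simp add: lift_hom_zero lift_hom_closed)
 next
 case (add f f')
 thus ?case using single
 by (simp add: T.L_r_distr lift_hom_add T.L_mult_closed B.r_distr lift_hom_closed)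
 next
 case s: (single y s)
 have "mu (x**.M y) = mu x**.B mu y" using mu single s by (auto simp: hom_def)
 moreover have "r *:.B (s *:.B (mu x**.B mu y)) = s *:.B (r *:.B (mu x**.B mu y))"
 using single s by (simp add: mu_closed R.m_comm flip: B.smult_assoc1)
 ultimately show ?case using single s
 by (simp add: T.L_mult_single lift_hom_single mu_closed B.smult_mult_left B.smult_mult_right B.smult_assoc1)
 qed
qed

lemma lift_hom_alg_hom: "lift_hom B mu : alg_hom R (monoid_algebra R M) B"
proof -
 have e: "(\<oplus>.(monoid_algebra R M)) = (\<oplus>.T.L)" "smult (monoid_algebra R M) = smult T.L" "1:.(monoid_algebra R M) = 1:.T.L"
 by (simp_all add: monoid_algebra_def twisted_algebra_def)
 show ?thesis
 unfolding alg_hom_def ring_hom_def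
 using lift_hom_single[OF M.one_closed R.one_closed] mu(2)
 by (auto simp: carrier_monoid_algebra e mult_monoid_algebra lift_hom_closed lift_hom_mult
 lift_hom_add lift_hom_smult T.L_one)
qed

lemma lift_hom_basis_elt: "x :.M ==> lift_hom B mu (basis_elt R x) = mu x"
 using lift_hom_single[of x \<one>] mu_closed[of x] by (simp add: basis_elt_def single_def)

end

lemma monoid_algebra_lspan:
 "f :.(monoid_algebra R M) ==> f : lspan R (monoid_algebra R M) (basis_elt R ` car M)"
proof (induction rule: monoid_algebra_induct)
 have sub: "basis_elt R ` car M <= car (monoid_algebra R M)" using basis_elt_closed by blast
 case (smult x r)
 thus ?case by (intro lspan_smult lspan_base sub S.assoc_algebra_axioms) auto
next
 have sub: "basis_elt R ` car M <= car (monoid_algebra R M)" using basis_elt_closed by blast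
 case (add f g)
 thus ?case by (intro lspan_add sub S.assoc_algebra_axioms)
qed (rule lspan.zero)

end

subsection \<open>Quotients\<close>

locale quot_alg = A?: assoc_algebra K A + ideal I A
 for K :: "('k, 'e) ring_scheme" and A :: "('k, 'a, 'x) module_scheme" and I
begin

abbreviation Q where "Q == quotient_algebra A I"
abbreviation pr where "pr a == I +>\<^bsub>A\<^esub> a"

lemma carrier_Q: "car Q = pr ` car A"
 by (auto simp: quotient_algebra_def with_smult_def FactRing_def A_RCOSETS_def')

lemma pr_eq_iff:
 assumes "a :.A" "b :.A"
 shows "pr a = pr b \<longleftrightarrow> a \<ominus>.A b : I"
 using assms quotient_eq_iff_same_a_r_cos[OF ideal_axioms] by metis

lemma pr_self: "a :.A ==> a : pr a"
 using a_rcos_self by blast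

lemma pr_mem: "a :.A ==> x : pr a ==> x :.A & pr x = pr a"
 using a_repr_independence' a_elemrcos_carrier by blast

lemma pr_mult: "a :.A ==> b :.A ==> pr a**.Q pr b = pr (a**.A b)"
 by (simp add: quotient_algebra_def with_smult_def FactRing_def rcoset_mult_add)

lemma pr_add: "a :.A ==> b :.A ==> pr a +:.Q pr b = pr (a +:.A b)"
 by (simp add: quotient_algebra_def with_smult_def FactRing_def a_rcos_sum)

lemma pr_one: "1:.Q = pr 1:.A"
 by (simp add: quotient_algebra_def with_smult_def FactRing_def)

lemma pr_zero: "0:.Q = pr 0:.A"
 using a_rcos_zero[OF ideal_axioms] 
 by (simp add: quotient_algebra_def with_smult_def FactRing_def a_r_coset_def r_coset_def)

text \<open>The scalar \<open>c\<close> acts as multiplication by \<open>c\<close> times the unit,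
  so a two-sided ideal is automatically a subspace and the quotient ring an algebra.\<close>

lemma I_smult: "c :.K ==> x : I ==> c *:.A x : I"
proof -
 assume c: "c :.K" and x: "x : I"
 hence "(c *:.A 1:.A)**.A x : I" by (intro I_l_closed) auto
 thus ?thesis using c x by (simp add: A.smult_mult_left)
qed

lemma pr_smult:
 assumes "c :.K" "a :.A"
 shows "c *:.Q pr a = pr (c *:.A a)"
proof -
 have "pr (c *:.A x) = pr (c *:.A a)" if x: "x : pr a" for x
 proof -
 have xc: "x :.A" "x \<ominus>.A a : I" using pr_mem[OF assms(2) x] pr_eq_iff assms by auto
 have "c *:.A x \<ominus>.A c *:.A a = c *:.A (x \<ominus>.A a)"
 using assms xc by (simp add: a_minus_def A.smult_r_distr A.smult_r_minus)
 thus ?thesis using I_smult[OF assms(1) xc(2)] assms xc pr_eq_iff by auto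
 qed
 hence "(\<Union>x\<in>pr a. pr (c *:.A x)) = pr (c *:.A a)" using pr_self[OF assms(2)] by blast
 thus ?thesis by (simp add: quotient_algebra_def with_smult_def)
qed

lemma Q_assoc_algebra: "assoc_algebra K Q"
proof -
 have r: "ring Q"
 proof -
 have "ring (A Quot I)" by (rule quotient_is_ring)
 thus ?thesis unfolding quotient_algebra_def by (rule ring_with_smult)
 qed
 then interpret Q: ring Q .
 show ?thesis
 by (intro assoc_algebra.intro module.intro assoc_algebra_axioms.intro module_axioms.intro A.R.is_cring Q.abelian_group_axioms r)
 (auto simp: carrier_Q pr_smult pr_add pr_mult A.smult_l_distr A.smult_r_distr A.smult_assoc1 A.smult_mult_left A.smult_mult_right)
qed

lemma pr_alg_hom: "pr : alg_hom K A Q"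
 unfolding alg_hom_def ring_hom_def
 by (auto simp: carrier_Q pr_mult pr_add pr_one pr_smult)

lemma pr_eq_zero_iff: "a :.A ==> pr a = 0:.Q \<longleftrightarrow> a : I"
 using pr_eq_iff[of a "0:.A"] by (simp add: pr_zero a_minus_def)

lemma factor_hom:
 assumes vp: "vp : alg_hom K A B" and B: "assoc_algebra K B" and I: "!!x. x : I ==> vp x = 0:.B"
 obtains ps where "ps : alg_hom K Q B" "!!a. a :.A ==> ps (pr a) = vp a"
proof -
 interpret B: assoc_algebra K B by fact
 define ps where "ps P = vp (SOME a. a :.A & P = pr a)" for P
 have v: "ps (pr a) = vp a" if a: "a :.A" for a
 proof -
 let ?b = "SOME b. b :.A & pr a = pr b"
 have b: "?b :.A & pr a = pr ?b" by (rule someI[of _ a]) (use a in simp)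
 hence "?b \<ominus>.A a : I" using pr_eq_iff[of ?b a] a by simp
 hence "vp (?b \<ominus>.A a) = 0:.B" by (rule I)
 hence "vp ?b \<ominus>.B vp a = 0:.B" using alg_hom_minus[OF vp ring_axioms B.ring_axioms] a b by simp
 thus ?thesis unfolding ps_def using alg_hom_closed[OF vp] a b by (simp add: B.r_right_minus_eq)
 qed
 have "ps : alg_hom K Q B"
 unfolding alg_hom_def ring_hom_def
 by (auto simp: carrier_Q pr_mult pr_add pr_one pr_smult v alg_hom_closed[OF vp] alg_hom_mult[OF vp] alg_hom_add[OF vp] alg_hom_one[OF vp] alg_hom_smult[OF vp])
 thus thesis using v that by blast
qed

lemma Q_lspan:
 assumes "!!a. a :.A ==> a : lspan K A S" "S <= car A" "q :.Q"
 shows "q : lspan K Q (pr ` S)"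
 using assms alg_hom_lspan[OF pr_alg_hom A.assoc_algebra_axioms Q_assoc_algebra] by (auto simp: carrier_Q)

end

section \<open>Quantum tori\<close>

abbreviation add_mon :: "'g::monoid_add monoid"
 where "add_mon == \<lparr>carrier = UNIV, monoid.mult = (+), one = 0\<rparr>"

text \<open>A linear group order on the exponents gives every nonzero element a highest and a lowest
  exponent. Both add under multiplication because \<open>c\<close> takes unit values, so there are
  no zero divisors.\<close>

locale torus = K?: field K for K :: "('k, 'e) ring_scheme" (structure) +
 fixes c :: "'g::linordered_ab_group_add => 'g => 'k"
 assumes c_unit: "c a b : Units K"
 and c_add_left: "c (a + b) d = c a d**c b d"
 and c_add_right: "c a (b + d) = c a b**c a d"
begin

lemma c_carrier [simp]: "c a b :.K" using c_unit Units_closed by blast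
lemma c_nonzero [simp]: "c a b ~= 0:" using c_unit field_Units by blast

lemma c_zero [simp]: "c 0 a = 1:" "c a 0 = 1:"
proof -
 have "c 0 a**c 0 a = c 0 a**1:" using c_add_left[of 0 0 a] by simp
 thus "c 0 a = 1:" using m_lcancel[of "c 0 a" "c 0 a" \<one>] by simp
 have "c a 0**c a 0 = c a 0**1:" using c_add_right[of a 0 0] by simp
 thus "c a 0 = 1:" using m_lcancel[of "c a 0" "c a 0" \<one>] by simp
qed

sublocale T: twist K add_mon c
proof (intro_locales)
 show "Group.monoid add_mon" by (rule monoidI) (auto simp: add.assoc)
 show "twist_axioms K add_mon c"
 by unfold_locales (auto simp: c_add_left c_add_right m_ac)
qed

abbreviation L where "L == T.L"
abbreviation sg where "sg == single K"

lemma sg_closed [simp]: "r :.K ==> sg g r :.L"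
 by (rule T.single_closed) auto

lemma sg_mult: "r :.K ==> s :.K ==> sg a r**.L sg b s = sg (a + b) (c a b**(r**s))"
 using T.L_mult_single[of a b r s] by simp

text \<open>If an exponent splits in only one way over the two supports, the convolution collapses
  to one term. Extreme exponents, least exponents and products with a monomial are all of this
  kind.\<close>

lemma L_mult_unique:
 assumes "f :.L" "g :.L"
 "!!a b. f a ~= 0: ==> g b ~= 0: ==> a + b = a0 + b0 ==> a = a0 & b = b0"
 shows "(f**.L g) (a0 + b0) = c a0 b0**(f a0**g b0)"
proof -
 let ?A = "insert a0 {x. f x ~= 0:}" and ?B = "insert b0 {x. g x ~= 0:}"
 have fin: "finite ?A" "finite ?B" using assms T.L_finite by auto
 have v: "!!x. f x :.K" "!!x. g x :.K" using assms T.L_value by blast+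
 have "(f**.L g) (a0 + b0) = (++p:?A \<times> ?B.
 if fst p**.add_mon snd p = a0 + b0 then c (fst p) (snd p)**(f (fst p)**g (snd p)) else 0:)"
 by (rule T.L_mult[OF assms(1,2) fin]) auto
 also have "... = (++p:{(a0, b0)}. c (fst p) (snd p)**(f (fst p)**g (snd p)))"
 proof (rule add.finprod_mono_neutral_cong_right)
 show "(if fst p**.add_mon snd p = a0 + b0 then c (fst p) (snd p)**(f (fst p)**g (snd p)) else 0:) = 0:"
 if p: "p : ?A \<times> ?B - {(a0, b0)}" for p
 proof -
 have "f (fst p) = 0: | g (snd p) = 0:" if "fst p + snd p = a0 + b0"
 using p assms(3)[of "fst p" "snd p"] that by (cases p) auto
 thus ?thesis using v by auto
 qed
 qed (use fin v in auto)
 also have "... = c a0 b0**(f a0**g b0)" using v by simp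
 finally show ?thesis .
qed

lemma L_mult_sg:
 assumes "f :.L" "r :.K"
 shows "(f**.L sg g r) (x + g) = c x g**(f x**r)"
 and "(sg g r**.L f) (g + x) = c g x**(r**f x)"
proof -
 have s: "sg g r :.L" "!!y. sg g r y ~= 0: ==> y = g" "sg g r g = r"
 using sg_closed[OF assms(2)] by (simp, simp_all add: single_def split: if_splits)
 show "(f**.L sg g r) (x + g) = c x g**(f x**r)"
 by (subst L_mult_unique[OF assms(1) s(1)]) (use s in force, simp add: s(3))
 show "(sg g r**.L f) (g + x) = c g x**(r**f x)"
 by (subst L_mult_unique[OF s(1) assms(1)]) (use s in force, simp add: s(3))
qed

lemma c_mult_nonzero:
 assumes "x :.K" "y :.K" "x ~= 0:" "y ~= 0:" shows "c a b**(x**y) ~= 0:"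
proof -
 have "x**y ~= 0:" using integral assms by blast
 thus ?thesis using integral[of "c a b" "x**y"] assms c_nonzero by auto
qed

lemma L_nonzeroE:
 assumes "f :.L" "f ~= 0:.L" obtains x where "f x ~= 0:"
 using assms by (auto simp: T.L_zero fun_eq_iff)

definition hi where "hi f = Max {x. f x ~= 0:}"
definition lo where "lo f = Min {x. f x ~= 0:}"

lemma hi_lo:
 assumes "f :.L" "f ~= 0:.L"
 shows "f (hi f) ~= 0:" "f (lo f) ~= 0:" "!!x. f x ~= 0: ==> x <= hi f" "!!x. f x ~= 0: ==> lo f <= x"
proof -
 have fin: "finite {x. f x ~= 0:}" "{x. f x ~= 0:} ~= {}" using assms T.L_finite L_nonzeroE by blast+
 show "f (hi f) ~= 0:" "f (lo f) ~= 0:" unfolding hi_def lo_def using Max_in[OF fin] Min_in[OF fin] by auto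
 show "!!x. f x ~= 0: ==> x <= hi f" "!!x. f x ~= 0: ==> lo f <= x" unfolding hi_def lo_def using fin by auto
qed

lemma hi_lo_mult:
 assumes f: "f :.L" "f ~= 0:.L" and g: "g :.L" "g ~= 0:.L"
 shows "f**.L g ~= 0:.L" "hi (f**.L g) = hi f + hi g" "lo (f**.L g) = lo f + lo g"
proof -
 note F = hi_lo[OF f] note G = hi_lo[OF g]
 have v: "!!x. f x :.K" "!!x. g x :.K" using f g T.L_value by blast+
 have fg: "f**.L g :.L" using f g by (simp add: T.L_mult_closed)
 have "(f**.L g) (hi f + hi g) = c (hi f) (hi g)**(f (hi f)**g (hi g))"
 proof (rule L_mult_unique[OF f(1) g(1)])
 fix a b assume "f a ~= 0:" "g b ~= 0:" "a + b = hi f + hi g"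
 moreover from this have "a <= hi f" "b <= hi g" using F G by auto
 ultimately show "a = hi f & b = hi g" by (metis add_le_cancel_left add_le_cancel_right antisym)
 qed
 hence 1: "(f**.L g) (hi f + hi g) ~= 0:" using c_mult_nonzero v F G by metis
 have "(f**.L g) (lo f + lo g) = c (lo f) (lo g)**(f (lo f)**g (lo g))"
 proof (rule L_mult_unique[OF f(1) g(1)])
 fix a b assume "f a ~= 0:" "g b ~= 0:" "a + b = lo f + lo g"
 moreover from this have "lo f <= a" "lo g <= b" using F G by auto
 ultimately show "a = lo f & b = lo g" by (metis add_le_cancel_left add_le_cancel_right antisym)
 qed
 hence 2: "(f**.L g) (lo f + lo g) ~= 0:" using c_mult_nonzero v F G by metis
 show nz: "f**.L g ~= 0:.L" using 1 by (auto simp: T.L_zero)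
 have b: "lo f + lo g <= x & x <= hi f + hi g" if x: "(f**.L g) x ~= 0:" for x
 proof -
 obtain a b where "f a ~= 0:" "g b ~= 0:" "x = a + b" using T.L_mult_support[OF f(1) g(1) x] by auto
 thus ?thesis using F G by (auto intro: add_mono)
 qed
 show "hi (f**.L g) = hi f + hi g" using hi_lo[OF fg nz] b 1 by (simp add: order_antisym)
 show "lo (f**.L g) = lo f + lo g" using hi_lo[OF fg nz] b 2 by (simp add: order_antisym)
qed

lemma L_integral: "f :.L ==> g :.L ==> f**.L g = 0:.L ==> f = 0:.L | g = 0:.L"
 using hi_lo_mult(1) by blast

lemma L_lcancel:
 assumes "f :.L" "g :.L" "h :.L" "h ~= 0:.L" "h**.L f = h**.L g"
 shows "f = g"
proof -
 have fg: "f \<ominus>.L g :.L" using assms by simp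
 have "h**.L (f \<ominus>.L g) = 0:.L" using assms by (simp add: T.L.r_minus T.L.r_distr a_minus_def T.L.r_neg)
 hence "f \<ominus>.L g = 0:.L" using L_integral[OF assms(3) fg] assms(4) by blast
 thus ?thesis using T.L.r_right_minus_eq[OF assms(1,2)] by simp
qed

lemma L_rcancel:
 assumes "f :.L" "g :.L" "h :.L" "h ~= 0:.L" "f**.L h = g**.L h"
 shows "f = g"
proof -
 have fg: "f \<ominus>.L g :.L" using assms by simp
 have "(f \<ominus>.L g)**.L h = 0:.L" using assms by (simp add: T.L.l_minus T.L.l_distr a_minus_def T.L.r_neg)
 hence "f \<ominus>.L g = 0:.L" using L_integral[OF fg assms(3)] assms(4) by blast
 thus ?thesis using T.L.r_right_minus_eq[OF assms(1,2)] by simp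
qed

lemma sg_nonzero [simp]: "r ~= 0: ==> sg g r ~= 0:.L"
 by (auto simp: single_def T.L_zero fun_eq_iff)

lemma L_one_nonzero [simp]: "1:.L ~= 0:.L"
 by (simp add: T.L_one)

text \<open>Highest and lowest exponents both add, so comparing them on the two sides leaves
  \<open>f\<close> with \<open>g\<close> as its highest and its lowest exponent.\<close>

lemma normal_factor_single:
 assumes "u :.L" "u ~= 0:.L" "f :.L" "r :.K" "r ~= 0:"
 "u**.L sg g r = f**.L u"
 obtains k where "k :.K" "f = sg g k"
proof -
 have hl: "hi (sg g r) = g" "lo (sg g r) = g"
 proof -
 have "{x. sg g r x ~= 0:} = {g}" using assms by (auto simp: single_def)
 thus "hi (sg g r) = g" "lo (sg g r) = g" by (auto simp: hi_def lo_def)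
 qed
 note HL = hi_lo_mult[OF assms(1,2) sg_closed[OF assms(4)] sg_nonzero[OF assms(5)], of g]
 have us: "u**.L sg g r ~= 0:.L" by (rule HL(1))
 have f: "f ~= 0:.L"
 proof
 assume "f = 0:.L"
 thus False using us assms(1,6) by simp
 qed
 have "hi f + hi u = hi u + g" "lo f + lo u = lo u + g"
 using hi_lo_mult(2,3)[OF assms(3) f assms(1,2)] HL(2,3) hl unfolding assms(6) by simp_all
 hence "hi f = g" "lo f = g" by (simp_all add: add.commute)
 hence "f x = 0:" if "x ~= g" for x using hi_lo(3,4)[OF assms(3) f, of x] that by force
 hence "f = sg g (f g)" by (auto simp: single_def)
 thus thesis using that T.L_value[OF assms(3)] by blast
qed

text \<open>Comparing coefficients at \<open>h + g\<close>: each exponent \<open>h\<close> of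
  \<open>u\<close> commutes with \<open>g\<close> up to the same scalar \<open>k\<close>. In this
  way a commutation relation restricts the whole support.\<close>

lemma normal_coeff:
 assumes "u :.L" "k :.K" "r :.K"
 "u**.L sg g r = sg g k**.L u" "u h ~= 0:"
 shows "c h g**r = k**c g h"
proof -
 have v: "u h :.K" using assms T.L_value by blast
 have "(u**.L sg g r) (h + g) = (sg g k**.L u) (g + h)" using assms(4) by (simp add: add.commute)
 hence "c h g**(u h**r) = c g h**(k**u h)"
 unfolding L_mult_sg(1)[OF assms(1,3)] L_mult_sg(2)[OF assms(1,2)] .
 hence "(c h g**r)**u h = (k**c g h)**u h" using v assms by (simp add: m_ac)
 thus ?thesis using v assms m_rcancel by auto
qed

text \<open>A least exponent for a partial order. Unlike \<open>lo\<close> it need not exist, but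
  where it does it bounds the whole support, and it is additive under products when the order is
  invariant under translation (\<open>low_at_mult\<close>).\<close>

definition low_at :: "('g => 'g => bool) => ('g => 'k) => 'g => bool"
 where "low_at lq f g \<longleftrightarrow> f :.L & f g ~= 0: & (ALL h. f h ~= 0: --> lq g h)"

lemma low_at_mult:
 assumes lq: "!!a b. lq a b \<longleftrightarrow> lq 0 (b - a)" "!!a b. lq 0 a ==> lq 0 b ==> lq 0 (a + b)"
 "!!a. lq 0 a ==> lq 0 (- a) ==> a = 0"
 and f: "low_at lq f a" and g: "low_at lq g b"
 shows "low_at lq (f**.L g) (a + b)"
proof -
 have fg: "f :.L" "g :.L" using f g by (auto simp: low_at_def)
 have v: "!!x. f x :.K" "!!x. g x :.K" using fg T.L_value by blast+
 have "(f**.L g) (a + b) = c a b**(f a**g b)"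
 proof (rule L_mult_unique[OF fg])
 fix x y assume *: "f x ~= 0:" "g y ~= 0:" "x + y = a + b"
 hence "lq 0 (x - a)" "lq 0 (y - b)" using f g lq(1) unfolding low_at_def by blast+
 moreover have "y - b = - (x - a)" using *(3) by (simp add: algebra_simps)
 ultimately have "x - a = 0" using lq(3) by metis
 thus "x = a & y = b" using *(3) by simp
 qed
 hence 1: "(f**.L g) (a + b) ~= 0:" using c_mult_nonzero v f g unfolding low_at_def by metis
 have "lq (a + b) x" if x: "(f**.L g) x ~= 0:" for x
 proof -
 obtain a' b' where *: "f a' ~= 0:" "g b' ~= 0:" "x = a' + b'" using T.L_mult_support[OF fg x] by auto
 hence "lq 0 (a' - a)" "lq 0 (b' - b)" using f g lq(1) unfolding low_at_def by blast+
 hence "lq 0 ((a' - a) + (b' - b))" by (rule lq(2))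
 thus ?thesis unfolding *(3) by (subst lq(1)) (simp add: algebra_simps)
 qed
 thus ?thesis using 1 fg T.L_mult_closed by (auto simp: low_at_def)
qed

end

section \<open>Polynomials as a monoid algebra\<close>

text \<open>A bound beyond which all coefficients vanish is the same as finite support over the
  naturals. Thus \<open>UP\<close> becomes a monoid algebra and inherits its induction rule and
  universal property.\<close>

lemma carrier_UP: "car (UP R) = car (monoid_algebra R (add_mon :: nat monoid))"
proof -
 have "p : up R \<longleftrightarrow> p : UNIV \<rightarrow> car R & finite {n. p n ~= 0:.R}" for p
 proof -
 have "(EX n. bound 0:.R n p) \<longleftrightarrow> finite {n. p n ~= 0:.R}"
 proof
 assume "EX n. bound 0:.R n p"
 then obtain n where n: "bound 0:.R n p" by blast
 have "{m. p m ~= 0:.R} <= {..n}"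
 proof
 fix m assume "m : {m. p m ~= 0:.R}"
 hence "~ n < m" using bound.bound[OF n] by blast
 thus "m : {..n}" by simp
 qed
 thus "finite {n. p n ~= 0:.R}" by (rule finite_subset) simp
 next
 assume "finite {n. p n ~= 0:.R}"
 then obtain n where n: "ALL m:{m. p m ~= 0:.R}. m <= n" using finite_nat_set_iff_bounded_le by blast
 have "bound 0:.R n p"
 proof (rule bound.intro)
 fix m assume "n < m"
 thus "p m = 0:.R" using n by (meson leD mem_Collect_eq)
 qed
 thus "EX n. bound 0:.R n p" by blast
 qed
 thus ?thesis by (simp add: up_def)
 qed
 thus ?thesis by (auto simp: UP_def monoid_algebra_def)
qed

lemma UP_value: "p :.(UP R) ==> p n :.R"
 by (auto simp: UP_def up_def)

lemma UP_mult_value: "p :.(UP R) ==> q :.(UP R) ==>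
 (p**.(UP R) q) n = (++.R i:{..n}. p i**.R q (n - i))"
 by (simp add: UP_def)

lemma UP_one_value: "1:.(UP R) n = (if n = 0 then 1:.R else 0:.R)"
 and UP_zero_value: "0:.(UP R) n = 0:.R"
 and UP_add_value: "p :.(UP R) ==> q :.(UP R) ==> (p +:.(UP R) q) n = p n +:.R q n"
 and UP_smult_value: "k :.R ==> p :.(UP R) ==> (k *:.(UP R) p) n = k**.R p n"
 and UP_monom_value: "k :.R ==> up_ring.monom (UP R) k j n = (if j = n then k else 0:.R)"
 by (auto simp: UP_def)

lemma UP_ops:
 "1:.(UP R) = 1:.(monoid_algebra R (add_mon :: nat monoid))"
 "0:.(UP R) = 0:.(monoid_algebra R (add_mon :: nat monoid))"
 "p :.(UP R) ==> q :.(UP R) ==> p +:.(UP R) q = p +:.(monoid_algebra R (add_mon :: nat monoid)) q"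
 "k :.R ==> p :.(UP R) ==> k *:.(UP R) p = k *:.(monoid_algebra R (add_mon :: nat monoid)) p"
 "1:.R :.R ==> up_ring.monom (UP R) 1:.R n = basis_elt R n"
 by (simp_all add: fun_eq_iff UP_one_value UP_zero_value UP_add_value UP_smult_value UP_monom_value monoid_algebra_def basis_elt_def)

context cring begin

lemma monoid_alg_nat: "monoid_alg R (add_mon :: nat monoid)"
 by (intro monoid_alg.intro cring_axioms monoidI) auto

lemma UP_mult_eq:
 assumes "p :.(UP R)" "q :.(UP R)"
 shows "p**.(UP R) q = p **.(monoid_algebra R (add_mon :: nat monoid)) q"
proof
 fix n
 have v: "!!i. p i :.R" "!!i. q i :.R" using assms by (auto intro: UP_value)
 have "(p **.(monoid_algebra R (add_mon :: nat monoid)) q) n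
 = (++x:{(a, b). p a ~= 0: & q b ~= 0: & a + b = n}. p (fst x)**q (snd x))"
 by (simp add: monoid_algebra_def)
 also have "... = (++x:(%i. (i, n - i)) ` {..n}. p (fst x)**q (snd x))"
 proof (rule add.finprod_mono_neutral_cong_left)
 show "{(a, b). p a ~= 0: & q b ~= 0: & a + b = n} <= (%i. (i, n - i)) ` {..n}" by force
 show "p (fst x)**q (snd x) = 0:" if "x : (%i. (i, n - i)) ` {..n} - {(a, b). p a ~= 0: & q b ~= 0: & a + b = n}" for x
 using that v by auto
 qed (use v in auto)
 also have "... = (++i:{..n}. p i**q (n - i))"
 by (subst add.finprod_reindex) (use v in \<open>auto simp: inj_on_def\<close>)
 also have "... = (p**.(UP R) q) n" using assms by (simp add: UP_mult_value)
 finally show "(p**.(UP R) q) n = (p **.(monoid_algebra R (add_mon :: nat monoid)) q) n" by simp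
qed

interpretation N: monoid_alg R "add_mon :: nat monoid" by (rule monoid_alg_nat)
interpretation U: UP_cring R "UP R" by (intro UP_cring.intro cring_axioms) 

lemma UP_assoc_algebra: "assoc_algebra R (UP R)"
 by (rule assoc_algebra_cong[OF N.monoid_algebra_assoc_algebra])
 (simp_all add: carrier_UP[symmetric] UP_ops UP_mult_eq)

lemma UP_induct [consumes 1, case_names zero smult add]:
 assumes "f :.(UP R)" "P 0:.(UP R)"
 "!!n r. r :.R ==> P (r *:.(UP R) up_ring.monom (UP R) 1: n)"
 "!!f g. f :.(UP R) ==> g :.(UP R) ==> P f ==> P g ==> P (f +:.(UP R) g)"
 shows "P f"
 using assms(1)[unfolded carrier_UP]
proof (induction rule: N.monoid_algebra_induct)
 case (smult x r)
 have "up_ring.monom (UP R) 1: x :.(UP R)" by simp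
 thus ?case using assms(3)[of r x] UP_ops(4)[of r R "up_ring.monom (UP R) 1: x"] smult
 by (simp add: UP_ops(5))
next
 case (add f g)
 thus ?case using assms(4)[of f g] by (simp add: UP_ops carrier_UP)
qed (use assms(2) in \<open>simp add: UP_ops\<close>)

lemma UP_lift_hom:
 assumes "assoc_algebra R B" "mu : hom (add_mon :: nat monoid) B" "mu 0 = 1:.B"
 obtains f where "f : alg_hom R (UP R) B" "!!n. f (up_ring.monom (UP R) 1: n) = mu n"
proof
 have h: "N.lift_hom B mu : alg_hom R (monoid_algebra R (add_mon :: nat monoid)) B"
 by (rule N.lift_hom_alg_hom) (use assms in auto)
 show "N.lift_hom B mu : alg_hom R (UP R) B"
 unfolding alg_hom_def ring_hom_def
 by (auto simp: UP_mult_eq UP_ops alg_hom_mult[OF h] alg_hom_add[OF h] alg_hom_smult[OF h] alg_hom_one[OF h]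
 alg_hom_closed[OF h] carrier_UP[symmetric] carrier_UP[THEN equalityD1, THEN subsetD])
 show "N.lift_hom B mu (up_ring.monom (UP R) 1: n) = mu n" for n
 unfolding UP_ops(5)[OF one_closed] by (rule N.lift_hom_basis_elt) (use assms in auto)
qed

lemma UP_lspan: "f :.(UP R) ==> f : lspan R (UP R) (range (up_ring.monom (UP R) 1:))"
proof (induction rule: UP_induct)
 have s: "range (up_ring.monom (UP R) 1:) <= car (UP R)" by auto
 {
 case (smult n r)
 thus ?case by (intro lspan_smult[OF UP_assoc_algebra] lspan_base[OF UP_assoc_algebra] s) auto
 next
 case (add f g)
 thus ?case by (intro lspan_add[OF UP_assoc_algebra] s)
 }
qed (rule lspan.zero)

end

section \<open>Automorphism groups of algebras\<close>

lemma alg_aut_subgroup: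
 assumes "assoc_algebra K A"
 shows "subgroup (alg_iso K A A \<inter> Bij (car A)) (BijGroup (car A))"
proof -
 interpret A: assoc_algebra K A by fact
 interpret B: group "BijGroup (car A)" by (rule group_BijGroup)
 show ?thesis
 proof (rule B.subgroupI)
 show "alg_iso K A A \<inter> Bij (car A) <= car (BijGroup (car A))" by (auto simp: BijGroup_def)
 have "(\<lambda>x\<in>car A. x) : alg_iso K A A \<inter> Bij (car A)"
 by (auto simp: alg_iso_def ring_iso_def ring_hom_def Bij_def bij_betw_def inj_on_def)
 thus "alg_iso K A A \<inter> Bij (car A) ~= {}" by blast
 next
 fix f assume f: "f : alg_iso K A A \<inter> Bij (car A)"
 let ?g = "restrict (inv_into (car A) f) (car A)"
 have g: "inv_into (car A) f : alg_iso K A A" using alg_hom_inv[of f K A A] f assms by auto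
 have "?g : alg_iso K A A"
 using g by (auto simp: alg_iso_def ring_iso_def ring_hom_def bij_betw_restrict_eq)
 moreover have "?g : Bij (car A)" using f restrict_inv_into_Bij by auto
 ultimately show "inv\<^bsub>BijGroup (car A)\<^esub> f : alg_iso K A A \<inter> Bij (car A)"
 using f by (simp add: inv_BijGroup)
 next
 fix f g assume fg: "f : alg_iso K A A \<inter> Bij (car A)" "g : alg_iso K A A \<inter> Bij (car A)"
 have gf: "f \<circ> g : alg_iso K A A"
 using fg alg_hom_comp[OF alg_iso_alg_hom alg_iso_alg_hom] bij_betw_trans[OF alg_iso_bij alg_iso_bij] alg_isoI by blast
 have "compose (car A) f g : alg_iso K A A"
 proof (rule alg_isoI)
 show "compose (car A) f g : alg_hom K A A"
 using alg_iso_alg_hom[OF gf] by (auto simp: alg_hom_def ring_hom_def compose_def)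
 show "bij_betw (compose (car A) f g) (car A) (car A)"
 using fg compose_Bij[of f "car A" g] by (auto simp: Bij_def)
 qed
 thus "f **.(BijGroup (car A)) g : alg_iso K A A \<inter> Bij (car A)"
 using fg compose_Bij by (auto simp: BijGroup_def)
 qed
qed

lemma alg_aut_group_facts:
 assumes A: "assoc_algebra K A"
 shows "group (alg_aut_group K A)"
 "car (alg_aut_group K A) = alg_iso K A A \<inter> Bij (car A)"
 "f :.(alg_aut_group K A) ==> g :.(alg_aut_group K A) ==>
 f**.(alg_aut_group K A) g = compose (car A) f g"
 "1:.(alg_aut_group K A) = (\<lambda>x\<in>car A. x)"
 "f :.(alg_aut_group K A) ==>
 inv\<^bsub>alg_aut_group K A\<^esub> f = restrict (inv_into (car A) f) (car A)"
proof -
 interpret B: group "BijGroup (car A)" by (rule group_BijGroup)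
 note s = alg_aut_subgroup[OF A]
 show "group (alg_aut_group K A)" unfolding alg_aut_group_def using subgroup.subgroup_is_group[OF s B.is_group] .
 show c: "car (alg_aut_group K A) = alg_iso K A A \<inter> Bij (car A)" by (simp add: alg_aut_group_def)
 show "f**.(alg_aut_group K A) g = compose (car A) f g"
 if "f :.(alg_aut_group K A)" "g :.(alg_aut_group K A)"
 using that by (simp add: alg_aut_group_def BijGroup_def)
 show "1:.(alg_aut_group K A) = (\<lambda>x\<in>car A. x)" by (simp add: alg_aut_group_def BijGroup_def)
 show "inv\<^bsub>alg_aut_group K A\<^esub> f = restrict (inv_into (car A) f) (car A)"
 if "f :.(alg_aut_group K A)"
 using that B.m_inv_consistent[OF s] unfolding c alg_aut_group_def by (auto simp: inv_BijGroup)
qed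

section \<open>Generators and spanning sets of quantum generalized Weyl algebras\<close>

locale qgwa = K?: field K for K :: "('k, 'e) ring_scheme" (structure) +
 fixes m :: nat and q :: "nat => 'k" and \<sigma> :: "nat => (nat => 'k) => nat => 'k" and h :: "nat => nat => 'k"
 assumes data: "quantum_gwa_data K m q \<sigma> h"
begin

abbreviation P where "P == UP K"
abbreviation tp where "tp n == up_ring.monom P 1: n"
abbreviation ta where "ta i == inv\<^bsub>alg_aut_group K P\<^esub> (\<sigma> i)"

sublocale U: UP_domain K P by (intro UP_domain.intro) (rule domain_axioms)
sublocale P: assoc_algebra K P by (rule UP_assoc_algebra)

lemma q_props: "i < m ==> q i :.K" "i < m ==> q i ~= 0:" "i < m ==> q i ~= 1:" "i < m ==> q i : Units K"
 using data by (auto simp: quantum_gwa_data_def field_Units)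

lemma \<sigma>_aut: "i < m ==> \<sigma> i :.(alg_aut_group K P)"
 using data by (auto simp: quantum_gwa_data_def gwa_data_def)

lemma \<sigma>_hom: "i < m ==> \<sigma> i : alg_hom K P P"
 using \<sigma>_aut alg_aut_group_facts(2)[OF P.assoc_algebra_axioms] alg_iso_alg_hom by blast

lemma \<sigma>_closed: "i < m ==> p :.P ==> \<sigma> i p :.P"
 using alg_hom_closed[OF \<sigma>_hom] .

lemma tp_add: "tp (i + j) = tp i**.P tp j"
 using U.monom_mult[of \<one> \<one> i j] by simp

lemma tp_closed [simp]: "tp n :.P" by simp

lemma \<sigma>_tp: assumes "i < m" shows "\<sigma> i (tp n) = (q i [^] n) *:.P tp n"
proof (induction n)
 case 0
 have "tp 0 = 1:.P" by (rule U.monom_one)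
 thus ?case using alg_hom_one[OF \<sigma>_hom[OF assms]] by simp
next
 case (Suc n)
 have t1: "\<sigma> i (tp 1) = q i *:.P tp 1" using data assms by (auto simp: quantum_gwa_data_def var_t_def)
 have "tp (Suc n) = tp n**.P tp 1" using tp_add[of n 1] by simp
 hence "\<sigma> i (tp (Suc n)) = (q i [^] n *:.P tp n)**.P (q i *:.P tp 1)"
 using alg_hom_mult[OF \<sigma>_hom[OF assms]] Suc t1 by simp
 also have "... = (q i [^] n**q i) *:.P (tp n**.P tp 1)"
 using q_props(1)[OF assms] by (simp add: P.smult_mult_left P.smult_mult_right del: U.monom_mult,
 simp add: m_comm flip: U.smult_assoc1)
 finally show ?case using \<open>tp (Suc n) = _\<close> by simp
qed

text \<open>An algebra endomorphism is determined by its value on t; here it is the substitution t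
  -> q_i t.\<close>

lemma \<sigma>_coeff:
 assumes "i < m" "p :.P"
 shows "\<sigma> i p n = q i [^] n**p n"
 using assms(2)
proof (induction rule: UP_induct)
 case zero
 have "\<sigma> i 0:.P = 0:.P" using alg_hom_zero[OF \<sigma>_hom[OF assms(1)] U.P.ring_axioms U.P.ring_axioms] .
 hence "\<sigma> i 0:.P n = 0:.P n" by (rule fun_cong)
 thus ?case using q_props(1)[OF assms(1)] UP_zero_value[of K n] by (metis r_null nat_pow_closed)
next
 case (smult k r)
 have t: "tp k n = (if n = k then 1: else 0:)" by (simp add: UP_monom_value)
 have sm: "(r' *:.P p) n = r'**p n" if "r' :.K" "p :.P" for r' p using that by (rule UP_smult_value)
 have "\<sigma> i (r *:.P tp k) = r *:.P (q i [^] k *:.P tp k)"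
 using alg_hom_smult[OF \<sigma>_hom[OF assms(1)] smult, of "tp k"] \<sigma>_tp[OF assms(1)] by simp
 thus ?case using smult q_props(1)[OF assms(1)] by (simp add: sm t m_comm)
next
 case (add f g)
 have v: "f n :.K" "g n :.K" using add by (auto intro: UP_value)
 have ad: "(f +:.P g) n = f n +: g n" if "f :.P" "g :.P" for f g using that by (rule UP_add_value)
 show ?case using add v q_props(1)[OF assms(1)] \<sigma>_closed[OF assms(1)] 
 by (simp add: alg_hom_add[OF \<sigma>_hom[OF assms(1)]] ad r_distr)
qed

lemma ta_hom: "i < m ==> ta i : alg_hom K P P"
 using group.inv_closed[OF alg_aut_group_facts(1)[OF P.assoc_algebra_axioms] \<sigma>_aut, of i]
 alg_aut_group_facts(2)[OF P.assoc_algebra_axioms] alg_iso_alg_hom by blast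

lemma ta_closed: "i < m ==> p :.P ==> ta i p :.P"
 using alg_hom_closed[OF ta_hom] .

lemma \<sigma>ta: assumes "i < m" "p :.P" shows "\<sigma> i (ta i p) = p" "ta i (\<sigma> i p) = p"
proof -
 have b: "bij_betw (\<sigma> i) (car P) (car P)"
 using \<sigma>_aut[OF assms(1)] alg_aut_group_facts(2)[OF P.assoc_algebra_axioms] by (auto simp: Bij_def)
 have t: "ta i = restrict (inv_into (car P) (\<sigma> i)) (car P)"
 using alg_aut_group_facts(5)[OF P.assoc_algebra_axioms \<sigma>_aut[OF assms(1)]] .
 show "\<sigma> i (ta i p) = p" "ta i (\<sigma> i p) = p"
 using b assms t \<sigma>_closed by (auto simp: bij_betw_def f_inv_into_f)
qed

lemma h_closed: "i < m ==> h i :.P"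
 and \<sigma>_h: "i < m ==> j < m ==> i ~= j ==> \<sigma> i (h j) = h j"
 using data by (auto simp: quantum_gwa_data_def gwa_data_def central_elt_def)

lemma h_nonzero: assumes "i < m" shows "h i ~= 0:.P"
proof
 assume "h i = 0:.P"
 moreover have "regular_elt P (h i)" using data assms by (auto simp: quantum_gwa_data_def gwa_data_def)
 ultimately have "0:.P**.P 1:.P = 0:.P --> 1:.P = 0:.P"
 unfolding regular_elt_def by (metis U.P.one_closed)
 thus False using U.UP_one_not_zero U.P.l_null[OF U.P.one_closed] by metis
qed

definition gens where "gens = Coef ` car P \<union> GenX ` {..<m} \<union> GenY ` {..<m}"
abbreviation wm where "wm == \<lparr>carrier = lists gens, monoid.mult = (@), one = []\<rparr>"

lemma gwa_free_eq: "gwa_free K P m = monoid_algebra K wm"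
 by (simp add: gwa_free_def free_algebra_def gens_def)

sublocale F: monoid_alg K wm
 by (intro monoid_alg.intro is_cring monoidI) auto

abbreviation F where "F == monoid_algebra K wm"
abbreviation be where "be == basis_elt K"
abbreviation I where "I == gwa_ideal K P m \<sigma> h"

lemma be_closed: "w : lists gens ==> be w :.F"
 using F.basis_elt_closed by simp

lemma gens_mem: "p :.P ==> Coef p : gens" "i < m ==> GenX i : gens" "i < m ==> GenY i : gens"
 by (auto simp: gens_def)

lemma relations_closed: "gwa_relations K P m \<sigma> h <= car F"
 unfolding gwa_relations_def Let_def gwa_free_eq
 by (auto intro!: F.S.minus_closed F.S.smult_closed be_closed F.S.add.m_closed
 simp: gens_mem \<sigma>_closed ta_closed h_closed)

lemma I_ideal: "ideal I F"
 unfolding gwa_ideal_def gwa_free_eq using relations_closed by (rule F.S.genideal_ideal)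

sublocale Q: quot_alg K F I
 by (intro quot_alg.intro F.S.assoc_algebra_axioms I_ideal)

abbreviation W where "W == gwa K P m \<sigma> h"

lemma W_eq: "W = quotient_algebra F I"
 by (simp add: gwa_def gwa_free_eq)

sublocale W: assoc_algebra K W
 unfolding W_eq by (rule Q.Q_assoc_algebra)

abbreviation cf where "cf == gwa_coef K P m \<sigma> h"
definition xg where "xg i = Q.pr (be [GenX i])"
definition yg where "yg i = Q.pr (be [GenY i])"

lemma cf_eq: "cf p = Q.pr (be [Coef p])"
 by (simp add: gwa_coef_def gwa_free_eq)

lemma pr_be_closed: "w : lists gens ==> Q.pr (be w) :.W"
 unfolding W_eq Q.carrier_Q using be_closed by blast

lemma cf_closed [simp]: "p :.P ==> cf p :.W"
 and xg_closed [simp]: "i < m ==> xg i :.W"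
 and yg_closed [simp]: "i < m ==> yg i :.W"
 unfolding cf_eq xg_def yg_def using pr_be_closed gens_mem by auto

lemma pr_be_append: "u : lists gens ==> v : lists gens ==> Q.pr (be (u @ v)) = Q.pr (be u)**.W Q.pr (be v)"
 unfolding W_eq using F.basis_elt_mult[of u v] by (simp add: Q.pr_mult be_closed)

lemma pr_relI:
 assumes "x \<ominus>.(gwa_free K P m) y : gwa_relations K P m \<sigma> h" "x :.F" "y :.F"
 shows "Q.pr x = Q.pr y"
proof -
 have "x \<ominus>.F y : I" unfolding gwa_ideal_def gwa_free_eq
 using F.S.genideal_self[OF relations_closed] assms(1) unfolding gwa_free_eq by blast
 thus ?thesis using Q.pr_eq_iff assms by blast
qed

lemma pr_be2: "a : gens ==> b : gens ==> Q.pr (be [a, b]) = Q.pr (be [a])**.W Q.pr (be [b])"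
 using pr_be_append[of "[a]" "[b]"] by simp

lemma cf_add: assumes "r :.P" "s :.P" shows "cf (r +:.P s) = cf r +:.W cf s"
proof -
 have "Q.pr (be [Coef (r +:.P s)]) = Q.pr (be [Coef r] +:.F be [Coef s])"
 by (rule pr_relI) (use assms in \<open>auto simp: be_closed gens_mem gwa_relations_def Let_def simp flip: gwa_free_eq\<close>, 
 simp_all add: gwa_free_eq be_closed gens_mem)
 thus ?thesis unfolding cf_eq W_eq using assms by (simp add: Q.pr_add be_closed gens_mem)
qed

lemma cf_smult: assumes "c :.K" "r :.P" shows "cf (c *:.P r) = c *:.W cf r"
proof -
 have "Q.pr (be [Coef (c *:.P r)]) = Q.pr (c *:.F be [Coef r])"
 by (rule pr_relI) (use assms in \<open>auto simp: be_closed gens_mem gwa_relations_def Let_def simp flip: gwa_free_eq\<close>, 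
 simp_all add: gwa_free_eq be_closed gens_mem)
 thus ?thesis unfolding cf_eq W_eq using assms by (simp add: Q.pr_smult be_closed gens_mem)
qed

lemma cf_one: "cf 1:.P = 1:.W"
proof -
 have "Q.pr (be [Coef 1:.P]) = Q.pr 1:.F"
 by (rule pr_relI) (auto simp: gwa_relations_def Let_def be_closed gens_mem simp flip: gwa_free_eq, 
 simp_all add: gwa_free_eq be_closed gens_mem)
 thus ?thesis unfolding cf_eq W_eq by (simp add: Q.pr_one)
qed

lemma cf_mult: assumes "r :.P" "s :.P" shows "cf (r**.P s) = cf r**.W cf s"
proof -
 have "Q.pr (be [Coef (r**.P s)]) = Q.pr (be [Coef r, Coef s])"
 by (rule pr_relI) (use assms in \<open>auto simp: be_closed gens_mem gwa_relations_def Let_def\<close>)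
 thus ?thesis unfolding cf_eq using assms pr_be2 gens_mem by simp
qed

lemma xg_cf: assumes "i < m" "r :.P" shows "xg i**.W cf r = cf (\<sigma> i r)**.W xg i"
proof -
 have "Q.pr (be [GenX i, Coef r]) = Q.pr (be [Coef (\<sigma> i r), GenX i])"
 by (rule pr_relI) (use assms in \<open>auto simp: be_closed gens_mem gwa_relations_def Let_def \<sigma>_closed\<close>)
 thus ?thesis unfolding cf_eq xg_def using assms pr_be2 gens_mem \<sigma>_closed by simp
qed

lemma yg_cf: assumes "i < m" "r :.P" shows "yg i**.W cf r = cf (ta i r)**.W yg i"
proof -
 have "Q.pr (be [GenY i, Coef r]) = Q.pr (be [Coef (ta i r), GenY i])"
 by (rule pr_relI) (use assms in \<open>auto simp: be_closed gens_mem gwa_relations_def Let_def ta_closed\<close>)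
 thus ?thesis unfolding cf_eq yg_def using assms pr_be2 gens_mem ta_closed by simp
qed

lemma XY: assumes "i < m" shows "xg i**.W yg i = cf (h i)"
proof -
 have "Q.pr (be [GenX i, GenY i]) = Q.pr (be [Coef (h i)])"
 by (rule pr_relI) (use assms in \<open>auto simp: be_closed gens_mem gwa_relations_def Let_def h_closed\<close>)
 thus ?thesis unfolding cf_eq xg_def yg_def using assms pr_be2 gens_mem by simp
qed

lemma YX: assumes "i < m" shows "yg i**.W xg i = cf (ta i (h i))"
proof -
 have "Q.pr (be [GenY i, GenX i]) = Q.pr (be [Coef (ta i (h i))])"
 by (rule pr_relI) (use assms in \<open>auto simp: be_closed gens_mem gwa_relations_def Let_def h_closed ta_closed\<close>)
 thus ?thesis unfolding cf_eq xg_def yg_def using assms pr_be2 gens_mem by simp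
qed

lemma XX: assumes "i < m" "j < m" shows "xg i**.W xg j = xg j**.W xg i"
proof (cases "i = j")
 case False
 have "Q.pr (be [GenX i, GenX j]) = Q.pr (be [GenX j, GenX i])"
 by (rule pr_relI) (use assms False in \<open>auto simp: be_closed gens_mem gwa_relations_def Let_def\<close>)
 thus ?thesis unfolding xg_def using assms pr_be2 gens_mem by simp
qed simp

lemma YY: assumes "i < m" "j < m" shows "yg i**.W yg j = yg j**.W yg i"
proof (cases "i = j")
 case False
 have "Q.pr (be [GenY i, GenY j]) = Q.pr (be [GenY j, GenY i])"
 by (rule pr_relI) (use assms False in \<open>auto simp: be_closed gens_mem gwa_relations_def Let_def\<close>)
 thus ?thesis unfolding yg_def using assms pr_be2 gens_mem by simp
qed simp

lemma XY_comm: assumes "i < m" "j < m" "i ~= j" shows "xg i**.W yg j = yg j**.W xg i"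
proof -
 have "Q.pr (be [GenX i, GenY j]) = Q.pr (be [GenY j, GenX i])"
 by (rule pr_relI) (use assms in \<open>auto simp: be_closed gens_mem gwa_relations_def Let_def\<close>)
 thus ?thesis unfolding xg_def yg_def using assms pr_be2 gens_mem by simp
qed

lemma W_words: "w :.W ==> w : lspan K W ((%u. Q.pr (be u)) ` lists gens)"
 using Q.Q_lspan[of "be ` lists gens" w] F.monoid_algebra_lspan F.basis_elt_closed
 unfolding W_eq by (auto simp: image_image)

text \<open>A word goes to the product of the images of its letters. The assumed identities say
  exactly that each defining relation is sent to zero, so the map factors through the ideal.\<close>

lemma gwa_hom:
 assumes B: "assoc_algebra K B" and f: "f : alg_hom K P B"
 and xy: "!!i. i < m ==> x i :.B" "!!i. i < m ==> y i :.B"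
 and rel: "!!i r. i < m ==> r :.P ==> x i**.B f r = f (\<sigma> i r)**.B x i"
 "!!i r. i < m ==> r :.P ==> y i**.B f r = f (ta i r)**.B y i"
 "!!i. i < m ==> x i**.B y i = f (h i)"
 "!!i. i < m ==> y i**.B x i = f (ta i (h i))"
 "!!i j. i < m ==> j < m ==> i ~= j ==> x i**.B x j = x j**.B x i"
 "!!i j. i < m ==> j < m ==> i ~= j ==> y i**.B y j = y j**.B y i"
 "!!i j. i < m ==> j < m ==> i ~= j ==> x i**.B y j = y j**.B x i"
 obtains vp where "vp : alg_hom K W B" "!!p. p :.P ==> vp (cf p) = f p"
 "!!i. i < m ==> vp (xg i) = x i" "!!i. i < m ==> vp (yg i) = y i"
proof -
 interpret B: assoc_algebra K B by fact
 define g where "g = (%u. case u of Coef p => f p | GenX i => x i | GenY i => y i)"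
 have g: "u : gens ==> g u :.B" for u using alg_hom_closed[OF f] xy by (auto simp: gens_def g_def)
 define mu where "mu w = foldr (%u b. g u**.B b) w 1:.B" for w
 have muc: "w : lists gens ==> mu w :.B" for w
 by (induction w) (auto simp: mu_def g)
 have mua: "u : lists gens ==> v : lists gens ==> mu (u @ v) = mu u**.B mu v" for u v
 proof (induction u)
 case Nil
 thus ?case using muc by (simp add: mu_def)
 next
 case (Cons a u)
 have "mu (a # w) = g a**.B mu w" for w by (simp add: mu_def)
 thus ?case using Cons muc g by (simp add: B.m_assoc)
 qed
 have muh: "mu : hom wm B" "mu 1:.wm = 1:.B"
 using muc mua by (auto simp: hom_def) (simp add: mu_def)
 define E where "E = F.lift_hom B mu"
 have E: "E : alg_hom K F B" unfolding E_def by (rule F.lift_hom_alg_hom[OF B muh])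
 have Eb: "E (be w) = mu w" if "w : lists gens" for w
 unfolding E_def by (rule F.lift_hom_basis_elt[OF B muh]) (use that in simp)
 interpret E: ring_hom_ring F B E
 using alg_hom_ring_hom[OF E] F.S.ring_axioms B.ring_axioms ring_hom_ringI2 by blast
 have mu1: "mu [u] = g u" "mu [u, v] = g u**.B g v" if "u : gens" "v : gens" for u v using g that by (simp_all add: mu_def)
 have E1: "E (be [u]) = g u" if "u : gens" for u using Eb[of "[u]"] mu1(1)[of u u] that by simp
 have E2: "E (be [u, v]) = g u**.B g v" if "u : gens" "v : gens" for u v using Eb[of "[u, v]"] mu1[of u v] that by simp
 have gs: "g (Coef p) = f p" "g (GenX i) = x i" "g (GenY i) = y i" for p i by (simp_all add: g_def)
 have rel0: "gwa_relations K P m \<sigma> h <= a_kernel F B E"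
 proof
 fix z assume z: "z : gwa_relations K P m \<sigma> h"
 hence zF: "z :.F" using relations_closed by blast
 have mi: "E (a \<ominus>.F b) = 0:.B" if "a :.F" "b :.F" "E a = E b" for a b
 using alg_hom_minus[OF E F.S.ring_axioms B.ring_axioms that(1,2)] that by (simp add: B.r_neg a_minus_def)
 note sm = alg_hom_smult[OF E] alg_hom_add[OF E] alg_hom_one[OF E]
 alg_hom_add[OF f] alg_hom_smult[OF f] alg_hom_mult[OF f] alg_hom_one[OF f]
 have "E z = 0:.B" using z unfolding gwa_relations_def Let_def gwa_free_eq Un_iff mem_Collect_eq singleton_iff
 by (elim disjE exE conjE; simp; intro mi)
 (simp_all add: be_closed gens_mem \<sigma>_closed ta_closed h_closed E1 E2 gs sm rel)
 thus "z : a_kernel F B E" using zF unfolding a_kernel_def' by blast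
 qed
 have "I <= a_kernel F B E" unfolding gwa_ideal_def gwa_free_eq
 by (rule F.S.genideal_minimal[OF E.kernel_is_ideal rel0])
 hence "!!z. z : I ==> E z = 0:.B" unfolding a_kernel_def' by blast
 from Q.factor_hom[OF E B this] obtain ps where ps: "ps : alg_hom K Q.Q B" "!!a. a :.F ==> ps (Q.pr a) = E a" by blast
 show thesis
 by (rule that[of ps]) (use ps in \<open>auto simp: W_eq cf_eq xg_def yg_def be_closed gens_mem E1 gs\<close>)
qed

end

declare pow_nat [simp del]

section \<open>Spanning by the normal monomials\<close>

context qgwa begin

definition zp :: "nat => int => ((nat => 'k) gwa_gen list => 'k) set"
 where "zp i k = (if k \<ge> 0 then xg i [^].W nat k else yg i [^].W nat (- k))"

primrec zz :: "nat => (nat => int) => ((nat => 'k) gwa_gen list => 'k) set"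
 where "zz 0 a = 1:.W"
 | "zz (Suc n) a = zz n a**.W zp n (a n)"

lemma zp_closed [simp]: "i < m ==> zp i k :.W"
 by (simp add: zp_def)

lemma zz_closed [simp]: "n <= m ==> zz n a :.W"
 by (induction n) auto

lemma zz_cong: "(!!i. i < n ==> a i = b i) ==> zz n a = zz n b"
 by (induction n) auto

text \<open>Elements past which a coefficient can be moved to the left. Only the existence of the
  new coefficient matters, which keeps the notion closed under products and hence true of all
  monomials.\<close>

definition passes where
 "passes z \<longleftrightarrow> z :.W & (ALL p:car P. EX p':car P. z**.W cf p = cf p'**.W z)"

lemma passes_one: "passes 1:.W"
 by (auto simp: passes_def)

lemma passes_mult:
 assumes "passes y" "passes z" shows "passes (y**.W z)"
 unfolding passes_def
proof (intro conjI ballI)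
 show "y**.W z :.W" using assms by (simp add: passes_def)
 fix p assume p: "p :.P"
 obtain p' where p': "p' :.P" "z**.W cf p = cf p'**.W z" using assms p by (auto simp: passes_def)
 obtain p'' where p'': "p'' :.P" "y**.W cf p' = cf p''**.W y" using assms p' by (auto simp: passes_def)
 have yz: "y :.W" "z :.W" using assms by (auto simp: passes_def)
 have "y**.W z**.W cf p = (y**.W cf p')**.W z" using yz p p' by (simp add: W.m_assoc)
 also have "... = cf p''**.W (y**.W z)" unfolding p''(2) using yz p'' by (simp add: W.m_assoc)
 finally show "EX p':car P. y**.W z**.W cf p = cf p'**.W (y**.W z)" using p'' by blast
qed

lemma passes_pow: "passes z ==> passes (z [^].W (n::nat))"
 by (induction n) (auto simp: passes_one passes_mult)

lemma passes_gens: "i < m ==> passes (xg i)" "i < m ==> passes (yg i)"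
 using xg_cf yg_cf \<sigma>_closed ta_closed by (auto simp: passes_def)

lemma passes_zz: "n <= m ==> passes (zz n a)"
 by (induction n) (auto simp: passes_one passes_gens zp_def intro!: passes_mult passes_pow)

lemma zp_comm:
 assumes "i < m" "j < m" "i ~= j" "g = xg i | g = yg i"
 shows "g**.W zp j k = zp j k**.W g"
proof -
 have g: "g :.W" using assms by auto
 have "xg j**.W g = g**.W xg j" "yg j**.W g = g**.W yg j"
 using assms XX YY XY_comm by metis+
 thus ?thesis unfolding zp_def
 using W.group_commutes_pow[of "xg j" g] W.group_commutes_pow[of "yg j" g] g assms by simp
qed

lemma zz_comm:
 assumes "i < m" "n <= i" "g = xg i | g = yg i"
 shows "g**.W zz n a = zz n a**.W g"
 using assms(2)
proof (induction n)
 case 0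
 have "g :.W" using assms by auto
 thus ?case by simp
next
 case (Suc n)
 have g: "g :.W" using assms by auto
 have zc: "zz n a :.W" "zp n (a n) :.W" using Suc assms by auto
 have "g**.W zz (Suc n) a = (zz n a**.W g)**.W zp n (a n)"
 using Suc g zc by (simp flip: W.m_assoc)
 also have "... = zz n a**.W (zp n (a n)**.W g)"
 using zp_comm[of i n g "a n"] Suc assms g zc by (simp add: W.m_assoc)
 finally show ?case using g zc by (simp add: W.m_assoc)
qed

text \<open>A generator of the same sign as the degree just lengthens the power. One of the opposite
  sign cancels a factor and releases the coefficient \<open>h i\<close> or
  \<open>ta i (h i)\<close>.\<close>

lemma zp_step:
 assumes "i < m" "g = xg i | g = yg i"
 obtains p k' where "p :.P" "g**.W zp i k = cf p**.W zp i k'"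
proof -
 have pw: "z**.W z [^].W n = z [^].W Suc n" if "z :.W" for z and n :: nat
 by (rule W.nat_pow_Suc2[OF that, symmetric])
 have one: "z = cf 1:.P**.W z" if "z :.W" for z using that by (simp add: cf_one)
 consider "k \<ge> 0" "g = xg i" | "k <= 0" "g = yg i" | n where "k = - int (Suc n)" "g = xg i" | n where "k = int (Suc n)" "g = yg i"
 proof (cases "k = 0 | (k > 0 \<longleftrightarrow> g = xg i)")
 case True
 thus ?thesis using assms(2) that(1,2) by fastforce
 next
 case False
 thus ?thesis using assms(2) that(3,4)[of "nat (\<bar>k\<bar> - 1)"] by auto
 qed
 thus thesis
 proof cases
 case 1
 have "g**.W zp i k = zp i (k + 1)" using 1 assms pw[of "xg i" "nat k"] by (simp add: zp_def nat_add_distrib)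
 thus thesis using that[of "1:.P" "k + 1"] one assms by simp
 next
 case 2
 have "g**.W zp i k = zp i (k - 1)"
 proof (cases "k = 0")
 case False
 hence "nat (- (k - 1)) = Suc (nat (- k))" using 2 by auto
 thus ?thesis using 2 False assms pw[of "yg i" "nat (- k)"] by (simp add: zp_def del: minus_diff_eq)
 qed (use 2 assms in \<open>simp add: zp_def\<close>)
 thus thesis using that[of "1:.P" "k - 1"] one assms by simp
 next
 case 3
 have e: "nat (- k) = Suc n" "~ k \<ge> 0" using 3 by auto
 have "g**.W zp i k = (xg i**.W yg i)**.W yg i [^].W n"
 unfolding zp_def using 3 e assms pw[of "yg i" n] by (simp add: W.m_assoc)
 also have "... = cf (h i)**.W zp i (- int n)" using assms XY by (simp add: zp_def)
 finally show thesis using that h_closed assms by blast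
 next
 case 4
 have e: "nat k = Suc n" "k \<ge> 0" using 4 by auto
 have "g**.W zp i k = (yg i**.W xg i)**.W xg i [^].W n"
 unfolding zp_def using 4 e assms pw[of "xg i" n] by (simp add: W.m_assoc)
 also have "... = cf (ta i (h i))**.W zp i (int n)" using assms YX by (simp add: zp_def)
 finally show thesis using that h_closed ta_closed assms by blast
 qed
qed

lemma zz_step:
 assumes "i < n" "n <= m" "g = xg i | g = yg i"
 shows "EX p a'. p :.P & g**.W zz n a = cf p**.W zz n a'"
 using assms(1,2)
proof (induction n)
 case (Suc n)
 have g: "g :.W" using assms Suc by auto
 have zc: "zz n a :.W" "zp n k :.W" for a k using Suc by auto
 show ?case
 proof (cases "i = n")
 case True
 obtain p k' where p: "p :.P" "g**.W zp n (a n) = cf p**.W zp n k'"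
 using zp_step[of n g "a n"] True assms Suc by auto
 obtain p' where p': "p' :.P" "zz n a**.W cf p = cf p'**.W zz n a"
 using passes_zz[of n a] Suc p by (auto simp: passes_def)
 have "g**.W zz (Suc n) a = zz n a**.W (g**.W zp n (a n))"
 using zz_comm[of i n g a] True Suc assms g zc by (simp flip: W.m_assoc)
 also have "... = (zz n a**.W cf p)**.W zp n k'" unfolding p(2) using p zc by (simp add: W.m_assoc)
 also have "... = cf p'**.W (zz n a**.W zp n k')" unfolding p'(2) using p' zc by (simp add: W.m_assoc)
 also have "zz n a**.W zp n k' = zz (Suc n) (a(n := k'))" using zz_cong[of n a "a(n := k')"] by simp
 finally show ?thesis using p' by blast
 next
 case False
 then obtain p a' where p: "p :.P" "g**.W zz n a = cf p**.W zz n a'" using Suc by auto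
 have "g**.W zz (Suc n) a = cf p**.W (zz n a'**.W zp n (a n))"
 using g zc p by (simp flip: W.m_assoc)
 also have "zz n a'**.W zp n (a n) = zz (Suc n) (a'(n := a n))" using zz_cong[of n a' "a'(n := a n)"] by simp
 finally show ?thesis using p by blast
 qed
qed simp

definition mons where "mons = (%(j, a). cf (tp j)**.W zz m a) ` UNIV"

lemma mons_closed: "mons <= car W"
 by (auto simp: mons_def)

lemma cf_hom: "cf : alg_hom K P W"
 by (auto simp: alg_hom_def ring_hom_def cf_mult cf_add cf_one cf_smult)

lemma cf_zz_span:
 assumes "p :.P" shows "cf p**.W zz m a : lspan K W mons"
proof -
 have "cf p : lspan K W (cf ` range tp)"
 by (rule alg_hom_lspan[OF cf_hom UP_assoc_algebra W.assoc_algebra_axioms UP_lspan[OF assms]]) auto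
 thus ?thesis
 by (rule lspan_mult[OF W.assoc_algebra_axioms _ lspan_base[OF W.assoc_algebra_axioms, of "zz m a" "{zz m a}"]])
 (auto simp: mons_def intro!: lspan_base[OF W.assoc_algebra_axioms])
qed

text \<open>Induction on words: by \<open>zz_step\<close> and \<open>passes_gens\<close>, left
  multiplication by a letter turns a monomial into a coefficient times a monomial, and
  \<open>cf_zz_span\<close> expands the coefficient in powers of t.\<close>

lemma W_span:
 assumes "w :.W" shows "w : lspan K W mons"
proof -
 note A = W.assoc_algebra_axioms
 have step: "Q.pr (be [u])**.W s : lspan K W mons" if u: "u : gens" and s: "s : mons" for u s
 proof -
 obtain j a where s: "s = cf (tp j)**.W zz m a" using s by (auto simp: mons_def)
 consider p where "u = Coef p" "p :.P" | i g where "i < m" "Q.pr (be [u]) = g" "g = xg i | g = yg i"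
 using u by (auto simp: gens_def xg_def yg_def)
 thus ?thesis
 proof cases
 case 1
 hence "Q.pr (be [u])**.W s = cf (p**.P tp j)**.W zz m a"
 using s by (simp add: cf_mult W.m_assoc flip: cf_eq)
 thus ?thesis using cf_zz_span[of "p**.P tp j" a] 1 by simp
 next
 case 2
 then obtain p where p: "p :.P" "g**.W cf (tp j) = cf p**.W g"
 using passes_gens[of i] tp_closed[of j] 2 unfolding passes_def by metis
 obtain p' a' where p': "p' :.P" "g**.W zz m a = cf p'**.W zz m a'" using zz_step[of i m g a] 2 by auto
 have g: "g :.W" using 2 by auto
 have "g**.W s = cf p**.W (g**.W zz m a)" unfolding s using g p by (simp flip: W.m_assoc)
 also have "... = cf (p**.P p')**.W zz m a'" unfolding p'(2) using p p' by (simp add: cf_mult W.m_assoc)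
 finally show ?thesis using cf_zz_span[of "p**.P p'" a'] p p' 2 by simp
 qed
 qed
 have words: "Q.pr (be u) : lspan K W mons" if "u : lists gens" for u
 using that
 proof (induction u)
 case Nil
 have "be [] = 1:.F" using F.basis_elt_one by simp
 hence "Q.pr (be []) = 1:.W" by (simp add: W_eq Q.pr_one)
 moreover have "zz n (%_. 0) = 1:.W" for n by (induction n) (auto simp: zp_def)
 moreover have "cf (tp 0) = 1:.W" using cf_one U.monom_one by simp
 ultimately have "Q.pr (be []) = cf (tp 0)**.W zz m (%_. 0)" by simp
 hence "Q.pr (be []) : mons" 
 unfolding mons_def by (intro image_eqI[where x = "(0, %_. 0)"]) simp_all
 thus ?case using lspan_base[OF A _ mons_closed] by blast
 next
 case (Cons u w)
 have "Q.pr (be (u # w)) = Q.pr (be [u])**.W Q.pr (be w)" using pr_be_append[of "[u]" w] Cons by simp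
 moreover have "Q.pr (be [u])**.W Q.pr (be w) : lspan K W mons"
 by (rule lspan_mult[OF A lspan_base[OF A, of _ "{Q.pr (be [u])}"] Cons.IH _ mons_closed mons_closed])
 (use Cons step pr_be_closed[of "[u]"] in auto)
 ultimately show ?case by simp
 qed
 show ?thesis
 by (rule lspan_trans[OF A W_words[OF assms] _ mons_closed]) (use words in auto)
qed

end

section \<open>Embedding families of quantum generalized Weyl algebras into a quantum torus\<close>

type_synonym expo = "(nat \<times> nat) \<Rightarrow>\<^sub>0 int"

text \<open>The key \<open>(l, 0)\<close> stands for the variable \<open>t\<close> of the \<open>l\<close>-th factor, the key \<open>(l, i + 1)\<close> for its \<open>x\<^sub>i\<close>.\<close>

abbreviation tk :: "nat => int => expo" where "tk l n == Poly_Mapping.single (l, 0) n"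
abbreviation xk :: "nat => nat => int => expo" where "xk l i n == Poly_Mapping.single (l, Suc i) n"
abbreviation lkt :: "expo => nat => int" where "lkt g l == Poly_Mapping.lookup g (l, 0)"
abbreviation lkx :: "expo => nat => nat => int" where "lkx g l i == Poly_Mapping.lookup g (l, Suc i)"

lemmas lk = lookup_add lookup_minus lookup_uminus lookup_zero lookup_single when_def

lemma expo_eqI:
 assumes "!!l. lkt g l = lkt h l" "!!l i. lkx g l i = lkx h l i" shows "g = h"
proof (rule poly_mapping_eqI)
 fix k :: "nat \<times> nat"
 obtain l j where k: "k = (l, j)" by (cases k)
 show "Poly_Mapping.lookup g k = Poly_Mapping.lookup h k"
 unfolding k using assms by (cases j) auto
qed

text \<open>Exponents are comparable only when their x-parts agree: x-degrees are a grading
  respected by the images of the normal monomials, whereas their t-degrees are controlled only from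
  below.\<close>

definition lq :: "expo => expo => bool"
 where "lq g h \<longleftrightarrow> (ALL l. lkt g l <= lkt h l) & (ALL l i. lkx g l i = lkx h l i)"

lemma lq_facts: "lq a b \<longleftrightarrow> lq 0 (b - a)" "lq 0 a ==> lq 0 b ==> lq 0 (a + b)" "lq 0 a ==> lq 0 (- a) ==> a = 0"
 by (auto simp: lq_def lk intro!: expo_eqI)

definition ordt :: "('k, 'e) ring_scheme => (nat => 'k) => nat"
 where "ordt K p = (LEAST n. p n ~= 0:.K)"

locale weyl_family = K?: field K for K :: "('k, 'e) ring_scheme" (structure) +
 fixes s :: nat and m :: "nat => nat" and q :: "nat => nat => 'k"
 and \<sigma> :: "nat => nat => (nat => 'k) => nat => 'k" and h :: "nat => nat => nat => 'k"
 assumes data: "l < s ==> quantum_gwa_data K (m l) (q l) (\<sigma> l) (h l)"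
begin

lemma qgwa: "l < s ==> qgwa K (m l) (q l) (\<sigma> l) (h l)"
 by (intro qgwa.intro qgwa_axioms.intro data field_axioms)

abbreviation Uk where "Uk == units_of K"

sublocale Uk: comm_group Uk by (rule units_comm_group)

lemma Uk_facts: "car Uk = Units K" "x**.Uk y = x**y" "1:.Uk = 1:"
 by (simp_all add: units_of_def)

definition Ix where "Ix = (SIGMA l:{..<s}. {..<m l})"

lemma finite_Ix: "finite Ix" by (simp add: Ix_def)

lemma q_Units: "p : Ix ==> q (fst p) (snd p) : Units K"
 using qgwa.q_props(4)[OF qgwa] by (auto simp: Ix_def)

text \<open>The exponent \<open>g\<close> stands for the monomial with all t to the left of all x.
  Reordering a product moves each x_i of the left factor past the t of the right one, at the price
  of one q_i per pair.\<close>

definition cc :: "expo => expo => 'k"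
 where "cc g d = finprod Uk (%p. q (fst p) (snd p) [^].Uk (lkx g (fst p) (snd p) * lkt d (fst p))) Ix"

lemma cc_term: "p : Ix ==> q (fst p) (snd p) [^].Uk (n::int) :.Uk"
 using q_Units by (intro Uk.int_pow_closed) (simp add: Uk_facts)

lemma cc_single:
 assumes "p : Ix" "!!p'. p' : Ix ==> p' ~= p ==> lkx g (fst p') (snd p') * lkt d (fst p') = 0"
 shows "cc g d = q (fst p) (snd p) [^].Uk (lkx g (fst p) (snd p) * lkt d (fst p))"
proof -
 have "cc g d = finprod Uk (%p. q (fst p) (snd p) [^].Uk (lkx g (fst p) (snd p) * lkt d (fst p))) {p}"
 unfolding cc_def
 proof (rule Uk.finprod_mono_neutral_cong_right)
 fix p' assume "p' : Ix - {p}"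
 hence "lkx g (fst p') (snd p') * lkt d (fst p') = 0" using assms(2)[of p'] by blast
 thus "q (fst p') (snd p') [^].Uk (lkx g (fst p') (snd p') * lkt d (fst p')) = 1:.Uk"
 by (simp only: int_pow_0)
 qed (use assms finite_Ix cc_term in auto)
 thus ?thesis using cc_term[OF assms(1)] by simp
qed

lemma cc_one: assumes "!!p. p : Ix ==> lkx g (fst p) (snd p) * lkt d (fst p) = 0" shows "cc g d = 1:"
proof -
 have "cc g d = finprod Uk (%p. 1:.Uk) Ix"
 unfolding cc_def
 proof (rule Uk.finprod_cong')
 fix p assume "p : Ix"
 from assms[OF this] show "q (fst p) (snd p) [^].Uk (lkx g (fst p) (snd p) * lkt d (fst p)) = 1:.Uk"
 by (simp only: int_pow_0)
 qed auto
 also have "... = 1:.Uk" by (rule Uk.finprod_one)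
 finally show ?thesis by (simp only: Uk_facts(3))
qed

lemma q_Uk: "p : Ix ==> q (fst p) (snd p) :.Uk"
 using q_Units by (simp add: Uk_facts)

sublocale T: torus K cc
proof (intro torus.intro torus_axioms.intro field_axioms)
 fix a b d :: expo
 show "cc a b : Units K" unfolding cc_def Uk_facts(1)[symmetric] by (rule Uk.finprod_closed) (use cc_term in auto)
 have "cc (a + b) d = finprod Uk (%p. q (fst p) (snd p) [^].Uk (lkx a (fst p) (snd p) * lkt d (fst p))
 **.Uk q (fst p) (snd p) [^].Uk (lkx b (fst p) (snd p) * lkt d (fst p))) Ix"
 unfolding cc_def by (rule Uk.finprod_cong')
 (use cc_term q_Uk in \<open>auto simp: lk distrib_right Uk.int_pow_mult\<close>)
 also have "... = cc a d**cc b d"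
 unfolding cc_def Uk_facts(2)[symmetric] by (rule Uk.finprod_multf) (use cc_term in auto)
 finally show "cc (a + b) d = cc a d**cc b d" .
 have "cc a (b + d) = finprod Uk (%p. q (fst p) (snd p) [^].Uk (lkx a (fst p) (snd p) * lkt b (fst p))
 **.Uk q (fst p) (snd p) [^].Uk (lkx a (fst p) (snd p) * lkt d (fst p))) Ix"
 unfolding cc_def by (rule Uk.finprod_cong')
 (use cc_term q_Uk in \<open>auto simp: lk distrib_left Uk.int_pow_mult\<close>)
 also have "... = cc a b**cc a d"
 unfolding cc_def Uk_facts(2)[symmetric] by (rule Uk.finprod_multf) (use cc_term in auto)
 finally show "cc a (b + d) = cc a b**cc a d" .
qed

abbreviation L where "L == T.L"
abbreviation sg where "sg == single K"
abbreviation P where "P == UP K"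
abbreviation tp where "tp n == up_ring.monom P 1: n"

lemma cc_tk_left [simp]: "cc (tk l n) g = 1:"
 by (rule cc_one) (simp add: lk)

lemma cc_xk_right [simp]: "cc g (xk l i n) = 1:"
 by (rule cc_one) (simp add: lk)

lemma cc_xk_left: assumes "l < s" "i < m l" shows "cc (xk l i n) g = q l i [^].Uk (n * lkt g l)"
proof -
 have p: "(l, i) : Ix" using assms by (auto simp: Ix_def)
 show ?thesis using cc_single[OF p, of "xk l i n" g] by (force simp: lk)
qed

lemma q_pow: assumes "l < s" "i < m l" shows "q l i [^].Uk (int n) = q l i [^] n"
proof -
 have "q l i : Units K" using q_Units[of "(l, i)"] assms by (auto simp: Ix_def)
 thus ?thesis using units_of_pow[of "q l i" n] by (simp add: int_pow_int)
qed

lemma sg_one_mult: "sg a 1:**.L sg b 1: = sg (a + b) (cc a b)"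
 by (simp add: T.sg_mult)

lemma smult_sg: "k :.K ==> r :.K ==> k *:.L sg g r = sg g (k**r)"
 by (auto simp: T.T.L_smult single_def)

definition pt where "pt l = (SOME f. f : alg_hom K P L & (ALL n. f (tp n) = sg (tk l (int n)) 1:))"

lemma pt: "pt l : alg_hom K P L" "pt l (tp n) = sg (tk l (int n)) 1:"
proof -
 have "(%n. sg (tk l (int n)) 1:) : hom (add_mon :: nat monoid) L"
 by (auto simp: hom_def sg_one_mult single_add)
 moreover have "sg (tk l (int 0)) 1: = 1:.L" by (simp add: T.T.L_one)
 ultimately obtain f where "f : alg_hom K P L" "!!n. f (tp n) = sg (tk l (int n)) 1:"
 using UP_lift_hom[OF T.T.L.assoc_algebra_axioms, of "%n. sg (tk l (int n)) 1:"] by blast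
 hence "EX f. f : alg_hom K P L & (ALL n. f (tp n) = sg (tk l (int n)) 1:)" by blast
 from someI_ex[OF this] show "pt l : alg_hom K P L" "pt l (tp n) = sg (tk l (int n)) 1:"
 unfolding pt_def by blast+
qed

sublocale UPK: UP_cring K P by (intro UP_cring.intro is_cring)
sublocale PK: assoc_algebra K P by (rule UP_assoc_algebra)

lemma pt_closed [simp]: "p :.P ==> pt l p :.L"
 using alg_hom_closed[OF pt(1)] .

lemma pt_coeff:
 assumes "p :.P" shows "pt l p g = (if g = tk l (lkt g l) & lkt g l \<ge> 0 then p (nat (lkt g l)) else 0:)"
 using assms
proof (induction rule: UP_induct)
 case zero
 have "pt l 0:.P = 0:.L" by (rule alg_hom_zero[OF pt(1) UPK.P.ring_axioms T.T.L.ring_axioms])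
 moreover have "0:.P n = 0:" for n by (rule UP_zero_value)
 ultimately show ?case by (metis T.T.L_zero)
next
 case (smult n r)
 have "pt l (r *:.P tp n) = sg (tk l (int n)) r"
 using smult alg_hom_smult[OF pt(1) smult, of "tp n"] by (simp add: pt(2) smult_sg)
 moreover have "(r *:.P tp n) (nat (lkt g l)) = (if n = nat (lkt g l) then r else 0:)"
 using smult UPK.monom_closed[OF one_closed] by (simp add: UP_smult_value UP_monom_value)
 moreover have "g = tk l (int n) \<longleftrightarrow> g = tk l (lkt g l) & lkt g l \<ge> 0 & n = nat (lkt g l)"
 by (auto simp: lk)
 ultimately show ?case by (simp add: single_def)
next
 case (add f g')
 have "(f +:.P g') (nat (lkt g l)) = f (nat (lkt g l)) +: g' (nat (lkt g l))" using add by (simp add: UP_add_value)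
 thus ?case using add by (simp add: alg_hom_add[OF pt(1)] T.T.L_add)
qed

lemma xe_pt:
 assumes "l < s" "i < m l" "p :.P"
 shows "sg (xk l i 1) 1:**.L pt l p = pt l (\<sigma> l i p)**.L sg (xk l i 1) 1:"
proof -
 interpret G: qgwa K "m l" "q l" "\<sigma> l" "h l" using qgwa[OF assms(1)] .
 note S = G.\<sigma>_hom[OF assms(2)]
 show ?thesis using assms(3)
 proof (induction rule: UP_induct)
 case zero
 have z: "pt l 0:.P = 0:.L" "\<sigma> l i 0:.P = 0:.P"
 using alg_hom_zero[OF pt(1) UPK.P.ring_axioms T.T.L.ring_axioms] alg_hom_zero[OF S UPK.P.ring_axioms UPK.P.ring_axioms] by auto
 show ?case unfolding z by simp
 next
 case (smult n r)
 have qn: "q l i [^] n :.K" using G.q_props assms by simp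
 have "\<sigma> l i (r *:.P tp n) = r *:.P (q l i [^] n *:.P tp n)"
 using alg_hom_smult[OF S smult, of "tp n"] G.\<sigma>_tp[OF assms(2)] by simp
 hence "pt l (\<sigma> l i (r *:.P tp n)) = sg (tk l (int n)) (r**q l i [^] n)"
 using smult qn by (simp add: alg_hom_smult[OF pt(1)] pt(2) smult_sg)
 moreover have "pt l (r *:.P tp n) = sg (tk l (int n)) r"
 using smult alg_hom_smult[OF pt(1) smult, of "tp n"] by (simp add: pt(2) smult_sg)
 moreover have "cc (xk l i 1) (tk l (int n)) = q l i [^] n"
 using cc_xk_left[OF assms(1,2), of 1 "tk l (int n)"] q_pow[OF assms(1,2)] by (simp add: lk)
 ultimately show ?case using smult qn by (simp add: T.sg_mult add.commute m_comm)
 next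
 case (add f g)
 thus ?case
 by (simp add: alg_hom_add[OF pt(1)] alg_hom_add[OF S] G.\<sigma>_closed assms T.T.L.l_distr T.T.L.r_distr)
 qed
qed

lemma xe_inv: "sg (xk l i 1) 1:**.L sg (xk l i (-1)) 1: = 1:.L"
 "sg (xk l i (-1)) 1:**.L sg (xk l i 1) 1: = 1:.L"
 by (simp_all add: sg_one_mult T.T.L_one flip: single_add)

lemma ye_pt:
 assumes "l < s" "i < m l" "p :.P"
 shows "sg (xk l i (-1)) 1:**.L pt l p = pt l (qgwa.ta K (\<sigma> l) i p)**.L sg (xk l i (-1)) 1:"
proof -
 interpret G: qgwa K "m l" "q l" "\<sigma> l" "h l" using qgwa[OF assms(1)] .
 let ?x = "sg (xk l i 1) 1:" and ?y = "sg (xk l i (-1)) 1:" and ?p = "G.ta i p"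
 have c: "?x :.L" "?y :.L" "pt l p :.L" "pt l ?p :.L"
 using assms G.ta_closed by auto
 have e: "?x**.L pt l ?p = pt l p**.L ?x"
 using xe_pt[OF assms(1,2), of ?p] G.\<sigma>ta assms G.ta_closed by simp
 have "?y**.L pt l p = ?y**.L pt l p**.L (?x**.L ?y)" using c by (simp add: xe_inv)
 also have "... = ?y**.L (pt l p**.L ?x)**.L ?y" using c by (simp add: T.T.L.m_assoc)
 also have "... = (?y**.L ?x)**.L pt l ?p**.L ?y" unfolding e[symmetric] using c by (simp add: T.T.L.m_assoc)
 also have "... = pt l ?p**.L ?y" using c by (simp add: xe_inv)
 finally show ?thesis .
qed

abbreviation A where "A l == gwa K P (m l) (\<sigma> l) (h l)"
abbreviation cfl where "cfl l == gwa_coef K P (m l) (\<sigma> l) (h l)"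
abbreviation xgl where "xgl l == qgwa.xg K (m l) (\<sigma> l) (h l)"
abbreviation ygl where "ygl l == qgwa.yg K (m l) (\<sigma> l) (h l)"
abbreviation zpl where "zpl l == qgwa.zp K (m l) (\<sigma> l) (h l)"
abbreviation zzl where "zzl l == qgwa.zz K (m l) (\<sigma> l) (h l)"

definition is_phi where "is_phi l vp \<longleftrightarrow> vp : alg_hom K (A l) L & (ALL p:car P. vp (cfl l p) = pt l p) &
 (ALL i<m l. vp (xgl l i) = sg (xk l i 1) 1:) & (ALL i<m l. vp (ygl l i) = sg (xk l i (-1)) 1:**.L pt l (h l i))"

definition vp where "vp l = (SOME f. is_phi l f)"

lemma vp_is_phi: assumes l: "l < s" shows "is_phi l (vp l)"
proof -
 interpret G: qgwa K "m l" "q l" "\<sigma> l" "h l" using qgwa[OF l] .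
 let ?x = "%i. sg (xk l i 1) 1:" and ?e = "%i. sg (xk l i (-1)) 1:"
 have hc: "i < m l ==> pt l (h l i) :.L" for i using G.h_closed by simp
 have ec: "?x i :.L" "?e i :.L" for i by auto
 have pm: "pt l r**.L pt l r' = pt l r'**.L pt l r" if "r :.P" "r' :.P" for r r'
 using alg_hom_mult[OF pt(1)] that UPK.UP_m_comm by metis
 have tah: "G.ta i (h l j) = h l j" if "i < m l" "j < m l" "i ~= j" for i j
 using G.\<sigma>ta(2)[of i "h l j"] G.\<sigma>_h[of i j] G.h_closed that by simp
 have xh: "?x i**.L pt l (h l j) = pt l (h l j)**.L ?x i" if "i < m l" "j < m l" "i ~= j" for i j
 using xe_pt[OF l that(1) G.h_closed[OF that(2)]] G.\<sigma>_h that by simp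
 have yh: "?e i**.L pt l (h l j) = pt l (h l j)**.L ?e i" if "i < m l" "j < m l" "i ~= j" for i j
 using ye_pt[OF l that(1) G.h_closed[OF that(2)]] tah that by simp
 have xx: "sg (xk l i a) 1:**.L sg (xk l j b) 1: = sg (xk l j b) 1:**.L sg (xk l i a) 1:" for i j a b
 by (simp add: sg_one_mult add.commute)
 obtain f where f: "f : alg_hom K G.W L" "!!p. p :.P ==> f (G.cf p) = pt l p"
 "!!i. i < m l ==> f (G.xg i) = ?x i" "!!i. i < m l ==> f (G.yg i) = ?e i**.L pt l (h l i)"
 proof (rule G.gwa_hom[OF T.T.L.assoc_algebra_axioms pt(1), of ?x "%i. ?e i**.L pt l (h l i)"])
 fix i r assume ir: "i < m l" "r :.P"
 show "?x i**.L pt l r = pt l (\<sigma> l i r)**.L ?x i" using xe_pt[OF l ir] .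
 have "?e i**.L pt l (h l i)**.L pt l r = (?e i**.L pt l r)**.L pt l (h l i)"
 using ir hc ec pm[of r "h l i"] G.h_closed by (simp add: T.T.L.m_assoc)
 also have "... = pt l (G.ta i r)**.L (?e i**.L pt l (h l i))"
 unfolding ye_pt[OF l ir] using ir hc ec G.ta_closed by (simp add: T.T.L.m_assoc)
 finally show "?e i**.L pt l (h l i)**.L pt l r = pt l (G.ta i r)**.L (?e i**.L pt l (h l i))" .
 next
 fix i assume i: "i < m l"
 show "?x i :.L" "?e i**.L pt l (h l i) :.L" using hc i by auto
 show "?x i**.L (?e i**.L pt l (h l i)) = pt l (h l i)"
 using hc[OF i] ec by (simp add: xe_inv flip: T.T.L.m_assoc)
 show "?e i**.L pt l (h l i)**.L ?x i = pt l (G.ta i (h l i))"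
 unfolding ye_pt[OF l i G.h_closed[OF i]] using G.ta_closed[OF i G.h_closed[OF i]] ec by (simp add: T.T.L.m_assoc xe_inv)
 next
 fix i j assume ij: "i < m l" "j < m l" "i ~= j"
 note c = hc[OF ij(1)] hc[OF ij(2)] ec
 show "?x i**.L ?x j = ?x j**.L ?x i" by (rule xx)
 have "?x i**.L (?e j**.L pt l (h l j)) = (?x i**.L ?e j)**.L pt l (h l j)" using c by (simp add: T.T.L.m_assoc)
 also have "... = ?e j**.L (?x i**.L pt l (h l j))" using xx[of i 1 j "-1"] c by (simp add: T.T.L.m_assoc)
 also have "... = ?e j**.L pt l (h l j)**.L ?x i" unfolding xh[OF ij] using c by (simp add: T.T.L.m_assoc)
 finally show "?x i**.L (?e j**.L pt l (h l j)) = ?e j**.L pt l (h l j)**.L ?x i" .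
 have r: "?e i**.L pt l (h l i)**.L (?e j**.L pt l (h l j)) = (?e i**.L ?e j)**.L (pt l (h l i)**.L pt l (h l j))"
 if ij: "i < m l" "j < m l" "i ~= j" for i j
 proof -
 note c = hc[OF ij(1)] hc[OF ij(2)] ec
 have "?e i**.L pt l (h l i)**.L (?e j**.L pt l (h l j)) = ?e i**.L (pt l (h l i)**.L ?e j)**.L pt l (h l j)"
 using c by (simp add: T.T.L.m_assoc)
 also have "pt l (h l i)**.L ?e j = ?e j**.L pt l (h l i)" using yh[of j i] ij by simp
 finally show ?thesis using c by (simp add: T.T.L.m_assoc)
 qed
 show "?e i**.L pt l (h l i)**.L (?e j**.L pt l (h l j)) = ?e j**.L pt l (h l j)**.L (?e i**.L pt l (h l i))"
 using r[OF ij] r[OF ij(2,1)] ij pm[of "h l i" "h l j"] xx[of i "-1" j "-1"] G.h_closed by simp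
 qed blast
 hence "is_phi l f" by (simp add: is_phi_def)
 thus ?thesis unfolding vp_def by (rule someI[of "is_phi l" f])
qed

lemma vp: "l < s ==> vp l : alg_hom K (A l) L" "l < s ==> p :.P ==> vp l (cfl l p) = pt l p"
 "l < s ==> i < m l ==> vp l (xgl l i) = sg (xk l i 1) 1:"
 "l < s ==> i < m l ==> vp l (ygl l i) = sg (xk l i (-1)) 1:**.L pt l (h l i)"
 using vp_is_phi by (auto simp: is_phi_def)

lemma A_algebra: assumes "l < s" shows "assoc_algebra K (A l)"
proof -
 interpret G: qgwa K "m l" "q l" "\<sigma> l" "h l" using qgwa[OF assms] .
 show ?thesis by (rule G.W.assoc_algebra_axioms)
qed

subsection \<open>Least exponents\<close>

abbreviation low where "low == T.low_at lq"

lemma low_mult: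
 assumes "low f a" "low g b" shows "low (f**.L g) (a + b)"
proof (rule T.low_at_mult[OF _ _ _ assms])
 show "lq a b \<longleftrightarrow> lq 0 (b - a)" for a b by (rule lq_facts(1))
 show "lq 0 a ==> lq 0 b ==> lq 0 (a + b)" for a b by (rule lq_facts(2))
 show "lq 0 a ==> lq 0 (- a) ==> a = 0" for a by (rule lq_facts(3))
qed

lemma low_sg: "low (sg g 1:) g"
 unfolding T.low_at_def by (intro conjI T.sg_closed one_closed) (auto simp: single_def lq_def split: if_splits)

definition co where "co l i = int (ordt K (h l i))"

lemma ordt_props:
 assumes "p :.P" "p ~= 0:.P"
 shows "p (ordt K p) ~= 0:" "!!n. p n ~= 0: ==> ordt K p <= n"
proof -
 have "EX n. p n ~= 0:"
 proof (rule ccontr)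
 assume "\<nexists>n. p n ~= 0:"
 hence "p = 0:.P" using UP_zero_value[of K] by (metis ext)
 thus False using assms by simp
 qed
 thus "p (ordt K p) ~= 0:" unfolding ordt_def by (metis (mono_tags, lifting) LeastI_ex)
 show "!!n. p n ~= 0: ==> ordt K p <= n" unfolding ordt_def by (rule Least_le)
qed

lemma low_pt:
 assumes "p :.P" "p ~= 0:.P" shows "low (pt l p) (tk l (int (ordt K p)))"
 unfolding T.low_at_def
proof (intro conjI allI impI)
 show "pt l p :.L" using assms by simp
 show "pt l p (tk l (int (ordt K p))) ~= 0:" using ordt_props[OF assms] by (simp add: pt_coeff[OF assms(1)] lk)
 fix g assume "pt l p g ~= 0:"
 hence g: "g = tk l (lkt g l)" "lkt g l \<ge> 0" "p (nat (lkt g l)) ~= 0:"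
 using pt_coeff[OF assms(1), of l g] by (auto split: if_splits)
 have "int (ordt K p) <= lkt g l" using ordt_props(2)[OF assms g(3)] g(2) by linarith
 thus "lq (tk l (int (ordt K p))) g" by (subst g(1)) (auto simp: lq_def lk)
qed

lemma alg_hom_pow:
 assumes "f : alg_hom K B L" "ring B" "x :.B" shows "f (x [^].B (n::nat)) = f x [^].L n"
proof -
 interpret B: ring B by fact
 show ?thesis by (induction n) (use assms in \<open>simp_all add: alg_hom_one[OF assms(1)] alg_hom_mult[OF assms(1)]\<close>)
qed

text \<open>Degree -k is reached by k factors y_i, and each of them has the least exponent of
  x_i^(-1) t^(co l i). This is where the additional t-exponent comes from.\<close>

definition zlow :: "nat => nat => int => expo" where "zlow l i k = xk l i k + tk l (max 0 (- k) * co l i)"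

lemma low_zp: assumes "l < s" "i < m l" shows "low (vp l (zpl l i k)) (zlow l i k)"
proof -
 interpret G: qgwa K "m l" "q l" "\<sigma> l" "h l" using qgwa[OF assms(1)] .
 note pw = alg_hom_pow[OF vp(1)[OF assms(1)] G.W.ring_axioms]
 have x: "low (sg (xk l i 1) 1: [^].L n) (xk l i (int n))" for n :: nat
 proof (induction n)
 case 0
 show ?case using low_sg[of 0] by (simp add: T.T.L_one)
 next
 case (Suc n)
 have "xk l i (int (Suc n)) = xk l i (int n) + xk l i 1" by (simp flip: single_add add: add.commute)
 thus ?case using low_mult[OF Suc low_sg[of "xk l i 1"]] by simp
 qed
 have y1: "low (sg (xk l i (-1)) 1:**.L pt l (h l i)) (xk l i (-1) + tk l (co l i))"
 unfolding co_def by (rule low_mult[OF low_sg low_pt[OF G.h_closed G.h_nonzero]]) (use assms in auto)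
 have y: "low ((sg (xk l i (-1)) 1:**.L pt l (h l i)) [^].L n) (xk l i (- int n) + tk l (int n * co l i))" for n :: nat
 proof (induction n)
 case 0
 show ?case using low_sg[of 0] by (simp add: T.T.L_one)
 next
 case (Suc n)
 have "xk l i (- int (Suc n)) + tk l (int (Suc n) * co l i) = (xk l i (- int n) + tk l (int n * co l i)) + (xk l i (-1) + tk l (co l i))"
 by (rule expo_eqI) (auto simp: lk algebra_simps)
 thus ?case using low_mult[OF Suc y1] by simp
 qed
 show ?thesis
 proof (cases "k \<ge> 0")
 case True
 thus ?thesis using x[of "nat k"] assms by (simp add: G.zp_def zlow_def pw vp(3))
 next
 case False
 thus ?thesis using y[of "nat (- k)"] assms by (simp add: G.zp_def zlow_def pw vp(4))
 qed
qed

lemma low_zz: assumes "l < s" "n <= m l" shows "low (vp l (zzl l n a)) (\<Sum>i<n. zlow l i (a i))"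
 using assms(2)
proof (induction n)
 case 0
 interpret G: qgwa K "m l" "q l" "\<sigma> l" "h l" using qgwa[OF assms(1)] .
 show ?case using low_sg[of 0] by (simp add: alg_hom_one[OF vp(1)[OF assms(1)]] T.T.L_one)
next
 case (Suc n)
 interpret G: qgwa K "m l" "q l" "\<sigma> l" "h l" using qgwa[OF assms(1)] .
 show ?case using low_mult[OF Suc.IH low_zp[OF assms(1), of n "a n"]] Suc.prems
 by (simp add: alg_hom_mult[OF vp(1)[OF assms(1)]])
qed

definition mon where "mon l r = cfl l (tp (nat (lkt r l)))**.(A l) zzl l (m l) (%i. lkx r l i)"

definition lowm where "lowm l r = tk l (int (nat (lkt r l))) + (\<Sum>i<m l. zlow l i (lkx r l i))"

lemma mon_closed: assumes "l < s" shows "mon l r :.(A l)"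
proof -
 interpret G: qgwa K "m l" "q l" "\<sigma> l" "h l" using qgwa[OF assms(1)] .
 show ?thesis by (simp add: mon_def)
qed

lemma low_mon: assumes "l < s" shows "low (vp l (mon l r)) (lowm l r)"
proof -
 interpret G: qgwa K "m l" "q l" "\<sigma> l" "h l" using qgwa[OF assms(1)] .
 have "low (pt l (tp (nat (lkt r l)))) (tk l (int (nat (lkt r l))))" unfolding pt(2) by (rule low_sg)
 thus ?thesis unfolding mon_def lowm_def using low_mult[OF _ low_zz[OF assms order_refl]] assms
 by (simp add: alg_hom_mult[OF vp(1)] vp(2))
qed

lemma lowm_lkx: "lkx (lowm l r) l' i = (if l' = l & i < m l then lkx r l i else 0)"
 by (auto simp: lowm_def zlow_def lookup_sum lk sum.distrib)

lemma lowm_lkt: "lkt (lowm l r) l' = (if l' = l then int (nat (lkt r l)) + (\<Sum>i<m l. max 0 (- lkx r l i) * co l i) else 0)"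
 by (auto simp: lowm_def zlow_def lookup_sum lk sum.distrib)

text \<open>The cocycle \<open>cc\<close> is trivial between exponents belonging to different
  factors, so monomials commute. The rest transports this along spans and words, since a map out of
  a presented algebra is known only on generators.\<close>

lemma vp_comm:
 assumes "l < s" "l' < s" "l ~= l'" "a :.(A l)" "b :.(A l')"
 shows "vp l a**.L vp l' b = vp l' b**.L vp l a"
proof -
 have comm: "f**.L g = g**.L f" if f: "f : lspan K L S" and g: "g : lspan K L S'" and S: "S <= car L" "S' <= car L"
 and SS': "!!x y. x : S ==> y : S' ==> x**.L y = y**.L x" for f g S S'
 proof -
 have gc: "g :.L" using lspan_closed[OF T.T.L.assoc_algebra_axioms g S(2)] .
 have 1: "x**.L g = g**.L x" if x: "x : S" for x
 using g
 proof (induction rule: lspan.induct)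
 case zero
 show ?case using x S by (auto simp: subset_eq)
 next
 case (step k b y)
 have "x :.L" "b :.L" "y :.L" using x S step lspan_closed[OF T.T.L.assoc_algebra_axioms] by blast+
 thus ?case using step SS'[OF x] by (simp add: T.T.L.l_distr T.T.L.r_distr T.T.L.smult_mult_left T.T.L.smult_mult_right)
 qed
 show ?thesis using f
 proof (induction rule: lspan.induct)
 case zero
 show ?case using gc by simp
 next
 case (step k b y)
 have "b :.L" "y :.L" using S step lspan_closed[OF T.T.L.assoc_algebra_axioms] by blast+
 thus ?case using step 1 gc by (simp add: T.T.L.l_distr T.T.L.r_distr T.T.L.smult_mult_left T.T.L.smult_mult_right)
 qed
 qed
 define gs where "gs l = {sg g 1: | g. EX j. g = tk l j | (EX i<m l. g = xk l i j)}" for l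
 have gsc: "gs l <= car L" for l by (auto simp: gs_def)
 have ptS: "pt l p : lspan K L (gs l)" if "p :.P" for l p
 proof -
 have "pt l p : lspan K L (pt l ` range tp)"
 by (rule alg_hom_lspan[OF pt(1) UP_assoc_algebra T.T.L.assoc_algebra_axioms UP_lspan[OF that]]) auto
 moreover have "pt l ` range tp <= gs l" by (auto simp: pt(2) gs_def)
 ultimately show ?thesis by (rule lspan_mono)
 qed
 have cross: "x**.L y = y**.L x" if x: "x : gs l" and y: "y : gs l'" and ll: "l < s" "l' < s" "l ~= l'" for x y l l'
 proof -
 obtain g g' where g: "x = sg g 1:" "y = sg g' 1:" "EX j. g = tk l j | (EX i<m l. g = xk l i j)" "EX j. g' = tk l' j | (EX i<m l'. g' = xk l' i j)"
 using x y by (auto simp: gs_def)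
 have "cc g g' = 1:" by (rule cc_one) (use g(3,4) ll in \<open>auto simp: lk\<close>)
 moreover have "cc g' g = 1:" by (rule cc_one) (use g(3,4) ll in \<open>auto simp: lk\<close>)
 ultimately show ?thesis by (simp add: g sg_one_mult add.commute)
 qed
 define S where "S l = pt l ` car P \<union> (%i. sg (xk l i 1) 1:) ` {..<m l} \<union> (%i. sg (xk l i (-1)) 1:) ` {..<m l}" for l
 have Ssp: "S l <= lspan K L (gs l)" for l
 proof -
 have "sg (xk l i k) 1: : lspan K L (gs l)" if "i < m l" for i k
 by (rule lspan_base[OF T.T.L.assoc_algebra_axioms _ gsc]) (use that in \<open>auto simp: gs_def\<close>)
 thus ?thesis using ptS unfolding S_def by blast
 qed
 have S1: "x**.L y = y**.L x" if "x : S l" "y : S l'" for x y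
 by (rule comm[OF _ _ gsc gsc, of _ l _ l']) (use that Ssp cross assms in blast)+
 have Sc: "S l <= car L" for l by (auto simp: S_def)
 text \<open>The centralizer of a set of elements contains the words in elements commuting with them.\<close>
 have words: "vp l a**.L z = z**.L vp l a"
 if l: "l < s" and a: "a :.(A l)" and z: "z :.L" "!!x. x : S l ==> x**.L z = z**.L x" for l a z
 proof -
 interpret G: qgwa K "m l" "q l" "\<sigma> l" "h l" using qgwa[OF l] .
 note ph = vp(1)[OF l]
 have cm: "(x**.L y)**.L z = z**.L (x**.L y)"
 if "x :.L" "y :.L" "x**.L z = z**.L x" "y**.L z = z**.L y" for x y
 using that z(1) by (metis T.T.L.m_assoc)
 have gen: "vp l (G.Q.pr (G.be [u]))**.L z = z**.L vp l (G.Q.pr (G.be [u]))" if "u : G.gens" for u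
 proof -
 consider p where "u = Coef p" "p :.P" | i where "u = GenX i" "i < m l" | i where "u = GenY i" "i < m l"
 using \<open>u \<in> G.gens\<close> by (auto simp: G.gens_def)
 thus ?thesis
 proof cases
 case 1
 thus ?thesis using z(2)[of "pt l p"] vp(2)[OF l, of p] by (simp add: G.cf_eq S_def)
 next
 case 2
 thus ?thesis using z(2)[of "sg (xk l i 1) 1:"] vp(3)[OF l, of i] by (simp add: G.xg_def S_def)
 next
 case 3
 have "(sg (xk l i (-1)) 1:**.L pt l (h l i))**.L z = z**.L (sg (xk l i (-1)) 1:**.L pt l (h l i))"
 by (rule cm) (use 3 G.h_closed z(2) in \<open>auto simp: S_def\<close>)
 thus ?thesis using 3 vp(4)[OF l, of i] by (simp add: G.yg_def)
 qed
 qed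
 have w: "vp l (G.Q.pr (G.be u))**.L z = z**.L vp l (G.Q.pr (G.be u))" if "u : lists G.gens" for u
 using that
 proof (induction u)
 case Nil
 have "G.be [] = 1:.G.F" using G.F.basis_elt_one by simp
 hence "G.Q.pr (G.be []) = 1:.G.W" by (simp add: G.W_eq G.Q.pr_one)
 thus ?case using alg_hom_one[OF ph] z by simp
 next
 case (Cons u v)
 have c: "G.Q.pr (G.be [u]) :.G.W" "G.Q.pr (G.be v) :.G.W" using Cons by (auto intro: G.pr_be_closed)
 have "G.Q.pr (G.be (u # v)) = G.Q.pr (G.be [u])**.G.W G.Q.pr (G.be v)" using G.pr_be_append[of "[u]" v] Cons by simp
 thus ?case using cm[of "vp l (G.Q.pr (G.be [u]))" "vp l (G.Q.pr (G.be v))"] Cons gen[of u] c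
 by (simp add: alg_hom_mult[OF ph] alg_hom_closed[OF ph])
 qed
 let ?W = "(%u. G.Q.pr (G.be u)) ` lists G.gens"
 have "vp l a : lspan K L (vp l ` ?W)"
 by (rule alg_hom_lspan[OF ph G.W.assoc_algebra_axioms T.T.L.assoc_algebra_axioms G.W_words[OF a]]) (auto intro: G.pr_be_closed)
 thus ?thesis
 by (rule comm[OF _ lspan_base[OF T.T.L.assoc_algebra_axioms, of z "{z}"]])
 (use z(1) w alg_hom_closed[OF ph G.pr_be_closed] in auto)
 qed
 have "vp l a**.L y = y**.L vp l a" if "y : S l'" for y
 by (rule words[OF assms(1,4)]) (use that Sc S1 in blast)+
 hence "vp l' b**.L vp l a = vp l a**.L vp l' b"
 by (intro words[OF assms(2,5)] alg_hom_closed[OF vp(1)[OF assms(1)] assms(4)]) auto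
 thus ?thesis by simp
qed

end

section \<open>Tensor products of finite families\<close>

locale tfam = R?: cring K for K :: "('k, 'e) ring_scheme" (structure) +
 fixes s :: nat and A :: "nat => ('k, 'a, 'x) module_scheme"
 assumes Aalg: "l < s ==> assoc_algebra K (A l)"
begin

abbreviation pm where "pm == product_group {..<s} A"

lemma Amon: "l < s ==> Group.monoid (A l)" and Aring: "l < s ==> ring (A l)"
proof -
 assume "l < s"
 then interpret G: assoc_algebra K "A l" by (rule Aalg)
 show "Group.monoid (A l)" "ring (A l)" by (rule G.monoid_axioms, rule G.ring_axioms)
qed

lemma A_closed:
 "l < s ==> a :.(A l) ==> b :.(A l) ==> a +:.(A l) b :.(A l)"
 "l < s ==> a :.(A l) ==> b :.(A l) ==> a**.(A l) b :.(A l)"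
 "l < s ==> k :.K ==> b :.(A l) ==> k *:.(A l) b :.(A l)"
 "l < s ==> 1:.(A l) :.(A l)" "l < s ==> 0:.(A l) :.(A l)"
proof -
 assume l: "l < s"
 then interpret G: assoc_algebra K "A l" by (rule Aalg)
 show "a :.(A l) ==> b :.(A l) ==> a +:.(A l) b :.(A l)"
 "a :.(A l) ==> b :.(A l) ==> a**.(A l) b :.(A l)"
 "k :.K ==> b :.(A l) ==> k *:.(A l) b :.(A l)"
 "1:.(A l) :.(A l)" "0:.(A l) :.(A l)" by auto
qed

lemma pm_monoid: "Group.monoid pm"
proof (rule monoidI)
 fix x y z assume "x :.pm" "y :.pm" "z :.pm"
 thus "x**.pm y**.pm z = x**.pm (y**.pm z)"
 using monoid.m_assoc[OF Amon] by (auto simp: PiE_iff intro!: restrict_ext)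
next
 fix x assume x: "x :.pm"
 have "(\<lambda>l\<in>{..<s}. 1:.(A l)**.(A l) x l) = x" "(\<lambda>l\<in>{..<s}. x l**.(A l) 1:.(A l)) = x"
 using x monoid.l_one[OF Amon] monoid.r_one[OF Amon]
 by (auto simp: PiE_iff extensional_def restrict_def intro!: ext)
 thus "1:.pm**.pm x = x" "x**.pm 1:.pm = x" by (simp_all cong: restrict_cong)
next
 fix x y assume "x :.pm" "y :.pm"
 thus "x**.pm y :.pm" using A_closed(2) by (simp add: PiE_iff)
next
 show "1:.pm :.pm" using A_closed(4) by (simp add: PiE_iff)
qed

sublocale M: monoid_alg K pm
 by (intro monoid_alg.intro is_cring pm_monoid)

abbreviation S where "S == monoid_algebra K pm"
abbreviation be where "be == basis_elt K"
abbreviation J where "J == Idl\<^bsub>S\<^esub> (tensor_family_relations K {..<s} A)"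

lemma be_closed: "f :.pm ==> be f :.S"
 by (rule M.basis_elt_closed)

lemma upd_closed: "f :.pm ==> i < s ==> a :.(A i) ==> f(i := a) :.pm"
 by (auto simp: PiE_iff extensional_def)

lemma rel_cases:
 assumes "z : tensor_family_relations K {..<s} A"
 obtains f i a b where "z = be (f(i := a +:.(A i) b)) \<ominus>.S (be (f(i := a)) +:.S be (f(i := b)))"
 "f :.pm" "i < s" "a :.(A i)" "b :.(A i)"
 | f i k a where "z = be (f(i := k *:.(A i) a)) \<ominus>.S (k *:.S be (f(i := a)))"
 "f :.pm" "i < s" "k :.K" "a :.(A i)"
proof -
 have pf: "f : (\<Pi>\<^sub>E j\<in>{..<s}. car (A j)) \<longleftrightarrow> f :.pm" for f by simp
 show thesis using assms that unfolding tensor_family_relations_def Let_def pf by blast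
qed

lemma rel_closed: "tensor_family_relations K {..<s} A <= car S"
proof
 fix z assume z: "z : tensor_family_relations K {..<s} A"
 note U = be_closed[OF upd_closed]
 from z show "z :.S"
 by (rule rel_cases) (auto intro!: M.S.minus_closed M.S.smult_closed M.S.add.m_closed U A_closed simp del: carrier_product_group)
qed

lemma J_ideal: "ideal J S" by (rule M.S.genideal_ideal[OF rel_closed])

sublocale Q: quot_alg K S J
 by (intro quot_alg.intro M.S.assoc_algebra_axioms J_ideal)

abbreviation TF where "TF == tensor_family K {..<s} A"

lemma TF_eq: "TF = quotient_algebra S J" by (simp add: tensor_family_def Let_def)

lemma TF_algebra: "assoc_algebra K TF" unfolding TF_eq by (rule Q.Q_assoc_algebra)

definition pure where "pure f = Q.pr (be f)"

lemma pure_closed: "f :.pm ==> pure f :.TF"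
 unfolding TF_eq Q.carrier_Q pure_def using be_closed by blast

lemma pure_mult: "f :.pm ==> g :.pm ==> pure f**.TF pure g = pure (f**.pm g)"
 unfolding TF_eq pure_def by (simp add: Q.pr_mult be_closed M.basis_elt_mult del: mult_product_group)

lemma pure_one: "pure 1:.pm = 1:.TF"
 unfolding TF_eq pure_def Q.pr_one M.basis_elt_one ..

lemma pr_relI:
 assumes "x \<ominus>.S y : tensor_family_relations K {..<s} A" "x :.S" "y :.S"
 shows "Q.pr x = Q.pr y"
 using M.S.genideal_self[OF rel_closed] assms Q.pr_eq_iff by blast

lemma pure_add:
 assumes "f :.pm" "i < s" "a :.(A i)" "b :.(A i)"
 shows "pure (f(i := a +:.(A i) b)) = pure (f(i := a)) +:.TF pure (f(i := b))"
proof -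
 have c: "be (f(i := a +:.(A i) b)) :.S" "be (f(i := a)) :.S" "be (f(i := b)) :.S"
 using assms be_closed upd_closed A_closed by auto
 have "Q.pr (be (f(i := a +:.(A i) b))) = Q.pr (be (f(i := a)) +:.S be (f(i := b)))"
 by (rule pr_relI[OF _ c(1)]) (unfold tensor_family_relations_def Let_def, intro UnI1 CollectI exI[of _ f] exI[of _ i] exI[of _ a] exI[of _ b] conjI refl,
 use assms c in simp_all)
 thus ?thesis unfolding pure_def TF_eq using c by (simp add: Q.pr_add)
qed

lemma pure_smult:
 assumes "f :.pm" "i < s" "a :.(A i)" "k :.K"
 shows "pure (f(i := k *:.(A i) a)) = k *:.TF pure (f(i := a))"
proof -
 have c: "be (f(i := k *:.(A i) a)) :.S" "be (f(i := a)) :.S"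
 using assms be_closed upd_closed A_closed by auto
 have "Q.pr (be (f(i := k *:.(A i) a))) = Q.pr (k *:.S be (f(i := a)))"
 by (rule pr_relI[OF _ c(1)]) (unfold tensor_family_relations_def Let_def, intro UnI2 CollectI exI[of _ f] exI[of _ i] exI[of _ k] exI[of _ a] conjI refl,
 use assms c in simp_all)
 thus ?thesis unfolding pure_def TF_eq using c assms by (simp add: Q.pr_smult)
qed

lemma TF_pure_span: "x :.TF ==> x : lspan K TF (pure ` car pm)"
proof -
 assume x: "x :.TF"
 have "x : lspan K Q.Q (Q.pr ` (be ` car pm))"
 by (rule Q.Q_lspan[OF M.monoid_algebra_lspan]) (use x be_closed in \<open>auto simp: TF_eq\<close>)
 thus ?thesis by (simp add: TF_eq pure_def image_image)
qed

text \<open>The slots are expanded one at a time: the induction is on the number \<open>n\<close> of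
  leading slots whose entries are still arbitrary, while the entries from slot \<open>n\<close> on
  already lie in the spanning sets.\<close>

lemma TF_span:
 assumes B: "!!l. l < s ==> B l <= car (A l)"
 and sp: "!!l a. l < s ==> a :.(A l) ==> a : lspan K (A l) (B l)"
 and x: "x :.TF"
 shows "x : lspan K TF (pure ` (\<Pi>\<^sub>E l\<in>{..<s}. B l))"
proof -
 let ?T = "pure ` (\<Pi>\<^sub>E l\<in>{..<s}. B l)"
 interpret TF: assoc_algebra K TF by (rule TF_algebra)
 note A = TF_algebra
 have sub: "(\<Pi>\<^sub>E l\<in>{..<s}. B l) <= car pm" using B by (auto simp: PiE_iff)
 hence T: "?T <= car TF" using pure_closed by blast
 have "f :.pm ==> (!!l. n <= l ==> l < s ==> f l : B l) ==> pure f : lspan K TF ?T" if "n <= s" for n f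
 using that
 proof (induction n arbitrary: f)
 case 0
 hence "f : (\<Pi>\<^sub>E l\<in>{..<s}. B l)" by (auto simp: PiE_iff)
 thus ?case by (intro lspan_base[OF A _ T]) auto
 next
 case (Suc n)
 hence n: "n < s" by simp
 interpret An: assoc_algebra K "A n" by (rule Aalg[OF n])
 have "f n : lspan K (A n) (B n)" using sp[OF n] Suc n by (auto simp: PiE_iff)
 hence "pure (f(n := f n)) : lspan K TF ?T"
 proof (induction rule: lspan.induct)
 case zero
 have "pure (f(n := 0: *:.(A n) 0:.(A n))) = 0: *:.TF pure (f(n := 0:.(A n)))"
 by (rule pure_smult) (use Suc n in auto)
 moreover have "pure (f(n := 0:.(A n))) :.TF" by (intro pure_closed upd_closed) (use Suc n in auto)
 ultimately have "pure (f(n := 0:.(A n))) = 0:.TF" by (simp add: TF.smult_l_null An.smult_l_null)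
 thus ?case by (simp add: lspan.zero del: fun_upd_apply)
 next
 case (step k b y)
 have c: "b :.(A n)" "y :.(A n)" using step B[OF n] lspan_closed[OF Aalg[OF n]] by blast+
 have "pure (f(n := k *:.(A n) b +:.(A n) y)) = k *:.TF pure (f(n := b)) +:.TF pure (f(n := y))"
 using pure_add[of f n "k *:.(A n) b" y] pure_smult[of f n b k] Suc n c step by simp
 moreover have "pure (f(n := b)) : lspan K TF ?T"
 proof (rule Suc.IH)
 show "f(n := b) :.pm" by (rule upd_closed) (use Suc n c in auto)
 show "(f(n := b)) l : B l" if "n <= l" "l < s" for l using that Suc.prems(2)[of l] step by (cases "l = n") auto
 qed (use n in simp)
 ultimately show ?case using step by (simp add: lspan_add[OF A] lspan_smult[OF A] T del: fun_upd_apply)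
 qed
 thus ?case by simp
 qed
 from this[of s] have "pure ` car pm <= lspan K TF ?T" by fastforce
 thus ?thesis by (rule lspan_trans[OF A TF_pure_span[OF x] _ T])
qed

text \<open>The target is noncommutative, so the factors are multiplied in a fixed order.\<close>

primrec oprod :: "('k, 'b, 'y) module_scheme => (nat => 'a => 'b) => (nat => 'a) => nat => 'b"
 where "oprod B vp f 0 = 1:.B"
 | "oprod B vp f (Suc n) = oprod B vp f n**.B vp n (f n)"

text \<open>The ordered product is linear in each slot, so it kills the relations of the tensor
  product. It is multiplicative because the n-th image commutes with the product of the earlier ones
  (\<open>pcm\<close>), which allows two ordered products to be interleaved.\<close>

lemma TF_hom:
 assumes B: "assoc_algebra K B" and vp: "!!l. l < s ==> vp l : alg_hom K (A l) B"
 and comm: "!!l l' a b. l < s ==> l' < s ==> l ~= l' ==> a :.(A l) ==> b :.(A l') ==>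
 vp l a**.B vp l' b = vp l' b**.B vp l a"
 obtains Ph where "Ph : alg_hom K TF B" "!!f. f :.pm ==> Ph (pure f) = oprod B vp f s"
proof -
 interpret B: assoc_algebra K B by fact
 let ?p = "oprod B vp"
 have pc: "n <= s ==> f :.pm ==> ?p f n :.B" for n f
 by (induction n) (auto simp: PiE_iff alg_hom_closed[OF vp])
 have pcm: "n <= l ==> l < s ==> f :.pm ==> a :.(A l) ==> vp l a**.B ?p f n = ?p f n**.B vp l a" for n l f a
 proof (induction n)
 case 0
 thus ?case using alg_hom_closed[OF vp] by simp
 next
 case (Suc n)
 have c: "vp l a :.B" "?p f n :.B" "vp n (f n) :.B" "f n :.(A n)"
 using Suc pc alg_hom_closed[OF vp] by (auto simp: PiE_iff)
 have "vp l a**.B ?p f (Suc n) = (?p f n**.B vp l a)**.B vp n (f n)" using Suc c by (simp flip: B.m_assoc)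
 also have "... = ?p f n**.B (vp n (f n)**.B vp l a)" using comm[of l n a "f n"] Suc c by (simp add: B.m_assoc)
 finally show ?case using c by (simp add: B.m_assoc)
 qed
 have pm: "n <= s ==> f :.pm ==> g :.pm ==> ?p (f**.pm g) n = ?p f n**.B ?p g n" for n f g
 proof (induction n)
 case 0
 show ?case by simp
 next
 case (Suc n)
 hence n: "n < s" by simp
 have c: "?p f n :.B" "?p g n :.B" "vp n (f n) :.B" "vp n (g n) :.B" "f n :.(A n)" "g n :.(A n)"
 using Suc pc alg_hom_closed[OF vp] by (auto simp: PiE_iff)
 have "(f**.pm g) n = f n**.(A n) g n" using n by simp
 hence "?p (f**.pm g) (Suc n) = (?p f n**.B ?p g n)**.B (vp n (f n)**.B vp n (g n))"
 using Suc alg_hom_mult[OF vp[OF n] c(5,6)] by (simp del: mult_product_group)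
 also have "... = ?p f n**.B (?p g n**.B vp n (f n))**.B vp n (g n)" using c by (simp add: B.m_assoc)
 also have "... = ?p f n**.B (vp n (f n)**.B ?p g n)**.B vp n (g n)"
 using pcm[of n n g "f n"] n Suc c by simp
 finally show ?case using c by (simp add: B.m_assoc del: mult_product_group)
 qed
 have p1: "n <= s ==> ?p 1:.pm n = 1:.B" for n
 by (induction n) (auto simp: alg_hom_one[OF vp])
 have peq: "n <= i ==> ?p (f(i := a)) n = ?p f n" for n i f a by (induction n) auto
 have psuc: "?p (f(i := a)) (Suc i) = ?p f i**.B vp i a" for i f a using peq[of i i f a] by simp
 have padd: "n <= s ==> i < n ==> f :.pm ==> a :.(A i) ==> b :.(A i) ==>
 ?p (f(i := a +:.(A i) b)) n = ?p (f(i := a)) n +:.B ?p (f(i := b)) n" for n i f a b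
 proof (induction n)
 case (Suc n)
 show ?case
 proof (cases "i = n")
 case True
 have c: "?p f i :.B" "vp i a :.B" "vp i b :.B" using Suc True pc alg_hom_closed[OF vp] by auto
 show ?thesis unfolding True[symmetric] psuc using alg_hom_add[OF vp, of i a b] Suc True c by (simp add: B.r_distr)
 next
 case False
 have "vp n (f n) :.B" using Suc alg_hom_closed[OF vp] by (auto simp: PiE_iff)
 moreover have "?p (f(i := a)) n :.B" "?p (f(i := b)) n :.B" by (intro pc upd_closed; use Suc in simp)+
 ultimately show ?thesis using Suc False by (simp add: B.l_distr fun_upd_other del: fun_upd_apply)
 qed
 qed simp
 have psm: "n <= s ==> i < n ==> f :.pm ==> a :.(A i) ==> k :.K ==>
 ?p (f(i := k *:.(A i) a)) n = k *:.B ?p (f(i := a)) n" for n i f a k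
 proof (induction n)
 case (Suc n)
 show ?case
 proof (cases "i = n")
 case True
 have c: "?p f i :.B" "vp i a :.B" using Suc True pc alg_hom_closed[OF vp] by auto
 show ?thesis unfolding True[symmetric] psuc using alg_hom_smult[OF vp, of i k a] Suc True c by (simp add: B.smult_mult_right)
 next
 case False
 have "vp n (f n) :.B" using Suc alg_hom_closed[OF vp] by (auto simp: PiE_iff)
 moreover have "?p (f(i := a)) n :.B" by (intro pc upd_closed; use Suc in simp)+
 ultimately show ?thesis using Suc False by (simp add: B.smult_mult_left fun_upd_other del: fun_upd_apply)
 qed
 qed simp
 define mu where "mu f = ?p f s" for f
 have mu: "mu : hom pm B" "mu 1:.pm = 1:.B" using pc pm p1 by (auto simp: hom_def mu_def simp del: mult_product_group one_product_group carrier_product_group)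
 define E where "E = M.lift_hom B mu"
 have E: "E : alg_hom K S B" unfolding E_def by (rule M.lift_hom_alg_hom[OF B mu])
 have Eb: "E (be f) = mu f" if "f :.pm" for f
 unfolding E_def by (rule M.lift_hom_basis_elt[OF B mu that])
 interpret E: ring_hom_ring S B E
 using alg_hom_ring_hom[OF E] M.S.ring_axioms B.ring_axioms ring_hom_ringI2 by blast
 have mi: "E (a \<ominus>.S b) = 0:.B" if "a :.S" "b :.S" "E a = E b" for a b
 using alg_hom_minus[OF E M.S.ring_axioms B.ring_axioms that(1,2)] that by (simp add: B.r_neg a_minus_def)
 have "tensor_family_relations K {..<s} A <= a_kernel S B E"
 proof
 fix z assume z: "z : tensor_family_relations K {..<s} A"
 have zF: "z :.S" using z rel_closed by blast
 note U = be_closed[OF upd_closed]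
 from z have "E z = 0:.B"
 proof (cases rule: rel_cases)
 case (1 f i a b)
 thus ?thesis unfolding 1(1)
 by (intro mi) (auto simp: alg_hom_add[OF E] U A_closed Eb upd_closed mu_def padd simp del: carrier_product_group)
 next
 case (2 f i k a)
 thus ?thesis unfolding 2(1)
 by (intro mi) (auto simp: alg_hom_smult[OF E] U A_closed Eb upd_closed mu_def psm simp del: carrier_product_group)
 qed
 thus "z : a_kernel S B E" using zF unfolding a_kernel_def' by blast
 qed
 hence "J <= a_kernel S B E" by (rule M.S.genideal_minimal[OF E.kernel_is_ideal])
 hence "!!z. z : J ==> E z = 0:.B" unfolding a_kernel_def' by blast
 from Q.factor_hom[OF E B this] obtain ps where ps: "ps : alg_hom K Q.Q B" "!!a. a :.S ==> ps (Q.pr a) = E a" by blast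
 show thesis
 by (rule that[of ps]) (use ps in \<open>auto simp: TF_eq pure_def be_closed Eb mu_def simp del: carrier_product_group\<close>)
qed

end

section \<open>Indices of monomials, their least exponents, and divisibility by the orders of the
  q_i\<close>

context weyl_family begin

definition R :: "expo set" where
 "R = {r. (ALL l j. Poly_Mapping.lookup r (l, j) ~= 0 --> l < s & j <= m l) & (ALL l. 0 <= lkt r l)}"

definition dl where "dl l r = (\<Sum>i<m l. max 0 (- lkx r l i) * co l i)"

text \<open>The shift \<open>dl\<close> depends on the x-exponents alone. As \<open>lq\<close>
  relates only indices with equal x-exponents, the shift neither creates nor destroys
  comparabilities (\<open>lowr_lq\<close>).\<close>

definition lowr :: "expo => expo" where "lowr r = r + (\<Sum>l<s. tk l (dl l r))"

lemma lowr_lkx [simp]: "lkx (lowr r) l i = lkx r l i"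
 by (simp add: lowr_def lookup_sum lk)

lemma lowr_lkt: "lkt (lowr r) l = lkt r l + (if l < s then dl l r else 0)"
 by (simp add: lowr_def lookup_sum lk)

lemma dl_cong: "(!!i. lkx r l i = lkx r' l i) ==> dl l r = dl l r'"
 by (simp add: dl_def)

lemma lowr_lq: "lq (lowr r) (lowr r') \<longleftrightarrow> lq r r'"
proof -
 have "dl l r = dl l r'" if "!!l i. lkx r l i = lkx r' l i" for l using that dl_cong by blast
 thus ?thesis by (force simp: lq_def lowr_lkt)
qed

lemma lq_antisym: "lq r r' ==> lq r' r ==> r = r'"
 by (rule expo_eqI) (auto simp: lq_def intro: antisym)

lemma lq_trans: "lq a b ==> lq b d ==> lq a d"
 by (auto simp: lq_def intro: order_trans)

lemma R_ge: "r : R ==> 0 <= lkt r l" by (simp add: R_def)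

lemma R_lkx: "r : R ==> ~ (l < s & i < m l) ==> lkx r l i = 0"
 and R_lkt: "r : R ==> ~ l < s ==> lkt r l = 0"
proof -
 have "r : R ==> Poly_Mapping.lookup r (l, j) ~= 0 --> l < s & j <= m l" for j by (simp add: R_def)
 from this[of "Suc i"] this[of 0]
 show "r : R ==> ~ (l < s & i < m l) ==> lkx r l i = 0" "r : R ==> ~ l < s ==> lkt r l = 0" by auto
qed

lemma RI:
 assumes "!!l i. lkx r l i ~= 0 ==> l < s & i < m l" "!!l. lkt r l ~= 0 ==> l < s" "!!l. 0 <= lkt r l"
 shows "r : R"
 unfolding R_def
proof (intro CollectI conjI allI impI)
 fix l j assume *: "Poly_Mapping.lookup r (l, j) ~= 0"
 show "l < s" "j <= m l" using * assms(1)[of l "j - 1"] assms(2)[of l] by (cases j; simp)+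
qed (rule assms(3))

lemma lowm_sum: assumes "r : R" shows "(\<Sum>l<s. lowm l r) = lowr r"
proof (rule expo_eqI)
 fix l
 have "lkt (\<Sum>l<s. lowm l r) l = (\<Sum>l'<s. if l = l' then int (nat (lkt r l')) + dl l' r else 0)"
 by (simp add: lookup_sum lowm_lkt dl_def)
 also have "... = (if l < s then int (nat (lkt r l)) + dl l r else 0)" by simp
 also have "... = lkt (lowr r) l" using R_ge[OF assms, of l] R_lkt[OF assms, of l] by (auto simp: lowr_lkt)
 finally show "lkt (\<Sum>l<s. lowm l r) l = lkt (lowr r) l" .
 fix i
 define v where "v = (if i < m l then lkx r l i else 0)"
 have "lkx (\<Sum>l<s. lowm l r) l i = (\<Sum>l'<s. lkx (lowm l' r) l i)" by (simp add: lookup_sum)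
 also have "... = (\<Sum>l'<s. if l' = l then v else 0)" by (rule sum.cong) (auto simp: lowm_lkx v_def)
 also have "... = (if l < s then v else 0)" by simp
 also have "... = lkx (lowr r) l i" using R_lkx[OF assms, of l i] by (auto simp: v_def)
 finally show "lkx (\<Sum>l<s. lowm l r) l i = lkx (lowr r) l i" .
qed

lemma R_combine:
 obtains r where "r : R" "!!l. l < s ==> lkt r l = int (j l)" "!!l i. l < s ==> i < m l ==> lkx r l i = a l i"
proof -
 define r where "r = (\<Sum>l<s. tk l (int (j l)) + (\<Sum>i<m l. xk l i (a l i)))"
 have t: "lkt r l = (if l < s then int (j l) else 0)" for l by (simp add: r_def lookup_sum lk)
 have x: "lkx r l i = (if l < s & i < m l then a l i else 0)" for l i
 proof -
 define v where "v = (if i < m l then a l i else 0)"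
 have "lkx r l i = (\<Sum>l'<s. lkx (tk l' (int (j l')) + (\<Sum>i<m l'. xk l' i (a l' i))) l i)" by (simp add: r_def lookup_sum)
 also have "... = (\<Sum>l'<s. if l' = l then v else 0)"
 proof (rule sum.cong)
 fix l'
 have "lkx (tk l' (int (j l')) + (\<Sum>i<m l'. xk l' i (a l' i))) l i = (\<Sum>i'<m l'. if i' = i then (if l' = l then a l' i else 0) else 0)"
 by (simp add: lk lookup_sum)
 thus "lkx (tk l' (int (j l')) + (\<Sum>i<m l'. xk l' i (a l' i))) l i = (if l' = l then v else 0)"
 by (simp add: v_def)
 qed simp
 also have "... = (if l < s then v else 0)" by simp
 finally show ?thesis by (simp add: v_def)
 qed
 show thesis by (rule that[of r]) (auto simp: t x intro!: RI split: if_splits)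
qed

definition nn where "nn l i = Uk.ord (q l i)"

lemma q_pow_eq_one: "l < s ==> i < m l ==> q l i [^].Uk (k::int) = 1: \<longleftrightarrow> int (nn l i) dvd k"
 using Uk.int_pow_eq_id[of "q l i" k] q_Uk[of "(l, i)"] by (simp add: nn_def Ix_def Uk_facts(3))

text \<open>The automorphism of index j fixes \<open>h l i\<close>. Applied to the lowest nonzero
  coefficient, of degree c, this says q_j^c = 1.\<close>

lemma nn_dvd_co:
 assumes "l < s" "i < m l" "j < m l" "i ~= j" shows "int (nn l j) dvd co l i"
proof -
 interpret G: qgwa K "m l" "q l" "\<sigma> l" "h l" using qgwa[OF assms(1)] .
 let ?c = "ordt K (h l i)"
 have nz: "h l i ?c ~= 0:" "h l i ?c :.K"
 using ordt_props(1)[OF G.h_closed G.h_nonzero] UP_value[OF G.h_closed] assms by auto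
 have "q l j [^] ?c**h l i ?c = h l i ?c"
 using G.\<sigma>_coeff[OF assms(3) G.h_closed[OF assms(2)], of ?c] G.\<sigma>_h[of j i] assms by simp
 hence "q l j [^] ?c = 1:" using nz G.q_props(1)[OF assms(3)] m_rcancel[of "h l i ?c" "q l j [^] ?c" \<one>] by simp
 thus ?thesis using q_pow[OF assms(1,3), of ?c] q_pow_eq_one[OF assms(1,3)] by (simp add: co_def)
qed

lemma dvd_prod_coprime:
 fixes n :: "nat => nat"
 assumes "finite I" "!!i. i : I ==> coprime (n 0) (n i)" "int (n 0) dvd x * int (\<Prod>i\<in>I. n i)"
 shows "int (n 0) dvd x"
proof -
 have "coprime (n 0) (\<Prod>i\<in>I. n i)" using assms by (intro prod_coprime_right) auto
 hence "coprime (int (n 0)) (int (\<Prod>i\<in>I. n i))" by (rule coprime_int_iff[THEN iffD2])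
 thus ?thesis using assms(3) by (simp only: coprime_dvd_mult_left_iff)
qed

text \<open>Commutation with t says that the product of the q_i^(a_i) is 1, a_i being the
  x-exponents. Raising to the power \<open>M\<close>, the product of the other orders, kills every
  factor except the j-th; then n_j divides a_j \<open>M\<close> and is coprime to
  \<open>M\<close>.\<close>

lemma cc_tk_dvd:
 assumes l: "l < s" "j < m l" and cop: "!!i. i < m l ==> i ~= j ==> coprime (nn l j) (nn l i)"
 and c: "cc g (tk l 1) = 1:"
 shows "int (nn l j) dvd lkx g l j"
proof -
 define M where "M = int (\<Prod>i\<in>{..<m l} - {j}. nn l i)"
 let ?f = "%p. q (fst p) (snd p) [^].Uk (lkx g (fst p) (snd p) * lkt (tk l 1) (fst p))"
 have pw: "finprod Uk ?f F [^].Uk M = finprod Uk (%p. ?f p [^].Uk M) F" if "finite F" "F <= Ix" for F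
 using that
 proof (induction F rule: finite_induct)
 case (insert p F)
 have c: "?f p :.Uk" "!!p. p : F ==> ?f p :.Uk" using insert cc_term by auto
 hence "finprod Uk ?f F :.Uk" by (intro Uk.finprod_closed) auto
 thus ?case using insert c by (simp add: Uk.int_pow_distrib Pi_def del: split_paired_All)
 qed simp
 have one: "finprod Uk (%p. ?f p [^].Uk M) Ix = 1:.Uk"
 using pw[OF finite_Ix order_refl] c by (simp add: cc_def Uk_facts(3))
 (metis Uk.int_pow_one Uk_facts(3))
 have p: "(l, j) : Ix" using l by (auto simp: Ix_def)
 have "finprod Uk (%p. ?f p [^].Uk M) Ix = finprod Uk (%p. ?f p [^].Uk M) {(l, j)}"
 proof (rule Uk.finprod_mono_neutral_cong_right)
 fix p assume p: "p : Ix - {(l, j)}"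
 obtain l' i where pe: "p = (l', i)" by (cases p)
 have li: "l' < s" "i < m l'" using p pe by (auto simp: Ix_def)
 show "?f p [^].Uk M = 1:.Uk"
 proof (cases "l' = l")
 case True
 have "i ~= j" using p pe True by auto
 hence "int (nn l i) dvd M" unfolding M_def using li True by (intro of_nat_dvd_iff[THEN iffD2] dvd_prodI) auto
 hence "int (nn l i) dvd lkx g l i * lkt (tk l 1) l * M" by simp
 hence "q l i [^].Uk (lkx g l i * lkt (tk l 1) l * M) = 1:" using q_pow_eq_one[of l i] li True by simp
 thus ?thesis using q_Uk[of p] p pe True by (simp add: Uk.int_pow_pow Uk_facts(3))
 next
 case False
 hence "lkt (tk l 1) (fst p) = 0" using pe by (simp add: lk)
 thus ?thesis by (simp only: mult_zero_right int_pow_0 Uk.int_pow_one)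
 qed
 next
 show "(%p. ?f p [^].Uk M) : Ix \<rightarrow> car Uk" using cc_term by (auto intro!: Uk.int_pow_closed)
 qed (use p finite_Ix in auto)
 also have "... = q l j [^].Uk (lkx g l j * M)"
 using q_Uk[OF p] by (simp add: Uk.int_pow_pow lk)
 finally have "q l j [^].Uk (lkx g l j * M) = 1:" using one by (simp add: Uk_facts(3))
 hence d: "int (nn l j) dvd lkx g l j * M" using q_pow_eq_one[OF l] by simp
 have "coprime (nn l j) (\<Prod>i\<in>{..<m l} - {j}. nn l i)" using cop by (intro prod_coprime_right) auto
 hence "coprime (int (nn l j)) M" unfolding M_def by (rule coprime_int_iff[THEN iffD2])
 thus ?thesis using d by (simp only: coprime_dvd_mult_left_iff)
qed

end

text \<open>
 An algebra mapped to the torus with a basis whose images have pairwise distinct least exponents.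
 Both a single generalized Weyl algebra and a tensor product of them are of this kind.
\<close>

locale low_basis = weyl_family K s m q \<sigma> h
 for K :: "('k, 'e) ring_scheme" (structure) and s m q \<sigma> h +
 fixes B :: "('k, 'b, 'y) module_scheme" and Ph :: "'b => expo => 'k" and b :: "expo => 'b" and tB xB :: "nat => 'b"
 assumes B: "assoc_algebra K B" and Ph: "Ph : alg_hom K B L"
 and b_closed: "r : R ==> b r :.B"
 and b_span: "x :.B ==> x : lspan K B (b ` R)"
 and b_low: "r : R ==> low (Ph (b r)) (lowr r)"
 and tB_closed: "l < s ==> tB l :.B"
 and Ph_tB: "l < s ==> Ph (tB l) = sg (tk l 1) 1:"
 and b_tB: "l < s ==> r : R ==> 1 <= lkt r l ==> b r = tB l**.B b (r - tk l 1)"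
 and xB_closed: "l < s ==> 0 < m l ==> xB l :.B"
 and Ph_xB: "l < s ==> 0 < m l ==> Ph (xB l) = sg (xk l 0 1) 1:"
 and b_zero: "b 0 = 1:.B"
begin

sublocale B: assoc_algebra K B by (rule B)

lemma Ph_closed: "x :.B ==> Ph x :.L" using alg_hom_closed[OF Ph] .

lemma b_img: "b ` R <= car B" using b_closed by blast

lemma expand:
 assumes "x :.B"
 obtains S k where "finite S" "S <= R" "!!r. r : S ==> k r :.K" "!!r. r : S ==> k r ~= 0:"
 "x = (++.B r:S. k r *:.B b r)"
proof -
 obtain S k where S: "finite S" "S <= R" "k : S \<rightarrow> car K" "x = (++.B r:S. k r *:.B b r)"
 using lspan_finsum[OF B b_span[OF assms] b_img] by blast
 have kb: "r : S ==> k r *:.B b r :.B" for r using S b_closed by auto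
 have "(++.B r:S. k r *:.B b r) = (++.B r:{r : S. k r ~= 0:}. k r *:.B b r)"
 by (rule B.add.finprod_mono_neutral_cong_right) (use S kb b_closed in \<open>auto simp: B.smult_l_null subset_eq\<close>)
 hence e: "x = (++.B r:{r : S. k r ~= 0:}. k r *:.B b r)" using S(4) by simp
 show thesis by (rule that[OF _ _ _ _ e]) (use S in auto)
qed

lemma Ph_sum:
 assumes "finite S" "S <= R" "!!r. r : S ==> k r :.K"
 shows "Ph (++.B r:S. k r *:.B b r) g = (++r:S. k r**Ph (b r) g)"
 using assms
proof (induction S rule: finite_induct)
 case empty
 thus ?case by (simp add: alg_hom_zero[OF Ph B.ring_axioms T.T.L.ring_axioms] T.T.L_zero)
next
 case (insert r S)
 have kb: "r' : insert r S ==> k r' *:.B b r' :.B" for r' using insert b_closed by auto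
 have kv: "r' : insert r S ==> k r'**Ph (b r') g :.K" for r'
 using insert b_closed T.T.L_value[OF Ph_closed, of "b r'" g] by auto
 have sc: "(++.B r:S. k r *:.B b r) :.B" using kb by (intro B.finsum_closed) auto
 have br: "b r :.B" "k r :.K" using insert b_closed by auto
 have "(++.B r:insert r S. k r *:.B b r) = k r *:.B b r +:.B (++.B r:S. k r *:.B b r)"
 by (rule B.finsum_insert) (use insert kb in auto)
 hence "Ph (++.B r:insert r S. k r *:.B b r) g = k r**Ph (b r) g +: (++r:S. k r**Ph (b r) g)"
 using sc br insert by (simp add: alg_hom_add[OF Ph] alg_hom_smult[OF Ph] T.T.L_add T.T.L_smult)
 also have "... = (++r:insert r S. k r**Ph (b r) g)"
 by (rule finsum_insert[symmetric]) (use insert kv in auto)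
 finally show ?case .
qed

text \<open>An index minimal among those occurring has a least exponent to which no other term
  contributes, because a term contributes only at exponents above its own least one. Hence no
  cancellation takes place there.\<close>

lemma exists_low:
 assumes S: "finite S" "S <= R" and k: "!!r. r : S ==> k r :.K" "!!r. r : S ==> k r ~= 0:" and r1: "r1 : S"
 obtains r0 where "r0 : S" "lq r0 r1" "Ph (++.B r:S. k r *:.B b r) (lowr r0) ~= 0:"
proof -
 \<comment> \<open>The total t-degree is strictly monotone for \<open>lq\<close> on
   \<open>R\<close>, so minimizing it below \<open>r1\<close> gives an \<open>lq\<close>-minimal
   index.\<close>
 define mu where "mu r = (\<Sum>l<s. nat (lkt r l))" for r
 let ?D = "{r : S. lq r r1}"
 have D: "finite ?D" "?D ~= {}" using S r1 by (auto simp: lq_def)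
 obtain r0 where r0: "r0 : ?D" "!!r. r : ?D ==> mu r0 <= mu r"
 using arg_min_if_finite(1)[OF D, of mu] arg_min_least[OF D, of _ mu] by blast
 have min: "r = r0" if r: "r : S" "lq r r0" for r
 proof (rule ccontr)
 assume ne: "r ~= r0"
 have rD: "r : ?D" using r r0 lq_trans by blast
 have RR: "r : R" "r0 : R" using S r r0 by auto
 have le: "lkt r l <= lkt r0 l" for l using r by (simp add: lq_def)
 have "EX l. lkt r l < lkt r0 l"
 proof (rule ccontr)
 assume "\<nexists>l. lkt r l < lkt r0 l"
 hence "lq r0 r" using r by (auto simp: lq_def not_less)
 thus False using lq_antisym[OF r(2)] ne by simp
 qed
 then obtain l where l: "lkt r l < lkt r0 l" by blast
 have "l < s" using l R_lkt[OF RR(1), of l] R_lkt[OF RR(2), of l] by force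
 moreover have "nat (lkt r l) < nat (lkt r0 l)" using l R_ge[OF RR(1), of l] by simp
 ultimately have "EX l:{..<s}. nat (lkt r l) < nat (lkt r0 l)" by blast
 hence "mu r < mu r0" unfolding mu_def
 by (intro sum_strict_mono_ex1) (use le in \<open>auto intro: nat_mono\<close>)
 thus False using r0(2)[OF rD] by simp
 qed
 have v: "Ph (b r) g :.K" if "r : S" for r g using that S b_closed T.T.L_value[OF Ph_closed] by blast
 have "(++r:S. k r**Ph (b r) (lowr r0)) = (++r:{r0}. k r**Ph (b r) (lowr r0))"
 proof (rule add.finprod_mono_neutral_cong_right)
 fix r assume r: "r : S - {r0}"
 hence "~ lq (lowr r) (lowr r0)" using min lowr_lq by auto
 hence "Ph (b r) (lowr r0) = 0:" using b_low[of r] r S unfolding T.low_at_def by blast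
 thus "k r**Ph (b r) (lowr r0) = 0:" using k r by simp
 qed (use S r0 k v in auto)
 also have "... = k r0**Ph (b r0) (lowr r0)" using r0 k v by simp
 also have "... ~= 0:"
 proof -
 have "Ph (b r0) (lowr r0) ~= 0:" using b_low[of r0] r0 S unfolding T.low_at_def by blast
 thus ?thesis using integral[of "k r0" "Ph (b r0) (lowr r0)"] k[of r0] v[of r0 "lowr r0"] r0 by blast
 qed
 finally have "Ph (++.B r:S. k r *:.B b r) (lowr r0) ~= 0:" using Ph_sum[OF S k(1)] by simp
 thus thesis using that[of r0] r0 by blast
qed

text \<open>A nonempty combination of monomials keeps a coefficient by \<open>exists_low\<close>.
  This is both the independence of the monomials and the injectivity by which torus computations are
  brought back to \<open>B\<close>.\<close>

lemma Ph_eq_zero: assumes "x :.B" "Ph x = 0:.L" shows "x = 0:.B"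
proof -
 obtain S k where S: "finite S" "S <= R" "!!r. r : S ==> k r :.K" "!!r. r : S ==> k r ~= 0:"
 "x = (++.B r:S. k r *:.B b r)" using expand[OF assms(1)] by blast
 have "S = {}"
 proof (rule ccontr)
 assume "S ~= {}"
 then obtain r1 where "r1 : S" by blast
 then obtain r0 where "Ph x (lowr r0) ~= 0:" using exists_low[of S k r1] S by metis
 thus False using assms by (simp add: T.T.L_zero)
 qed
 thus ?thesis using S by simp
qed

lemma Ph_inj: assumes "x :.B" "y :.B" "Ph x = Ph y" shows "x = y"
proof -
 have "Ph (x \<ominus>.B y) = Ph x \<ominus>.L Ph y"
 by (rule alg_hom_minus[OF Ph B.ring_axioms T.T.L.ring_axioms assms(1,2)])
 also have "... = 0:.L" using assms Ph_closed by (simp add: a_minus_def T.T.L.r_neg)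
 finally have "x \<ominus>.B y = 0:.B" using Ph_eq_zero assms by simp
 thus ?thesis using B.r_right_minus_eq assms by blast
qed

lemma B_integral: assumes "x :.B" "y :.B" "x**.B y = 0:.B" shows "x = 0:.B | y = 0:.B"
proof -
 have "Ph x**.L Ph y = 0:.L"
 using alg_hom_mult[OF Ph assms(1,2)] assms(3) alg_hom_zero[OF Ph B.ring_axioms T.T.L.ring_axioms] by simp
 thus ?thesis using T.L_integral Ph_closed Ph_eq_zero assms by blast
qed

lemma B_nontrivial: "1:.B ~= 0:.B"
 using alg_hom_zero[OF Ph B.ring_axioms T.T.L.ring_axioms] alg_hom_one[OF Ph] T.L_one_nonzero by metis

text \<open>The expansion of \<open>x\<close> itself is not visible in the torus, but every index in
  it lies above one whose least exponent survives in \<open>Ph x\<close>. For an upward closed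
  \<open>Q\<close> it therefore suffices to test the surviving ones.\<close>

lemma span_of_support:
 assumes x: "x :.B"
 and P: "!!r. r : R ==> Ph x (lowr r) ~= 0: ==> Q r" and mono: "!!r r'. r : R ==> r' : R ==> lq r r' ==> Q r ==> Q r'"
 shows "x : lspan K B (b ` {r : R. Q r})"
proof -
 obtain S k where S: "finite S" "S <= R" "!!r. r : S ==> k r :.K" "!!r. r : S ==> k r ~= 0:"
 "x = (++.B r:S. k r *:.B b r)" using expand[OF x] by blast
 have Q: "Q r1" if r1: "r1 : S" for r1
 proof -
 obtain r0 where "r0 : S" "lq r0 r1" "Ph x (lowr r0) ~= 0:" using exists_low[of S k r1] S r1 by metis
 thus ?thesis using P[of r0] mono[of r0 r1] S r1 by blast
 qed
 have sub: "b ` {r : R. Q r} <= car B" using b_closed by blast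
 have "S' <= S ==> (++.B r:S'. k r *:.B b r) : lspan K B (b ` {r : R. Q r})" if "finite S'" for S'
 using that
 proof (induction S' rule: finite_induct)
 case empty
 show ?case by (simp add: lspan.zero)
 next
 case (insert r S')
 have "(++.B r:insert r S'. k r *:.B b r) = k r *:.B b r +:.B (++.B r:S'. k r *:.B b r)"
 by (rule B.finsum_insert) (use insert S b_closed in \<open>auto simp: subset_eq\<close>)
 thus ?case using insert S Q by (auto intro!: lspan.step)
 qed
 from this[OF S(1) order_refl] show ?thesis using S by simp
qed

lemma left_multiples:
 assumes "y :.B" "S <= car B" "!!s. s : S ==> EX z:car B. s = y**.B z" "x : lspan K B S"
 shows "EX z:car B. x = y**.B z"
 using assms(4)
proof (induction rule: lspan.induct)
 case zero
 show ?case using assms by (intro bexI[of _ "0:.B"]) auto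
next
 case (step k b x)
 then obtain z w where "z :.B" "b = y**.B z" "w :.B" "x = y**.B w" using assms(3) by blast
 hence "k *:.B b +:.B x = y**.B (k *:.B z +:.B w)" "k *:.B z +:.B w :.B"
 using step assms(1) by (simp_all add: B.r_distr B.smult_mult_right)
 thus ?case by blast
qed

lemma R_minus_tk: "r : R ==> 1 <= lkt r l ==> l < s ==> r - tk l 1 : R"
proof (rule RI)
 assume r: "r : R" "1 <= lkt r l" "l < s"
 show "l' < s & i < m l'" if "lkx (r - tk l 1) l' i ~= 0" for l' i
 using that R_lkx[OF r(1), of l' i] by (auto simp: lk)
 show "l' < s" if "lkt (r - tk l 1) l' ~= 0" for l'
 using that R_lkt[OF r(1), of l'] r by (auto simp: lk split: if_splits)
 show "0 <= lkt (r - tk l 1) l'" for l' using r R_ge[OF r(1), of l'] by (simp add: lk)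
qed

text \<open>Condition \<open>C\<close> says that each exponent of \<open>v\<close> commutes with t
  and with x_0 as t itself does. Writing n for the order of q_0, n divides the x_0-exponent and the
  t-exponent is 1 modulo n. The shift \<open>dl\<close> is 0 modulo n: its term of index 0 by the
  former, the others by \<open>nn_dvd_co\<close>. So the t-exponent of the index is 1 modulo n as
  well, hence not 0 as n is at least 2, and a factor t can be split off.\<close>

lemma multiple_of_tB:
 assumes l: "l < s" "0 < m l" and cop: "!!i. 0 < i ==> i < m l ==> coprime (nn l 0) (nn l i)" and n2: "2 <= nn l 0"
 and v: "v :.B" and C: "!!g. Ph v g ~= 0: ==> cc g (tk l 1) = 1: & cc (xk l 0 1) g = q l 0"
 obtains z where "z :.B" "v = tB l**.B z"
proof -
 have "v : lspan K B (b ` {r : R. 1 <= lkt r l})"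
 proof (rule span_of_support[OF v])
 fix r assume r: "r : R" "Ph v (lowr r) ~= 0:"
 let ?n = "int (nn l 0)"
 have d0: "?n dvd lkx r l 0" using cc_tk_dvd[OF l, of "lowr r"] C[OF r(2)] cop by auto
 have "q l 0 [^].Uk (1 * lkt (lowr r) l) = q l 0 [^].Uk (1 ::int)"
 using C[OF r(2)] cc_xk_left[OF l(1) l(2), of 1 "lowr r"] Uk.int_pow_1[of "q l 0"] q_Uk[of "(l, 0)"] l by (auto simp: Ix_def)
 hence "q l 0 [^].Uk (lkt (lowr r) l - 1) = 1:"
 using Uk.int_pow_diff[of "q l 0" "lkt (lowr r) l" 1] q_Uk[of "(l, 0)"] l by (auto simp: Ix_def Uk_facts(3))
 hence d1: "?n dvd lkt (lowr r) l - 1" using q_pow_eq_one[OF l] by simp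
 have "?n dvd max 0 (- lkx r l i) * co l i" if "i < m l" for i
 proof (cases "i = 0")
 case True
 thus ?thesis using d0 by (auto simp: max_def)
 next
 case False
 thus ?thesis using nn_dvd_co[OF l(1) that l(2)] by simp
 qed
 hence "?n dvd dl l r" unfolding dl_def by (intro dvd_sum) auto
 moreover have "lkt (lowr r) l = lkt r l + dl l r" using l by (simp add: lowr_lkt)
 ultimately have d2: "?n dvd lkt r l - 1" using d1 by (metis (no_types, lifting) add_diff_eq add.commute dvd_add_right_iff)
 show "1 <= lkt r l"
 proof (rule ccontr)
 assume "~ 1 <= lkt r l"
 hence "lkt r l = 0" using R_ge[OF r(1), of l] by simp
 hence "?n dvd 1" using d2 by simp
 thus False using n2 by simp
 qed
 next
 show "lq r r' ==> 1 <= lkt r l ==> 1 <= lkt r' l" for r r' unfolding lq_def by (meson order_trans)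
 qed
 hence "EX z:car B. v = tB l**.B z"
 by (rule left_multiples[OF tB_closed[OF l(1)], rotated 2])
 (use b_closed b_tB[OF l(1)] R_minus_tk l in blast)+
 thus thesis using that by blast
qed

text \<open>All exponents of the image of one monomial have the same x-part, and the scalar for
  moving t past an exponent depends only on that part. So t commutes with each monomial up to a
  scalar.\<close>

lemma tB_normal:
 assumes l: "l < s" and x: "x :.B"
 obtains f where "f :.B" "tB l**.B x = f**.B tB l"
proof -
 have t: "tB l :.B" using tB_closed[OF l] .
 have br: "EX f:car B. tB l**.B b r = f**.B tB l" if r: "r : R" for r
 proof -
 have bc: "b r :.B" "Ph (b r) :.L" using r b_closed Ph_closed by auto
 define k where "k = inv\<^bsub>Uk\<^esub> (cc r (tk l 1))"
 have ccU: "cc g g' :.Uk" for g g' using T.c_unit by (simp add: Uk_facts(1))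
 have k: "k :.K" "k**cc r (tk l 1) = 1:"
 proof -
 have "k :.Uk" unfolding k_def using ccU by (rule Uk.inv_closed)
 thus "k :.K" using Units_closed by (simp add: Uk_facts(1))
 have "k**.Uk cc r (tk l 1) = 1:.Uk" unfolding k_def using ccU by (rule Uk.l_inv)
 thus "k**cc r (tk l 1) = 1:" by (simp only: Uk_facts)
 qed
 have "sg (tk l 1) 1:**.L Ph (b r) = k *:.L (Ph (b r)**.L sg (tk l 1) 1:)"
 proof
 fix g
 let ?g = "g - tk l 1"
 have v: "Ph (b r) ?g :.K" using T.T.L_value[OF bc(2)] .
 have e1: "(sg (tk l 1) 1:**.L Ph (b r)) g = Ph (b r) ?g"
 using T.L_mult_sg(2)[OF bc(2) one_closed, of "tk l 1" ?g] v by simp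
 have e2: "(Ph (b r)**.L sg (tk l 1) 1:) g = cc ?g (tk l 1)**Ph (b r) ?g"
 using T.L_mult_sg(1)[OF bc(2) one_closed, of "tk l 1" ?g] v by simp
 show "(sg (tk l 1) 1:**.L Ph (b r)) g = (k *:.L (Ph (b r)**.L sg (tk l 1) 1:)) g"
 proof (cases "Ph (b r) ?g = 0:")
 case True
 thus ?thesis using e1 e2 k by (simp add: T.T.L_smult)
 next
 case False
 hence "lq (lowr r) ?g" using b_low[OF r] unfolding T.low_at_def by blast
 hence "lkx ?g l' i = lkx r l' i" for l' i unfolding lq_def by simp
 hence "cc ?g (tk l 1) = cc r (tk l 1)" unfolding cc_def by simp
 thus ?thesis using e1 e2 k v by (simp add: T.T.L_smult flip: m_assoc)
 qed
 qed
 hence "Ph (tB l**.B b r) = Ph ((k *:.B b r)**.B tB l)"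
 using bc t k by (simp add: alg_hom_mult[OF Ph] alg_hom_smult[OF Ph] Ph_tB[OF l] T.T.L_smult_left)
 hence "tB l**.B b r = (k *:.B b r)**.B tB l" using Ph_inj bc t k by simp
 thus ?thesis using bc k by (intro bexI[of _ "k *:.B b r"]) auto
 qed
 have "EX f:car B. tB l**.B x = f**.B tB l" using b_span[OF x]
 proof (induction rule: lspan.induct)
 case zero
 show ?case using t by (intro bexI[of _ "0:.B"]) auto
 next
 case (step k y x)
 then obtain f g where fg: "f :.B" "tB l**.B y = f**.B tB l" "g :.B" "tB l**.B x = g**.B tB l"
 using br by blast
 have c: "y :.B" "x :.B" using step b_closed lspan_closed[OF B _ b_img] by auto
 have "tB l**.B (k *:.B y +:.B x) = (k *:.B f +:.B g)**.B tB l"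
 using fg c t step by (simp add: B.r_distr B.l_distr B.smult_mult_left B.smult_mult_right)
 thus ?case using fg step by (intro bexI[of _ "k *:.B f +:.B g"]) auto
 qed
 thus thesis using that by blast
qed

text \<open>Multiplying by a monomial of opposite x-degree leaves only polynomials in the variables
  t. With additive degrees this makes the images of monomials constant once the images of the t are
  known to be constant.\<close>

lemma b_divides_polynomial:
 assumes r: "r : R"
 obtains r' where "r' : R" "b r**.B b r' : lspan K B (b ` {r : R. ALL l i. lkx r l i = 0})" "b r**.B b r' ~= 0:.B"
proof -
 \<comment> \<open>The x-exponents of \<open>r\<close> reversed, and the t-exponents cancelled to
   0.\<close>
 define r' where "r' = - r + (\<Sum>l<s. tk l (lkt r l))"
 have x: "lkx r' l i = - lkx r l i" for l i by (simp add: r'_def lk lookup_sum)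
 have t: "lkt r' l = 0" for l using R_lkt[OF r, of l] by (auto simp: r'_def lk lookup_sum)
 have r': "r' : R" by (rule RI) (use x t R_lkx[OF r] in auto)
 have low: "low (Ph (b r**.B b r')) (lowr r + lowr r')"
 using low_mult[OF b_low[OF r] b_low[OF r']] alg_hom_mult[OF Ph b_closed[OF r] b_closed[OF r']] by simp
 have c: "b r**.B b r' :.B" using b_closed r r' by simp
 have "b r**.B b r' : lspan K B (b ` {r : R. ALL l i. lkx r l i = 0})"
 proof (rule span_of_support[OF c])
 fix r1 assume "r1 : R" "Ph (b r**.B b r') (lowr r1) ~= 0:"
 hence "lq (lowr r + lowr r') (lowr r1)" using low unfolding T.low_at_def by blast
 thus "ALL l i. lkx r1 l i = 0" unfolding lq_def by (simp add: lk x)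
 qed (auto simp: lq_def)
 moreover have "b r**.B b r' ~= 0:.B"
 using low alg_hom_zero[OF Ph B.ring_axioms T.T.L.ring_axioms] unfolding T.low_at_def by (auto simp: T.T.L_zero)
 ultimately show thesis using that r' by blast
qed

end

section \<open>The two instances of \<open>low_basis\<close>: a single algebra and a tensor
  product\<close>

context weyl_family begin

lemma mon_cong:
 assumes "l < s" "lkt r l = lkt r' l" "!!i. i < m l ==> lkx r l i = lkx r' l i" shows "mon l r = mon l r'"
proof -
 interpret G: qgwa K "m l" "q l" "\<sigma> l" "h l" using qgwa[OF assms(1)] .
 have "zzl l (m l) (%i. lkx r l i) = zzl l (m l) (%i. lkx r' l i)" using assms(3) by (intro G.zz_cong)
 thus ?thesis using assms(2) by (simp add: mon_def)
qed

lemma mon_step: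
 assumes "l < s" "1 <= lkt r l" shows "mon l r = cfl l (tp 1)**.(A l) mon l (r - tk l 1)"
proof -
 interpret G: qgwa K "m l" "q l" "\<sigma> l" "h l" using qgwa[OF assms(1)] .
 have e: "nat (lkt r l) = 1 + nat (lkt (r - tk l 1) l)" using assms by (simp add: lk)
 have z: "zzl l (m l) (%i. lkx (r - tk l 1) l i) = zzl l (m l) (%i. lkx r l i)"
 by (rule G.zz_cong) (simp add: lk)
 show ?thesis unfolding mon_def z e G.tp_add by (simp add: G.cf_mult G.W.m_assoc del: UPK.monom_mult)
qed

lemma mon_zero: assumes "l < s" shows "mon l 0 = 1:.(A l)"
proof -
 interpret G: qgwa K "m l" "q l" "\<sigma> l" "h l" using qgwa[OF assms] .
 have "G.zz n (%_. 0) = 1:.G.W" for n by (induction n) (auto simp: G.zp_def)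
 moreover have "G.cf (tp 0) = 1:.G.W" using G.cf_one UPK.monom_one by simp
 ultimately show ?thesis by (simp add: mon_def lk)
qed

lemma A_span:
 assumes "l < s" "a :.(A l)"
 shows "a : lspan K (A l) (mon l ` R)"
proof -
 interpret G: qgwa K "m l" "q l" "\<sigma> l" "h l" using qgwa[OF assms(1)] .
 have "G.mons <= mon l ` R"
 proof
 fix x assume "x : G.mons"
 then obtain j a where x: "x = G.cf (tp j)**.G.W G.zz (m l) a" by (auto simp: G.mons_def)
 obtain r where r: "r : R" "!!l. l < s ==> lkt r l = int j" "!!l i. l < s ==> i < m l ==> lkx r l i = a i"
 using R_combine[of "%_. j" "%_ i. a i"] by blast
 have "G.zz (m l) (%i. lkx r l i) = G.zz (m l) a" by (rule G.zz_cong) (use r(3) assms in auto)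
 hence "mon l r = x" using r(2)[OF assms(1)] x by (simp add: mon_def)
 thus "x : mon l ` R" using r(1) by blast
 qed
 thus ?thesis using lspan_mono[OF G.W_span[OF assms(2)]] by blast
qed

lemma tp1_img: assumes "l < s" shows "cfl l (tp 1) :.(A l)" "vp l (cfl l (tp 1)) = sg (tk l 1) 1:"
proof -
 interpret G: qgwa K "m l" "q l" "\<sigma> l" "h l" using qgwa[OF assms] .
 show "cfl l (tp 1) :.(A l)" by simp
 show "vp l (cfl l (tp 1)) = sg (tk l 1) 1:" using vp(2)[OF assms, of "tp 1"] pt(2)[of l 1] by simp
qed

lemma xg_img: assumes "l < s" "0 < m l" shows "xgl l 0 :.(A l)" "vp l (xgl l 0) = sg (xk l 0 1) 1:"
proof -
 interpret G: qgwa K "m l" "q l" "\<sigma> l" "h l" using qgwa[OF assms(1)] .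
 show "xgl l 0 :.(A l)" using assms by simp
 show "vp l (xgl l 0) = sg (xk l 0 1) 1:" using vp(3) assms by simp
qed

lemma gwa_low_basis:
 assumes "s = 1"
 shows "low_basis K s m q \<sigma> h (A 0) (vp 0) (mon 0) (%l. cfl l (tp 1)) (%l. xgl l 0)"
proof (intro low_basis.intro weyl_family_axioms low_basis_axioms.intro)
 have s0: "0 < s" using assms by simp
 show "assoc_algebra K (A 0)" using A_algebra[OF s0] .
 show "vp 0 : alg_hom K (A 0) L" using vp(1)[OF s0] .
 show "mon 0 0 = 1:.(A 0)" using mon_zero[OF s0] .
 fix r assume r: "r : R"
 show "mon 0 r :.(A 0)" using mon_closed[OF s0] .
 have "lowr r = lowm 0 r" using lowm_sum[OF r] assms by simp
 thus "low (vp 0 (mon 0 r)) (lowr r)" using low_mon[OF s0] by simp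
 fix l assume "l < s" "1 <= lkt r l"
 thus "mon 0 r = cfl l (tp 1)**.(A 0) mon 0 (r - tk l 1)" using mon_step[of l r] assms by simp
next
 show "x :.(A 0) ==> x : lspan K (A 0) (mon 0 ` R)" for x using A_span assms by simp
 show "l < s ==> cfl l (tp 1) :.(A 0)" "l < s ==> vp 0 (cfl l (tp 1)) = sg (tk l 1) 1:" for l
 using tp1_img[of l] assms by auto
 show "l < s ==> 0 < m l ==> xgl l 0 :.(A 0)" "l < s ==> 0 < m l ==> vp 0 (xgl l 0) = sg (xk l 0 1) 1:" for l
 using xg_img[of l] assms by auto
qed

sublocale TT: tfam K s A
 by (intro tfam.intro is_cring tfam_axioms.intro A_algebra)

definition tens where "tens r = TT.pure (\<lambda>l\<in>{..<s}. mon l r)"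
definition slot where "slot l a = TT.pure (\<lambda>i\<in>{..<s}. if i = l then a else 1:.(A i))"
definition Pht where "Pht = (SOME Ph. Ph : alg_hom K TT.TF L & (ALL f:car TT.pm. Ph (TT.pure f) = TT.oprod L vp f s))"

lemma Pht: "Pht : alg_hom K TT.TF L" "f :.TT.pm ==> Pht (TT.pure f) = TT.oprod L vp f s"
proof -
 obtain Ph where "Ph : alg_hom K TT.TF L" "!!f. f :.TT.pm ==> Ph (TT.pure f) = TT.oprod L vp f s"
 using TT.TF_hom[OF T.T.L.assoc_algebra_axioms vp(1) vp_comm] by blast
 hence "EX Ph. Ph : alg_hom K TT.TF L & (ALL f:car TT.pm. Ph (TT.pure f) = TT.oprod L vp f s)" by blast
 from someI_ex[OF this] show "Pht : alg_hom K TT.TF L" "f :.TT.pm ==> Pht (TT.pure f) = TT.oprod L vp f s"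
 unfolding Pht_def by blast+
qed

lemma tens_mem: "(\<lambda>l\<in>{..<s}. mon l r) :.TT.pm"
 using mon_closed by (simp add: PiE_iff)

lemma slot_mem: "l < s ==> a :.(A l) ==> (\<lambda>i\<in>{..<s}. if i = l then a else 1:.(A i)) :.TT.pm"
 using TT.A_closed(4) by (simp add: PiE_iff)

lemma Pht_tens: assumes "r : R" shows "low (Pht (tens r)) (lowr r)"
proof -
 have "n <= s ==> low (TT.oprod L vp (\<lambda>l\<in>{..<s}. mon l r) n) (\<Sum>l<n. lowm l r)" for n
 proof (induction n)
 case 0
 show ?case using low_sg[of 0] by (simp add: T.T.L_one)
 next
 case (Suc n)
 thus ?case using low_mult[OF Suc.IH low_mon[of n r]] by simp
 qed
 from this[of s] show ?thesis using lowm_sum[OF assms] by (simp add: tens_def Pht(2)[OF tens_mem])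
qed

lemma Pht_slot: assumes "l < s" "a :.(A l)" shows "Pht (slot l a) = vp l a"
proof -
 have c: "vp l a :.L" using alg_hom_closed[OF vp(1)] assms by blast
 have "n <= s ==> TT.oprod L vp (\<lambda>i\<in>{..<s}. if i = l then a else 1:.(A i)) n = (if l < n then vp l a else 1:.L)" for n
 by (induction n) (use c in \<open>auto simp: alg_hom_one[OF vp(1)] less_Suc_eq\<close>)
 from this[of s] show ?thesis using assms by (simp add: slot_def Pht(2)[OF slot_mem])
qed

lemma tens_span: assumes "x :.TT.TF" shows "x : lspan K TT.TF (tens ` R)"
proof -
 have "x : lspan K TT.TF (TT.pure ` (\<Pi>\<^sub>E l\<in>{..<s}. mon l ` R))"
 by (rule TT.TF_span[OF _ A_span assms]) (use mon_closed in blast)+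
 moreover have "TT.pure ` (\<Pi>\<^sub>E l\<in>{..<s}. mon l ` R) <= tens ` R"
 proof
 fix y assume "y : TT.pure ` (\<Pi>\<^sub>E l\<in>{..<s}. mon l ` R)"
 then obtain f where f: "y = TT.pure f" "f : (\<Pi>\<^sub>E l\<in>{..<s}. mon l ` R)" by blast
 have "ALL l. EX r. l < s --> r : R & f l = mon l r" using f by (fastforce simp: PiE_iff)
 then obtain rr where rr: "!!l. l < s ==> rr l : R" "!!l. l < s ==> f l = mon l (rr l)" by metis
 \<comment> \<open>Each slot comes with an index of its own; since slot l reads only entries with
   first key l, these indices glue to a single one.\<close>
 obtain r where r: "r : R" "!!l. l < s ==> lkt r l = int (nat (lkt (rr l) l))"
 "!!l i. l < s ==> i < m l ==> lkx r l i = lkx (rr l) l i"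
 using R_combine[of "%l. nat (lkt (rr l) l)" "%l i. lkx (rr l) l i"] by blast
 have "f l = mon l r" if l: "l < s" for l
 using rr(2)[OF l] mon_cong[OF l, of r "rr l"] r(2,3) l R_ge[OF rr(1)[OF l], of l] by simp
 hence "f = (\<lambda>l\<in>{..<s}. mon l r)" using f(2) by (auto simp: PiE_iff extensional_def fun_eq_iff)
 thus "y : tens ` R" using f(1) r(1) by (auto simp: tens_def)
 qed
 ultimately show ?thesis by (rule lspan_mono)
qed

lemma tensor_low_basis:
 "low_basis K s m q \<sigma> h TT.TF Pht tens (%l. slot l (cfl l (tp 1))) (%l. slot l (xgl l 0))"
proof (intro low_basis.intro weyl_family_axioms low_basis_axioms.intro TT.TF_algebra Pht(1) tens_span Pht_tens)
 show "tens r :.TT.TF" for r unfolding tens_def using TT.pure_closed[OF tens_mem] .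
 show "slot l (cfl l (tp 1)) :.TT.TF" "Pht (slot l (cfl l (tp 1))) = sg (tk l 1) 1:" if "l < s" for l
 using tp1_img[OF that] Pht_slot[OF that] slot_mem[OF that] TT.pure_closed by (simp_all add: slot_def)
 show "slot l (xgl l 0) :.TT.TF" "Pht (slot l (xgl l 0)) = sg (xk l 0 1) 1:" if "l < s" "0 < m l" for l
 using xg_img[OF that] Pht_slot[OF that(1)] slot_mem[OF that(1)] TT.pure_closed by (simp_all add: slot_def)
 have "(\<lambda>l\<in>{..<s}. mon l 0) = 1:.TT.pm" using mon_zero by (auto simp: fun_eq_iff)
 thus "tens 0 = 1:.TT.TF" unfolding tens_def using TT.pure_one by simp
 fix l r assume l: "l < s" and r: "r : R" "1 <= lkt r l"
 have "(\<lambda>i\<in>{..<s}. mon i r) = (\<lambda>i\<in>{..<s}. if i = l then cfl l (tp 1) else 1:.(A i))**.TT.pm (\<lambda>i\<in>{..<s}. mon i (r - tk l 1))"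
 proof -
 have "mon i r = (if i = l then cfl l (tp 1) else 1:.(A i))**.(A i) mon i (r - tk l 1)" if i: "i < s" for i
 proof (cases "i = l")
 case True
 thus ?thesis using mon_step[OF l r(2)] by simp
 next
 case False
 have "mon i r = mon i (r - tk l 1)" by (rule mon_cong[OF i]) (use False in \<open>auto simp: lk\<close>)
 thus ?thesis using False mon_closed[OF i] monoid.l_one[OF TT.Amon[OF i]] by simp
 qed
 thus ?thesis by (auto simp: fun_eq_iff)
 qed
 thus "tens r = slot l (cfl l (tp 1))**.TT.TF tens (r - tk l 1)"
 unfolding tens_def slot_def using TT.pure_mult[OF slot_mem[OF l tp1_img(1)[OF l]] tens_mem] by simp
qed

end

section \<open>Polynomials over noncommutative algebras\<close>

locale poly_alg = A?: assoc_algebra K A for K :: "('k, 'e) ring_scheme" and A :: "('k, 'a, 'x) module_scheme" (structure)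
begin

abbreviation PA where "PA == poly_algebra A"
definition mo where "mo a n = up_ring.monom (UP A) a n"

sublocale UA: UP_ring A "UP A" by (intro UP_ring.intro ring_axioms)

lemma PA_ops: "car PA = car (UP A)" "p**.PA r = p**.(UP A) r" "1:.PA = 1:.(UP A)"
 "0:.PA = 0:.(UP A)" "p +:.PA r = p +:.(UP A) r" "(k *:.PA p) n = k *: p n"
 by (simp_all add: poly_algebra_def with_smult_def)

lemma PA_iff: "p : car PA \<longleftrightarrow> (ALL n. p n :.A) & finite {n. p n ~= 0:}"
 unfolding PA_ops carrier_UP by (auto simp: monoid_algebra_def)

lemma PA_value: "p :.PA ==> p n :.A" by (simp add: PA_iff)

lemma PA_add: "p :.PA ==> r :.PA ==> (p +:.PA r) n = p n +: r n"
 unfolding PA_ops by (rule UP_add_value)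

lemma PA_mult: "p :.PA ==> r :.PA ==> (p**.PA r) n = (++i:{..n}. p i**r (n - i))"
 unfolding PA_ops by (rule UP_mult_value)

lemma PA_zero: "0:.PA n = 0:" and PA_one: "1:.PA n = (if n = 0 then 1: else 0:)"
 unfolding PA_ops by (rule UP_zero_value, rule UP_one_value)

lemma PA_smult_closed: assumes "k :.K" "p :.PA" shows "k *:.PA p :.PA"
proof -
 have "{n. k *: p n ~= 0:} <= {n. p n ~= 0:}" using assms by (auto simp: smult_r_null)
 thus ?thesis using assms unfolding PA_iff PA_ops(6) by (meson finite_subset smult_closed)
qed

lemma PA_ring: "ring PA"
 unfolding poly_algebra_def by (rule ring_with_smult[OF UA.UP_ring])

lemma PA_algebra: "assoc_algebra K PA"
proof -
 interpret PA: ring PA by (rule PA_ring)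
 show ?thesis
 proof (intro assoc_algebra.intro module.intro assoc_algebra_axioms.intro module_axioms.intro A.R.is_cring PA.abelian_group_axioms PA_ring)
 show "a *:.PA x :.PA" if "a :.K" "x :.PA" for a x using PA_smult_closed that .
 show "1:.K *:.PA x = x" if "x :.PA" for x using PA_value[OF that] by (simp add: PA_ops fun_eq_iff)
 show "(a +:.K b) *:.PA x = a *:.PA x +:.PA b *:.PA x"
 if "a :.K" "b :.K" "x :.PA" for a b x
 by (rule ext, subst PA_add) (use that PA_value[OF that(3)] PA_smult_closed in \<open>auto simp: PA_ops(6) smult_l_distr\<close>)
 show "(a**.K b) *:.PA x = a *:.PA (b *:.PA x)"
 if "a :.K" "b :.K" "x :.PA" for a b x
 by (rule ext) (use that PA_value[OF that(3)] in \<open>auto simp: PA_ops(6) smult_assoc1\<close>)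
 fix a x y assume that: "a :.K" "x :.PA" "y :.PA"
 note v = PA_value[OF that(2)] PA_value[OF that(3)]
 have c: "a *:.PA x :.PA" "a *:.PA y :.PA" using PA_smult_closed that by auto
 show "a *:.PA (x +:.PA y) = a *:.PA x +:.PA a *:.PA y"
 by (rule ext, subst PA_add) (use that c v in \<open>auto simp: PA_ops(6) smult_r_distr PA_add\<close>)
 have s: "a *: (++i:{..n}. x i**y (n - i)) = (++i:{..n}. a *: (x i**y (n - i)))" for n
 using finsum_smult_ldistr[of "{..n}" a "%i. x i**y (n - i)"] that v by simp
 have s2: "(++i:{..n}. (a *:.PA x) i**y (n - i)) = (++i:{..n}. a *: (x i**y (n - i)))"
 "(++i:{..n}. x i**(a *:.PA y) (n - i)) = (++i:{..n}. a *: (x i**y (n - i)))" for n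
 by (rule finsum_cong'; use that v in \<open>auto simp: PA_ops(6) smult_mult_left smult_mult_right\<close>)+
 show "a *:.PA x**.PA y = a *:.PA (x**.PA y)" "x**.PA (a *:.PA y) = a *:.PA (x**.PA y)"
 using that c s s2 by (auto simp: fun_eq_iff PA_ops(6) PA_mult)
 qed
qed

sublocale PA: assoc_algebra K "poly_algebra A" by (rule PA_algebra)

lemma mo_closed [simp]: "a :.A ==> mo a n :.PA"
 unfolding PA_ops mo_def by simp

lemma mo_value: "a :.A ==> mo a n k = (if n = k then a else 0:)"
 unfolding mo_def by (rule UP_monom_value)

lemma PA_mult_unique:
 assumes p: "p :.PA" and r: "r :.PA"
 and u: "!!i' j'. p i' ~= 0: ==> r j' ~= 0: ==> i' + j' = i + j ==> i' = i"
 shows "(p**.PA r) (i + j) = p i**r j"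
proof -
 note v = PA_value[OF p] PA_value[OF r]
 have "(++i':{..i + j}. p i'**r (i + j - i')) = (++i':{i}. p i'**r (i + j - i'))"
 proof (rule add.finprod_mono_neutral_cong_right)
 fix i' assume i': "i' : {..i + j} - {i}"
 hence "p i' = 0: | r (i + j - i') = 0:" using u[of i' "i + j - i'"] by auto
 thus "p i'**r (i + j - i') = 0:" using v by auto
 qed (use v in auto)
 thus ?thesis using v by (simp add: PA_mult[OF p r])
qed

lemma PA_mult_zero: 
 assumes p: "p :.PA" and r: "r :.PA"
 and u: "!!i j. p i ~= 0: ==> r j ~= 0: ==> i + j ~= n"
 shows "(p**.PA r) n = 0:"
 using PA_mult_unique[OF p r, of 0 n] u[of 0 n] u PA_value[OF p] PA_value[OF r] by fastforce

lemma mo_nz: "a :.A ==> mo a n k ~= 0: ==> k = n"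
 by (simp add: mo_value split: if_splits)

lemma const_mult:
 assumes "a :.A" "p :.PA"
 shows "(mo a 0**.PA p) n = a**p n" "(p**.PA mo a 0) n = p n**a"
proof -
 have "(mo a 0**.PA p) (0 + n) = mo a 0 0**p n"
 by (rule PA_mult_unique[OF mo_closed[OF assms(1)] assms(2)]) (use mo_nz[OF assms(1)] in blast)
 thus "(mo a 0**.PA p) n = a**p n" using assms by (simp add: mo_value)
 have "(p**.PA mo a 0) (n + 0) = p n**mo a 0 0"
 by (rule PA_mult_unique[OF assms(2) mo_closed[OF assms(1)]]) (use mo_nz[OF assms(1)] in force)
 thus "(p**.PA mo a 0) n = p n**a" using assms by (simp add: mo_value)
qed

lemma mo_mult:
 assumes "a :.A" "b :.A" shows "mo a i**.PA mo b j = mo (a**b) (i + j)"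
proof
 fix n
 have "(mo a i**.PA mo b j) (i + j) = mo a i i**mo b j j"
 by (rule PA_mult_unique) (use mo_nz[OF assms(1)] assms in auto)
 moreover have "(mo a i**.PA mo b j) n = 0:" if "n ~= i + j"
 by (rule PA_mult_zero) (use mo_nz[OF assms(1)] mo_nz[OF assms(2)] that assms in auto)
 ultimately show "(mo a i**.PA mo b j) n = mo (a**b) (i + j) n"
 using assms by (cases "n = i + j") (simp_all add: mo_value)
qed

lemma y_central:
 assumes "p :.PA" shows "p**.PA mo 1: d = mo 1: d**.PA p"
proof
 fix n
 note v = PA_value[OF assms] and o = mo_nz[OF one_closed, of d]
 show "(p**.PA mo 1: d) n = (mo 1: d**.PA p) n"
 proof (cases "d <= n")
 case True
 have "(p**.PA mo 1: d) (n - d + d) = p (n - d)**mo 1: d d"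
 by (rule PA_mult_unique[OF assms mo_closed[OF one_closed]]) (metis o add_right_cancel)
 moreover have "(mo 1: d**.PA p) (d + (n - d)) = mo 1: d d**p (n - d)"
 by (rule PA_mult_unique) (use o assms in auto)
 ultimately show ?thesis using True v by (simp add: mo_value)
 next
 case False
 have "(p**.PA mo 1: d) n = 0:" by (rule PA_mult_zero) (use o assms False in force)+
 moreover have "(mo 1: d**.PA p) n = 0:" by (rule PA_mult_zero) (use o assms False in force)+
 ultimately show ?thesis by simp
 qed
qed

text \<open>The substitution y -> c y on polynomials in a central variable y. For nonzero c in the
  field it is an automorphism fixing the constants; its eigenspaces detect homogeneous
  components.\<close>

definition scale where "scale c p = (%n. (c [^].K (n::nat)) *: p n)"

lemma scale_closed: assumes "c :.K" "p :.PA" shows "scale c p :.PA"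
proof -
 have "{n. scale c p n ~= 0:} <= {n. p n ~= 0:}" using assms by (auto simp: smult_r_null scale_def)
 thus ?thesis using assms unfolding PA_iff by (auto simp: scale_def intro: finite_subset)
qed

lemma scale_hom: assumes c: "c :.K" shows "scale c : alg_hom K PA PA"
proof -
 have m: "scale c (p**.PA r) = scale c p**.PA scale c r" if p: "p :.PA" and r: "r :.PA" for p r
 proof
 fix n
 note v = PA_value[OF p] PA_value[OF r]
 have "scale c (p**.PA r) n = (++i:{..n}. c [^].K n *: (p i**r (n - i)))"
 unfolding scale_def PA_mult[OF p r] using finsum_smult_ldistr[of "{..n}" "c [^].K n" "%i. p i**r (n - i)"] c v by simp
 also have "... = (++i:{..n}. scale c p i**scale c r (n - i))"
 proof (rule finsum_cong')
 fix i assume "i : {..n}"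
 hence "c [^].K n = c [^].K i**.K c [^].K (n - i)" using A.R.nat_pow_mult[OF c, of i "n - i"] by simp
 thus "c [^].K n *: (p i**r (n - i)) = scale c p i**scale c r (n - i)"
 using c v by (simp add: scale_def smult_mult_left smult_mult_right A.R.m_comm flip: smult_assoc1)
 qed (use c v in \<open>auto simp: scale_def\<close>)
 also have "... = (scale c p**.PA scale c r) n" using scale_closed[OF c] p r by (simp add: PA_mult)
 finally show "scale c (p**.PA r) n = (scale c p**.PA scale c r) n" .
 qed
 have ad: "scale c (p +:.PA r) = scale c p +:.PA scale c r" if p: "p :.PA" and r: "r :.PA" for p r
 proof
 fix n
 show "scale c (p +:.PA r) n = (scale c p +:.PA scale c r) n"
 using PA_value[OF p] PA_value[OF r] c PA_add[OF p r, of n] PA_add[OF scale_closed[OF c p] scale_closed[OF c r], of n]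
 by (simp add: scale_def smult_r_distr)
 qed
 have sm: "scale c (k *:.PA p) = k *:.PA scale c p" if k: "k :.K" and p: "p :.PA" for k p
 proof
 fix n
 show "scale c (k *:.PA p) n = (k *:.PA scale c p) n"
 using PA_value[OF p, of n] c k by (simp add: scale_def PA_ops(6) A.R.m_comm flip: smult_assoc1)
 qed
 have on: "scale c 1:.PA = 1:.PA"
 proof
 fix n
 show "scale c 1:.PA n = 1:.PA n" using c by (cases n) (simp_all add: scale_def PA_one smult_r_null)
 qed
 show ?thesis unfolding alg_hom_def ring_hom_def
 using m ad sm on scale_closed[OF c] by simp
qed

lemma scale_scale: assumes "c :.K" "d :.K" "p :.PA" shows "scale c (scale d p) = scale (c**.K d) p"
 using assms PA_value[OF assms(3)] by (auto simp: scale_def A.R.nat_pow_distrib simp flip: smult_assoc1)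

lemma scale_one: "p :.PA ==> scale 1:.K p = p"
 using PA_value by (auto simp: scale_def)

lemma PA_expand:
 assumes p: "p :.PA" and N: "!!n. p n ~= 0: ==> n <= N"
 shows "p = (++.PA n:{..N}. mo (p n) n)"
proof -
 note v = PA_value[OF p]
 have "(++.PA n:{..k}. mo (p n) n) j = (if j <= k then p j else 0:)" for j k
 proof (induction k)
 case 0
 have "(++.PA n:{..0 ::nat}. mo (p n) n) = mo (p 0) 0" using v by simp
 thus ?case using mo_value[OF v, of 0 0 j] by auto
 next
 case (Suc k)
 have c: "(++.PA n:{..k}. mo (p n) n) :.PA" using v by (intro PA.finsum_closed) auto
 have "(++.PA n:{..Suc k}. mo (p n) n) = mo (p (Suc k)) (Suc k) +:.PA (++.PA n:{..k}. mo (p n) n)"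
 using v by (intro PA.finsum_Suc) auto
 hence "(++.PA n:{..Suc k}. mo (p n) n) j = mo (p (Suc k)) (Suc k) j +: (if j <= k then p j else 0:)"
 using Suc v c by (simp only: PA_add mo_closed)
 thus ?case using mo_value[OF v, of "Suc k" "Suc k" j] v by (auto simp: le_Suc_eq)
 qed
 thus ?thesis using N by (auto simp: fun_eq_iff)
qed

end

locale poly_dom = poly_alg +
 assumes int: "a :.A ==> b :.A ==> a**b = 0: ==> a = 0: | b = 0:"
begin

definition dg where "dg p = Max {n. p n ~= 0:}"
definition ld where "ld p = Min {n. p n ~= 0:}"

lemma dg_ld:
 assumes "p :.PA" "p ~= 0:.PA"
 shows "p (dg p) ~= 0:" "p (ld p) ~= 0:" "!!n. p n ~= 0: ==> n <= dg p" "!!n. p n ~= 0: ==> ld p <= n"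
proof -
 have "EX n. p n ~= 0:"
 proof (rule ccontr)
 assume "\<nexists>n. p n ~= 0:"
 hence "p = 0:.PA" using PA_zero by (metis ext)
 thus False using assms by simp
 qed
 hence fin: "finite {n. p n ~= 0:}" "{n. p n ~= 0:} ~= {}" using assms by (auto simp: PA_iff)
 show "p (dg p) ~= 0:" "p (ld p) ~= 0:" unfolding dg_def ld_def using Max_in[OF fin] Min_in[OF fin] by auto
 show "!!n. p n ~= 0: ==> n <= dg p" "!!n. p n ~= 0: ==> ld p <= n" unfolding dg_def ld_def using fin by auto
qed

lemma dg_eqI: "p :.PA ==> p n ~= 0: ==> (!!k. p k ~= 0: ==> k <= n) ==> dg p = n"
 and ld_eqI: "p :.PA ==> p n ~= 0: ==> (!!k. p k ~= 0: ==> n <= k) ==> ld p = n"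
 unfolding dg_def ld_def by (auto simp: PA_iff intro: Max_eqI Min_eqI)

lemma dg_ld_mult:
 assumes p: "p :.PA" "p ~= 0:.PA" and r: "r :.PA" "r ~= 0:.PA"
 shows "p**.PA r ~= 0:.PA" "dg (p**.PA r) = dg p + dg r" "ld (p**.PA r) = ld p + ld r"
proof -
 note P = dg_ld[OF p] and Q = dg_ld[OF r] and v = PA_value[OF p(1)] PA_value[OF r(1)]
 have c: "p**.PA r :.PA" using p r by simp
 have "(p**.PA r) (dg p + dg r) = p (dg p)**r (dg r)"
 by (rule PA_mult_unique[OF p(1) r(1)]) (use P Q in fastforce)
 hence 1: "(p**.PA r) (dg p + dg r) ~= 0:" using int v P Q by metis
 have "(p**.PA r) (ld p + ld r) = p (ld p)**r (ld r)"
 by (rule PA_mult_unique[OF p(1) r(1)]) (use P Q in fastforce)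
 hence 2: "(p**.PA r) (ld p + ld r) ~= 0:" using int v P Q by metis
 show "p**.PA r ~= 0:.PA" using 1 PA_zero by metis
 have b: "EX i j. p i ~= 0: & r j ~= 0: & i + j = n" if "(p**.PA r) n ~= 0:" for n
 using PA_mult_zero[OF p(1) r(1), of n] that by blast
 show "dg (p**.PA r) = dg p + dg r"
 proof (rule dg_eqI[OF c 1])
 fix n assume "(p**.PA r) n ~= 0:"
 then obtain i j where "p i ~= 0:" "r j ~= 0:" "i + j = n" using b by blast
 thus "n <= dg p + dg r" using P(3)[of i] Q(3)[of j] by simp
 qed
 show "ld (p**.PA r) = ld p + ld r"
 proof (rule ld_eqI[OF c 2])
 fix n assume "(p**.PA r) n ~= 0:"
 then obtain i j where "p i ~= 0:" "r j ~= 0:" "i + j = n" using b by blast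
 thus "ld p + ld r <= n" using P(4)[of i] Q(4)[of j] by simp
 qed
qed

lemma mo_nonzero: "a :.A ==> a ~= 0: ==> mo a n ~= 0:.PA"
 using mo_value[of a n n] PA_zero by metis

lemma dg_ld_mo: "a :.A ==> a ~= 0: ==> dg (mo a n) = n & ld (mo a n) = n"
 by (auto simp: mo_value split: if_splits intro!: dg_eqI ld_eqI)

lemma ld_le_dg: "p :.PA ==> p ~= 0:.PA ==> ld p <= dg p"
 using dg_ld(1,4) by blast

lemma homogeneous: assumes "p :.PA" "p ~= 0:.PA" "dg p = ld p" shows "p = mo (p (dg p)) (dg p)"
proof
 fix n
 show "p n = mo (p (dg p)) (dg p) n"
 using dg_ld(3,4)[OF assms(1,2), of n] assms(3) PA_value[OF assms(1)] by (cases "p n = 0:") (auto simp: mo_value)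
qed

end

section \<open>Cancellation\<close>

lemma (in domain) finite_zeros:
 assumes d: "!!k. k <= N ==> d k :.R" and nz: "k0 <= (N::nat)" "d k0 ~= 0:"
 shows "finite {c : car R. (++k:{..N}. d k**c [^] k) = 0:}"
proof -
 \<comment> \<open>Polynomials as coefficient lists must have a nonzero leading entry, so the list
   is cut at the true degree.\<close>
 define M where "M = Max {k. k <= N & d k ~= 0:}"
 have fin: "finite {k. k <= N & d k ~= 0:}" "{k. k <= N & d k ~= 0:} ~= {}" using nz by auto
 have M: "M <= N" "d M ~= 0:" using Max_in[OF fin] by (auto simp: M_def)
 have above: "d k = 0:" if "M < k" "k <= N" for k
 proof (rule ccontr)
 assume "d k ~= 0:"
 hence "k <= M" unfolding M_def using Max_ge[OF fin(1), of k] that by simp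
 thus False using that by simp
 qed
 have ev: "eval (rev (map d [0..<Suc j])) c = (++k:{..j}. d k**c [^] k)" if "j <= N" "c :.R" for j c
 using that
 proof (induction j)
 case 0
 thus ?case using d by simp
 next
 case (Suc j)
 have "eval (rev (map d [0..<Suc (Suc j)])) c = d (Suc j)**c [^] (Suc j) +: eval (rev (map d [0..<Suc j])) c"
 by simp
 also have "... = (++k:{..Suc j}. d k**c [^] k)"
 using Suc d finsum_Suc[of "%k. d k**c [^] k" j] by (simp del: nat_pow_Suc)
 finally show ?case .
 qed
 let ?p = "rev (map d [0..<Suc M])"
 have p: "?p :.(poly_ring R)"
 unfolding univ_poly_carrier[symmetric] polynomial_def using M d by auto
 have "{c : car R. (++k:{..N}. d k**c [^] k) = 0:} <= {x. is_root ?p x}"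
 proof
 fix c assume c: "c : {c : car R. (++k:{..N}. d k**c [^] k) = 0:}"
 have "(++k:{..N}. d k**c [^] k) = (++k:{..M}. d k**c [^] k)"
 by (rule add.finprod_mono_neutral_cong_right) (use M d c above in auto)
 thus "c : {x. is_root ?p x}" using c ev[OF M(1), of c] by (simp add: is_root_def)
 qed
 thus ?thesis using finite_number_of_roots[OF p] finite_subset by blast
qed

text \<open>Each nonzero polynomial of the finite set \<open>D\<close> excludes finitely many values
  of \<open>c\<close>, and zero is excluded too; an infinite carrier leaves one value over.\<close>

lemma (in domain) exists_generic:
 assumes inf: "infinite (car R)" and D: "finite D"
 and d: "!!d k. d : D ==> d k :.R"
 obtains c where "c :.R" "c ~= 0:" "!!d k. d : D ==> k <= N ==> d k ~= 0: ==> (++k:{..N::nat}. d k**c [^] k) ~= 0:"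
proof -
 let ?Z = "%d. if EX k<=N. d k ~= 0: then {c : car R. (++k:{..N}. d k**c [^] k) = 0:} else {}"
 have "finite (?Z d)" if "d : D" for d
 using finite_zeros[of N d] d[OF that] by auto
 hence "finite ({0:} \<union> (\<Union>d\<in>D. ?Z d))" using D by blast
 then obtain c where c: "c :.R" "c \<notin> {0:} \<union> (\<Union>d\<in>D. ?Z d)" using inf by (meson finite_subset subsetI)
 show thesis
 proof (rule that[OF c(1)])
 show "c ~= 0:" using c by blast
 show "(++k:{..N}. d k**c [^] k) ~= 0:" if "d : D" "k <= N" "d k ~= 0:" for d k
 proof
 assume "(++k:{..N}. d k**c [^] k) = 0:"
 hence "c : ?Z d" using that c(1) by auto
 thus False using c(2) that(1) by blast
 qed
 qed
qed

text \<open>The assumptions \<open>cond\<close> single out the index 0 in every factor: its q is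
  nontrivial of an order coprime to the others, so that t can be identified by its commutation with
  t and x_0.\<close>

locale cancel = low_basis K s m q \<sigma> h B Ph b tB xB + B': assoc_algebra K B'
 for K :: "('k, 'e) ring_scheme" (structure) and s m q \<sigma> h
 and B :: "('k, 'b, 'y) module_scheme" and Ph b tB xB and B' :: "('k, 'c, 'z) module_scheme" +
 fixes ps
 assumes cond: "!!l. l < s ==> 0 < m l" "!!l. l < s ==> 2 <= nn l 0"
 "!!l i. l < s ==> 0 < i ==> i < m l ==> coprime (nn l 0) (nn l i)"
 and inf: "infinite (car K)"
 and ps: "ps : alg_iso K (poly_algebra B) (poly_algebra B')"
begin

sublocale P1: poly_dom K B
 by (intro poly_dom.intro poly_alg.intro poly_dom_axioms.intro B.assoc_algebra_axioms B_integral)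
sublocale P2: poly_alg K B' by (intro poly_alg.intro B'.assoc_algebra_axioms)

abbreviation P1 where "P1 == poly_algebra B"
abbreviation P2 where "P2 == poly_algebra B'"
definition ch where "ch = inv_into (car P1) ps"

lemma psh: "ps : alg_hom K P1 P2" using alg_iso_alg_hom[OF ps] .
lemma chi: "ch : alg_iso K P2 P1" unfolding ch_def by (rule alg_hom_inv[OF ps P1.PA_algebra])
lemma chh: "ch : alg_hom K P2 P1" using alg_iso_alg_hom[OF chi] .
lemma psb: "bij_betw ps (car P1) (car P2)" using alg_iso_bij[OF ps] .

lemma chps [simp]: "x :.P1 ==> ch (ps x) = x" "y :.P2 ==> ps (ch y) = y"
 using psb unfolding ch_def by (auto simp: bij_betw_def f_inv_into_f)

lemma ps_closed [simp]: "x :.P1 ==> ps x :.P2" "y :.P2 ==> ch y :.P1"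
 using alg_hom_closed[OF psh] alg_hom_closed[OF chh] by auto

lemma ps_zero: "ps 0:.P1 = 0:.P2" "ch 0:.P2 = 0:.P1"
 using alg_hom_zero[OF psh P1.PA.ring_axioms P2.PA.ring_axioms] alg_hom_zero[OF chh P2.PA.ring_axioms P1.PA.ring_axioms] by auto

lemma P2_integral:
 assumes "x :.P2" "y :.P2" "x**.P2 y = 0:.P2" shows "x = 0:.P2 | y = 0:.P2"
proof (rule ccontr)
 assume a: "~ ?thesis"
 have "ch x ~= 0:.P1" "ch y ~= 0:.P1" using a chps(2) assms ps_zero by metis+
 hence "ch x**.P1 ch y ~= 0:.P1" using P1.dg_ld_mult(1)[OF ps_closed(2)[OF assms(1)] _ ps_closed(2)[OF assms(2)]] by blast
 thus False using alg_hom_mult[OF chh assms(1,2)] assms(3) ps_zero by simp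
qed

lemma B'_integral:
 assumes "a :.B'" "a' :.B'" "a**.B' a' = 0:.B'" shows "a = 0:.B' | a' = 0:.B'"
proof -
 have z: "P2.mo 0:.B' 0 = 0:.P2" by (rule ext) (simp add: P2.mo_value P2.PA_zero)
 have "P2.mo a 0**.P2 P2.mo a' 0 = 0:.P2" using assms z by (simp add: P2.mo_mult)
 hence "P2.mo a 0 = 0:.P2 | P2.mo a' 0 = 0:.P2" using P2_integral assms by simp
 thus ?thesis using P2.mo_value[of a 0 0] P2.mo_value[of a' 0 0] assms P2.PA_zero by (metis (full_types))
qed

sublocale P2: poly_dom K B'
 by (intro poly_dom.intro poly_dom_axioms.intro P2.poly_alg_axioms B'_integral)

lemmas D1 = P1.dg_ld_mult and D2 = P2.dg_ld_mult

lemma B'_one: "1:.B' ~= 0:.B'"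
proof
 assume "1:.B' = 0:.B'"
 hence "1:.P2 = 0:.P2" by (auto simp: fun_eq_iff P2.PA_one P2.PA_zero)
 hence "ch 1:.P2 = 0:.P1" using ps_zero by simp
 hence "1:.P1 = 0:.P1" using alg_hom_one[OF chh] by simp
 thus False using B_nontrivial P1.PA_one[of 0] P1.PA_zero[of 0] by simp
qed

lemma Ph_nz: "x :.B ==> x ~= 0:.B ==> Ph x ~= 0:.L" using Ph_eq_zero by blast

text \<open>Degrees in the central variable add, and the constant \<open>s0\<close> has degree 0, so
  \<open>f\<close> has degree 0 too. Then all coefficients of \<open>u\<close> satisfy the
  commutation relation with the same constant \<open>f 0\<close>, whose image is a monomial; this is
  why one scalar \<open>k\<close> serves all exponents.\<close>

lemma normal_coeffs:
 assumes u: "u :.P1" "u i0 ~= 0:.B" and s0: "s0 :.B" "Ph s0 = sg g 1:"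
 and f: "f :.P1" "u**.P1 P1.mo s0 0 = f**.P1 u"
 obtains k where "k :.K" "!!i d. Ph (u i) d ~= 0: ==> cc d g = k**cc g d"
proof -
 have s0n: "s0 ~= 0:.B"
 proof
 assume "s0 = 0:.B"
 hence "sg g 1: = 0:.L" using s0 alg_hom_zero[OF Ph B.ring_axioms T.T.L.ring_axioms] by simp
 thus False using T.sg_nonzero[of \<one> g] by simp
 qed
 have un: "u ~= 0:.P1" using u P1.PA_zero by metis
 note mo0 = P1.mo_nonzero[OF s0(1) s0n]
 have us: "u**.P1 P1.mo s0 0 ~= 0:.P1" using D1(1)[OF u(1) un P1.mo_closed[OF s0(1)] mo0] by blast
 have fn: "f ~= 0:.P1" using us f u(1) by auto
 have "P1.dg f + P1.dg u = P1.dg u + 0"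
 using D1(2)[OF u(1) un P1.mo_closed[OF s0(1)] mo0[of 0]] D1(2)[OF f(1) fn u(1) un] P1.dg_ld_mo[OF s0(1) s0n, of 0] unfolding f(2) by presburger
 hence dgf: "P1.dg f = 0" by simp
 hence ldf: "P1.ld f = 0" using P1.ld_le_dg[OF f(1) fn] by simp
 have "f = P1.mo (f (P1.dg f)) (P1.dg f)" by (rule P1.homogeneous[OF f(1) fn]) (simp add: dgf ldf)
 hence fm: "f = P1.mo (f 0) 0" unfolding dgf .
 have f0: "f 0 :.B" using P1.PA_value[OF f(1)] .
 have ui: "u i :.B" for i using P1.PA_value[OF u(1)] .
 have e: "u i**.B s0 = f 0**.B u i" for i
 using P1.const_mult[OF s0(1) u(1), of i] P1.const_mult[OF f0 u(1), of i] f(2) fm by metis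
 have el: "Ph (u i)**.L sg g 1: = Ph (f 0)**.L Ph (u i)" for i
 using arg_cong[OF e[of i], of Ph] ui f0 s0 by (simp add: alg_hom_mult[OF Ph])
 obtain k where k: "k :.K" "Ph (f 0) = sg g k"
 using T.normal_factor_single[OF Ph_closed[OF ui] Ph_nz[OF ui u(2)] Ph_closed[OF f0] one_closed _ el[of i0]] by auto
 show thesis
 proof (rule that[OF k(1)])
 fix i d assume "Ph (u i) d ~= 0:"
 thus "cc d g = k**cc g d"
 using T.normal_coeff[OF Ph_closed[OF ui[of i]] k(1) one_closed, of g d] el[of i] k(2) by simp
 qed
qed

text \<open>Every exponent in every coefficient of \<open>u\<close> has the commutation scalars of
  t_l with respect to t_l and x_(l,0). This is the hypothesis of \<open>multiple_of_tB\<close>,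
  coefficient by coefficient.\<close>

definition ok where "ok l u \<longleftrightarrow> (ALL i g. Ph (u i) g ~= 0: --> cc g (tk l 1) = 1: & cc (xk l 0 1) g = q l 0)"

lemma q0: "l < s ==> q l 0 :.K & q l 0 ~= 0:"
 using q_Units[of "(l, 0)"] cond(1)[of l] field_Units by (auto simp: Ix_def)

lemma cc_x_tk: assumes "l < s" shows "cc (xk l 0 1) (tk l 1) = q l 0"
 using cc_xk_left[OF assms cond(1)[OF assms], of 1 "tk l 1"] Uk.int_pow_1[of "q l 0"] q_Uk[of "(l, 0)"] assms cond(1)[OF assms]
 by (simp add: lk Ix_def)

lemma okI:
 assumes l: "l < s" and kt: "k1 :.K" "!!i d. Ph (u i) d ~= 0: ==> cc d (tk l 1) = k1**cc (tk l 1) d"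
 and kx: "k2 :.K" "!!i d. Ph (u i) d ~= 0: ==> cc d (xk l 0 1) = k2**cc (xk l 0 1) d"
 and k: "k1 = 1:" "1: = k2**q l 0"
 shows "ok l u"
 unfolding ok_def
proof (intro allI impI conjI)
 fix i g assume g: "Ph (u i) g ~= 0:"
 show "cc g (tk l 1) = 1:" using kt(2)[OF g] k(1) by simp
 have "1: = k2**cc (xk l 0 1) g" using kx(2)[OF g] by simp
 hence "k2**cc (xk l 0 1) g = k2**q l 0" using k(2) by metis
 moreover have "k2 ~= 0:"
 proof
 assume "k2 = 0:"
 hence "1: = 0:" using k(2) q0[OF l] by simp
 thus False by simp
 qed
 ultimately show "cc (xk l 0 1) g = q l 0" using kx(1) q0[OF l] m_lcancel[of k2 "cc (xk l 0 1) g" "q l 0"] by simp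
qed

text \<open>Normality yields scalars \<open>k1\<close> and \<open>k2\<close> common to all exponents
  of \<open>u\<close>. The exponent of t itself occurs, and evaluating there fixes them to be those
  of t.\<close>

lemma ok_self:
 assumes l: "l < s" and u: "u :.P1"
 and n: "!!x. x :.P1 ==> EX f:car P1. u**.P1 x = f**.P1 u"
 and t: "Ph (u i0) (tk l 1) ~= 0:"
 shows "ok l u"
proof -
 have u0: "u i0 ~= 0:.B"
 proof
 assume "u i0 = 0:.B"
 thus False using t alg_hom_zero[OF Ph B.ring_axioms T.T.L.ring_axioms] by (simp add: T.T.L_zero)
 qed
 note m0 = cond(1)[OF l]
 obtain f1 where f1: "f1 :.P1" "u**.P1 P1.mo (tB l) 0 = f1**.P1 u" using n P1.mo_closed[OF tB_closed[OF l]] by blast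
 obtain f2 where f2: "f2 :.P1" "u**.P1 P1.mo (xB l) 0 = f2**.P1 u" using n P1.mo_closed[OF xB_closed[OF l m0]] by blast
 obtain k1 where k1: "k1 :.K" "!!i d. Ph (u i) d ~= 0: ==> cc d (tk l 1) = k1**cc (tk l 1) d"
 using normal_coeffs[OF u u0 tB_closed[OF l] Ph_tB[OF l] f1] by blast
 obtain k2 where k2: "k2 :.K" "!!i d. Ph (u i) d ~= 0: ==> cc d (xk l 0 1) = k2**cc (xk l 0 1) d"
 using normal_coeffs[OF u u0 xB_closed[OF l m0] Ph_xB[OF l m0] f2] by blast
 show ?thesis
 proof (rule okI[OF l k1 k2])
 show "k1 = 1:" using k1(2)[OF t] k1(1) by simp
 show "1: = k2**q l 0" using k2(2)[OF t] cc_x_tk[OF l] by simp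
 qed
qed

lemma ok_multiple:
 assumes l: "l < s" and u: "u :.P1" and o: "ok l u"
 obtains z where "z :.P1" "u = P1.mo (tB l) 0**.P1 z"
proof -
 have ui: "u i :.B" for i using P1.PA_value[OF u] .
 \<comment> \<open>A zero coefficient is given the quotient zero, so that the quotients have finite
   support and form a polynomial.\<close>
 have "EX z. z :.B & u i = tB l**.B z & (u i = 0:.B --> z = 0:.B)" for i
 proof (cases "u i = 0:.B")
 case True
 thus ?thesis using tB_closed[OF l] by (intro exI[of _ "0:.B"]) simp
 next
 case False
 show ?thesis
 using multiple_of_tB[OF l cond(1)[OF l] cond(3)[OF l] cond(2)[OF l] ui[of i]] o False unfolding ok_def by metis
 qed
 then obtain z where z: "!!i. z i :.B" "!!i. u i = tB l**.B z i" "!!i. u i = 0:.B ==> z i = 0:.B" by metis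
 have "{i. z i ~= 0:.B} <= {i. u i ~= 0:.B}" using z(3) by blast
 hence zc: "z :.P1" using u z(1) unfolding P1.PA_iff by (blast intro: finite_subset)
 have "u = P1.mo (tB l) 0**.P1 z" using P1.const_mult(1)[OF tB_closed[OF l] zc] z(2) by (simp add: fun_eq_iff)
 thus thesis using that zc by blast
qed

abbreviation t1 where "t1 l == P1.mo (tB l) 0"

lemma t1_normal:
 assumes l: "l < s" and x: "x :.P1"
 obtains f where "f :.P1" "t1 l**.P1 x = f**.P1 t1 l"
proof -
 have xi: "x i :.B" for i using P1.PA_value[OF x] .
 have "EX f. f :.B & tB l**.B x i = f**.B tB l & (x i = 0:.B --> f = 0:.B)" for i
 proof (cases "x i = 0:.B")
 case True
 thus ?thesis using tB_closed[OF l] by (intro exI[of _ "0:.B"]) simp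
 next
 case False
 thus ?thesis using tB_normal[OF l xi[of i]] by metis
 qed
 then obtain f where f: "!!i. f i :.B" "!!i. tB l**.B x i = f i**.B tB l" "!!i. x i = 0:.B ==> f i = 0:.B" by metis
 have "{i. f i ~= 0:.B} <= {i. x i ~= 0:.B}" using f(3) by blast
 hence fc: "f :.P1" using x f(1) unfolding P1.PA_iff by (blast intro: finite_subset)
 have "t1 l**.P1 x = f**.P1 t1 l"
 using P1.const_mult(1)[OF tB_closed[OF l] x] P1.const_mult(2)[OF tB_closed[OF l] fc] f(2) by (simp add: fun_eq_iff)
 thus thesis using that fc by blast
qed

lemma tB_nz: "l < s ==> tB l ~= 0:.B"
 using Ph_tB[of l] alg_hom_zero[OF Ph B.ring_axioms T.T.L.ring_axioms] T.sg_nonzero[OF one_not_zero, of "tk l 1"] by metis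

text \<open>
 Applying the automorphisms \<open>y \<mapsto> c y\<close> of \<open>B'[y]\<close> to \<open>ps t\<close> for generic \<open>c\<close> shows that
 all homogeneous components of \<open>ps t\<close> pull back to left multiples of \<open>t\<close>; the lowest component then
 forces \<open>ps t\<close> to be homogeneous.
\<close>

lemma ps_t_homogeneous:
 assumes l: "l < s"
 shows "ps (t1 l) = P2.mo (ps (t1 l) (P2.dg (ps (t1 l)))) (P2.dg (ps (t1 l)))"
proof -
 have tc: "t1 l :.P1" using tB_closed[OF l] by simp
 define T where "T = ps (t1 l)"
 have Tc: "T :.P2" using tc by (simp add: T_def)
 have tn: "t1 l ~= 0:.P1" using P1.mo_nonzero[OF tB_closed[OF l] tB_nz[OF l]] .
 have Tn: "T ~= 0:.P2" using chps(1)[OF tc] tn ps_zero unfolding T_def by metis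
 note TD = P2.dg_ld[OF Tc Tn]
 define N where "N = P2.dg T"
 have Tk: "T k :.B'" for k using P2.PA_value[OF Tc] .
 define w where "w k = ch (P2.mo (T k) k)" for k
 have wc: "w k :.P1" for k using Tk by (simp add: w_def)
 have wki: "w k i :.B" for k i using P1.PA_value[OF wc] .
 have Texp: "T = (++.P2 k:{..N}. P2.mo (T k) k)" unfolding N_def by (rule P2.PA_expand[OF Tc TD(3)])
 \<comment> \<open>Here \<open>u c\<close> is the image of t under the automorphism y -> c y of the
   second polynomial ring, carried back to the first. It is the combination of the
   \<open>w k\<close> with coefficients c^k.\<close>
 define u where "u c = ch (P2.scale c T)" for c
 have uc: "u c :.P1" if "c :.K" for c using P2.scale_closed[OF that Tc] by (simp add: u_def)
 have uexp: "u c = (++.P1 k:{..N}. (c [^] k) *:.P1 w k)" if c: "c :.K" for c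
 proof -
 have sm: "P2.scale c (P2.mo (T k) k) = (c [^] k) *:.P2 P2.mo (T k) k" for k
 proof
 fix n
 show "P2.scale c (P2.mo (T k) k) n = ((c [^] k) *:.P2 P2.mo (T k) k) n"
 using Tk[of k] c P2.mo_value[OF Tk[of k], of k n] by (auto simp: P2.scale_def P2.PA_ops(6) B'.smult_r_null)
 qed
 have "P2.scale c T = (++.P2 k:{..N}. P2.scale c (P2.mo (T k) k))"
 by (subst Texp, rule alg_hom_finsum[OF P2.scale_hom[OF c] P2.PA_algebra P2.PA_algebra]) (use Tk in auto)
 hence "u c = ch (++.P2 k:{..N}. (c [^] k) *:.P2 P2.mo (T k) k)" by (simp add: u_def sm)
 also have "... = (++.P1 k:{..N}. ch ((c [^] k) *:.P2 P2.mo (T k) k))"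
 by (rule alg_hom_finsum[OF chh P2.PA_algebra P1.PA_algebra]) (use Tk c in auto)
 also have "... = (++.P1 k:{..N}. (c [^] k) *:.P1 w k)"
 using c Tk wc by (intro P1.PA.finsum_cong') (auto simp: w_def alg_hom_smult[OF chh])
 finally show ?thesis .
 qed
 have ucoef: "Ph (u c i) g = (++k:{..N}. Ph (w k i) g**c [^] k)" if c: "c :.K" for c i g
 proof -
 have v: "Ph (w k i) g :.K" for k using T.T.L_value[OF Ph_closed[OF wki]] .
 have "(++.P1 k:{..n}. (c [^] k) *:.P1 w k) :.P1 &
 Ph ((++.P1 k:{..n}. (c [^] k) *:.P1 w k) i) g = (++k:{..n}. Ph (w k i) g**c [^] k)" for n
 proof (induction n)
 case 0
 have "(1: *:.P1 w 0) i = w 0 i" using wc[of 0] by simp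
 thus ?case using c wc v by simp
 next
 case (Suc n)
 let ?S = "++.P1 k:{..n}. (c [^] k) *:.P1 w k"
 have e: "(++.P1 k:{..Suc n}. (c [^] k) *:.P1 w k) = (c [^] Suc n) *:.P1 w (Suc n) +:.P1 ?S"
 using c wc by (intro P1.PA.finsum_Suc) auto
 have sc: "(c [^] Suc n) *:.P1 w (Suc n) :.P1" using c wc by (simp del: nat_pow_Suc)
 have Si: "?S i :.B" using P1.PA_value Suc by blast
 have "Ph ((++.P1 k:{..Suc n}. (c [^] k) *:.P1 w k) i) g
 = Ph ((c [^] Suc n) *:.B w (Suc n) i +:.B ?S i) g"
 unfolding e using P1.PA_add[OF sc, of ?S i] Suc by (simp add: P1.PA_ops(6) del: nat_pow_Suc)
 also have "... = Ph (w (Suc n) i) g**c [^] Suc n +: (++k:{..n}. Ph (w k i) g**c [^] k)"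
 using c wki Si Suc v by (simp add: alg_hom_add[OF Ph] alg_hom_smult[OF Ph] T.T.L_add T.T.L_smult m_comm del: nat_pow_Suc)
 also have "... = (++k:{..Suc n}. Ph (w k i) g**c [^] k)"
 using v c by (intro finsum_Suc[symmetric]) auto
 finally show ?case unfolding e using sc Suc by simp
 qed
 thus ?thesis using uexp[OF c] by simp
 qed
 \<comment> \<open>t is normal, and automorphisms preserve normality.\<close>
 have unormal: "EX f:car P1. u c**.P1 x = f**.P1 u c" if c: "c :.K" "c ~= 0:" and x: "x :.P1" for c x
 proof -
 have ci: "inv c :.K" "c**inv c = 1:" using c by (auto simp: field_Units)
 let ?al = "ch \<circ> (P2.scale c \<circ> ps)"
 have al: "?al : alg_hom K P1 P1"
 by (rule alg_hom_comp[OF alg_hom_comp[OF psh P2.scale_hom[OF c(1)]] chh])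
 define x' where "x' = ch (P2.scale (inv c) (ps x))"
 have x': "x' :.P1" "?al x' = x"
 using P2.scale_closed[OF ci(1), of "ps x"] P2.scale_scale[OF c(1) ci(1), of "ps x"] P2.scale_one[of "ps x"] x ci by (simp_all add: x'_def)
 obtain f where f: "f :.P1" "t1 l**.P1 x' = f**.P1 t1 l" using t1_normal[OF l x'(1)] by blast
 have "?al (t1 l) = u c" by (simp add: u_def T_def)
 hence "u c**.P1 x = ?al f**.P1 u c"
 using arg_cong[OF f(2), of ?al] alg_hom_mult[OF al tc x'(1)] alg_hom_mult[OF al f(1) tc] x'(2) by simp
 thus ?thesis using alg_hom_closed[OF al f(1)] by blast
 qed
 \<comment> \<open>The coefficient of \<open>u c\<close> at a fixed place is a polynomial in
   \<open>c\<close> whose coefficients come from the \<open>w k\<close>. Only finitely many places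
   give a nonzero one, so one generic \<open>c\<close> keeps every exponent of every
   \<open>w k\<close> in the support of \<open>u c\<close>.\<close>
 define Dset where "Dset = (%(i, g). %k. Ph (w k i) g) ` (\<Union>k\<in>{..N}. SIGMA i:{i. w k i ~= 0:.B}. {g. Ph (w k i) g ~= 0:})"
 have "finite Dset" unfolding Dset_def
 using wc T.T.L_finite[OF Ph_closed[OF wki]] by (intro finite_imageI finite_UN_I finite_SigmaI) (auto simp: P1.PA_iff)
 moreover have "d k :.K" if "d : Dset" for d k
 using that T.T.L_value[OF Ph_closed[OF wki]] unfolding Dset_def by auto
 ultimately obtain c where c: "c :.K" "c ~= 0:"
 "!!d k. d : Dset ==> k <= N ==> d k ~= 0: ==> (++k:{..N}. d k**c [^] k) ~= 0:"
 using exists_generic[OF inf, of Dset N] by blast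
 have gen: "Ph (u c i) g ~= 0:" if k: "k <= N" "Ph (w k i) g ~= 0:" for k i g
 proof -
 have "w k i ~= 0:.B" using k(2) alg_hom_zero[OF Ph B.ring_axioms T.T.L.ring_axioms] by (auto simp: T.T.L_zero)
 hence "(%k. Ph (w k i) g) : Dset" unfolding Dset_def using k by (intro image_eqI[of _ _ "(i, g)"]) auto
 thus ?thesis using c(3)[of "%k. Ph (w k i) g" k] k ucoef[OF c(1)] by simp
 qed
 \<comment> \<open>At \<open>c\<close> equal to one the sum of the components is t itself, so its
   exponent occurs in some component.\<close>
 have "EX k<=N. Ph (w k 0) (tk l 1) ~= 0:"
 proof (rule ccontr)
 assume "~ ?thesis"
 hence "Ph (u 1: 0) (tk l 1) = (++k:{..N}. 0:)" unfolding ucoef[OF one_closed] by (intro finsum_cong') auto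
 hence "Ph (u 1: 0) (tk l 1) = 0:" by simp
 moreover have "u 1: = t1 l" using P2.scale_one[OF Tc] tc by (simp add: u_def T_def)
 ultimately have "Ph (tB l) (tk l 1) = 0:" using P1.mo_value[OF tB_closed[OF l], of 0 0] by simp
 thus False using Ph_tB[OF l] by (simp add: single_def)
 qed
 hence "Ph (u c 0) (tk l 1) ~= 0:" using gen by blast
 hence oku: "ok l (u c)" by (intro ok_self[OF l uc[OF c(1)] unormal[OF c(1,2)]])
 have okw: "ok l (w k)" if "k <= N" for k
 using oku gen[OF that] unfolding ok_def by blast
 obtain z where z: "z :.P1" "w N = t1 l**.P1 z" using ok_multiple[OF l wc okw[OF order_refl]] by blast
 have wN: "ps (w N) = P2.mo (T N) N" using Tk by (simp add: w_def)
 hence e: "P2.mo (T N) N = T**.P2 ps z" using alg_hom_mult[OF psh tc z(1)] z(2) by (simp add: T_def)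
 have TN: "T N ~= 0:.B'" unfolding N_def by (rule TD(1))
 have mn: "P2.mo (T N) N ~= 0:.P2" using P2.mo_nonzero[OF Tk TN] .
 have zn: "ps z ~= 0:.P2" using e mn Tc by auto
 have pz: "ps z :.P2" using z by simp
 \<comment> \<open>The top component is T times another element, and a factor of a homogeneous
   element of a graded domain is homogeneous: highest and lowest degrees of the two factors both add
   up to \<open>N\<close>.\<close>
 have "P2.dg T + P2.dg (ps z) = N" "P2.ld T + P2.ld (ps z) = N"
 using D2(2,3)[OF Tc Tn pz zn] P2.dg_ld_mo[OF Tk TN, of N] unfolding e[symmetric] by presburger+
 moreover have "P2.ld T <= P2.dg T" "P2.ld (ps z) <= P2.dg (ps z)"
 using P2.dg_ld[OF Tc Tn] P2.dg_ld[OF pz zn] by blast+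
 ultimately have "P2.dg T = P2.ld T" by linarith
 thus ?thesis using P2.homogeneous[OF Tc Tn] unfolding T_def by blast
qed

text \<open>Pulling back the homogeneous element v y^d gives t = v' Y with Y central, Y being the
  pullback of y^d. Then v' commutes like t, so v' = t z by \<open>ok_multiple\<close>. Cancelling t
  yields z Y = 1, so y^d is invertible and d = 0.\<close>

lemma ps_t_const:
 assumes l: "l < s" shows "ps (t1 l) : (%a. P2.mo a 0) ` car B'"
proof -
 have tc: "t1 l :.P1" using tB_closed[OF l] by simp
 define d where "d = P2.dg (ps (t1 l))"
 define v where "v = ps (t1 l) d"
 have vc: "v :.B'" unfolding v_def using P2.PA_value tc by simp
 have T: "ps (t1 l) = P2.mo v d" using ps_t_homogeneous[OF l] by (simp add: v_def d_def)
 define v' where "v' = ch (P2.mo v 0)"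
 define Yd where "Yd = ch (P2.mo 1:.B' d)"
 have c: "v' :.P1" "Yd :.P1" using vc by (auto simp: v'_def Yd_def)
 have "P2.mo v d = P2.mo v 0**.P2 P2.mo 1:.B' d" using vc by (simp add: P2.mo_mult)
 hence "ch (ps (t1 l)) = v'**.P1 Yd" unfolding T v'_def Yd_def using alg_hom_mult[OF chh] vc by simp
 hence tv: "t1 l = v'**.P1 Yd" using tc by simp
 have Ycen: "x**.P1 Yd = Yd**.P1 x" if x: "x :.P1" for x
 proof -
 have "ch (ps x**.P2 P2.mo 1:.B' d) = ch (P2.mo 1:.B' d**.P2 ps x)" using P2.y_central[of "ps x" d] x by simp
 thus ?thesis using x alg_hom_mult[OF chh] by (simp add: Yd_def)
 qed
 have Yn: "Yd ~= 0:.P1"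
 proof
 assume "Yd = 0:.P1"
 hence "P2.mo 1:.B' d = 0:.P2" using chps(2)[of "P2.mo 1:.B' d"] ps_zero by (simp add: Yd_def)
 thus False using P2.mo_nonzero[OF _ B'_one, of d] by simp
 qed
 have tn: "t1 l ~= 0:.P1" using P1.mo_nonzero[OF tB_closed[OF l] tB_nz[OF l]] .
 hence vn: "v' ~= 0:.P1" using tv c by auto
 have cancelY: "x = y" if "x :.P1" "y :.P1" "x**.P1 Yd = y**.P1 Yd" for x y
 proof -
 have "(x \<ominus>.P1 y)**.P1 Yd = 0:.P1"
 using that c by (simp add: a_minus_def P1.PA.l_distr P1.PA.l_minus P1.PA.r_neg)
 hence "x \<ominus>.P1 y = 0:.P1" using D1(1)[OF P1.PA.minus_closed[OF that(1,2)] _ c(2) Yn] by blast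
 thus ?thesis using P1.PA.r_right_minus_eq that by blast
 qed
 text \<open>\<open>v'\<close> commutes with \<open>t\<close> and \<open>x\<close> up to the same scalars as \<open>t\<close> does, because \<open>t = v' Y\<^sup>d\<close> with \<open>Y\<close> central.\<close>
 have tr: "v'**.P1 P1.mo s0 0 = (k *:.P1 P1.mo s0 0)**.P1 v'"
 if s0: "s0 :.B" and k: "k :.K" and e: "tB l**.B s0 = (k *:.B s0)**.B tB l" for s0 k
 proof (rule cancelY)
 let ?s = "P1.mo s0 0"
 have sc: "?s :.P1" using s0 by simp
 have ks: "k *:.P1 ?s = P1.mo (k *:.B s0) 0"
 by (rule ext) (use s0 k in \<open>simp add: P1.PA_ops(6) P1.mo_value B.smult_r_null\<close>)
 have ts: "t1 l**.P1 ?s = (k *:.P1 ?s)**.P1 t1 l"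
 unfolding ks using s0 k e tB_closed[OF l] by (simp add: P1.mo_mult)
 have "v'**.P1 ?s**.P1 Yd = v'**.P1 (Yd**.P1 ?s)" using c sc Ycen[OF sc] by (simp add: P1.PA.m_assoc)
 also have "... = t1 l**.P1 ?s" unfolding tv using c sc by (simp add: P1.PA.m_assoc)
 also have "... = (k *:.P1 ?s)**.P1 v'**.P1 Yd" unfolding ts unfolding tv using c sc k by (simp add: P1.PA.m_assoc)
 finally show "v'**.P1 ?s**.P1 Yd = (k *:.P1 ?s)**.P1 v'**.P1 Yd" .
 qed (use s0 k c in auto)
 have coeffs: "cc d g = k**cc g d" if s0: "s0 :.B" "Ph s0 = sg g 1:" and k: "k :.K"
 and e: "tB l**.B s0 = (k *:.B s0)**.B tB l" and nz: "Ph (v' i) d ~= 0:" for s0 g k i d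
 proof -
 have vi: "v' i :.B" using P1.PA_value[OF c(1)] .
 have ks: "k *:.P1 P1.mo s0 0 = P1.mo (k *:.B s0) 0"
 by (rule ext) (use s0 k in \<open>simp add: P1.PA_ops(6) P1.mo_value B.smult_r_null\<close>)
 have "v' i**.B s0 = (k *:.B s0)**.B v' i"
 using fun_cong[OF tr[OF s0(1) k e], of i] s0 k unfolding ks by (simp add: P1.const_mult[OF _ c(1)])
 hence "Ph (v' i)**.L sg g 1: = sg g k**.L Ph (v' i)"
 using arg_cong[of _ _ Ph] vi s0 k by (auto simp: alg_hom_mult[OF Ph] alg_hom_smult[OF Ph] smult_sg dest!: arg_cong[of _ _ Ph])
 from T.normal_coeff[OF Ph_closed[OF vi] k one_closed this nz] show ?thesis by simp
 qed
 have "ok l v'"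
 proof (rule okI[OF l])
 show "cc d (tk l 1) = 1:**cc (tk l 1) d" if "Ph (v' i) d ~= 0:" for i d
 by (rule coeffs[OF tB_closed[OF l] Ph_tB[OF l] one_closed _ that]) (use tB_closed[OF l] in simp)
 note m0 = cond(1)[OF l]
 have qi: "inv (q l 0) :.K" "inv (q l 0)**q l 0 = 1:" using q0[OF l] by (auto simp: field_Units)
 have "Ph (tB l**.B xB l) = Ph ((inv (q l 0) *:.B xB l)**.B tB l)"
 using tB_closed[OF l] xB_closed[OF l m0] qi cc_x_tk[OF l] q0[OF l]
 by (simp add: alg_hom_mult[OF Ph] alg_hom_smult[OF Ph] Ph_tB[OF l] Ph_xB[OF l m0] smult_sg T.sg_mult add.commute m_comm)
 hence e: "tB l**.B xB l = (inv (q l 0) *:.B xB l)**.B tB l"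
 using Ph_inj tB_closed[OF l] xB_closed[OF l m0] qi by simp
 show "cc d (xk l 0 1) = inv (q l 0)**cc (xk l 0 1) d" if "Ph (v' i) d ~= 0:" for i d
 by (rule coeffs[OF xB_closed[OF l m0] Ph_xB[OF l m0] qi(1) e that])
 show "1: = inv (q l 0)**q l 0" using qi by simp
 qed (use q0[OF l] in \<open>auto simp: field_Units\<close>)
 then obtain z where z: "z :.P1" "v' = t1 l**.P1 z" using ok_multiple[OF l c(1)] by blast
 have zn: "z ~= 0:.P1" using z vn tc by auto
 have zY: "z**.P1 Yd :.P1" using z c by simp
 have "t1 l**.P1 (z**.P1 Yd \<ominus>.P1 1:.P1) = v'**.P1 Yd \<ominus>.P1 t1 l"
 using z(1) c tc unfolding z(2) by (simp add: a_minus_def P1.PA.r_distr P1.PA.r_minus P1.PA.m_assoc)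
 also have "... = 0:.P1" using tv tc by (simp add: a_minus_def P1.PA.r_neg)
 finally have "z**.P1 Yd \<ominus>.P1 1:.P1 = 0:.P1"
 using D1(1)[OF tc tn P1.PA.minus_closed[OF zY P1.PA.one_closed]] by blast
 hence "z**.P1 Yd = 1:.P1" using P1.PA.r_right_minus_eq[OF zY P1.PA.one_closed] by simp
 hence e: "ps z**.P2 P2.mo 1:.B' d = 1:.P2"
 using alg_hom_mult[OF psh z(1) c(2)] alg_hom_one[OF psh] by (simp add: Yd_def)
 have o: "1:.P2 = P2.mo 1:.B' 0" by (auto simp: fun_eq_iff P2.PA_one P2.mo_value)
 have on: "1:.P2 ~= 0:.P2" unfolding o using P2.mo_nonzero[OF _ B'_one] by simp
 have pz: "ps z :.P2" using z by simp
 have pzn: "ps z ~= 0:.P2" using e on by auto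
 have "P2.dg (ps z) + d = 0"
 using D2(2)[OF pz pzn P2.mo_closed[OF B'.one_closed] P2.mo_nonzero[OF B'.one_closed B'_one], of d]
 P2.dg_ld_mo[OF B'.one_closed B'_one] e o by force
 thus ?thesis using T vc by simp
qed

section \<open>The isomorphism matches constants with constants\<close>

abbreviation CC where "CC == (%a. P2.mo a 0) ` car B'"

lemma CC_iff: "p :.P2 ==> p ~= 0:.P2 ==> p : CC \<longleftrightarrow> P2.dg p = 0"
proof
 assume p: "p :.P2" "p ~= 0:.P2"
 show "P2.dg p = 0" if "p : CC"
 proof -
 from that obtain a where a: "p = P2.mo a 0" "a :.B'" by (rule imageE)
 have "a ~= 0:.B'"
 proof
 assume "a = 0:.B'"
 hence "p = 0:.P2" using a by (auto simp: fun_eq_iff P2.mo_value P2.PA_zero)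
 thus False using p by simp
 qed
 thus ?thesis using P2.dg_ld_mo[OF a(2), of 0] a(1) by blast
 qed
 show "p : CC" if "P2.dg p = 0"
 proof -
 have "P2.ld p = 0" using P2.ld_le_dg[OF p] that by simp
 hence "p = P2.mo (p (P2.dg p)) (P2.dg p)" using P2.homogeneous[OF p] that by argo
 hence "p = P2.mo (p 0) 0" unfolding that .
 thus ?thesis using P2.PA_value[OF p(1)] by blast
 qed
qed

lemma CC_ops:
 "x : CC ==> y : CC ==> x**.P2 y : CC" "x : CC ==> y : CC ==> x +:.P2 y : CC"
 "k :.K ==> x : CC ==> k *:.P2 x : CC" "1:.P2 : CC" "0:.P2 : CC" "x : CC ==> x :.P2"
proof -
 show "x**.P2 y : CC" if "x : CC" "y : CC" using that by (auto simp: P2.mo_mult)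
 show "x +:.P2 y : CC" if xy: "x : CC" "y : CC"
 proof -
 obtain a a' where a: "a :.B'" "x = P2.mo a 0" "a' :.B'" "y = P2.mo a' 0" using xy by blast
 have "(x +:.P2 y) n = P2.mo (a +:.B' a') 0 n" for n
 using P2.PA_add[of x y n] P2.mo_value[OF a(1), of 0 n] P2.mo_value[OF a(3), of 0 n] P2.mo_value[of "a +:.B' a'" 0 n] a by simp
 hence "x +:.P2 y = P2.mo (a +:.B' a') 0" by blast
 thus ?thesis using a by blast
 qed
 show "k *:.P2 x : CC" if kx: "k :.K" "x : CC"
 proof -
 obtain a where a: "a :.B'" "x = P2.mo a 0" using kx by blast
 have "k *:.P2 x = P2.mo (k *:.B' a) 0"
 by (rule ext) (use a kx in \<open>simp add: P2.PA_ops(6) P2.mo_value B'.smult_r_null\<close>)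
 thus ?thesis using a kx by blast
 qed
 have "1:.P2 = P2.mo 1:.B' 0" by (auto simp: fun_eq_iff P2.PA_one P2.mo_value)
 thus "1:.P2 : CC" by blast
 have "0:.P2 = P2.mo 0:.B' 0" by (auto simp: fun_eq_iff P2.PA_zero P2.mo_value)
 thus "0:.P2 : CC" by blast
 show "x : CC ==> x :.P2" by auto
qed

definition io where "io a = ps (P1.mo a 0)"

lemma io: "a :.B ==> io a :.P2" "io : alg_hom K B P2"
 "a :.B ==> a ~= 0:.B ==> io a ~= 0:.P2"
proof -
 show c: "a :.B ==> io a :.P2" for a by (simp add: io_def)
 have "(%a. P1.mo a 0) : alg_hom K B P1"
 proof -
 have ad: "P1.mo (a +:.B a') 0 = P1.mo a 0 +:.P1 P1.mo a' 0" if a: "a :.B" "a' :.B" for a a'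
 proof
 fix n
 show "P1.mo (a +:.B a') 0 n = (P1.mo a 0 +:.P1 P1.mo a' 0) n"
 using P1.PA_add[of "P1.mo a 0" "P1.mo a' 0" n] P1.mo_value[OF a(1), of 0 n] P1.mo_value[OF a(2), of 0 n] P1.mo_value[of "a +:.B a'" 0 n] a by simp
 qed
 have sm: "P1.mo (k *:.B a) 0 = k *:.P1 P1.mo a 0" if "k :.K" "a :.B" for k a
 by (rule ext) (use that in \<open>simp add: P1.PA_ops(6) P1.mo_value B.smult_r_null\<close>)
 have on: "P1.mo 1:.B 0 = 1:.P1" by (auto simp: fun_eq_iff P1.PA_one P1.mo_value)
 show ?thesis unfolding alg_hom_def ring_hom_def using ad sm on by (simp add: P1.mo_mult)
 qed
 from alg_hom_comp[OF this psh] show "io : alg_hom K B P2" by (simp add: io_def[abs_def] comp_def)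
 show "io a ~= 0:.P2" if "a :.B" "a ~= 0:.B"
 using P1.mo_nonzero[OF that, of 0] chps(1)[of "P1.mo a 0"] ps_zero that unfolding io_def by (metis P1.mo_closed)
qed

lemma io_span: assumes "!!x. x : S ==> io x : CC" "S <= car B" "x : lspan K B S" shows "io x : CC"
 using assms(3)
proof (induction rule: lspan.induct)
 case zero
 thus ?case using alg_hom_zero[OF io(2) B.ring_axioms P2.PA.ring_axioms] CC_ops(5) by simp
next
 case (step k y x)
 have "y :.B" "x :.B" using step assms lspan_closed[OF B] by blast+
 thus ?case using step assms(1) CC_ops by (simp add: alg_hom_add[OF io(2)] alg_hom_smult[OF io(2)])
qed

text \<open>Products of the t have constant images by \<open>ps_t_const\<close>. Any other monomial
  divides a nonzero polynomial in the t, and since degrees add, a factor of an element of degree 0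
  has degree 0.\<close>

lemma io_CC: assumes "x :.B" shows "io x : CC"
proof -
 have poly: "io (b r) : CC" if "r : R" "ALL l i. lkx r l i = 0" for r
 proof -
 have "ALL r. r : R --> (ALL l i. lkx r l i = 0) --> (\<Sum>l<s. nat (lkt r l)) = n --> io (b r) : CC" for n
 proof (induction n rule: less_induct)
 case (less n)
 show ?case
 proof (intro allI impI)
 fix r assume r: "r : R" "ALL l i. lkx r l i = 0" "(\<Sum>l<s. nat (lkt r l)) = n"
 show "io (b r) : CC"
 proof (cases "EX l<s. 1 <= lkt r l")
 case True
 then obtain l where l: "l < s" "1 <= lkt r l" by blast
 let ?r = "r - tk l 1"
 have r': "?r : R" using R_minus_tk r l by blast
 have x: "ALL l i. lkx ?r l i = 0" using r by (simp add: lk)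
 have "(\<Sum>l<s. nat (lkt ?r l)) < (\<Sum>l<s. nat (lkt r l))"
 by (rule sum_strict_mono_ex1) (use l in \<open>auto simp: lk intro!: bexI[of _ l]\<close>)
 hence "io (b ?r) : CC" using less r' x r(3) by blast
 moreover have "io (tB l) : CC" unfolding io_def by (rule ps_t_const[OF l(1)])
 ultimately show ?thesis
 unfolding b_tB[OF l(1) r(1) l(2)] alg_hom_mult[OF io(2) tB_closed[OF l(1)] b_closed[OF r']] by (intro CC_ops(1))
 next
 case False
 have "r = 0"
 proof (rule expo_eqI)
 show "lkt r l = lkt 0 l" for l using False R_ge[OF r(1), of l] R_lkt[OF r(1), of l] by (force simp: lk)
 qed (use r in \<open>simp add: lk\<close>)
 thus ?thesis using b_zero alg_hom_one[OF io(2)] CC_ops(4) by simp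
 qed
 qed
 qed
 thus ?thesis using that by blast
 qed
 have br: "io (b r) : CC" if r: "r : R" for r
 proof -
 obtain r' where r': "r' : R" "b r**.B b r' : lspan K B (b ` {r : R. ALL l i. lkx r l i = 0})" "b r**.B b r' ~= 0:.B"
 using b_divides_polynomial[OF r] by blast
 have c: "b r :.B" "b r' :.B" using r r' b_closed by auto
 have nz: "b r ~= 0:.B" "b r' ~= 0:.B" using r'(3) c by auto
 have "io (b r**.B b r') : CC" by (rule io_span[OF _ _ r'(2)]) (use poly b_closed in auto)
 hence "P2.dg (io (b r)**.P2 io (b r')) = 0"
 using CC_iff[of "io (b r**.B b r')"] io(1)[OF B.m_closed[OF c]] io(3)[OF B.m_closed[OF c] r'(3)]
 alg_hom_mult[OF io(2) c] by metis
 hence "P2.dg (io (b r)) = 0" using D2(2)[OF io(1)[OF c(1)] io(3)[OF c(1) nz(1)] io(1)[OF c(2)] io(3)[OF c(2) nz(2)]] by simp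
 thus ?thesis using CC_iff io c nz by blast
 qed
 show ?thesis by (rule io_span[OF _ b_img b_span[OF assms]]) (use br in blast)
qed

text \<open>Every element of the second polynomial ring is a polynomial in \<open>Y\<close>, the
  image of the variable, with constant coefficients by \<open>io_CC\<close>. Once \<open>Y\<close>
  has positive degree, a term of positive order in \<open>Y\<close> raises the degree, so a constant
  needs only the term of order 0.\<close>

lemma CC_io: assumes a: "a :.B'" shows "EX x:car B. io x = P2.mo a 0"
proof -
 define Y where "Y = ps (P1.mo 1:.B 1)"
 have Yc: "Y :.P2" by (simp add: Y_def)
 have expd: "ps p = (++.P2 n:{..N}. io (p n)**.P2 Y [^].P2 n)" if p: "p :.P1" and N: "!!n. p n ~= 0:.B ==> n <= N" for p N
 proof -
 have pn: "p n :.B" for n using P1.PA_value[OF p] .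
 have my: "ps (P1.mo 1:.B n) = Y [^].P2 n" for n
 proof (induction n)
 case 0
 have "P1.mo 1:.B 0 = 1:.P1" by (auto simp: fun_eq_iff P1.PA_one P1.mo_value)
 thus ?case using alg_hom_one[OF psh] by simp
 next
 case (Suc n)
 have "P1.mo 1:.B (Suc n) = P1.mo 1:.B n**.P1 P1.mo 1:.B 1" by (simp add: P1.mo_mult)
 thus ?case using Suc alg_hom_mult[OF psh] by (simp add: Y_def)
 qed
 have "ps p = (++.P2 n:{..N}. ps (P1.mo (p n) n))"
 by (subst P1.PA_expand[OF p N]) (auto intro!: alg_hom_finsum[OF psh P1.PA_algebra P2.PA_algebra] simp: pn)
 also have "... = (++.P2 n:{..N}. io (p n)**.P2 Y [^].P2 n)"
 proof (rule P2.PA.finsum_cong')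
 fix n
 have "P1.mo (p n) n = P1.mo (p n) 0**.P1 P1.mo 1:.B n" using pn by (simp add: P1.mo_mult)
 thus "ps (P1.mo (p n) n) = io (p n)**.P2 Y [^].P2 n" using alg_hom_mult[OF psh] pn my by (simp add: io_def)
 qed (use io(1)[OF pn] Yc in auto)
 finally show ?thesis .
 qed
 have Yn: "Y ~= 0:.P2"
 using P1.mo_nonzero[OF _ B_nontrivial, of 1] chps(1)[of "P1.mo 1:.B 1"] ps_zero unfolding Y_def by (metis P1.mo_closed B.one_closed)
 have pn: "Y [^].P2 n ~= 0:.P2 & P2.dg (Y [^].P2 n) = n * P2.dg Y" for n :: nat
 proof (induction n)
 case 0
 have o: "1:.P2 = P2.mo 1:.B' 0" by (auto simp: fun_eq_iff P2.PA_one P2.mo_value)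
 show ?case using P2.mo_nonzero[OF _ B'_one, of 0] P2.dg_ld_mo[OF _ B'_one, of 0] by (simp add: o)
 next
 case (Suc n)
 thus ?case using D2(1,2)[OF P2.PA.nat_pow_closed[OF Yc] _ Yc Yn, of n] by simp
 qed
 have fs: "(++.P2 n:{..k}. io (p n)**.P2 Y [^].P2 n) :.P2 &
 (ALL j. k * P2.dg Y < j --> (++.P2 n:{..k}. io (p n)**.P2 Y [^].P2 n) j = 0:.B')" if p: "p :.P1" for p k
 proof (induction k)
 case 0
 obtain a0 where a0: "a0 :.B'" "io (p 0) = P2.mo a0 0" using io_CC P1.PA_value[OF p] by blast
 have "io (p 0) :.P2" unfolding a0(2) using a0(1) by (rule P2.mo_closed)
 moreover have "io (p 0) j = 0:.B'" if "0 < j" for j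
 using P2.mo_value[OF a0(1), of 0 j] that unfolding a0(2) by simp
 ultimately show ?case by simp
 next
 case (Suc k)
 have tc: "io (p n)**.P2 Y [^].P2 n :.P2" for n using io(1) P1.PA_value[OF p] Yc by simp
 obtain a0 where a0: "a0 :.B'" "io (p (Suc k)) = P2.mo a0 0" using io_CC P1.PA_value[OF p] by blast
 have e: "(++.P2 n:{..Suc k}. io (p n)**.P2 Y [^].P2 n)
 = io (p (Suc k))**.P2 Y [^].P2 Suc k +:.P2 (++.P2 n:{..k}. io (p n)**.P2 Y [^].P2 n)"
 using tc by (intro P2.PA.finsum_Suc) auto
 have z: "(io (p (Suc k))**.P2 Y [^].P2 Suc k) j = 0:.B'" if "Suc k * P2.dg Y < j" for j
 proof -
 have Yk: "Y [^].P2 Suc k :.P2" using P2.PA.nat_pow_closed[OF Yc] .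
 have "(Y [^].P2 Suc k) j = 0:.B'"
 proof (rule ccontr)
 assume "(Y [^].P2 Suc k) j ~= 0:.B'"
 hence "j <= P2.dg (Y [^].P2 Suc k)" using P2.dg_ld(3)[OF Yk] pn[of "Suc k"] by blast
 thus False using pn[of "Suc k"] that by linarith
 qed
 thus ?thesis using P2.const_mult(1)[OF a0(1) Yk, of j] a0 by simp
 qed
 show ?case unfolding e
 proof (intro conjI allI impI)
 show "io (p (Suc k))**.P2 Y [^].P2 Suc k +:.P2 (++.P2 n:{..k}. io (p n)**.P2 Y [^].P2 n) :.P2"
 using tc[of "Suc k"] Suc by blast
 fix j assume "Suc k * P2.dg Y < j"
 thus "(io (p (Suc k))**.P2 Y [^].P2 Suc k +:.P2 (++.P2 n:{..k}. io (p n)**.P2 Y [^].P2 n)) j = 0:.B'"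
 using P2.PA_add[OF tc[of "Suc k"], of "++.P2 n:{..k}. io (p n)**.P2 Y [^].P2 n" j] z[of j] Suc by simp
 qed
 qed
 \<comment> \<open>If \<open>Y\<close> had degree 0, all images would have degree 0, but the
   variable of the second ring is an image.\<close>
 have Yd: "0 < P2.dg Y"
 proof (rule ccontr)
 assume d: "~ 0 < P2.dg Y"
 let ?y = "P2.mo 1:.B' 1"
 have yc: "ch ?y :.P1" by simp
 obtain N where N: "!!n. ch ?y n ~= 0:.B ==> n <= N"
 using yc finite_nat_set_iff_bounded_le[of "{n. ch ?y n ~= 0:.B}"] unfolding P1.PA_iff by auto
 have "?y = (++.P2 n:{..N}. io (ch ?y n)**.P2 Y [^].P2 n)" using expd[OF yc N] by simp
 hence "?y 1 = 0:.B'" using fs[OF yc, of N] d by auto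
 thus False using B'_one by (simp add: P2.mo_value)
 qed
 let ?p = "ch (P2.mo a 0)"
 have pc: "?p :.P1" using a by simp
 have pk: "?p n :.B" for n using P1.PA_value[OF pc] .
 have top: "?p k = 0:.B" if k: "0 < k" for k
 proof (rule ccontr)
 assume "?p k ~= 0:.B"
 hence pn0: "?p ~= 0:.P1" using P1.PA_zero by metis
 define N where "N = P1.dg ?p"
 have N: "?p N ~= 0:.B" "!!n. ?p n ~= 0:.B ==> n <= N" using P1.dg_ld[OF pc pn0] unfolding N_def by blast+
 have "k <= N" using N(2) \<open>?p k \<noteq> \<zero>\<^bsub>B\<^esub>\<close> by blast
 then obtain M where M: "N = Suc M" using k by (cases N) auto
 let ?g = "%n. io (?p n)**.P2 Y [^].P2 n"
 have gc: "?g n :.P2" for n using io(1)[OF pk] Yc by simp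
 have "P2.mo a 0 = (++.P2 n:{..N}. ?g n)" using expd[OF pc N(2)] a by simp
 also have "... = ?g N +:.P2 (++.P2 n:{..M}. ?g n)" unfolding M using gc by (intro P2.PA.finsum_Suc) auto
 finally have e: "P2.mo a 0 = ?g N +:.P2 (++.P2 n:{..M}. ?g n)" .
 have gn: "?g N ~= 0:.P2" "P2.dg (?g N) = N * P2.dg Y"
 proof -
 have YN: "Y [^].P2 N :.P2" "Y [^].P2 N ~= 0:.P2" using pn Yc by auto
 have iN: "io (?p N) :.P2" "io (?p N) ~= 0:.P2" "P2.dg (io (?p N)) = 0"
 using io(1,3)[OF pk] N(1) io_CC[OF pk] CC_iff by blast+
 show "?g N ~= 0:.P2" "P2.dg (?g N) = N * P2.dg Y"
 using D2(1,2)[OF iN(1,2) YN] iN(3) pn[of N] by auto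
 qed
 let ?j = "N * P2.dg Y"
 have "?g N ?j ~= 0:.B'" using P2.dg_ld(1)[OF gc gn(1)] unfolding gn(2) .
 moreover have "(++.P2 n:{..M}. ?g n) ?j = 0:.B'" using fs[OF pc, of M] M Yd by simp
 moreover have "P2.mo a 0 ?j = 0:.B'" using M Yd a by (simp add: P2.mo_value)
 ultimately show False using P2.PA_add[OF gc[of N], of "++.P2 n:{..M}. ?g n" ?j] fs[OF pc, of M] e P2.PA_value[OF gc[of N], of ?j] by simp
 qed
 have "?p = P1.mo (?p 0) 0" using top pk by (auto simp: fun_eq_iff P1.mo_value)
 hence "io (?p 0) = P2.mo a 0" unfolding io_def using a by (metis chps(2) P2.mo_closed)
 thus ?thesis using pk by blast
qed

text \<open>By \<open>io_CC\<close> and \<open>CC_io\<close> the given isomorphism restricts to a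
  bijection between the constants; taking the coefficient of order 0 identifies those with the two
  algebras.\<close>

lemma base_isomorphic: "alg_isomorphic K B B'"
proof -
 have i0: "io x = P2.mo (io x 0) 0" if "x :.B" for x
 using io_CC[OF that] by (auto simp: P2.mo_value)
 have c: "io x 0 :.B'" if "x :.B" for x using P2.PA_value[OF io(1)[OF that]] .
 let ?f = "%x. io x 0"
 have "?f : alg_hom K B B'"
 proof -
 have m: "io (x**.B y) 0 = io x 0**.B' io y 0" if xy: "x :.B" "y :.B" for x y
 using alg_hom_mult[OF io(2) xy] i0[OF xy(1)] P2.const_mult(1)[OF c[OF xy(1)] io(1)[OF xy(2)], of 0] by simp
 show ?thesis unfolding alg_hom_def ring_hom_def
 using c m io(1) by (simp add: alg_hom_add[OF io(2)] alg_hom_smult[OF io(2)] alg_hom_one[OF io(2)] P2.PA_add P2.PA_ops(6) P2.PA_one)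
 qed
 moreover have "bij_betw ?f (car B) (car B')"
 proof (rule bij_betwI')
 fix x y assume xy: "x :.B" "y :.B"
 show "(io x 0 = io y 0) = (x = y)"
 proof
 assume "io x 0 = io y 0"
 hence "io x = io y" using i0 xy by metis
 hence "P1.mo x 0 = P1.mo y 0" unfolding io_def using chps(1) xy by (metis P1.mo_closed)
 thus "x = y" using P1.mo_value[OF xy(1), of 0 0] P1.mo_value[OF xy(2), of 0 0] by metis
 qed simp
 next
 fix a assume a: "a :.B'"
 obtain x where "x :.B" "io x = P2.mo a 0" using CC_io[OF a] by blast
 thus "EX x:car B. a = io x 0" using a by (intro bexI[of _ x]) (auto simp: P2.mo_value)
 qed (use c in blast)
 ultimately have "?f : alg_iso K B B'" by (rule alg_isoI)
 thus ?thesis unfolding alg_isomorphic_def by blast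
qed

end

section \<open>Orders of the automorphisms and cancellation\<close>

context qgwa
begin

text \<open>The n-th power of the automorphism multiplies the k-th coefficient by (q_i^n)^k. It is
  the identity precisely when q_i^n = 1, as the coefficient of t shows.\<close>

lemma aut_order_eq: assumes i: "i < m" shows "aut_order K P (\<sigma> i) = group.ord (units_of K) (q i)"
proof -
 interpret U0: group "units_of K" by (rule units_group)
 note F = alg_aut_group_facts[OF P.assoc_algebra_axioms]
 interpret G: group "alg_aut_group K P" by (rule F(1))
 have qU: "q i :.(units_of K)" using q_props(4)[OF i] by (simp add: units_of_def)
 have qn: "q i [^].(units_of K) (n::nat) = q i [^] n" for n using q_props(4)[OF i] by (simp add: units_of_pow)
 have p: "(\<sigma> i [^].(alg_aut_group K P) (n::nat)) p k = (q i [^] n) [^] k**p k" if "p :.P" for p k n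
 using that
 proof (induction n arbitrary: p)
 case 0
 thus ?case using UP_value[OF 0, of k] by (simp add: F(4) nat_pow_one)
 next
 case (Suc n)
 have pk: "p k :.K" using UP_value[OF Suc.prems] .
 have "(\<sigma> i [^].(alg_aut_group K P) (Suc n)) p = (\<sigma> i [^].(alg_aut_group K P) n) (\<sigma> i p)"
 using F(3)[OF G.nat_pow_closed[OF \<sigma>_aut[OF i]] \<sigma>_aut[OF i]] Suc.prems by (simp add: compose_def)
 hence "(\<sigma> i [^].(alg_aut_group K P) (Suc n)) p k = (q i [^] n) [^] k**(q i [^] k**p k)"
 unfolding \<sigma>_coeff[OF i Suc.prems, symmetric] using Suc.IH[OF \<sigma>_closed[OF i Suc.prems]] by simp
 also have "... = ((q i [^] n) [^] k**q i [^] k)**p k"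
 using q_props(1)[OF i] pk by (simp only: m_assoc nat_pow_closed)
 also have "(q i [^] n) [^] k**q i [^] k = (q i [^] Suc n) [^] k"
 using q_props(1)[OF i] by (simp add: nat_pow_distrib)
 finally show ?case .
 qed
 have "(\<sigma> i [^].(alg_aut_group K P) (n::nat) = 1:.(alg_aut_group K P)) = (q i [^] n = 1:)" for n
 proof
 assume e: "\<sigma> i [^].(alg_aut_group K P) n = 1:.(alg_aut_group K P)"
 have "(\<sigma> i [^].(alg_aut_group K P) n) (tp 1) 1 = tp 1 1" unfolding e by (simp only: F(4) restrict_apply' tp_closed)
 moreover have "tp 1 1 = 1:" using UP_monom_value[of \<one> K 1 1] by simp
 ultimately show "q i [^] n = 1:" using p[of "tp 1" n 1] q_props(1)[OF i] by simp
 next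
 assume e: "q i [^] n = 1:"
 have c: "\<sigma> i [^].(alg_aut_group K P) n : extensional (car P)"
 using G.nat_pow_closed[OF \<sigma>_aut[OF i], of n] unfolding F(2) by (auto simp: Bij_def)
 show "\<sigma> i [^].(alg_aut_group K P) n = 1:.(alg_aut_group K P)"
 unfolding F(4)
 proof (rule extensionalityI[OF c])
 fix x assume x: "x :.P"
 have "(\<sigma> i [^].(alg_aut_group K P) n) x = x"
 using p[OF x, of n] UP_value[OF x] by (simp add: fun_eq_iff e)
 thus "(\<sigma> i [^].(alg_aut_group K P) n) x = (\<lambda>x\<in>car P. x) x" using x by simp
 qed simp
 qed
 hence "ALL n::nat. (\<sigma> i [^].(alg_aut_group K P) n = 1:.(alg_aut_group K P)) = (U0.ord (q i) dvd n)"
 using U0.pow_eq_id[OF qU] by (simp add: qn units_of_one)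
 thus ?thesis using G.ord_unique[OF \<sigma>_aut[OF i], of "U0.ord (q i)"] by simp
qed

lemma ord_ge_2: assumes i: "i < m" and r: "root_of_unity K (q i)" shows "2 <= group.ord (units_of K) (q i)"
proof -
 interpret U0: group "units_of K" by (rule units_group)
 have qU: "q i :.(units_of K)" using q_props(4)[OF i] by (simp add: units_of_def)
 have qn: "q i [^].(units_of K) (n::nat) = q i [^] n" for n using q_props(4)[OF i] by (simp add: units_of_pow)
 obtain n :: nat where "0 < n" "q i [^] n = 1:" using r by (auto simp: root_of_unity_def)
 hence "U0.ord (q i) ~= 0" using U0.pow_eq_id[OF qU, of n] by (auto simp: qn units_of_one)
 moreover have "U0.ord (q i) ~= 1" using U0.pow_eq_id[OF qU, of 1] q_props(1,3)[OF i] unfolding qn units_of_one by auto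
 ultimately show ?thesis by simp
qed

end

lemma (in field) infinite_carrier_of_char_zero:
 assumes "char_zero R" shows "infinite (car R)"
proof
 assume f: "finite (car R)"
 have "inj (%n::nat. add_pow R n 1:)"
 proof (rule linorder_injI)
 fix a b :: nat assume ab: "a < b"
 show "add_pow R a 1: ~= add_pow R b 1:"
 proof
 assume e: "add_pow R a 1: = add_pow R b 1:"
 have "add_pow R b 1: = add_pow R a 1: +: add_pow R (b - a) 1:" using ab add.nat_pow_mult[of \<one> a "b - a"] by simp
 hence "add_pow R (b - a) 1: = 0:" using e add.nat_pow_closed[of \<one> a] add.nat_pow_closed[of \<one> "b - a"] add.r_cancel_one'[of "add_pow R a 1:" "add_pow R (b - a) 1:"] by simp
 thus False using assms ab using zero_less_diff unfolding char_zero_def by blast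
 qed
 qed
 hence "infinite (range (%n::nat. add_pow R n 1:))" by (rule range_inj_infinite)
 moreover have "range (%n::nat. add_pow R n 1:) <= car R" using add.nat_pow_closed[of \<one>] by auto
 ultimately show False using f finite_subset by blast
qed

lemma (in weyl_family) tensor_cancellative:
 assumes "char_zero K" "!!l. l < s ==> 0 < m l" "!!l. l < s ==> 2 <= nn l 0"
 "!!l i. l < s ==> 0 < i ==> i < m l ==> coprime (nn l 0) (nn l i)"
 shows "cancellative TYPE('b) K (tensor_family K {..<s} A)"
 unfolding cancellative_def
proof (intro allI impI)
 fix B :: "('k, 'b) module"
 assume B: "assoc_algebra K B" and iso: "alg_isomorphic K (poly_algebra (tensor_family K {..<s} A)) (poly_algebra B)"
 obtain ps where "ps : alg_iso K (poly_algebra (tensor_family K {..<s} A)) (poly_algebra B)"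
 using iso unfolding alg_isomorphic_def by blast
 then interpret cancel K s m q \<sigma> h "tensor_family K {..<s} A" Pht tens "%l. slot l (cfl l (tp 1))" "%l. slot l (xgl l 0)" B ps
 using assms infinite_carrier_of_char_zero
 by (intro cancel.intro tensor_low_basis B cancel_axioms.intro) auto
 show "alg_isomorphic K (tensor_family K {..<s} A) B" by (rule base_isomorphic)
qed

lemma quantum_tensor_cancellative:
 fixes K :: "('k, 'e) ring_scheme" and s :: nat
 assumes K: "field K" and c: "char_zero K" and factors: "!!l. l < s ==> coprime_quantum_gwa_data K (m l) (q l) (\<sigma> l) (h l) |
 (m l = 1 & quantum_gwa_data K (m l) (q l) (\<sigma> l) (h l) & root_of_unity K (q l 0))"
 shows "cancellative TYPE('b) K (tensor_family K {..<s} (%l. gwa K (UP K) (m l) (\<sigma> l) (h l)))"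
proof -
 have qd: "quantum_gwa_data K (m l) (q l) (\<sigma> l) (h l)" if "l < s" for l
 using factors[OF that] by (auto simp: coprime_quantum_gwa_data_def)
 interpret weyl_family K s m q \<sigma> h by (intro weyl_family.intro weyl_family_axioms.intro K qd)
 show ?thesis
 proof (rule tensor_cancellative[OF c])
 show m0: "0 < m l" if "l < s" for l using factors[OF that] by (auto simp: coprime_quantum_gwa_data_def)
 show "2 <= nn l 0" if "l < s" for l
 unfolding nn_def using qgwa.ord_ge_2[OF qgwa[OF that] m0[OF that]] factors[OF that] m0[OF that]
 by (auto simp: coprime_quantum_gwa_data_def)
 show "coprime (nn l 0) (nn l i)" if "l < s" "0 < i" "i < m l" for l i
 using factors[OF that(1)] that qgwa.aut_order_eq[OF qgwa[OF that(1)]] m0[OF that(1)] unfolding nn_def coprime_quantum_gwa_data_def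
 by force
 qed
qed

section \<open>Central fractions\<close>

text \<open>Fractions of a possibly noncommutative ring with central regular denominators. The
  construction serves twice: for the center it is \<open>fraction_ring\<close>, and for the whole
  algebra with denominators in the center it is a concrete model to which the tensor product with
  the fraction field is mapped.\<close>

definition cfrac :: "('a, 'x) ring_scheme => 'a set => 'a => 'a => ('a \<times> 'a) set"
 where "cfrac W S a b = {(c, d). c :.W & d : S & a**.W d = c**.W b}"

definition cfrac_ring :: "('a, 'x) ring_scheme => 'a set => ('a \<times> 'a) set ring"
 where "cfrac_ring W S =
 \<lparr>carrier = {cfrac W S a b | a b. a :.W & b : S},
 monoid.mult = (%P Q. \<Union>(a, b)\<in>P. \<Union>(c, d)\<in>Q. cfrac W S (a**.W c) (b**.W d)),
 one = cfrac W S 1:.W 1:.W, ring.zero = cfrac W S 0:.W 1:.W,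
 add = (%P Q. \<Union>(a, b)\<in>P. \<Union>(c, d)\<in>Q. cfrac W S (a**.W d +:.W c**.W b) (b**.W d))\<rparr>"

lemma fraction_ring_eq: "fraction_ring Z = cfrac_ring Z (car Z - {0:.Z})"
 and fraction_eq: "fraction Z = cfrac Z (car Z - {0:.Z})"
 by (auto simp: fraction_ring_def cfrac_ring_def fraction_def cfrac_def fun_eq_iff)

locale central_fractions = W?: ring W for W :: "('a, 'x) ring_scheme" (structure) +
 fixes S
 assumes S_sub: "S <= car W" and S_one: "1: : S" and S_mult: "b : S ==> d : S ==> b**d : S"
 and S_central: "b : S ==> x :.W ==> b**x = x**b"
 and S_regular: "b : S ==> x :.W ==> b**x = 0: ==> x = 0:"
begin

abbreviation fr where "fr == cfrac W S"
abbreviation Q where "Q == cfrac_ring W S"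

lemma S_car [simp]: "b : S ==> b :.W" using S_sub by blast

lemma S_left: "x :.W ==> b : S ==> x**b = b**x"
 "x :.W ==> b : S ==> y :.W ==> x**(b**y) = b**(x**y)"
 using S_central S_car by (metis, metis W.m_assoc)

lemma S_cancel: assumes "b : S" "x :.W" "y :.W" "x**b = y**b" shows "x = y"
proof -
 have "b**(x \<ominus> y) = b**x \<ominus> b**y" using assms by (simp add: a_minus_def r_distr r_minus)
 also have "... = 0:" using assms S_central[of b] by simp
 finally show ?thesis using S_regular[OF assms(1), of "x \<ominus> y"] assms by simp
qed

lemma fr_eq_iff:
 assumes "x :.W" "y :.W" "b : S" "d : S"
 shows "fr x b = fr y d \<longleftrightarrow> x**d = y**b"
proof
 assume e: "fr x b = fr y d"
 have "(y, d) : fr y d" using assms by (simp add: cfrac_def)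
 thus "x**d = y**b" unfolding e[symmetric] by (simp add: cfrac_def)
next
 have "fr x b <= fr y d" if a: "x :.W" "y :.W" "b : S" "d : S" and e: "x**d = y**b" for x y b d
 proof (clarify)
 fix z g assume "(z, g) : fr x b"
 hence z: "z :.W" "g : S" "x**g = z**b" by (auto simp: cfrac_def)
 have "(y**g)**b = (y**b)**g" using a z by (simp add: m_assoc S_left)
 also have "... = (x**g)**d" unfolding e[symmetric] using a z by (simp add: m_assoc S_left)
 also have "... = (z**d)**b" unfolding z(3) using a z by (simp add: m_assoc S_left)
 finally have "y**g = z**d" using S_cancel[OF a(3)] a z by simp
 thus "(z, g) : fr y d" using z by (simp add: cfrac_def)
 qed
 thus "x**d = y**b ==> fr x b = fr y d" using assms by (metis subset_antisym)
qed

lemma UN2_const: "P ~= {} ==> R ~= {} ==> (!!a b c d. (a, b) : P ==> (c, d) : R ==> F a b c d = C) ==>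
 (\<Union>(a, b)\<in>P. \<Union>(c, d)\<in>R. F a b c d) = C"
 by fastforce

lemma fr_nonempty: "x :.W ==> b : S ==> fr x b ~= {}"
 by (auto simp: cfrac_def)

lemma fr_mult:
 assumes a: "x :.W" "y :.W" "b : S" "d : S"
 shows "fr x b**.Q fr y d = fr (x**y) (b**d)"
proof -
 have "fr (u**v) (f**g) = fr (x**y) (b**d)" if "(u, f) : fr x b" "(v, g) : fr y d" for u f v g
 proof -
 have u: "u :.W" "f : S" "x**f = u**b" and v: "v :.W" "g : S" "y**g = v**d"
 using that by (auto simp: cfrac_def)
 have "(u**v)**(b**d) = (u**b)**(v**d)" using a u(1,2) v(1,2) by (simp add: m_assoc S_left)
 also have "... = (x**y)**(f**g)"
 unfolding u(3)[symmetric] v(3)[symmetric] using a u(1,2) v(1,2) by (simp add: m_assoc S_left)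
 finally show ?thesis using a u v by (subst fr_eq_iff) (auto intro: S_mult)
 qed
 thus ?thesis using UN2_const[OF fr_nonempty[OF a(1,3)] fr_nonempty[OF a(2,4)], of "%u f v g. fr (u**v) (f**g)"]
 by (simp add: cfrac_ring_def)
qed

lemma fr_add:
 assumes a: "x :.W" "y :.W" "b : S" "d : S"
 shows "fr x b +:.Q fr y d = fr (x**d +: y**b) (b**d)"
proof -
 have "fr (u**g +: v**f) (f**g) = fr (x**d +: y**b) (b**d)" if "(u, f) : fr x b" "(v, g) : fr y d" for u f v g
 proof -
 have u: "u :.W" "f : S" "x**f = u**b" and v: "v :.W" "g : S" "y**g = v**d"
 using that by (auto simp: cfrac_def)
 have "(u**g +: v**f)**(b**d) = (u**b)**(g**d) +: (v**d)**(f**b)"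
 using a u(1,2) v(1,2) by (simp add: m_assoc S_left l_distr r_distr)
 also have "... = (x**d +: y**b)**(f**g)"
 unfolding u(3)[symmetric] v(3)[symmetric] using a u(1,2) v(1,2) by (simp add: m_assoc S_left l_distr r_distr)
 finally show ?thesis using a u v by (subst fr_eq_iff) (auto intro: S_mult)
 qed
 thus ?thesis using UN2_const[OF fr_nonempty[OF a(1,3)] fr_nonempty[OF a(2,4)], of "%u f v g. fr (u**g +: v**f) (f**g)"]
 by (simp add: cfrac_ring_def)
qed

lemma Q_consts: "1:.Q = fr 1: 1:" "0:.Q = fr 0: 1:" by (simp_all add: cfrac_ring_def)

lemma fr_closed [simp]: "x :.W ==> b : S ==> fr x b :.Q"
 by (auto simp: cfrac_ring_def)

lemma Q_cases: assumes "p :.Q" obtains x b where "x :.W" "b : S" "p = fr x b"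
 using assms by (auto simp: cfrac_ring_def)

lemma fr_add_same: assumes "x :.W" "y :.W" "b : S" shows "fr x b +:.Q fr y b = fr (x +: y) b"
 unfolding fr_add[OF assms(1,2,3,3)] using assms
 by (subst fr_eq_iff) (auto simp: S_mult l_distr r_distr m_assoc S_left)

lemma fr_ext: assumes "x :.W" "b : S" "d : S" shows "fr x b = fr (x**d) (b**d)"
 using assms by (subst fr_eq_iff) (auto simp: S_mult m_assoc S_left)

lemma fr_common:
 assumes "p :.Q" "q :.Q"
 obtains x y b where "x :.W" "y :.W" "b : S" "p = fr x b" "q = fr y b"
proof -
 obtain x b where x: "x :.W" "b : S" "p = fr x b" using Q_cases[OF assms(1)] .
 obtain y d where y: "y :.W" "d : S" "q = fr y d" using Q_cases[OF assms(2)] .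
 show thesis
 proof (rule that)
 show "p = fr (x**d) (b**d)" unfolding x(3) by (rule fr_ext) (use x y in auto)
 show "q = fr (y**b) (b**d)" unfolding y(3) S_central[OF x(2) S_car[OF y(2)]] by (rule fr_ext) (use x y in auto)
 qed (use x y S_mult in auto)
qed

lemma Q_ring: "ring Q"
proof (rule ringI)
 show "abelian_group Q"
 proof (rule abelian_groupI)
 show "0:.Q :.Q" by (simp add: Q_consts S_one)
 fix p q assume p: "p :.Q" and q: "q :.Q"
 obtain x y b where xy: "x :.W" "y :.W" "b : S" "p = fr x b" "q = fr y b" using fr_common[OF p q] .
 show "p +:.Q q :.Q" "p +:.Q q = q +:.Q p" using xy by (simp_all add: fr_add_same a_comm)
 have z: "0:.Q = fr 0: b" unfolding Q_consts using xy S_one by (subst fr_eq_iff) auto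
 show "0:.Q +:.Q p = p" using xy by (simp add: z fr_add_same)
 show "EX r:car Q. r +:.Q p = 0:.Q"
 by (rule bexI[of _ "fr (\<ominus> x) b"]) (use xy in \<open>simp_all add: z fr_add_same l_neg\<close>)
 fix r assume r: "r :.Q"
 obtain z d where z: "z :.W" "d : S" "r = fr z d" using Q_cases[OF r] .
 have "p = fr (x**d) (b**d)" "q = fr (y**d) (b**d)" "r = fr (z**b) (b**d)"
 using xy z fr_ext[of x b d] fr_ext[of y b d] fr_ext[of z d b] S_left(1)[of d b] by simp_all
 thus "(p +:.Q q) +:.Q r = p +:.Q (q +:.Q r)" using xy z by (simp add: fr_add_same S_mult a_assoc)
 qed
 show "Group.monoid Q"
 proof (rule monoidI)
 show "1:.Q :.Q" by (simp add: Q_consts S_one)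
 fix p q assume p: "p :.Q" and q: "q :.Q"
 obtain x y b where xy: "x :.W" "y :.W" "b : S" "p = fr x b" "q = fr y b" using fr_common[OF p q] .
 show "p**.Q q :.Q" using xy by (simp add: fr_mult S_mult)
 show "1:.Q**.Q p = p" "p**.Q 1:.Q = p" using xy by (simp_all add: Q_consts fr_mult S_one)
 fix r assume r: "r :.Q"
 obtain z d where z: "z :.W" "d : S" "r = fr z d" using Q_cases[OF r] .
 show "(p**.Q q)**.Q r = p**.Q (q**.Q r)" using xy z by (simp add: fr_mult S_mult m_assoc)
 qed
 fix p q r assume p: "p :.Q" and q: "q :.Q" and r: "r :.Q"
 obtain x y b where xy: "x :.W" "y :.W" "b : S" "p = fr x b" "q = fr y b" using fr_common[OF p q] .
 obtain z d where z: "z :.W" "d : S" "r = fr z d" using Q_cases[OF r] .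
 show "(p +:.Q q)**.Q r = p**.Q r +:.Q q**.Q r" "r**.Q (p +:.Q q) = r**.Q p +:.Q r**.Q q"
 using xy z by (simp_all add: fr_mult S_mult fr_add_same l_distr r_distr)
qed

lemma fr_embedding: "(%x. fr x 1:) : ring_hom W Q" "inj_on (%x. fr x 1:) (car W)"
 using S_one by (auto simp: ring_hom_def fr_mult fr_add_same Q_consts inj_on_def fr_eq_iff)

end

lemma (in domain) fraction_field:
 "central_fractions R (car R - {0:})" "field (fraction_ring R)"
proof -
 show "central_fractions R (car R - {0:})"
 by unfold_locales (auto simp: integral_iff m_comm)
 then interpret C: central_fractions R "car R - {0:}" .
 note Q = C.Q_ring
 interpret Q: ring "cfrac_ring R (car R - {0:})" by (rule Q)
 have "cring C.Q"
 proof (intro cring.intro Q comm_monoid.intro comm_monoid_axioms.intro Q.monoid_axioms)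
 fix p q assume "p :.C.Q" "q :.C.Q"
 then obtain x y b where "x :.R" "y :.R" "b : car R - {0:}" "p = C.fr x b" "q = C.fr y b" using C.fr_common by blast
 thus "p**.C.Q q = q**.C.Q p" by (simp add: C.fr_mult m_comm)
 qed
 then interpret Q: cring C.Q .
 have "field C.Q"
 proof (rule Q.cring_fieldI2)
 show "0:.C.Q ~= 1:.C.Q" by (simp add: C.Q_consts C.fr_eq_iff)
 fix p assume p: "p :.C.Q" "p ~= 0:.C.Q"
 then obtain x b where x: "x :.R" "b : car R - {0:}" "p = C.fr x b" using C.Q_cases by blast
 hence "x ~= 0:" using p(2) by (auto simp: C.Q_consts C.fr_eq_iff)
 thus "EX q:car C.Q. p**.C.Q q = 1:.C.Q"
 using x by (intro bexI[of _ "C.fr b x"]) (simp_all add: C.fr_mult C.Q_consts C.fr_eq_iff integral_iff m_comm)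
 qed
 thus "field (fraction_ring R)" by (simp add: fraction_ring_eq)
qed

section \<open>Dimension and trace\<close>

text \<open>Gaussian elimination by induction on the number of equations: the last equation either
  is zero or is solved for one unknown \<open>p\<close>, which is then substituted into the
  others.\<close>

lemma (in field) homogeneous_solution:
 assumes "finite J" "n < card J" "!!i j. i < n ==> j : J ==> a i j :.R"
 shows "EX x : J \<rightarrow> car R. (EX j:J. x j ~= 0:) & (ALL i<n. (++j:J. a i j**x j) = 0:)"
 using assms
proof (induction n arbitrary: J a)
 case 0
 thus ?case by (intro bexI[of _ "%_. 1:"]) (auto simp: card_gt_0_iff)
next
 case (Suc n)
 show ?case
 proof (cases "ALL j:J. a n j = 0:")
 case True
 obtain x where x: "x : J \<rightarrow> car R" "EX j:J. x j ~= 0:" "ALL i<n. (++j:J. a i j**x j) = 0:"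
 using Suc.IH[OF Suc.prems(1), of a] Suc.prems by (meson Suc_lessD less_Suc_eq)
 have "(++j:J. a n j**x j) = (++j:J. 0:)" using True x by (intro finsum_cong') (auto simp: Pi_iff)
 thus ?thesis using x by (intro bexI[of _ x]) (auto simp: less_Suc_eq)
 next
 case False
 then obtain p where p: "p : J" "a n p ~= 0:" by blast
 let ?J = "J - {p}" and ?u = "inv (a n p)"
 have ac: "!!i j. i <= n ==> j : J ==> a i j :.R" using Suc.prems by simp
 have u: "?u :.R" "a n p**?u = 1:" using p ac[of n p] field_Units by (auto intro!: Units_r_inv)
 \<comment> \<open>The remaining equations after elimination of the unknown
   \<open>p\<close>.\<close>
 define a' where "a' i j = a i j \<ominus> a i p**?u**a n j" for i j
 have a'c: "a' i j :.R" if "i < n" "j : ?J" for i j using that p u ac by (simp add: a'_def)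
 have nJ: "n < card ?J" using Suc.prems(1,2) p by simp
 have "EX x:?J \<rightarrow> car R. (EX j:?J. x j ~= 0:) & (ALL i<n. (++j:?J. a' i j**x j) = 0:)"
 by (rule Suc.IH[OF _ nJ a'c]) (use Suc.prems(1) in auto)
 then obtain x where x: "x : ?J \<rightarrow> car R" "EX j:?J. x j ~= 0:" "ALL i<n. (++j:?J. a' i j**x j) = 0:"
 by meson
 define s where "s = (++j:?J. a n j**x j)"
 \<comment> \<open>The value at \<open>p\<close> is the one forced by the last equation.\<close>
 define y where "y = x(p := \<ominus> (?u**s))"
 have s: "s :.R" unfolding s_def using x ac by (intro finsum_closed) (auto simp: Pi_iff)
 have yc: "y : J \<rightarrow> car R" using x u s by (auto simp: y_def Pi_iff)
 have split: "(++j:J. a i j**y j) = \<ominus> (a i p**(?u**s)) +: (++j:?J. a i j**x j)" if i: "i <= n" for i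
 proof -
 have "(++j:J. a i j**y j) = (++j:insert p ?J. a i j**y j)" using p by (simp add: insert_absorb)
 also have "... = a i p**y p +: (++j:?J. a i j**y j)"
 using Suc.prems(1) yc ac[OF i] p by (intro finsum_insert) (auto simp: Pi_iff)
 also have "(++j:?J. a i j**y j) = (++j:?J. a i j**x j)" using x ac[OF i] by (intro finsum_cong') (auto simp: y_def Pi_iff)
 also have "a i p**y p = \<ominus> (a i p**(?u**s))" using ac[OF i p(1)] u s by (simp add: y_def r_minus)
 finally show ?thesis .
 qed
 have "(++j:J. a i j**y j) = 0:" if i: "i <= n" for i
 proof (cases "i = n")
 case True
 have "a n p**(?u**s) = s" using ac[of n p] p u s by (simp flip: m_assoc)
 thus ?thesis using split[OF order_refl] s unfolding True s_def[symmetric] by (simp add: l_neg)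
 next
 case False
 hence i': "i < n" using i by simp
 have t: "a i j**x j = a' i j**x j +: (a i p**?u)**(a n j**x j)" if j: "j : ?J" for j
 proof -
 have c: "a i j :.R" "a n j :.R" "a i p**?u :.R" "x j :.R"
 using ac[OF i] ac[of n] j p u x by auto
 hence "a i j**x j = (a i j \<ominus> (a i p**?u)**a n j +: (a i p**?u)**a n j)**x j"
 by (simp add: a_minus_def a_assoc l_neg)
 also have "... = a' i j**x j +: (a i p**?u)**(a n j**x j)"
 unfolding a'_def[symmetric] using c a'c[OF i' j] by (subst l_distr) (auto simp: m_assoc)
 finally show ?thesis .
 qed
 have c: "(%j. a' i j**x j) : ?J \<rightarrow> car R" "(%j. a n j**x j) : ?J \<rightarrow> car R" "a i p**?u :.R"
 using a'c[OF i'] x ac[of n] ac[OF i p(1)] u by (auto simp: Pi_iff)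
 have "(++j:?J. a i j**x j) = (++j:?J. a' i j**x j +: (a i p**?u)**(a n j**x j))"
 using c t by (intro finsum_cong') (auto simp: Pi_iff)
 also have "... = (++j:?J. a' i j**x j) +: (++j:?J. (a i p**?u)**(a n j**x j))"
 using c by (intro finsum_addf) (auto simp: Pi_iff)
 also have "(++j:?J. (a i p**?u)**(a n j**x j)) = (a i p**?u)**s"
 unfolding s_def using Suc.prems(1) c by (intro finsum_rdistr[symmetric]) auto
 also have "(++j:?J. a' i j**x j) = 0:" using x(3) i' by blast
 finally show ?thesis unfolding split[OF i] using c s u ac[OF i p(1)] by (simp add: l_neg m_assoc)
 qed
 moreover have "EX j:J. y j ~= 0:" using x(2) by (auto simp: y_def)
 ultimately show ?thesis using yc by (intro bexI[of _ y]) auto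
 qed
qed

lemma (in abelian_monoid) finsum_swap:
 assumes "finite A" "finite B" "!!i j. i : A ==> j : B ==> f i j :.G"
 shows "(++i:A. ++j:B. f i j) = (++j:B. ++i:A. f i j)"
 using assms(1,3)
proof (induction A rule: finite_induct)
 case empty
 thus ?case by simp
next
 case (insert a A)
 have "(++i:insert a A. ++j:B. f i j) = (++j:B. f a j) +: (++j:B. ++i:A. f i j)"
 using insert by (subst finsum_insert) (auto intro!: finsum_closed)
 also have "... = (++j:B. f a j +: (++i:A. f i j))"
 using insert.prems by (intro finsum_addf[symmetric]) (auto intro!: finsum_closed)
 also have "... = (++j:B. ++i:insert a A. f i j)"
 using insert by (intro finsum_cong') (auto intro!: finsum_closed)
 finally show ?case .
qed

locale vspace = F?: field F + V: module F V for F :: "('f, 'e) ring_scheme" (structure) and V :: "('f, 'v, 'x) module_scheme"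
begin

definition lc where "lc w c v = (++.V i:{..<w::nat}. c i *:.V v i)"

lemma lc_closed: "v : {..<w} \<rightarrow> car V ==> c : {..<w} \<rightarrow> car F ==> lc w c v :.V"
 unfolding lc_def by (intro V.finsum_closed) (auto simp: Pi_iff)

lemma lc_cong: "v : {..<w} \<rightarrow> car V ==> c : {..<w} \<rightarrow> car F ==> (!!i. i < w ==> d i = c i) ==> lc w d v = lc w c v"
 unfolding lc_def by (intro V.finsum_cong') (auto simp: Pi_iff)

lemma lc_add:
 assumes "v : {..<w} \<rightarrow> car V" "c : {..<w} \<rightarrow> car F" "d : {..<w} \<rightarrow> car F"
 shows "lc w (%i. c i +: d i) v = lc w c v +:.V lc w d v"
proof -
 have "lc w (%i. c i +: d i) v = (++.V i:{..<w}. c i *:.V v i +:.V d i *:.V v i)"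
 unfolding lc_def using assms by (intro V.finsum_cong') (auto simp: Pi_iff V.smult_l_distr)
 also have "... = lc w c v +:.V lc w d v" unfolding lc_def using assms by (intro V.finsum_addf) (auto simp: Pi_iff)
 finally show ?thesis .
qed

lemma lc_smult:
 assumes "v : {..<w} \<rightarrow> car V" "c : {..<w} \<rightarrow> car F" "k :.F"
 shows "lc w (%i. k**c i) v = k *:.V lc w c v"
proof -
 have "lc w (%i. k**c i) v = (++.V i:{..<w}. k *:.V (c i *:.V v i))"
 unfolding lc_def using assms by (intro V.finsum_cong') (auto simp: Pi_iff V.smult_assoc1)
 thus ?thesis using assms V.finsum_smult_ldistr[of "{..<w}" k "%i. c i *:.V v i"] by (auto simp: lc_def Pi_iff)
qed

lemma lc_lc:
 assumes v: "v : {..<w} \<rightarrow> car V" and c: "c : {..<u} \<rightarrow> car F" and M: "!!j i. j < u ==> i < w ==> M j i :.F"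
 shows "lc u c (%j. lc w (M j) v) = lc w (%i. ++j:{..<u}. c j**M j i) v"
 using c M
proof (induction u)
 case 0
 have "lc w (%i. 0:) v = (++.V i:{..<w}. 0:.V)" unfolding lc_def using v by (intro V.finsum_cong') (auto simp: Pi_iff)
 thus ?case by (simp add: lc_def)
next
 case (Suc u)
 have Mu: "M u : {..<w} \<rightarrow> car F" "c u :.F" using Suc.prems by auto
 have IH: "lc u c (%j. lc w (M j) v) = lc w (%i. ++j:{..<u}. c j**M j i) v" using Suc by (intro Suc.IH) auto
 have lj: "lc w (M j) v :.V" if "j < Suc u" for j using Suc.prems(2)[OF that] v by (intro lc_closed) auto
 have "lc (Suc u) c (%j. lc w (M j) v) = c u *:.V lc w (M u) v +:.V lc u c (%j. lc w (M j) v)"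
 unfolding lc_def[of "Suc u"] lc_def[of u] lessThan_Suc using lj Suc.prems(1) by (intro V.finsum_insert) (auto simp: Pi_iff)
 also have "... = lc w (%i. c u**M u i +: (++j:{..<u}. c j**M j i)) v"
 unfolding IH lc_smult[OF v Mu, symmetric] using v Mu Suc.prems by (intro lc_add[symmetric]) (auto intro!: finsum_closed simp: Pi_iff)
 also have "... = lc w (%i. ++j:{..<Suc u}. c j**M j i) v"
 proof (rule lc_cong[OF v, symmetric])
 show "(++j:{..<Suc u}. c j**M j i) = c u**M u i +: (++j:{..<u}. c j**M j i)" if "i < w" for i
 unfolding lessThan_Suc using Suc.prems that by (intro finsum_insert) (auto simp: Pi_iff)
 show "(%i. c u**M u i +: (++j:{..<u}. c j**M j i)) : {..<w} \<rightarrow> car F"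
 using Mu Suc.prems by (auto intro!: finsum_closed simp: Pi_iff)
 qed
 finally show ?case .
qed

lemma is_basis_iff: "is_basis F V w v \<longleftrightarrow> v : {..<w} \<rightarrow> car V &
 (ALL x:car V. EX! c. c : {..<w} \<rightarrow>\<^sub>E car F & x = lc w c v)"
 by (simp add: is_basis_def lc_def)

lemma basis_coordinates:
 assumes b: "is_basis F V w v" and x: "x :.V"
 shows "coordinates F V w v x : {..<w} \<rightarrow>\<^sub>E car F" "x = lc w (coordinates F V w v x) v"
 and "d : {..<w} \<rightarrow> car F ==> x = lc w d v ==> i < w ==> d i = coordinates F V w v x i"
proof -
 have u: "EX! c. c : {..<w} \<rightarrow>\<^sub>E car F & x = lc w c v" and v: "v : {..<w} \<rightarrow> car V"
 using b x unfolding is_basis_iff by blast+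
 have e: "coordinates F V w v x = (THE c. c : {..<w} \<rightarrow>\<^sub>E car F & x = lc w c v)" by (simp add: coordinates_def lc_def)
 show c: "coordinates F V w v x : {..<w} \<rightarrow>\<^sub>E car F" "x = lc w (coordinates F V w v x) v"
 using theI'[OF u] unfolding e by blast+
 assume d: "d : {..<w} \<rightarrow> car F" "x = lc w d v" and i: "i < w"
 have "x = lc w (restrict d {..<w}) v" using d lc_cong[OF v d(1), of "restrict d {..<w}"] by simp
 moreover have "restrict d {..<w} : {..<w} \<rightarrow>\<^sub>E car F" using d by auto
 ultimately have "restrict d {..<w} = coordinates F V w v x" using u c by blast
 thus "d i = coordinates F V w v x i" using i by (metis lessThan_iff restrict_apply')
qed

lemma basis_independent:
 assumes b: "is_basis F V w v" and d: "c : {..<w} \<rightarrow> car F" "d : {..<w} \<rightarrow> car F" "lc w c v = lc w d v" and i: "i < w"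
 shows "c i = d i"
proof -
 have v: "lc w d v :.V" using b d by (intro lc_closed) (auto simp: is_basis_iff)
 show ?thesis using basis_coordinates(3)[OF b v d(1) d(3)[symmetric] i] basis_coordinates(3)[OF b v d(2) refl i] by simp
qed

text \<open>Were the second basis larger, its coordinates in the first would be a homogeneous system
  with more unknowns than equations, and a nontrivial solution would be a linear relation in the
  second basis.\<close>

lemma basis_size_le:
 assumes b: "is_basis F V w v" "is_basis F V w' v'" shows "w' <= w"
proof (rule ccontr)
 assume "~ w' <= w"
 hence lt: "w < card {..<w'}" by simp
 have v: "v : {..<w} \<rightarrow> car V" "v' : {..<w'} \<rightarrow> car V" using b by (auto simp: is_basis_iff)
 define M where "M j = coordinates F V w v (v' j)" for j
 have M: "M j : {..<w} \<rightarrow> car F" "v' j = lc w (M j) v" if "j < w'" for j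
 using basis_coordinates[OF b(1), of "v' j"] v that unfolding M_def by (auto simp: PiE_def Pi_iff)
 obtain x where x: "x : {..<w'} \<rightarrow> car F" "EX j:{..<w'}. x j ~= 0:" "ALL i<w. (++j:{..<w'}. M j i**x j) = 0:"
 using homogeneous_solution[OF _ lt, of "%i j. M j i"] M(1) by (auto simp: Pi_iff)
 have "lc w' x v' = lc w' x (%j. lc w (M j) v)"
 unfolding lc_def[of w'] using M lc_closed[OF v(1) M(1)] x(1) by (intro V.finsum_cong') (auto simp: Pi_iff)
 also have "... = lc w (%i. ++j:{..<w'}. x j**M j i) v" using M(1) by (intro lc_lc[OF v(1) x(1)]) auto
 also have "... = lc w (%i. 0:) v"
 proof (rule lc_cong[OF v(1)])
 fix i assume i: "i < w"
 have "(++j:{..<w'}. x j**M j i) = (++j:{..<w'}. M j i**x j)"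
 using M(1) x(1) i by (intro finsum_cong') (auto simp: Pi_iff m_comm)
 thus "(++j:{..<w'}. x j**M j i) = 0:" using x(3) i by simp
 qed simp
 also have "... = lc w' (%i. 0:) v'"
 proof -
 have "lc u (%i. 0:) y = 0:.V" if y: "y : {..<u} \<rightarrow> car V" for u y
 proof -
 have "lc u (%i. 0:) y = (++.V i:{..<u}. 0:.V)" unfolding lc_def using y by (intro V.finsum_cong') (auto simp: Pi_iff)
 thus ?thesis by simp
 qed
 thus ?thesis using v by simp
 qed
 finally have "x j = 0:" if "j < w'" for j using basis_independent[OF b(2) x(1) _ _ that, of "%i. 0:"] by auto
 thus False using x(2) by auto
qed

lemma vs_dim_eq: assumes "is_basis F V w v" shows "vs_dim F V = w"
 unfolding vs_dim_def using assms basis_size_le by (intro the_equality) (auto intro: antisym)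

text \<open>\<open>trace\<close> is a definite description over all bases, so independence of the
  basis is needed to evaluate it. The coordinate matrices \<open>C\<close> and \<open>D\<close>
  between the bases are inverse to each other (\<open>delta\<close>), and the diagonal sum becomes a
  triple sum in which the order of summation is changed.\<close>

lemma trace_sum_eq:
 assumes b: "is_basis F V w v" "is_basis F V u y"
 and f: "!!x. x :.V ==> f x :.V"
 and lin: "!!n c z. z : {..<n} \<rightarrow> car V ==> c : {..<n} \<rightarrow> car F ==> f (lc n c z) = lc n c (%i. f (z i))"
 shows "(++i:{..<w}. coordinates F V w v (f (v i)) i) = (++i:{..<u}. coordinates F V u y (f (y i)) i)"
proof -
 have v: "v : {..<w} \<rightarrow> car V" "y : {..<u} \<rightarrow> car V" using b by (auto simp: is_basis_iff)
 have vc: "!!i. i < w ==> v i :.V" "!!i. i < u ==> y i :.V" using v by auto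
 define C where "C = coordinates F V w v"
 define D where "D = coordinates F V u y"
 have C: "C x : {..<w} \<rightarrow> car F" "x = lc w (C x) v" "i < w ==> C x i :.F" if "x :.V" for x i
 using basis_coordinates(1,2)[OF b(1) that] unfolding C_def by (auto simp: PiE_def Pi_iff)
 have D: "D x : {..<u} \<rightarrow> car F" "x = lc u (D x) y" "i < u ==> D x i :.F" if "x :.V" for x i
 using basis_coordinates(1,2)[OF b(2) that] unfolding D_def by (auto simp: PiE_def Pi_iff)
 have lcD: "lc w c (%k. lc u (D (v k)) y) = lc w c v" if c: "c : {..<w} \<rightarrow> car F" for c
 unfolding lc_def[of w] using D(2) vc c by (intro V.finsum_cong') (auto simp: Pi_iff)
 have conv: "D x j = (++k:{..<w}. C x k**D (v k) j)" if x: "x :.V" and j: "j < u" for x j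
 proof -
 have e: "x = lc u (%j. ++k:{..<w}. C x k**D (v k) j) y"
 using lc_lc[OF v(2) C(1)[OF x], of "%k. D (v k)"] D(3) vc lcD[OF C(1)[OF x]] C(2)[OF x] by simp
 have "(%j. ++k:{..<w}. C x k**D (v k) j) : {..<u} \<rightarrow> car F"
 using C(3)[OF x] D(3) vc by (auto intro!: finsum_closed)
 thus ?thesis using basis_coordinates(3)[OF b(2) x _ e j] unfolding D_def by simp
 qed
 have lin': "C (f (y j)) k = (++i:{..<w}. C (y j) i**C (f (v i)) k)" if j: "j < u" and k: "k < w" for j k
 proof -
 have "f (y j) = f (lc w (C (y j)) v)" using C(2)[OF vc(2)[OF j]] by simp
 also have "... = lc w (C (y j)) (%i. f (v i))" by (rule lin[OF v(1) C(1)[OF vc(2)[OF j]]])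
 also have "... = lc w (C (y j)) (%i. lc w (C (f (v i))) v)"
 unfolding lc_def[of w "C (y j)"] using C(2)[OF f] vc C(3) f j by (intro V.finsum_cong') (auto simp: Pi_iff)
 also have "... = lc w (%k. ++i:{..<w}. C (y j) i**C (f (v i)) k) v"
 using C(3) f vc j by (intro lc_lc[OF v(1)]) (auto simp: Pi_iff)
 finally have e: "f (y j) = lc w (%k. ++i:{..<w}. C (y j) i**C (f (v i)) k) v" .
 have "(%k. ++i:{..<w}. C (y j) i**C (f (v i)) k) : {..<w} \<rightarrow> car F"
 using C(3) f vc j by (auto intro!: finsum_closed)
 thus ?thesis using basis_coordinates(3)[OF b(1) f[OF vc(2)[OF j]] _ e k] unfolding C_def by metis
 qed
 have delta: "(++j:{..<u}. D (v k) j**C (y j) i) = (if i = k then 1: else 0:)" if k: "k < w" and i: "i < w" for k i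
 proof -
 have "lc u (D (v k)) (%j. lc w (C (y j)) v) = lc u (D (v k)) y"
 unfolding lc_def[of u] using C(2)[OF vc(2)] vc D(3)[OF vc(1)[OF k]] by (intro V.finsum_cong') (auto simp: Pi_iff)
 hence a: "v k = lc w (%i. ++j:{..<u}. D (v k) j**C (y j) i) v"
 using lc_lc[OF v(1) D(1)[OF vc(1)[OF k]], of "%j. C (y j)"] C(3)[OF vc(2)] D(2)[OF vc(1)[OF k]] by simp
 have "lc w (%i. if i = k then 1: else 0:) v = (++.V i:{..<w}. if k = i then v i else 0:.V)"
 unfolding lc_def using vc by (intro V.finsum_cong') auto
 also have "... = v k" using k vc V.finsum_singleton[of k "{..<w}" v] by auto
 finally have d: "v k = lc w (%i. if i = k then 1: else 0:) v" by simp
 show ?thesis using basis_coordinates(3)[OF b(1) vc(1)[OF k] _ a i] basis_coordinates(3)[OF b(1) vc(1)[OF k] _ d i]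
 C(3)[OF vc(2)] D(3)[OF vc(1)[OF k]] by (auto intro!: finsum_closed)
 qed
 have cl: "C (f (v i)) k :.F" "C (y j) i :.F" "D (v k) j :.F" "C (f (y j)) k :.F"
 if "i < w" "j < u" "k < w" for i j k using that C(3) D(3) f vc by auto
 have "(++j:{..<u}. D (f (y j)) j) = (++j:{..<u}. ++k:{..<w}. ++i:{..<w}. C (f (v i)) k**(D (v k) j**C (y j) i))"
 proof (rule finsum_cong')
 fix j assume "j : {..<u}" hence j: "j < u" by simp
 have "D (f (y j)) j = (++k:{..<w}. C (f (y j)) k**D (v k) j)" using conv[OF f[OF vc(2)[OF j]] j] .
 also have "... = (++k:{..<w}. ++i:{..<w}. C (f (v i)) k**(D (v k) j**C (y j) i))"
 proof (rule finsum_cong')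
 fix k assume "k : {..<w}" hence k: "k < w" by simp
 have "C (f (y j)) k**D (v k) j = (++i:{..<w}. C (y j) i**C (f (v i)) k)**D (v k) j" by (simp add: lin'[OF j k])
 also have "... = (++i:{..<w}. (C (y j) i**C (f (v i)) k)**D (v k) j)"
 using cl j k by (intro finsum_ldistr) auto
 also have "... = (++i:{..<w}. C (f (v i)) k**(D (v k) j**C (y j) i))"
 using cl j k by (intro finsum_cong') (auto simp: m_ac)
 finally show "C (f (y j)) k**D (v k) j = (++i:{..<w}. C (f (v i)) k**(D (v k) j**C (y j) i))" .
 qed (use cl j in \<open>auto intro!: finsum_closed\<close>)
 finally show "D (f (y j)) j = (++k:{..<w}. ++i:{..<w}. C (f (v i)) k**(D (v k) j**C (y j) i))" .
 qed (use cl in \<open>auto intro!: finsum_closed\<close>)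
 also have "... = (++k:{..<w}. ++j:{..<u}. ++i:{..<w}. C (f (v i)) k**(D (v k) j**C (y j) i))"
 by (rule finsum_swap) (use cl in \<open>auto intro!: finsum_closed\<close>)
 also have "... = (++k:{..<w}. C (f (v k)) k)"
 proof (rule finsum_cong')
 fix k assume "k : {..<w}" hence k: "k < w" by simp
 have "(++j:{..<u}. ++i:{..<w}. C (f (v i)) k**(D (v k) j**C (y j) i)) =
 (++i:{..<w}. ++j:{..<u}. C (f (v i)) k**(D (v k) j**C (y j) i))"
 by (rule finsum_swap) (use cl k in \<open>auto intro!: finsum_closed\<close>)
 also have "... = (++i:{..<w}. if k = i then C (f (v i)) k else 0:)"
 proof (rule finsum_cong')
 fix i assume "i : {..<w}" hence i: "i < w" by simp
 have "(++j:{..<u}. C (f (v i)) k**(D (v k) j**C (y j) i)) = C (f (v i)) k**(++j:{..<u}. D (v k) j**C (y j) i)"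
 using cl i k C(3) f vc by (intro finsum_rdistr[symmetric]) auto
 thus "(++j:{..<u}. C (f (v i)) k**(D (v k) j**C (y j) i)) = (if k = i then C (f (v i)) k else 0:)"
 unfolding delta[OF k i] using C(3)[OF f[OF vc(1)[OF i]] k] by auto
 qed (use C(3) f vc k in auto)
 also have "... = C (f (v k)) k" using k C(3) f vc by (intro finsum_singleton) auto
 finally show "(++j:{..<u}. ++i:{..<w}. C (f (v i)) k**(D (v k) j**C (y j) i)) = C (f (v k)) k" .
 qed (use C(3) f vc in auto)
 finally show ?thesis unfolding C_def D_def by simp
qed

lemma trace_eq:
 assumes b: "is_basis F V w v" and f: "!!x. x :.V ==> f x :.V"
 and lin: "!!n c z. z : {..<n} \<rightarrow> car V ==> c : {..<n} \<rightarrow> car F ==> f (lc n c z) = lc n c (%i. f (z i))"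
 shows "trace F V f = (++i:{..<w}. coordinates F V w v (f (v i)) i)"
 unfolding trace_def using b trace_sum_eq[OF _ b f lin] by (intro the_equality) blast+

end

section \<open>Determinants\<close>

context cring
begin

lemma det_term_closed:
 "p permutes {..<w} ==> (!!i j. i < w ==> j < w ==> a i j :.R) ==> (\<Otimes>i\<in>{..<w}. a i (p i)) :.R"
 using permutes_in_image[of p "{..<w}"] by (intro finprod_closed) fastforce

lemma det_closed: "(!!i j. i < w ==> j < w ==> a i j :.R) ==> ring_det R w a :.R"
 unfolding ring_det_def using det_term_closed[of _ w a] by (intro finsum_closed) auto

lemma det_cong:
 assumes "!!i j. i < w ==> j < w ==> b i j :.R" "!!i j. i < w ==> j < w ==> a i j = b i j"
 shows "ring_det R w a = ring_det R w b"
 unfolding ring_det_def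
proof (rule finsum_cong')
 fix p assume "p : {p. p permutes {..<w}}"
 hence p: "p permutes {..<w}" by simp
 have "(\<Otimes>i\<in>{..<w}. a i (p i)) = (\<Otimes>i\<in>{..<w}. b i (p i))"
 using assms permutes_in_image[OF p] by (intro finprod_cong') auto
 thus "(if evenperm p then \<Otimes>i\<in>{..<w}. a i (p i) else \<ominus> (\<Otimes>i\<in>{..<w}. a i (p i))) =
 (if evenperm p then \<Otimes>i\<in>{..<w}. b i (p i) else \<ominus> (\<Otimes>i\<in>{..<w}. b i (p i)))" by simp
qed (use det_term_closed[of _ w b] assms(1) in auto)

lemma det_diagonal:
 assumes a: "!!i j. i < w ==> j < w ==> a i j :.R" and d: "!!i j. i < w ==> j < w ==> i ~= j ==> a i j = 0:"
 shows "ring_det R w a = (\<Otimes>i\<in>{..<w}. a i i)"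
proof -
 have "ring_det R w a = (++p:{p. p permutes {..<w}}. if id = p then \<Otimes>i\<in>{..<w}. a i (id i) else 0:)"
 unfolding ring_det_def
 proof (rule finsum_cong')
 fix p assume "p : {p. p permutes {..<w}}"
 hence p: "p permutes {..<w}" by simp
 show "(if evenperm p then \<Otimes>i\<in>{..<w}. a i (p i) else \<ominus> (\<Otimes>i\<in>{..<w}. a i (p i))) =
 (if id = p then \<Otimes>i\<in>{..<w}. a i (id i) else 0:)"
 proof (cases "p = id")
 case True
 thus ?thesis by (simp add: evenperm_id)
 next
 case False
 then obtain i where i: "p i ~= i" by (auto simp: fun_eq_iff)
 have iw: "i < w" using i permutes_not_in[OF p, of i] by auto
 have "(\<Otimes>i\<in>{..<w}. a i (p i)) = (\<Otimes>i\<in>insert i ({..<w} - {i}). a i (p i))" using iw by (simp add: insert_absorb)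
 also have "... = a i (p i)**(\<Otimes>i\<in>{..<w} - {i}. a i (p i))"
 using a permutes_in_image[OF p] iw by (intro finprod_insert) auto
 also have "a i (p i) = 0:" using d[of i "p i"] i iw permutes_in_image[OF p, of i] by auto
 also have "0:**(\<Otimes>i\<in>{..<w} - {i}. a i (p i)) = 0:"
 using a permutes_in_image[OF p] by (intro l_null finprod_closed) auto
 finally show ?thesis using False by simp
 qed
 qed (use a in \<open>auto intro!: finprod_closed\<close>)
 also have "... = (\<Otimes>i\<in>{..<w}. a i (id i))"
 using a by (intro finsum_singleton) (auto intro!: finprod_closed simp: permutes_id finite_permutations)
 finally show ?thesis by simp
qed

lemma finsum_times:
 assumes "finite A" "finite B" "!!i j. i : A ==> j : B ==> f i j :.R"
 shows "(++i:A. ++j:B. f i j) = (++x:A \<times> B. f (fst x) (snd x))"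
 using assms(1,3)
proof (induction A rule: finite_induct)
 case empty
 thus ?case by simp
next
 case (insert a A)
 have "(++x:Pair a ` B. f (fst x) (snd x)) = (++j:B. f a j)"
 using insert.prems by (subst finsum_reindex) (auto simp: inj_on_def)
 moreover have "(++x:Pair a ` B \<union> A \<times> B. f (fst x) (snd x)) =
 (++x:Pair a ` B. f (fst x) (snd x)) +: (++x:A \<times> B. f (fst x) (snd x))"
 using insert assms(2) by (intro finsum_Un_disjoint) auto
 moreover have "insert a A \<times> B = Pair a ` B \<union> A \<times> B" by auto
 ultimately show ?case using insert by (subst finsum_insert) (auto intro!: finsum_closed)
qed

lemma finprod_finsum:
 assumes "finite B" "!!i r. i < n ==> r : B ==> f i r :.R"
 shows "(\<Otimes>i\<in>{..<n::nat}. ++r:B. f i r) = (++rh:({..<n} \<rightarrow>\<^sub>E B). \<Otimes>i\<in>{..<n}. f i (rh i))"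
 using assms(2)
proof (induction n)
 case 0
 thus ?case by simp
next
 case (Suc n)
 let ?E = "{..<n} \<rightarrow>\<^sub>E B"
 have fE: "finite ?E" using assms(1) by (intro finite_PiE) auto
 have pc: "(\<Otimes>i\<in>{..<n}. f i (rh i)) :.R" if "rh : ?E" for rh
 using that Suc.prems by (intro finprod_closed) (auto simp: PiE_iff)
 have inj: "inj_on (%x. (snd x)(n := fst x)) (B \<times> ?E)"
 proof (rule inj_onI, clarsimp)
 fix r rh r' rh' assume a: "rh : ?E" "rh' : ?E" and e: "rh(n := r) = rh'(n := r')"
 have "rh i = rh' i" for i
 proof (cases "i = n")
 case True
 thus ?thesis using a by (metis PiE_arb lessThan_iff less_irrefl)
 next
 case False
 thus ?thesis using fun_cong[OF e, of i] by simp
 qed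
 thus "r = r' & rh = rh'" using fun_cong[OF e, of n] by auto
 qed
 have img: "(%x. (snd x)(n := fst x)) ` (B \<times> ?E) = {..<Suc n} \<rightarrow>\<^sub>E B"
 using PiE_insert_eq[of n "{..<n}" "%_. B"] by (simp add: lessThan_Suc case_prod_beta)
 have cl: "(++r:B. f n r) :.R" using Suc.prems by (intro finsum_closed) auto
 have "(\<Otimes>i\<in>{..<Suc n}. ++r:B. f i r) = (++r:B. f n r)**(\<Otimes>i\<in>{..<n}. ++r:B. f i r)"
 unfolding lessThan_Suc using Suc.prems by (intro finprod_insert) (auto intro!: finsum_closed)
 also have "... = (++r:B. f n r)**(++rh:?E. \<Otimes>i\<in>{..<n}. f i (rh i))" using Suc by simp
 also have "... = (++r:B. f n r**(++rh:?E. \<Otimes>i\<in>{..<n}. f i (rh i)))"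
 using assms(1) Suc.prems pc by (intro finsum_ldistr) (auto intro!: finsum_closed)
 also have "... = (++r:B. ++rh:?E. f n r**(\<Otimes>i\<in>{..<n}. f i (rh i)))"
 using fE Suc.prems pc by (intro finsum_cong' finsum_rdistr) (auto intro!: finsum_closed)
 also have "... = (++x:B \<times> ?E. f n (fst x)**(\<Otimes>i\<in>{..<n}. f i (snd x i)))"
 using assms(1) fE Suc.prems pc by (intro finsum_times) auto
 also have "... = (++x:B \<times> ?E. \<Otimes>i\<in>{..<Suc n}. f i (((snd x)(n := fst x)) i))"
 proof (rule finsum_cong')
 show "(%x. \<Otimes>i\<in>{..<Suc n}. f i (((snd x)(n := fst x)) i)) : B \<times> ?E \<rightarrow> car R"
 using Suc.prems by (auto intro!: finprod_closed simp: PiE_iff)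
 fix x assume x: "x : B \<times> ?E"
 obtain r rh where r: "x = (r, rh)" "r : B" "rh : ?E" using x by blast
 have "(\<Otimes>i\<in>{..<Suc n}. f i ((rh(n := r)) i)) = f n r**(\<Otimes>i\<in>{..<n}. f i ((rh(n := r)) i))"
 unfolding lessThan_Suc using Suc.prems r by (subst finprod_insert) (auto simp: PiE_iff)
 also have "(\<Otimes>i\<in>{..<n}. f i ((rh(n := r)) i)) = (\<Otimes>i\<in>{..<n}. f i (rh i))"
 using Suc.prems r by (intro finprod_cong') (auto simp: PiE_iff)
 finally show "f n (fst x)**(\<Otimes>i\<in>{..<n}. f i (snd x i)) = (\<Otimes>i\<in>{..<Suc n}. f i (((snd x)(n := fst x)) i))"
 using r by simp
 qed auto
 also have "... = (++rh:({..<Suc n} \<rightarrow>\<^sub>E B). \<Otimes>i\<in>{..<Suc n}. f i (rh i))"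
 unfolding img[symmetric] using Suc.prems
 by (subst finsum_reindex[OF _ inj]) (auto intro!: finprod_closed finsum_cong' simp: PiE_iff split: if_splits)
 finally show ?case .
qed

text \<open>Composition with the transposition of the two rows matches even with odd permutations
  having the same product. Cancelling in pairs is valid in every characteristic, including
  2.\<close>

lemma det_equal_rows:
 assumes a: "!!i j. i < w ==> j < w ==> a i j :.R" and r: "r < w" "r' < w" "r ~= r'"
 and e: "!!j. j < w ==> a r j = a r' j"
 shows "ring_det R w a = 0:"
proof -
 let ?P = "{p. p permutes {..<w}}" and ?t = "transpose r r'"
 let ?g = "%p. \<Otimes>i\<in>{..<w}. a i (p i)"
 let ?E = "{p : ?P. evenperm p}" and ?O = "{p : ?P. ~ evenperm p}"
 have fin: "finite ?P" by (simp add: finite_permutations)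
 have t: "?t permutes {..<w}" using r by (intro permutes_swap_id) auto
 have gc: "?g p :.R" if "p permutes {..<w}" for p using det_term_closed[OF that] a by blast
 have gc': "(\<Otimes>i\<in>{..<w}. a i (p (?t i))) :.R" if "p permutes {..<w}" for p
 using gc[OF permutes_compose[OF t that]] by simp
 have gt: "?g (p \<circ> ?t) = ?g p" if p: "p permutes {..<w}" for p
 proof -
 have "?g p = (\<Otimes>i\<in>?t ` {..<w}. a i (p i))" using permutes_image[OF t] by simp
 also have "... = (\<Otimes>i\<in>{..<w}. a (?t i) (p (?t i)))"
 using a permutes_in_image[OF p] permutes_in_image[OF t] permutes_image[OF t] inj_on_subset[OF permutes_inj[OF t]]
 by (intro finprod_reindex) auto
 also have "... = ?g (p \<circ> ?t)"
 proof (rule finprod_cong')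
 have pt: "p (?t i) < w" if "i < w" for i using that permutes_in_image[OF p] permutes_in_image[OF t] by (metis lessThan_iff)
 thus "(%i. a i ((p \<circ> ?t) i)) : {..<w} \<rightarrow> car R" using a by auto
 fix i assume "i : {..<w}"
 thus "a (?t i) (p (?t i)) = a i ((p \<circ> ?t) i)" using e[OF pt, of i] by (auto simp: transpose_def)
 qed simp
 finally show ?thesis by simp
 qed
 have par: "evenperm (p \<circ> ?t) \<longleftrightarrow> ~ evenperm p" if p: "p permutes {..<w}" for p
 using evenperm_comp[of p ?t] permutation_permutes p t r by (auto simp: evenperm_swap permutation_swap_id)
 have tt: "(p \<circ> ?t) \<circ> ?t = p" for p by (simp add: fun_eq_iff)
 have bij: "(%p. p \<circ> ?t) ` ?E = ?O"
 proof (intro subset_antisym subsetI)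
 fix p assume "p : ?O"
 hence "p \<circ> ?t : ?E" using par[of p] permutes_compose[OF t] by simp
 thus "p : (%p. p \<circ> ?t) ` ?E" by (rule rev_image_eqI) (rule tt[symmetric])
 qed (use par permutes_compose[OF t] in auto)
 have inj: "inj_on (%p. p \<circ> ?t) ?E" by (rule inj_on_inverseI[where g = "%p. p \<circ> ?t"]) (rule tt)
 let ?s = "%p. if evenperm p then ?g p else \<ominus> ?g p"
 have "ring_det R w a = (++p:?E \<union> ?O. ?s p)"
 unfolding ring_det_def by (rule arg_cong[of _ _ "finsum R _"]) auto
 also have "... = (++p:?E. ?s p) +: (++p:?O. ?s p)" using fin gc by (intro finsum_Un_disjoint) auto
 also have "(++p:?O. ?s p) = (++p:?E. ?s (p \<circ> ?t))"
 unfolding bij[symmetric] using gc' by (intro finsum_reindex[OF _ inj]) auto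
 also have "... = (++p:?E. \<ominus> ?s p)" using gc par gt by (intro finsum_cong') auto
 also have "(++p:?E. ?s p) +: (++p:?E. \<ominus> ?s p) = (++p:?E. ?s p +: \<ominus> ?s p)"
 using gc by (intro finsum_addf[symmetric]) auto
 also have "... = (++p:?E. 0:)" using gc by (intro finsum_cong') (auto simp: r_neg)
 finally show ?thesis by simp
qed

text \<open>Multilinearity in the rows for a matrix product: each row chooses a row
  \<open>rh i\<close> of the second factor. Maps \<open>rh\<close> that are not injective are kept;
  their determinants have two equal rows.\<close>

lemma det_row_expansion:
 assumes w: "!!i r. i < w ==> r < w ==> x i r :.R" and b: "!!i j. i < w ==> j < w ==> b i j :.R"
 shows "ring_det R w (%i j. ++r:{..<w}. x i r**b r j) =
 (++rh:({..<w} \<rightarrow>\<^sub>E {..<w}). (\<Otimes>i\<in>{..<w}. x i (rh i))**ring_det R w (%i j. b (rh i) j))"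
proof -
 let ?E = "{..<w} \<rightarrow>\<^sub>E {..<w}" and ?P = "{p. p permutes {..<w}}"
 have fin: "finite ?E" "finite ?P" by (simp_all add: finite_PiE finite_permutations)
 let ?X = "%rh. \<Otimes>i\<in>{..<w}. x i (rh i)" and ?B = "%rh p. \<Otimes>i\<in>{..<w}. b (rh i) (p i)"
 let ?s = "%p z. if evenperm p then z else \<ominus> z"
 have pw: "p i < w" if "p : ?P" "i < w" for p i using that permutes_in_image[of p "{..<w}"] by auto
 have rhw: "rh i < w" if "rh : ?E" "i < w" for rh i using that by (auto simp: PiE_iff)
 have X: "?X rh :.R" if "rh : ?E" for rh using w rhw[OF that] by (intro finprod_closed) auto
 have B: "?B rh p :.R" if "rh : ?E" "p : ?P" for rh p using b rhw[OF that(1)] pw[OF that(2)] by (intro finprod_closed) auto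
 have "ring_det R w (%i j. ++r:{..<w}. x i r**b r j) = (++p:?P. ++rh:?E. ?X rh**?s p (?B rh p))"
 unfolding ring_det_def
 proof (rule finsum_cong')
 show "(%p. ++rh:?E. ?X rh**?s p (?B rh p)) : ?P \<rightarrow> car R" using X B by (auto intro!: finsum_closed)
 fix p assume p: "p : ?P"
 have "(\<Otimes>i\<in>{..<w}. ++r:{..<w}. x i r**b r (p i)) = (++rh:?E. \<Otimes>i\<in>{..<w}. x i (rh i)**b (rh i) (p i))"
 using w b pw[OF p] by (intro finprod_finsum) auto
 also have "... = (++rh:?E. ?X rh**?B rh p)"
 proof (rule finsum_cong')
 fix rh assume "rh : ?E"
 thus "(\<Otimes>i\<in>{..<w}. x i (rh i)**b (rh i) (p i)) = ?X rh**?B rh p"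
 using w b pw[OF p] rhw by (intro finprod_multf) auto
 qed (use X B p in auto)
 finally have e: "(\<Otimes>i\<in>{..<w}. ++r:{..<w}. x i r**b r (p i)) = (++rh:?E. ?X rh**?B rh p)" .
 have n: "\<ominus> (++rh:?E. ?X rh**?B rh p) = (++rh:?E. ?X rh**\<ominus> ?B rh p)"
 proof -
 have "(++rh:?E. ?X rh**\<ominus> ?B rh p) = (++rh:?E. \<ominus> 1:**(?X rh**?B rh p))"
 using X B p by (intro finsum_cong') (auto simp: l_minus r_minus)
 also have "... = \<ominus> 1:**(++rh:?E. ?X rh**?B rh p)"
 using X B p fin by (intro finsum_rdistr[symmetric]) auto
 finally show ?thesis using X B p by (simp add: l_minus finsum_closed)
 qed
 show "?s p (\<Otimes>i\<in>{..<w}. ++r:{..<w}. x i r**b r (p i)) = (++rh:?E. ?X rh**?s p (?B rh p))"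
 unfolding e by (simp add: n)
 qed simp
 also have "... = (++rh:?E. ++p:?P. ?X rh**?s p (?B rh p))" using X B fin by (intro finsum_swap) auto
 also have "... = (++rh:?E. ?X rh**ring_det R w (%i j. b (rh i) j))"
 proof (rule finsum_cong')
 show "(%rh. ?X rh**ring_det R w (%i j. b (rh i) j)) : ?E \<rightarrow> car R"
 using X b rhw by (auto intro!: m_closed det_closed)
 fix rh assume r: "rh : ?E"
 show "(++p:?P. ?X rh**?s p (?B rh p)) = ?X rh**ring_det R w (%i j. b (rh i) j)"
 unfolding ring_det_def using X[OF r] B[OF r] fin by (intro finsum_rdistr[symmetric]) auto
 qed simp
 finally show ?thesis .
qed

end

lemma ring_det_hom:
 assumes R: "cring R" and S: "cring S" and f: "f : ring_hom R S" and a: "!!i j. i < w ==> j < w ==> a i j :.R"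
 shows "f (ring_det R w a) = ring_det S w (%i j. f (a i j))"
proof -
 interpret R: cring R by fact
 interpret S: cring S by fact
 interpret h: ring_hom_cring R S f by unfold_locales (rule f)
 have t: "(\<Otimes>.R i\<in>{..<w}. a i (p i)) :.R" if "p permutes {..<w}" for p using R.det_term_closed[OF that] a by blast
 have pw: "p i < w" if "p permutes {..<w}" "i < w" for p i using that permutes_in_image[of p "{..<w}"] by auto
 have "f (ring_det R w a) = (++.S p:{p. p permutes {..<w}}. f (if evenperm p then \<Otimes>.R i\<in>{..<w}. a i (p i) else \<ominus>.R (\<Otimes>.R i\<in>{..<w}. a i (p i))))"
 unfolding ring_det_def using t by (subst h.hom_finsum) (auto simp: comp_def)
 also have "... = ring_det S w (%i j. f (a i j))"
 unfolding ring_det_def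
 proof (rule S.finsum_cong')
 show "(%p. if evenperm p then \<Otimes>.S i\<in>{..<w}. f (a i (p i)) else \<ominus>.S (\<Otimes>.S i\<in>{..<w}. f (a i (p i)))) : {p. p permutes {..<w}} \<rightarrow> car S"
 using a pw by (auto intro!: S.finprod_closed)
 fix p assume "p : {p. p permutes {..<w}}"
 hence p: "p permutes {..<w}" by simp
 have "f (\<Otimes>.R i\<in>{..<w}. a i (p i)) = (\<Otimes>.S i\<in>{..<w}. f (a i (p i)))"
 using a pw[OF p] by (subst h.hom_finprod) (auto simp: comp_def)
 thus "f (if evenperm p then \<Otimes>.R i\<in>{..<w}. a i (p i) else \<ominus>.R (\<Otimes>.R i\<in>{..<w}. a i (p i))) =
 (if evenperm p then \<Otimes>.S i\<in>{..<w}. f (a i (p i)) else \<ominus>.S (\<Otimes>.S i\<in>{..<w}. f (a i (p i))))"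
 using t[OF p] by (simp add: h.hom_a_inv)
 qed simp
 finally show ?thesis .
qed

section \<open>Reflexive hulls\<close>

text \<open>Under the hypotheses every linear form on \<open>I\<close> is multiplication by c/d for
  some c in the ring. So the dual of \<open>I\<close> is free of rank one on 1/d, a form on this
  dual is determined by its value there, and the inclusion of \<open>I\<close>, being d times 1/d,
  takes as values all multiples of \<open>d\<close>.\<close>

lemma (in domain) reflexive_hull_principal:
 assumes I: "ideal I R" and d: "d :.R" "d ~= 0:" and Id: "!!x. x : I ==> EX c:car R. x = d**c"
 and nz: "x0 : I" "x0 ~= 0:"
 and hom: "!!f. f : module_hom R (ideal_module R I) (with_smult R (\<otimes>)) ==> EX c:car R. ALL x:I. d**f x = c**x"
 shows "reflexive_hull R I = PIdl d"
proof -
 interpret I: ideal I R by fact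
 have Ic: "x :.R" if "x : I" for x using that I.Icarr by blast
 have H: "f : module_hom R (ideal_module R I) (with_smult R (\<otimes>)) \<longleftrightarrow> f : I \<rightarrow>\<^sub>E car R &
 (ALL x:I. ALL y:I. f (x +: y) = f x +: f y) & (ALL c:car R. ALL x:I. f (c**x) = c**f x)" for f
 by (simp add: module_hom_def ideal_module_def with_smult_def)
 define quo where "quo x = (THE c. c :.R & x = d**c)" for x
 have quo: "quo x :.R" "d**quo x = x" if "x : I" for x
 proof -
 have "EX! c. c :.R & x = d**c" using Id[OF that] d m_lcancel by blast
 from theI'[OF this] show "quo x :.R" "d**quo x = x" by (auto simp: quo_def)
 qed
 have quo_eq: "quo x = c" if "x : I" "c :.R" "x = d**c" for x c using quo[OF that(1)] that d m_lcancel by metis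
 \<comment> \<open>\<open>F c\<close> is multiplication by c/d, written with exact quotients by
   \<open>d\<close>.\<close>
 define F where "F c = (\<lambda>x\<in>I. c**quo x)" for c
 have q_add: "quo (x +: y) = quo x +: quo y" if "x : I" "y : I" for x y
 using that quo d by (intro quo_eq) (auto simp: r_distr)
 have q_mult: "quo (c**x) = c**quo x" if "c :.R" "x : I" for x c
 using that quo[OF that(2)] d I.I_l_closed[OF that(2,1)] by (intro quo_eq) (auto simp: m_lcomm[of d])
 have F: "F c : module_hom R (ideal_module R I) (with_smult R (\<otimes>))" if "c :.R" for c
 unfolding H F_def using that quo I.I_l_closed by (auto simp: q_add q_mult r_distr m_lcomm)
 let ?D = "dual_module R (ideal_module R I)"
 have carD: "car ?D = F ` car R"
 proof
 show "F ` car R <= car ?D" using F by (auto simp: dual_module_def)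
 show "car ?D <= F ` car R"
 proof
 fix f assume "f : car ?D"
 hence f: "f : module_hom R (ideal_module R I) (with_smult R (\<otimes>))" by (simp add: dual_module_def)
 obtain c where c: "c :.R" "ALL x:I. d**f x = c**x" using hom[OF f] by blast
 have fE: "f : I \<rightarrow>\<^sub>E car R" using f H by blast
 have "f x = c**quo x" if x: "x : I" for x
 proof -
 have "d**f x = d**(c**quo x)" using c x quo[OF x] d by (simp add: m_lcomm)
 thus ?thesis using m_lcancel d c quo[OF x] fE x by (metis PiE_mem m_closed)
 qed
 hence "f = F c" using fE by (auto simp: F_def PiE_def extensional_def fun_eq_iff)
 thus "f : F ` car R" using c by blast
 qed
 qed
 have q0: "quo x0 ~= 0:" using quo[OF nz(1)] nz d by auto
 have F_inj: "F c = F c' ==> c = c'" if "c :.R" "c' :.R" for c c'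
 proof -
 assume "F c = F c'"
 hence "c**quo x0 = c'**quo x0" using nz(1) by (metis F_def restrict_apply')
 thus ?thesis using m_rcancel q0 quo[OF nz(1)] that by metis
 qed
 have D_ops: "F c +:.(?D) F c' = F (c +: c')" "k *:.(?D) F c = F (k**c)" if "c :.R" "c' :.R" "k :.R" for c c' k
 using that quo by (auto simp: dual_module_def ideal_module_def F_def fun_eq_iff l_distr m_assoc)
 have incl: "(\<lambda>x\<in>I. x) = F d" using quo by (auto simp: F_def fun_eq_iff)
 have H2: "vp : car (dual_module R ?D) \<longleftrightarrow> vp : F ` car R \<rightarrow>\<^sub>E car R &
 (ALL x:car R. ALL y:car R. vp (F (x +: y)) = vp (F x) +: vp (F y)) & (ALL c:car R. ALL x:car R. vp (F (c**x)) = c**vp (F x))" for vp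
 unfolding dual_module_def[of R ?D] module_hom_def carD with_smult_def
 using D_ops by auto
 show ?thesis
 proof
 show "reflexive_hull R I <= PIdl d"
 proof
 fix y assume "y : reflexive_hull R I"
 then obtain vp where p: "vp :.(dual_module R ?D)" "y = vp (F d)" by (auto simp: reflexive_hull_def incl)
 have "vp (F (d**1:)) = d**vp (F 1:)" using p(1) d unfolding H2 by blast
 moreover have "vp (F 1:) :.R" using p(1) unfolding H2 by blast
 ultimately have "y = vp (F 1:)**d" "vp (F 1:) :.R" using p(2) d by (simp_all add: m_comm)
 thus "y : PIdl d" unfolding cgenideal_def by blast
 qed
 show "PIdl d <= reflexive_hull R I"
 proof
 fix y assume "y : PIdl d"
 then obtain z where z: "z :.R" "y = z**d" by (auto simp: cgenideal_def)
 define vp where "vp = (\<lambda>f\<in>F ` car R. (THE c. c :.R & f = F c)**z)"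
 have vp: "vp (F c) = c**z" if "c :.R" for c
 proof -
 have "(THE c'. c' :.R & F c = F c') = c" using that F_inj by blast
 thus ?thesis using that by (simp add: vp_def)
 qed
 have "vp :.(dual_module R ?D)"
 unfolding H2 using z vp by (auto simp: vp l_distr m_assoc) (simp add: vp_def)
 moreover have "y = vp (\<lambda>x\<in>I. x)" unfolding incl using vp[OF d(1)] z d by (simp add: m_comm)
 ultimately show "y : reflexive_hull R I" unfolding reflexive_hull_def by blast
 qed
 qed
qed

section \<open>Localization at the center\<close>

lemma field_with_smult: assumes "field A" shows "field (with_smult A s)"
proof -
 interpret A: field A by fact
 interpret B: ring "with_smult A s" by (rule ring_with_smult[OF A.ring_axioms])
 have o: "car (with_smult A s) = car A" "(\<otimes>.(with_smult A s)) = (\<otimes>.A)" "1:.(with_smult A s) = 1:.A" "0:.(with_smult A s) = 0:.A"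
 by (simp_all add: with_smult_def)
 have "cring (with_smult A s)"
 by (intro cring.intro B.ring_axioms comm_monoid.intro comm_monoid_axioms.intro B.monoid_axioms) (simp add: o A.m_comm)
 thus ?thesis
 proof (rule cring.cring_fieldI2)
 fix a assume a: "a :.(with_smult A s)" "a ~= 0:.(with_smult A s)"
 hence "a : Units A" using A.field_Units by (simp add: o)
 thus "EX b:car (with_smult A s). a**.(with_smult A s) b = 1:.(with_smult A s)"
 unfolding o by (intro bexI[of _ "inv\<^bsub>A\<^esub> a"]) auto
 qed (simp add: o)
qed

locale noncomm_domain = W?: ring W for W :: "('b, 'x) ring_scheme" (structure) +
 assumes one_nz: "1: ~= 0:" and integral: "x :.W ==> y :.W ==> x**y = 0: ==> x = 0: | y = 0:"
begin

abbreviation Z where "Z == center W"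

lemma Z_ops: "car Z = {z. central_elt W z}" "(\<otimes>.Z) = (\<otimes>)" "1:.Z = 1:" "0:.Z = 0:" "(\<oplus>.Z) = (\<oplus>)"
 by (simp_all add: center_def)

lemma Z_iff: "z : car Z \<longleftrightarrow> z :.W & (ALL x:car W. z**x = x**z)"
 by (simp add: Z_ops central_elt_def)

lemma Z_car: "z :.Z ==> z :.W" and Z_comm: "z :.Z ==> x :.W ==> z**x = x**z"
 by (simp_all add: Z_iff)

lemma Z_closed: "1: :.Z" "0: :.Z" "z :.Z ==> y :.Z ==> z**y :.Z"
 "z :.Z ==> y :.Z ==> z +: y :.Z" "z :.Z ==> \<ominus> z :.Z"
proof -
 show "z**y :.Z" if "z :.Z" "y :.Z"
 using that unfolding Z_iff by (metis m_assoc m_closed)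
qed (auto simp: Z_iff l_distr r_distr l_minus r_minus)

lemma Z_domain: "domain Z"
proof -
 have mon: "Group.monoid Z"
 proof (rule monoidI)
 fix x y z assume "x :.Z" "y :.Z" "z :.Z"
 thus "x**.Z y**.Z z = x**.Z (y**.Z z)" using m_assoc[OF Z_car Z_car Z_car] by (simp only: Z_ops(2))
 qed (simp_all add: Z_ops(2,3) Z_closed Z_car)
 show ?thesis
proof (intro domain.intro cring.intro ringI comm_monoid.intro comm_monoid_axioms.intro domain_axioms.intro)
 show ag: "abelian_group Z"
 proof (rule abelian_groupI)
 show "EX y:car Z. y +:.Z x = 0:.Z" if "x :.Z" for x
 using that Z_closed(5)[OF that] Z_car[OF that] by (intro bexI[of _ "\<ominus> x"]) (auto simp: Z_ops(4,5) l_neg)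
 qed (use Z_closed Z_car in \<open>auto simp: Z_ops(2-5) a_ac\<close>)
 show "Group.monoid Z" "Group.monoid Z" by (rule mon)+
 show "1:.Z ~= 0:.Z" using one_nz by (simp add: Z_ops)
qed (use Z_car Z_comm integral in \<open>auto simp: Z_ops(2-5) l_distr r_distr\<close>)
qed

end

locale center_localization = noncomm_domain
begin

sublocale Z: domain Z by (rule Z_domain)

abbreviation S where "S == car Z - {0:.Z}"

sublocale C: central_fractions W S
proof
 show "S <= car W" using Z_car by blast
 show "1: : S" using Z_closed one_nz by (simp add: Z_ops)
 show "b**d : S" if "b : S" "d : S" for b d
 using that Z_closed(3) integral[OF Z_car Z_car] by (auto simp: Z_ops(4))
 show "b**x = x**b" if "b : S" "x :.W" for b x using that Z_comm by blast
 show "x = 0:" if "b : S" "x :.W" "b**x = 0:" for b x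
 using that integral[OF Z_car, of b x] by (auto simp: Z_ops(4))
qed

sublocale CZ: central_fractions Z S using Z.fraction_field(1) .

abbreviation F where "F == center_field W"
abbreviation oc where "oc == over_center W"

lemma F_ops: "car F = car CZ.Q" "(\<otimes>.F) = (\<otimes>.CZ.Q)" "1:.F = 1:.CZ.Q" "0:.F = 0:.CZ.Q" "(\<oplus>.F) = (\<oplus>.CZ.Q)"
 "z *:.F f = CZ.fr z 1:**.CZ.Q f"
 by (simp_all add: fraction_field_def with_smult_def fraction_ring_eq fraction_eq Z_ops(3))

sublocale F: field F
 unfolding fraction_field_def by (rule field_with_smult[OF Z.fraction_field(2)])

lemma oc_ops: "car oc = car W" "(\<otimes>.oc) = (\<otimes>)" "1:.oc = 1:" "0:.oc = 0:" "(\<oplus>.oc) = (\<oplus>)" "(\<odot>.oc) = (\<otimes>)"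
 by (simp_all add: over_center_def with_smult_def)

lemma emb_hom: "CZ.fr z 1: :.F" if "z :.Z" for z
 using that CZ.S_one by (simp add: F_ops(1) Z_ops(3))

lemma emb_ring_hom: "(%z. CZ.fr z 1:) : ring_hom Z F"
 using CZ.fr_embedding(1) unfolding ring_hom_def by (simp add: F_ops(1-5) Z_ops(3))

lemma oc_algebra: "assoc_algebra Z oc"
proof -
 interpret O: ring oc unfolding over_center_def by (rule ring_with_smult[OF W.ring_axioms])
 have c: "x :.W ==> z :.Z ==> x**(z**y) = z**(x**y)" if "y :.W" for x y z
 using Z_comm Z_car that by (metis m_assoc)
 have 1: "a**x :.W" if "a :.Z" "x :.W" for a x using that Z_car by simp
 have 2: "(a +: b)**x = a**x +: b**x" "a**b**x = a**(b**x)" if "a :.Z" "b :.Z" "x :.W" for a b x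
 using that Z_car l_distr m_assoc by simp_all
 have 3: "a**(x +: y) = a**x +: a**y" "a**x**y = a**(x**y)" if "a :.Z" "x :.W" "y :.W" for a x y
 using that Z_car r_distr m_assoc by simp_all
 show ?thesis
 by (intro assoc_algebra.intro module.intro assoc_algebra_axioms.intro module_axioms.intro Z.is_cring O.is_abelian_group O.ring_axioms;
 unfold oc_ops Z_ops(2-5); (rule 1 2 3 c l_one; assumption))
qed

lemma F_algebra: "assoc_algebra Z F"
proof -
 have e: "CZ.fr (x**y) 1: = CZ.fr x 1:**.F CZ.fr y 1:" "CZ.fr (x +: y) 1: = CZ.fr x 1: +:.F CZ.fr y 1:"
 if "x :.Z" "y :.Z" for x y
 using emb_ring_hom that unfolding ring_hom_def by (auto simp: Z_ops(2,5))
 have o: "CZ.fr 1: 1: = 1:.F" by (simp add: F_ops(3) CZ.Q_consts Z_ops(3))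
 have s: "z *:.F f = CZ.fr z 1:**.F f" for z f by (simp add: F_ops(2,6))
 show ?thesis
 by (intro assoc_algebra.intro module.intro assoc_algebra_axioms.intro module_axioms.intro Z.is_cring F.is_abelian_group F.ring_axioms)
 (simp_all add: s Z_ops(2,3,5) e o emb_hom F.l_distr F.r_distr F.m_ac)
qed

sublocale oc: assoc_algebra Z oc by (rule oc_algebra)
sublocale FA: assoc_algebra Z F by (rule F_algebra)

sublocale M: monoid_alg Z "oc \<times>\<times> F"
 by (intro monoid_alg.intro Z.is_cring DirProd_monoid oc.monoid_axioms F.monoid_axioms)

abbreviation SA where "SA == monoid_algebra Z (oc \<times>\<times> F)"
abbreviation TI where "TI == Idl\<^bsub>SA\<^esub> (tensor_relations Z oc F)"
abbreviation T where "T == tensor Z oc F"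
abbreviation pt where "pt == pure_tensor Z oc F"

lemma car: "x :.W ==> f :.F ==> (x, f) :.(oc \<times>\<times> F)"
 by (simp add: oc_ops)

lemma be: "x :.W ==> f :.F ==> basis_elt Z (x, f) :.SA"
 using M.basis_elt_closed[OF car] .

lemma tensor_relations_cases:
 assumes "r : tensor_relations Z oc F"
 obtains x y f where "x :.W" "y :.W" "f :.F"
 "r = basis_elt Z (x +: y, f) \<ominus>.SA (basis_elt Z (x, f) +:.SA basis_elt Z (y, f))"
 | x f g where "x :.W" "f :.F" "g :.F"
 "r = basis_elt Z (x, f +:.F g) \<ominus>.SA (basis_elt Z (x, f) +:.SA basis_elt Z (x, g))"
 | z x f where "z :.Z" "x :.W" "f :.F"
 "r = basis_elt Z (z**x, f) \<ominus>.SA z *:.SA basis_elt Z (x, f)"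
 | z x f where "z :.Z" "x :.W" "f :.F"
 "r = basis_elt Z (x, z *:.F f) \<ominus>.SA z *:.SA basis_elt Z (x, f)"
 using assms unfolding tensor_relations_def Let_def oc_ops
 apply (elim UnE CollectE exE conjE)
 subgoal by (rule that(1))
 subgoal by (rule that(2))
 subgoal by (rule that(3))
 subgoal by (rule that(4))
 done

lemma relations_closed: "tensor_relations Z oc F <= car SA"
proof
 fix r assume "r : tensor_relations Z oc F"
 thus "r :.SA"
 by (cases rule: tensor_relations_cases) (simp_all add: be Z_car)
qed

sublocale Tq: quot_alg Z SA TI
 by (intro quot_alg.intro M.S.assoc_algebra_axioms M.S.genideal_ideal relations_closed)

lemma T_eq: "T = Tq.Q" by (simp add: tensor_def Let_def)
lemma pt_eq: "pt x f = Tq.pr (basis_elt Z (x, f))" by (simp add: pure_tensor_def Let_def)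

sublocale T: assoc_algebra Z T unfolding T_eq by (rule Tq.Q_assoc_algebra)

lemma pt_closed [simp]: "x :.W ==> f :.F ==> pt x f :.T"
 using be by (auto simp: pt_eq T_eq Tq.carrier_Q)

lemma pr_rel: "a :.SA ==> b :.SA ==> a \<ominus>.SA b : tensor_relations Z oc F ==> Tq.pr a = Tq.pr b"
 unfolding Tq.pr_eq_iff using M.S.genideal_self[OF relations_closed] by blast

lemma relI:
 "x :.W ==> y :.W ==> f :.F ==>
 basis_elt Z (x +: y, f) \<ominus>.SA (basis_elt Z (x, f) +:.SA basis_elt Z (y, f)) : tensor_relations Z oc F"
 "x :.W ==> f :.F ==> g :.F ==>
 basis_elt Z (x, f +:.F g) \<ominus>.SA (basis_elt Z (x, f) +:.SA basis_elt Z (x, g)) : tensor_relations Z oc F"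
 "z :.Z ==> x :.W ==> f :.F ==>
 basis_elt Z (z**x, f) \<ominus>.SA z *:.SA basis_elt Z (x, f) : tensor_relations Z oc F"
 "z :.Z ==> x :.W ==> f :.F ==>
 basis_elt Z (x, z *:.F f) \<ominus>.SA z *:.SA basis_elt Z (x, f) : tensor_relations Z oc F"
 unfolding tensor_relations_def Let_def oc_ops
 apply (rule UnI1, rule UnI1, rule UnI1, blast)
 apply (rule UnI1, rule UnI1, rule UnI2, blast)
 apply (rule UnI1, rule UnI2, blast)
 apply (rule UnI2, blast)
 done

lemma pt_add_left:
 assumes "x :.W" "y :.W" "f :.F" shows "pt (x +: y) f = pt x f +:.T pt y f"
proof -
 have "Tq.pr (basis_elt Z (x +: y, f)) = Tq.pr (basis_elt Z (x, f) +:.SA basis_elt Z (y, f))"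
 by (rule pr_rel[OF _ _ relI(1)]) (use assms be in auto)
 thus ?thesis unfolding pt_eq T_eq using assms be by (simp add: Tq.pr_add)
qed

lemma pt_add_right:
 assumes "x :.W" "f :.F" "g :.F" shows "pt x (f +:.F g) = pt x f +:.T pt x g"
proof -
 have "Tq.pr (basis_elt Z (x, f +:.F g)) = Tq.pr (basis_elt Z (x, f) +:.SA basis_elt Z (x, g))"
 by (rule pr_rel[OF _ _ relI(2)]) (use assms be in auto)
 thus ?thesis unfolding pt_eq T_eq using assms be by (simp add: Tq.pr_add)
qed

lemma pt_smult:
 assumes "x :.W" "f :.F" "z :.Z"
 shows "pt (z**x) f = z *:.T pt x f" "pt x (CZ.fr z 1:**.F f) = z *:.T pt x f"
proof -
 have c: "z *:.F f :.F" "z**x :.W" using assms Z_car by auto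
 have s: "z *:.SA basis_elt Z (x, f) :.SA" using be[OF assms(1,2)] assms(3) by simp
 have "Tq.pr (basis_elt Z (z**x, f)) = Tq.pr (z *:.SA basis_elt Z (x, f))"
 by (rule pr_rel[OF be[OF c(2) assms(2)] s relI(3)[OF assms(3,1,2)]])
 thus "pt (z**x) f = z *:.T pt x f" unfolding pt_eq T_eq using assms be by (simp add: Tq.pr_smult)
 have "Tq.pr (basis_elt Z (x, z *:.F f)) = Tq.pr (z *:.SA basis_elt Z (x, f))"
 by (rule pr_rel[OF be[OF assms(1) c(1)] s relI(4)[OF assms(3,1,2)]])
 moreover have "CZ.fr z 1:**.F f = z *:.F f" by (simp add: F_ops(2,6))
 ultimately show "pt x (CZ.fr z 1:**.F f) = z *:.T pt x f" unfolding pt_eq T_eq using assms be by (simp add: Tq.pr_smult)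
qed

lemma pt_mult:
 assumes "x :.W" "y :.W" "f :.F" "g :.F"
 shows "pt x f**.T pt y g = pt (x**y) (f**.F g)"
 unfolding pt_eq T_eq using assms be M.basis_elt_mult[OF car car] by (simp add: Tq.pr_mult oc_ops)

lemma pt_one: "pt 1: 1:.F = 1:.T"
 unfolding pt_eq T_eq Tq.pr_one M.basis_elt_one[symmetric] by (simp add: oc_ops)

lemma pt_zero: "f :.F ==> pt 0: f = 0:.T"
 using pt_add_left[of \<zero> \<zero> f] T.add.r_cancel_one'[of "pt 0: f" "pt 0: f"] by simp

lemma pt_finsum:
 assumes "finite A" "!!i. i : A ==> x i :.W" "f :.F"
 shows "pt (++i:A. x i) f = (++.T i:A. pt (x i) f)"
 using assms
proof (induction A rule: finite_induct)
 case empty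
 thus ?case by (simp add: pt_zero)
next
 case (insert a A)
 have "pt (++i:insert a A. x i) f = pt (x a +: (++i:A. x i)) f" using insert by (subst finsum_insert) auto
 also have "... = pt (x a) f +:.T (++.T i:A. pt (x i) f)"
 using insert by (subst pt_add_left) (auto intro!: finsum_closed)
 finally show ?case using insert by (subst T.finsum_insert) auto
qed

abbreviation V where "V == localized W"

lemma V_ops: "car V = car T" "(\<otimes>.V) = (\<otimes>.T)" "0:.V = 0:.T" "(\<oplus>.V) = (\<oplus>.T)" "f *:.V x = pt 1: f**.T x"
 by (simp_all add: localized_def Let_def with_smult_def)

lemma V_module: "module F V"
proof -
 interpret V: ring V unfolding localized_def Let_def by (rule ring_with_smult[OF T.ring_axioms])
 show ?thesis
 proof (intro module.intro module_axioms.intro F.is_cring V.is_abelian_group)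
 fix f g x assume a: "f :.F" "g :.F" "x :.V"
 have "pt 1: (f**.F g) = pt 1: f**.T pt 1: g" using a pt_mult[of \<one> \<one> f g] by simp
 thus "(f**.F g) *:.V x = f *:.V (g *:.V x)" using a by (simp add: V_ops T.m_assoc)
 qed (simp_all add: V_ops pt_one pt_add_right T.l_distr T.r_distr)
qed

sublocale V: vspace F V by (intro vspace.intro F.field_axioms V_module)

lemma finsum_V: "finsum V = finsum T"
 unfolding finsum_def finprod_def by (simp add: V_ops fun_eq_iff)

text \<open>Elements of a quotient of a free module are hard to tell apart. A homomorphism to
  concrete fractions separates them: it is what turns a linear relation in the tensor product into
  an equation between elements of the algebra.\<close>

lemma to_fractions:
 "EX Th:alg_hom Z T (with_smult C.Q (%z p. C.fr z 1:**.C.Q p)).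
 ALL x:car W. ALL z:car Z. ALL d:S. Th (pt x (CZ.fr z d)) = C.fr (x**z) d"
proof -
 let ?Q = "with_smult C.Q (%z p. C.fr z 1:**.C.Q p)"
 have o: "car ?Q = car C.Q" "(\<otimes>.(?Q)) = (\<otimes>.C.Q)" "1:.(?Q) = 1:.C.Q" "0:.(?Q) = 0:.C.Q" "(\<oplus>.(?Q)) = (\<oplus>.C.Q)"
 "z *:.(?Q) f = C.fr z 1:**.C.Q f" for z f by (simp_all add: with_smult_def)
 interpret Q: ring C.Q by (rule C.Q_ring)
 interpret Q': ring ?Q by (rule ring_with_smult[OF C.Q_ring])
 have one: "C.fr 1: 1: = 1:.C.Q" by (simp add: C.Q_consts)
 have m: "C.fr (x**y) 1: = C.fr x 1:**.C.Q C.fr y 1:" "C.fr (x +: y) 1: = C.fr x 1: +:.C.Q C.fr y 1:"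
 if "x :.W" "y :.W" for x y
 using that C.S_one by (simp_all add: C.fr_mult C.fr_add_same)
 have zc: "C.fr z 1:**.C.Q p = p**.C.Q C.fr z 1:" if z: "z :.Z" and p: "p :.C.Q" for z p
 proof -
 obtain x b where x: "x :.W" "b : S" "p = C.fr x b" using C.Q_cases[OF p] .
 show ?thesis unfolding x(3) C.fr_mult[OF Z_car[OF z] x(1) C.S_one x(2)] C.fr_mult[OF x(1) Z_car[OF z] x(2) C.S_one]
 using x(1,2) Z_comm[OF z x(1)] C.S_car[OF x(2)] by simp
 qed
 have zcl: "C.fr z 1: :.C.Q" if "z :.Z" for z using C.fr_closed[OF Z_car[OF that] C.S_one] .
 have Qalg: "assoc_algebra Z ?Q"
 proof (intro assoc_algebra.intro module.intro assoc_algebra_axioms.intro module_axioms.intro Z.is_cring Q'.is_abelian_group Q'.ring_axioms)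
 fix z x y assume "z :.Z" "x : car ?Q" "y : car ?Q"
 thus "x**.(?Q) (z *:.(?Q) y) = z *:.(?Q) (x**.(?Q) y)"
 using zc[of z x] zcl[of z] by (simp add: o flip: Q.m_assoc)
 qed (simp_all add: o Z_ops(2,3,5) Z_car m one zcl Q.l_distr Q.r_distr Q.m_assoc)
 \<comment> \<open>The fraction field of the center mapped to fractions of the algebra by reading
   the same numerator and denominator; \<open>io\<close> as proved next shows that the chosen
   representatives do not matter.\<close>
 define io where "io f = (SOME p. EX z d. z :.Z & d : S & f = CZ.fr z d & p = C.fr z d)" for f
 have io: "io (CZ.fr z d) = C.fr z d" if zd: "z :.Z" "d : S" for z d
 proof -
 have "EX p z' d'. z' :.Z & d' : S & CZ.fr z d = CZ.fr z' d' & p = C.fr z' d'" using zd by blast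
 from someI_ex[OF this] obtain z' d' where z': "z' :.Z" "d' : S" "CZ.fr z d = CZ.fr z' d'" "io (CZ.fr z d) = C.fr z' d'"
 unfolding io_def[symmetric] by blast
 have "z**d' = z'**d" using z'(3) CZ.fr_eq_iff[OF zd(1) z'(1) zd(2) z'(2)] by (simp add: Z_ops(2))
 thus ?thesis unfolding z'(4) using C.fr_eq_iff[OF Z_car[OF zd(1)] Z_car[OF z'(1)] zd(2) z'(2)] by simp
 qed
 have Fc: "EX z d. z :.Z & d : S & f = CZ.fr z d" if "f :.F" for f
 proof -
 have "f :.CZ.Q" using that by (simp only: F_ops(1))
 thus ?thesis by (rule CZ.Q_cases) (intro exI conjI; assumption)
 qed
 have ioc: "io f :.C.Q" if "f :.F" for f using Fc[OF that] io C.fr_closed Z_car by metis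
 have iom: "io (f**.F g) = io f**.C.Q io g" and ioa: "io (f +:.F g) = io f +:.C.Q io g"
 and iox: "x :.W ==> io f**.C.Q C.fr x 1: = C.fr x 1:**.C.Q io f"
 if f: "f :.F" and g: "g :.F" for f g x
 proof -
 obtain z d where z: "z :.Z" "d : S" "f = CZ.fr z d" using Fc[OF f] by blast
 obtain y e where y: "y :.Z" "e : S" "g = CZ.fr y e" using Fc[OF g] by blast
 have cl: "z**y :.Z" "d**e : S" "z**e +: y**d :.Z"
 by (rule Z_closed(3)[OF z(1) y(1)], rule C.S_mult[OF z(2) y(2)],
 rule Z_closed(4)[OF Z_closed(3)[OF z(1) DiffD1[OF y(2)]] Z_closed(3)[OF y(1) DiffD1[OF z(2)]]])
 show "io (f**.F g) = io f**.C.Q io g"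
 using CZ.fr_mult[OF z(1) y(1) z(2) y(2)] C.fr_mult[OF Z_car[OF z(1)] Z_car[OF y(1)] z(2) y(2)] io[OF z(1,2)] io[OF y(1,2)] io[OF cl(1,2)]
 by (simp add: z(3) y(3) F_ops(2) Z_ops(2))
 show "io (f +:.F g) = io f +:.C.Q io g"
 using CZ.fr_add[OF z(1) y(1) z(2) y(2)] C.fr_add[OF Z_car[OF z(1)] Z_car[OF y(1)] z(2) y(2)] io[OF z(1,2)] io[OF y(1,2)] io[OF cl(3,2)]
 by (simp add: z(3) y(3) F_ops(5) Z_ops(2,5))
 show "io f**.C.Q C.fr x 1: = C.fr x 1:**.C.Q io f" if "x :.W"
 using that z C.S_one Z_car[OF z(1)] Z_comm[OF z(1) that] by (simp add: io[OF z(1,2)] z(3) C.fr_mult)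
 qed
 define mu where "mu = (%(x, f). C.fr x 1:**.C.Q io f)"
 have xc: "C.fr x 1: :.C.Q" if "x :.W" for x using C.fr_closed[OF that C.S_one] .
 have mu: "mu : hom (oc \<times>\<times> F) ?Q"
 unfolding hom_def
 proof (intro CollectI conjI ballI funcsetI)
 show "mu p : car ?Q" if "p :.(oc \<times>\<times> F)" for p using that xc ioc by (auto simp: mu_def o oc_ops)
 fix p p' assume p: "p :.(oc \<times>\<times> F)" "p' :.(oc \<times>\<times> F)"
 obtain x f where x: "p = (x, f)" "x :.W" "f :.F" using p(1) by (cases p) (auto simp: oc_ops)
 obtain y g where y: "p' = (y, g)" "y :.W" "g :.F" using p(2) by (cases p') (auto simp: oc_ops)
 have "C.fr (x**y) 1:**.C.Q io (f**.F g) = C.fr x 1:**.C.Q (C.fr y 1:**.C.Q io f)**.C.Q io g"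
 using x y xc ioc by (simp add: m iom Q.m_assoc)
 also have "C.fr y 1:**.C.Q io f = io f**.C.Q C.fr y 1:" using iox x y by simp
 also have "C.fr x 1:**.C.Q (io f**.C.Q C.fr y 1:)**.C.Q io g = (C.fr x 1:**.C.Q io f)**.C.Q (C.fr y 1:**.C.Q io g)"
 using x y xc ioc by (simp add: Q.m_assoc)
 finally show "mu (p**.(oc \<times>\<times> F) p') = mu p**.(?Q) mu p'" using x y by (simp add: mu_def o oc_ops)
 qed
 have one_F: "1:.F = CZ.fr 1: 1:" by (simp add: F_ops(3) CZ.Q_consts Z_ops(3))
 have mu1: "mu 1:.(oc \<times>\<times> F) = 1:.(?Q)"
 using io[OF Z_closed(1) C.S_one] by (simp add: mu_def o oc_ops one_F one)
 note LH = M.lift_hom_alg_hom[OF Qalg mu mu1]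
 note LB = M.lift_hom_basis_elt[OF Qalg mu mu1]
 let ?h = "M.lift_hom ?Q mu"
 have kill: "?h r = 0:.(?Q)" if "r : tensor_relations Z oc F" for r
 proof -
 have minus: "?h (a \<ominus>.SA b) = ?h a \<ominus>.(?Q) ?h b" if "a :.SA" "b :.SA" for a b
 using alg_hom_minus[OF LH M.S.ring_axioms Q'.ring_axioms that] .
 have hb: "?h (basis_elt Z (x, f)) = C.fr x 1:**.C.Q io f" if "x :.W" "f :.F" for x f
 using LB[OF car[OF that]] by (simp add: mu_def)
 have z0: "?h (a \<ominus>.SA b) = 0:.(?Q)" if "a :.SA" "b :.SA" "?h a = ?h b" for a b
 using minus[OF that(1,2)] that(3) alg_hom_closed[OF LH that(2)] by (simp add: a_minus_def Q'.r_neg)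
 have sm: "?h (z *:.SA a) = C.fr z 1:**.C.Q ?h a" if "z :.Z" "a :.SA" for z a
 using alg_hom_smult[OF LH that] by (simp add: o)
 have ad: "?h (a +:.SA b) = ?h a +:.C.Q ?h b" if "a :.SA" "b :.SA" for a b
 using alg_hom_add[OF LH that] by (simp add: o)
 have ioz: "io (z *:.F f) = C.fr z 1:**.C.Q io f" if "z :.Z" "f :.F" for z f
 using iom[OF emb_hom[OF that(1)] that(2)] io[OF that(1) C.S_one] by (simp add: F_ops(2,6))
 show ?thesis using that
 proof (cases rule: tensor_relations_cases)
 case (1 x y f)
 show ?thesis unfolding 1(4) using 1(1-3) by (intro z0) (simp_all add: be hb ad m xc ioc Q.l_distr)
 next
 case (2 x f g)
 show ?thesis unfolding 2(4) using 2(1-3) by (intro z0) (simp_all add: be hb ad xc ioa ioc Q.r_distr)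
 next
 case (3 z x f)
 show ?thesis unfolding 3(4) using 3(1-3) by (intro z0) (simp_all add: be hb sm Z_car m xc ioc Q.m_assoc)
 next
 case a: (4 z x f)
 have zf: "z *:.F f :.F" using a by simp
 have "C.fr x 1:**.C.Q (C.fr z 1:**.C.Q io f) = (C.fr x 1:**.C.Q C.fr z 1:)**.C.Q io f"
 using Q.m_assoc[OF xc[OF a(2)] zcl[OF a(1)] ioc[OF a(3)]] by simp
 also have "... = C.fr z 1:**.C.Q (C.fr x 1:**.C.Q io f)"
 unfolding zc[OF a(1) xc[OF a(2)], symmetric] by (rule Q.m_assoc[OF zcl[OF a(1)] xc[OF a(2)] ioc[OF a(3)]])
 finally show ?thesis unfolding a(4)
 using a(1-3) zf be[OF a(2) zf] be[OF a(2,3)] by (intro z0) (simp_all add: hb sm ioz)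
 qed
 qed
 have "TI <= {r : car SA. ?h r = 0:.(?Q)}"
 proof (rule M.S.genideal_minimal)
 interpret hh: ring_hom_ring SA ?Q ?h
 by (intro ring_hom_ringI2 M.S.ring_axioms Q'.ring_axioms alg_hom_ring_hom[OF LH])
 show "ideal {r : car SA. ?h r = 0:.(?Q)} SA" using hh.kernel_is_ideal unfolding a_kernel_def' .
 show "tensor_relations Z oc F <= {r : car SA. ?h r = 0:.(?Q)}" using kill relations_closed by blast
 qed
 hence kI: "?h x = 0:.(?Q)" if "x : TI" for x using that by blast
 have "EX Th:alg_hom Z Tq.Q ?Q. ALL a:car SA. Th (Tq.pr a) = ?h a"
 proof (rule Tq.factor_hom[OF LH Qalg])
 fix ps assume "ps : alg_hom Z Tq.Q ?Q" "!!a. a :.SA ==> ps (Tq.pr a) = ?h a"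
 thus "EX Th:alg_hom Z Tq.Q ?Q. ALL a:car SA. Th (Tq.pr a) = ?h a" by (intro bexI[of _ ps] ballI)
 qed (rule kI)
 then obtain Th where Th: "Th : alg_hom Z Tq.Q ?Q" "ALL a:car SA. Th (Tq.pr a) = ?h a" by (elim bexE)
 show ?thesis
 proof (intro bexI[of _ Th] ballI)
 show "Th : alg_hom Z T ?Q" using Th(1) by (simp add: T_eq)
 fix x z d assume a: "x :.W" "z :.Z" "d : S"
 have f: "CZ.fr z d :.F" using a by (simp add: F_ops(1))
 have "Th (pt x (CZ.fr z d)) = C.fr x 1:**.C.Q C.fr z d"
 unfolding pt_eq using bspec[OF Th(2) be[OF a(1) f]] LB[OF car[OF a(1) f]] io[OF a(2,3)] by (simp add: mu_def)
 thus "Th (pt x (CZ.fr z d)) = C.fr (x**z) d"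
 using a C.fr_mult[OF a(1) Z_car[OF a(2)] C.S_one a(3)] C.S_car[OF a(3)] by simp
 qed
qed

end

text \<open>A basis \<open>v\<close> over the fraction field with coordinates La_r / D. Keeping the
  common denominator \<open>D\<close> in the center lets all data stay inside the algebra.\<close>

locale dual_basis = center_localization W for W :: "('b, 'x) ring_scheme" (structure) +
 fixes w :: nat and v :: "nat => 'b" and La :: "nat => 'b => 'b" and D :: 'b
 assumes v: "r < w ==> v r :.W" and La_closed: "r < w ==> x :.W ==> La r x :.(center W)"
 and La_add: "r < w ==> x :.W ==> y :.W ==> La r (x +: y) = La r x +: La r y"
 and La_mult: "r < w ==> z :.(center W) ==> x :.W ==> La r (z**x) = z**La r x"
 and D: "D :.(center W)" "D ~= 0:"
 and expansion: "x :.W ==> D**x = (++r:{..<w}. La r x**v r)"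
 and La_v: "r < w ==> r' < w ==> La r (v r') = (if r' = r then D else 0:)"
begin

abbreviation e where "e r == pt (v r) 1:.F"

lemma D_S: "D : S" unfolding Z_ops(4) using D by blast

lemma S_Z: "d : S ==> d :.Z" by simp

lemma F_car: "z :.Z ==> d : S ==> CZ.fr z d :.F"
 by (simp add: F_ops(1))

lemma e_closed: "e : {..<w} \<rightarrow> car V"
 using v by (auto simp: V_ops)

lemma scale_e: "r < w ==> f :.F ==> f *:.V e r = pt (v r) f"
 using v pt_mult[of \<one> "v r" f "1:.F"] by (simp add: V_ops)

lemma lc_e: assumes "c : {..<w} \<rightarrow> car F" shows "V.lc w c e = (++.T r:{..<w}. pt (v r) (c r))"
 unfolding V.lc_def finsum_V using assms v by (intro T.finsum_cong') (simp_all add: Pi_iff scale_e)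

lemma pt_coordinates:
 assumes x: "x :.W" and zd: "z :.Z" "d : S"
 shows "pt x (CZ.fr z d) = V.lc w (%r. CZ.fr (La r x**z) (D**d)) e"
proof -
 have zc: "CZ.fr z (D**d) :.F" using zd C.S_mult[OF D_S zd(2)] by (intro F_car) auto
 have split: "CZ.fr (y**z) (D**d) = CZ.fr y 1:**.F CZ.fr z (D**d)" if y: "y :.Z" for y
 using CZ.fr_mult[OF y zd(1) C.S_one C.S_mult[OF D_S zd(2)]] C.S_car[OF C.S_mult[OF D_S zd(2)]] by (simp add: F_ops(2) Z_ops(2))
 \<comment> \<open>The scalar z/d is written as D times z/(D d), so that \<open>D\<close> can be
   moved to the left tensor factor, where \<open>expansion\<close> applies.\<close>
 have can: "CZ.fr z d = CZ.fr D 1:**.F CZ.fr z (D**d)"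
 proof -
 have "CZ.fr (D**z) (D**d) = CZ.fr z d"
 using CZ.fr_eq_iff[OF Z_closed(3)[OF D(1) zd(1)] zd(1) C.S_mult[OF D_S zd(2)] zd(2)] Z.m_assoc[OF D(1) zd(1) S_Z[OF zd(2)]]
 Z.m_lcomm[OF zd(1) D(1) S_Z[OF zd(2)]] by (simp add: Z_ops(2))
 thus ?thesis using split[OF D(1)] by simp
 qed
 have "pt x (CZ.fr z d) = pt (D**x) (CZ.fr z (D**d))"
 unfolding can pt_smult(1)[OF x zc D(1)] pt_smult(2)[OF x zc D(1)] by simp
 also have "... = (++.T r:{..<w}. pt (La r x**v r) (CZ.fr z (D**d)))"
 unfolding expansion[OF x] using v La_closed[OF _ x] Z_car zc by (intro pt_finsum) auto
 also have "... = (++.T r:{..<w}. pt (v r) (CZ.fr (La r x**z) (D**d)))"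
 proof (rule T.finsum_cong')
 fix r assume "r : {..<w}"
 hence r: "r < w" by simp
 show "pt (La r x**v r) (CZ.fr z (D**d)) = pt (v r) (CZ.fr (La r x**z) (D**d))"
 unfolding split[OF La_closed[OF r x]] pt_smult(1)[OF v[OF r] zc La_closed[OF r x]] pt_smult(2)[OF v[OF r] zc La_closed[OF r x]] by simp
 next
 show "(%r. pt (v r) (CZ.fr (La r x**z) (D**d))) : {..<w} \<rightarrow> car T"
 using v Z_closed(3)[OF La_closed[OF _ x] zd(1)] C.S_mult[OF D_S zd(2)] by (auto intro!: pt_closed F_car)
 qed simp
 also have "... = V.lc w (%r. CZ.fr (La r x**z) (D**d)) e"
 using Z_closed(3)[OF La_closed[OF _ x] zd(1)] C.S_mult[OF D_S zd(2)] by (intro lc_e[symmetric]) (auto intro!: F_car)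
 finally show ?thesis .
qed

lemma common_denominator:
 assumes "!!r. r < n ==> c r :.F"
 shows "EX d z. d : S & (ALL r<n::nat. z r :.Z & c r = CZ.fr (z r) d)"
 using assms
proof (induction n)
 case 0
 thus ?case using C.S_one by blast
next
 case (Suc n)
 have "EX d z. d : S & (ALL r<n. z r :.Z & c r = CZ.fr (z r) d)" by (rule Suc.IH) (use Suc.prems in auto)
 then obtain d z where dz0: "d : S & (ALL r<n. z r :.Z & c r = CZ.fr (z r) d)" by (elim exE)
 have dz: "d : S" "!!r. r < n ==> z r :.Z" "!!r. r < n ==> c r = CZ.fr (z r) d" using dz0 by auto
 have "c n :.CZ.Q" using Suc.prems[of n] by (simp add: F_ops(1))
 then obtain y b where y: "y :.Z" "b : S" "c n = CZ.fr y b" by (rule CZ.Q_cases)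
 have "c r = CZ.fr (z r**b) (d**b)" if "r < n" for r
 using dz(3)[OF that] CZ.fr_ext[OF dz(2)[OF that] dz(1) y(2)] by (simp add: Z_ops(2))
 moreover have "c n = CZ.fr (y**d) (d**b)"
 using y(3) CZ.fr_ext[OF y(1,2) dz(1)] Z.m_comm[OF S_Z[OF dz(1)] S_Z[OF y(2)]] by (simp add: Z_ops(2))
 moreover have "z r**b :.Z" if "r < n" for r using Z_closed(3)[OF dz(2)[OF that] S_Z[OF y(2)]] .
 moreover have "y**d :.Z" using Z_closed(3)[OF y(1) S_Z[OF dz(1)]] .
 ultimately show ?case using C.S_mult[OF dz(1) y(2)]
 by (intro exI[of _ "d**b"] exI[of _ "%r. if r = n then y**d else z r**b"]) (auto simp: less_Suc_eq)
qed

lemma La_sum: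
 assumes r: "r < w" and z: "!!i. i < n ==> z i :.Z" and n: "n <= w"
 shows "La r (++i:{..<n}. z i**v i) = (if r < n then z r**D else 0:)"
 using z n
proof (induction n)
 case 0
 have "La r 0: = 0:**La r 0:" using La_mult[OF r Z_closed(2) W.zero_closed] by simp
 thus ?case using Z_car[OF La_closed[OF r W.zero_closed]] by simp
next
 case (Suc n)
 have nw: "n < w" and zn: "z n :.Z" using Suc.prems by auto
 have c: "(%i. z i**v i) : {..<n} \<rightarrow> car W" using Suc.prems v Z_car by auto
 have cn: "z n**v n :.W" using Z_car[OF zn] v[OF nw] by simp
 have "(++i:{..<Suc n}. z i**v i) = z n**v n +: (++i:{..<n}. z i**v i)"
 unfolding lessThan_Suc using c cn by (intro W.finsum_insert) auto
 hence "La r (++i:{..<Suc n}. z i**v i) = z n**La r (v n) +: (if r < n then z r**D else 0:)"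
 using La_add[OF r cn W.finsum_closed[OF c]] La_mult[OF r zn v[OF nw]] Suc by simp
 thus ?case using La_v[OF r nw] Z_car[OF zn] Z_car[OF D(1)] Z_car[OF Suc.prems(1)[of r]]
 by (cases "r = n") (auto simp: less_Suc_eq)
qed

text \<open>Both combinations are mapped to fractions of the algebra and brought to common
  denominators. Clearing these gives an equation in the algebra, from which \<open>La r\<close>
  extracts the coefficient with the factor \<open>D\<close>.\<close>

lemma e_independent:
 assumes c: "c : {..<w} \<rightarrow> car F" and c': "c' : {..<w} \<rightarrow> car F" and eq: "V.lc w c e = V.lc w c' e" and r: "r < w"
 shows "c r = c' r"
proof -
 let ?Q = "with_smult C.Q (%z p. C.fr z 1:**.C.Q p)"
 obtain Th where Th0: "Th : alg_hom Z T ?Q" "ALL x:car W. ALL z:car Z. ALL d:S. Th (pt x (CZ.fr z d)) = C.fr (x**z) d"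
 using to_fractions by (elim bexE)
 have Th2: "Th (pt x (CZ.fr z d)) = C.fr (x**z) d" if "x :.W" "z :.Z" "d : S" for x z d
 by (rule bspec[OF bspec[OF bspec[OF Th0(2) that(1)] that(2)] that(3)])
 interpret Q: ring ?Q by (rule ring_with_smult[OF C.Q_ring])
 have ad: "a +:.(?Q) b = a +:.C.Q b" for a b by (simp add: with_smult_def)
 have *: "Th (++.T r:{..<n}. pt (v r) (CZ.fr (z r) d)) = C.fr (++i:{..<n}. z i**v i) d"
 if d: "d : S" and z: "!!i. i < n ==> z i :.Z" and n: "n <= w" for n z d
 using z n
 proof (induction n)
 case 0
 have "C.fr 0: 1: = C.fr 0: d" using C.fr_eq_iff[OF W.zero_closed W.zero_closed C.S_one d] C.S_car[OF d] by simp
 thus ?case using alg_hom_zero[OF Th0(1) T.ring_axioms Q.ring_axioms] by (simp add: with_smult_def C.Q_consts)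
 next
 case (Suc n)
 have nw: "n < w" and zn: "z n :.Z" using Suc.prems by auto
 have c: "(%i. z i**v i) : {..<n} \<rightarrow> car W" using Suc.prems v Z_car by auto
 have cn: "z n**v n :.W" using Z_car[OF zn] v[OF nw] by simp
 have p: "(%r. pt (v r) (CZ.fr (z r) d)) : {..<n} \<rightarrow> car T" "pt (v n) (CZ.fr (z n) d) :.T"
 using Suc.prems v d by (auto intro!: pt_closed F_car)
 have "(++.T r:{..<Suc n}. pt (v r) (CZ.fr (z r) d)) = pt (v n) (CZ.fr (z n) d) +:.T (++.T r:{..<n}. pt (v r) (CZ.fr (z r) d))"
 unfolding lessThan_Suc using p by (intro T.finsum_insert) auto
 hence "Th (++.T r:{..<Suc n}. pt (v r) (CZ.fr (z r) d)) = C.fr (v n**z n) d +:.C.Q C.fr (++i:{..<n}. z i**v i) d"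
 using alg_hom_add[OF Th0(1) p(2) T.finsum_closed[OF p(1)]] Th2[OF v[OF nw] zn d] Suc by (simp add: ad)
 also have "v n**z n = z n**v n" using Z_comm[OF zn v[OF nw]] by simp
 also have "C.fr (z n**v n) d +:.C.Q C.fr (++i:{..<n}. z i**v i) d = C.fr (z n**v n +: (++i:{..<n}. z i**v i)) d"
 by (rule C.fr_add_same[OF cn W.finsum_closed[OF c] d])
 also have "z n**v n +: (++i:{..<n}. z i**v i) = (++i:{..<Suc n}. z i**v i)"
 unfolding lessThan_Suc using c cn by (intro W.finsum_insert[symmetric]) auto
 finally show ?case .
 qed
 have co: "EX d z. d : S & (ALL r<w. z r :.Z & c r = CZ.fr (z r) d) &
 Th (V.lc w c e) = C.fr (++i:{..<w}. z i**v i) d" if c: "c : {..<w} \<rightarrow> car F" for c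
 proof -
 obtain d z where dz: "d : S" "ALL r<w. z r :.Z & c r = CZ.fr (z r) d" using common_denominator[of w c] c by blast
 have "(++.T r:{..<w}. pt (v r) (c r)) = (++.T r:{..<w}. pt (v r) (CZ.fr (z r) d))"
 using dz v by (intro T.finsum_cong') (auto intro!: pt_closed F_car)
 thus ?thesis using *[OF dz(1), of w z] dz lc_e[OF c] by (intro exI[of _ d] exI[of _ z] conjI) auto
 qed
 obtain d z where dz: "d : S" "!!r. r < w ==> z r :.Z" "!!r. r < w ==> c r = CZ.fr (z r) d"
 "Th (V.lc w c e) = C.fr (++i:{..<w}. z i**v i) d" using co[OF c] by blast
 obtain d' z' where dz': "d' : S" "!!r. r < w ==> z' r :.Z" "!!r. r < w ==> c' r = CZ.fr (z' r) d'"
 "Th (V.lc w c' e) = C.fr (++i:{..<w}. z' i**v i) d'" using co[OF c'] by blast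
 have sc: "(++i:{..<w}. z i**v i) :.W" "(++i:{..<w}. z' i**v i) :.W"
 using dz(2) dz'(2) v Z_car by (auto intro!: W.finsum_closed)
 have "(++i:{..<w}. z i**v i)**d' = (++i:{..<w}. z' i**v i)**d"
 using eq dz(4) dz'(4) C.fr_eq_iff[OF sc dz(1) dz'(1)] by simp
 hence "d'**(++i:{..<w}. z i**v i) = d**(++i:{..<w}. z' i**v i)"
 using Z_comm[OF S_Z[OF dz(1)] sc(2)] Z_comm[OF S_Z[OF dz'(1)] sc(1)] by simp
 hence "d'**La r (++i:{..<w}. z i**v i) = d**La r (++i:{..<w}. z' i**v i)"
 using La_mult[OF r S_Z[OF dz(1)] sc(2)] La_mult[OF r S_Z[OF dz'(1)] sc(1)] by simp
 hence "d'**(z r**D) = d**(z' r**D)" using La_sum[OF r dz(2) order_refl] La_sum[OF r dz'(2) order_refl] r by simp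
 hence "(z r**d')**D = (z' r**d)**D"
 using Z.m_assoc[OF S_Z[OF dz'(1)] dz(2)[OF r] D(1)] Z.m_assoc[OF S_Z[OF dz(1)] dz'(2)[OF r] D(1)]
 Z.m_comm[OF S_Z[OF dz'(1)] dz(2)[OF r]] Z.m_comm[OF S_Z[OF dz(1)] dz'(2)[OF r]] by (simp add: Z_ops(2))
 hence "z r**d' = z' r**d"
 using C.S_cancel[OF D_S _ _, of "z r**d'" "z' r**d"] Z_car[OF dz(2)[OF r]] Z_car[OF dz'(2)[OF r]] C.S_car[OF dz(1)] C.S_car[OF dz'(1)] by simp
 thus ?thesis using CZ.fr_eq_iff[OF dz(2)[OF r] dz'(2)[OF r] dz(1) dz'(1)] dz(3)[OF r] dz'(3)[OF r] by (simp add: Z_ops(2))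
qed

lemma e_spans: assumes "x :.V" shows "EX c:{..<w} \<rightarrow> car F. x = V.lc w c e"
proof -
 have sub: "basis_elt Z ` car (oc \<times>\<times> F) <= car SA" using M.basis_elt_closed by blast
 have x: "x : lspan Z Tq.Q (Tq.pr ` basis_elt Z ` car (oc \<times>\<times> F))"
 by (rule Tq.Q_lspan[OF M.monoid_algebra_lspan sub]) (use assms in \<open>auto simp: V_ops T_eq\<close>)
 hence "x : lspan Z T (Tq.pr ` basis_elt Z ` car (oc \<times>\<times> F))" by (simp only: T_eq)
 thus ?thesis
 proof (induction rule: lspan.induct)
 case zero
 have "V.lc w (%r. 0:.F) e = (++.V r:{..<w}. 0:.V)"
 unfolding V.lc_def using e_closed by (intro V.V.finsum_cong') (auto simp: Pi_iff)
 also have "... = 0:.V" by simp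
 finally have "0:.T = V.lc w (%r. 0:.F) e" by (simp only: V_ops(3))
 thus ?case by (intro bexI[of _ "%r. 0:.F"]) auto
 next
 case (step k b x)
 obtain y f where y: "y :.W" "f :.F" "b = pt y f" using step(2) by (auto simp: pt_eq oc_ops)
 have "f :.CZ.Q" using y(2) by (simp only: F_ops(1))
 then obtain z d where z: "z :.Z" "d : S" "f = CZ.fr z d" by (rule CZ.Q_cases)
 have ky: "k**y :.W" using Z_car[OF step(1)] y(1) by simp
 define g where "g r = CZ.fr (La r (k**y)**z) (D**d)" for r
 have gc: "g : {..<w} \<rightarrow> car F"
 using Z_closed(3)[OF La_closed[OF _ ky] z(1)] C.S_mult[OF D_S z(2)] by (auto intro!: F_car simp: g_def)
 obtain c where c: "c : {..<w} \<rightarrow> car F" "x = V.lc w c e" using step(4) by blast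
 have "k *:.T b = pt (k**y) f" unfolding y(3) using pt_smult(1)[OF y(1,2) step(1)] by simp
 also have "... = V.lc w g e" unfolding z(3) g_def by (rule pt_coordinates[OF ky z(1,2)])
 finally have "k *:.T b +:.T x = V.lc w (%r. g r +:.F c r) e"
 using V.lc_add[OF e_closed gc c(1)] c(2) by (simp add: V_ops(4))
 thus ?case using gc c(1) by (intro bexI[of _ "%r. g r +:.F c r"]) auto
 qed
qed

lemma e_basis: "is_basis F V w e"
 unfolding V.is_basis_iff
proof (intro conjI ballI ex_ex1I e_closed)
 fix x assume "x :.V"
 then obtain c where c: "c : {..<w} \<rightarrow> car F" "x = V.lc w c e" using e_spans by blast
 show "EX c. c : {..<w} \<rightarrow>\<^sub>E car F & x = V.lc w c e"
 using c V.lc_cong[OF e_closed c(1), of "restrict c {..<w}"] by (intro exI[of _ "restrict c {..<w}"]) auto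
next
 fix x c c' assume "c : {..<w} \<rightarrow>\<^sub>E car F & x = V.lc w c e" "c' : {..<w} \<rightarrow>\<^sub>E car F & x = V.lc w c' e"
 thus "c = c'" using e_independent[of c c'] by (intro PiE_ext[of c "{..<w}" "%_. car F" c']) (auto simp: PiE_def)
qed

lemma center_rank_eq: "center_rank W = w"
 unfolding center_rank_def by (rule V.vs_dim_eq[OF e_basis])

text \<open>The r-th diagonal entry of left multiplication by \<open>x\<close> is La_r (x v_r) / D.
  When all these equal the same \<open>p\<close>, the trace is \<open>w\<close> times
  \<open>p\<close>.\<close>

lemma regular_trace_eq:
 assumes x: "x :.W" and p: "p :.Z" and diag: "!!r. r < w ==> La r (x**v r) = D**p"
 shows "regular_trace W x = center_embedding W (add_pow Z w p)"
proof -
 let ?f = "%y. pt x 1:.F**.V y"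
 have px: "pt x 1:.F :.T" using x by simp
 have fc: "?f y :.V" if "y :.V" for y using that px by (simp add: V_ops)
 have sm: "?f (c *:.V y) = c *:.V ?f y" if "y :.V" "c :.F" for c y
 proof -
 have "pt x 1:.F**.T pt 1: c = pt 1: c**.T pt x 1:.F" using x that pt_mult[of x \<one> "1:.F" c] pt_mult[of \<one> x c "1:.F"] by simp
 thus ?thesis using that px by (simp add: V_ops flip: T.m_assoc)
 qed
 have lin: "?f (V.lc n c z) = V.lc n c (%i. ?f (z i))" if "z : {..<n} \<rightarrow> car V" "c : {..<n} \<rightarrow> car F" for n c z
 proof -
 have "?f (V.lc n c z) = (++.T i:{..<n}. pt x 1:.F**.T (c i *:.V z i))"
 unfolding V.lc_def finsum_V V_ops(2) using that px by (intro T.finsum_rdistr) (auto simp: Pi_iff V_ops)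
 also have "... = (++.T i:{..<n}. c i *:.V ?f (z i))"
 using that fc sm by (intro T.finsum_cong') (auto simp: Pi_iff V_ops(1,2,5))
 finally show ?thesis unfolding V.lc_def finsum_V .
 qed
 have coord: "coordinates F V w e (?f (e r)) r = CZ.fr p 1:" if r: "r < w" for r
 proof -
 have xv: "x**v r :.W" using x v[OF r] by simp
 have oF: "1:.F = CZ.fr 1: 1:" by (simp add: F_ops(3) CZ.Q_consts Z_ops(3))
 have "?f (e r) = pt (x**v r) (CZ.fr 1: 1:)" using x v[OF r] pt_mult[of x "v r" "1:.F" "1:.F"] by (simp add: V_ops flip: oF)
 also have "... = V.lc w (%r'. CZ.fr (La r' (x**v r)**1:) (D**1:)) e" by (rule pt_coordinates[OF xv Z_closed(1) C.S_one])
 finally have e: "?f (e r) = V.lc w (%r'. CZ.fr (La r' (x**v r)**1:) (D**1:)) e" .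
 have gc: "(%r'. CZ.fr (La r' (x**v r)**1:) (D**1:)) : {..<w} \<rightarrow> car F"
 using Z_closed(3)[OF La_closed[OF _ xv] Z_closed(1)] C.S_mult[OF D_S C.S_one] by (auto intro!: F_car)
 have er: "e r :.V" using e_closed r by auto
 have "coordinates F V w e (?f (e r)) r = CZ.fr (La r (x**v r)**1:) (D**1:)"
 using V.basis_coordinates(3)[OF e_basis fc[OF er] gc e r] by simp
 also have "... = CZ.fr (D**p) D" using diag[OF r] Z_car[OF D(1)] Z_car[OF p] by simp
 also have "... = CZ.fr p 1:"
 using CZ.fr_eq_iff[OF Z_closed(3)[OF D(1) p] p D_S C.S_one] Z.m_comm[OF D(1) p] Z_car[OF D(1)] Z_car[OF p] by (simp add: Z_ops(2))
 finally show ?thesis .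
 qed
 interpret h: ring_hom_cring Z F "%z. CZ.fr z 1:" by unfold_locales (rule emb_ring_hom)
 have "regular_trace W x = (++.F r:{..<w}. coordinates F V w e (?f (e r)) r)"
 unfolding regular_trace_def by (rule V.trace_eq[OF e_basis fc lin])
 also have "... = (++.F r:{..<w}. CZ.fr p 1:)" using coord emb_hom[OF p] by (intro F.finsum_cong') auto
 also have "... = CZ.fr (++.Z r:{..<w}. p) 1:" using p h.hom_finsum[of "%_. p" "{..<w}"] by (simp add: comp_def)
 also have "(++.Z r:{..<w}. p) = add_pow Z w p" using Z.add.finprod_const[OF p, of "{..<w}"] by simp
 finally show ?thesis by (simp add: center_embedding_def fraction_eq Z_ops(3))
qed

end

section \<open>The center and the reduced trace form\<close>

context qgwa
begin

lemma zp_add: assumes "i < m" "0 <= a * b" shows "zp i a**.W zp i b = zp i (a + b)"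
proof -
 have neg: "zp i c = yg i [^].W nat (- c)" if "c <= 0" for c using that by (cases "c = 0") (auto simp: zp_def)
 consider "0 <= a" "0 <= b" | "a <= 0" "b <= 0" using assms(2) by (auto simp: zero_le_mult_iff)
 thus ?thesis
 proof cases
 case 1
 thus ?thesis using assms W.nat_pow_mult[of "xg i" "nat a" "nat b"] by (simp add: zp_def nat_add_distrib)
 next
 case 2
 have "nat (- a) + nat (- b) = nat (- (a + b))" using 2 by simp
 thus ?thesis using assms 2 W.nat_pow_mult[of "yg i" "nat (- a)" "nat (- b)"] by (simp add: neg)
 qed
qed

lemma zp_zz: "n <= i ==> i < m ==> zp i k**.W zz n a = zz n a**.W zp i k"
 unfolding zp_def using W.group_commutes_pow[of "xg i" "zz n a"] W.group_commutes_pow[of "yg i" "zz n a"] zz_comm[of i n] by simp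

lemma zz_add: assumes "n <= m" "!!i. i < n ==> 0 <= a i * b i" shows "zz n a**.W zz n b = zz n (%i. a i + b i)"
 using assms
proof (induction n)
 case (Suc n)
 have c: "zz n a :.W" "zz n b :.W" "zp n (a n) :.W" "zp n (b n) :.W" using Suc by auto
 have "zz (Suc n) a**.W zz (Suc n) b = zz n a**.W (zp n (a n)**.W zz n b)**.W zp n (b n)"
 using c by (simp add: W.m_assoc)
 also have "... = (zz n a**.W zz n b)**.W (zp n (a n)**.W zp n (b n))"
 using c zp_zz[of n n "a n" b] Suc.prems by (simp add: W.m_assoc)
 finally show ?case using Suc zp_add[of n "a n" "b n"] by simp
qed simp

lemma zz_single: "n <= m ==> zz n (%j. if j = i then p else 0) = (if i < n then zp i p else 1:.W)"
proof (induction n)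
 case (Suc n)
 have "zp n 0 = 1:.W" by (simp add: zp_def)
 thus ?case using Suc by (auto simp: less_Suc_eq)
qed simp

text \<open>The n-th iterate of the inverse automorphism is the identity, so y_i^n passes
  coefficients unchanged; for x_i the letters are moved one by one. This is done in the algebra
  since the image of y_i in the torus need not be a monomial.\<close>

lemma yg_pow_central:
 assumes i: "i < m" and n: "q i [^] n = 1:" "0 < (n::nat)"
 shows "p :.P ==> yg i [^].W n**.W cf p = cf p**.W yg i [^].W n"
 and "yg i [^].W n**.W xg i = xg i**.W yg i [^].W n"
proof -
 have y: "yg i :.W" "xg i :.W" using i by auto
 have c: "(ta i ^^ k) p :.P" if "p :.P" for k p using that ta_closed[OF i] by (induction k) auto
 have v: "(q i [^] k) [^] j**(ta i ^^ k) p j = p j" if p: "p :.P" for k p j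
 proof (induction k)
 case 0
 thus ?case using UP_value[OF p] by (simp add: nat_pow_one)
 next
 case (Suc k)
 let ?r = "(ta i ^^ k) p"
 have "?r j = q i [^] j**ta i ?r j" using \<sigma>_coeff[OF i ta_closed[OF i c[OF p]], of k j] \<sigma>ta(1)[OF i c[OF p]] by simp
 moreover have "(q i [^] Suc k) [^] j = (q i [^] k) [^] j**q i [^] j" using q_props(1)[OF i] by (simp add: nat_pow_distrib)
 ultimately show ?case using Suc UP_value[OF ta_closed[OF i c[OF p]]] q_props(1)[OF i] by (simp add: m_assoc)
 qed
 have id: "(ta i ^^ n) p = p" if p: "p :.P" for p
 using v[OF p, of n] UP_value[OF c[OF p]] by (simp add: fun_eq_iff n(1))
 have yk: "yg i [^].W k**.W cf p = cf ((ta i ^^ k) p)**.W yg i [^].W k" if p: "p :.P" for k :: nat and p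
 using p
 proof (induction k arbitrary: p)
 case (Suc k)
 have "yg i [^].W Suc k**.W cf p = yg i [^].W k**.W (cf (ta i p)**.W yg i)"
 using y Suc.prems yg_cf[OF i Suc.prems] by (simp add: W.m_assoc)
 also have "... = (yg i [^].W k**.W cf (ta i p))**.W yg i" using y ta_closed[OF i Suc.prems] by (simp add: W.m_assoc)
 finally show ?case using Suc.IH[OF ta_closed[OF i Suc.prems]] y ta_closed[OF i Suc.prems] c[OF ta_closed[OF i Suc.prems]]
 by (simp add: funpow_swap1 W.m_assoc)
 qed (simp add: y)
 show "yg i [^].W n**.W cf p = cf p**.W yg i [^].W n" if "p :.P" for p using yk[OF that] id[OF that] by simp
 obtain k where k: "n = Suc k" using n(2) gr0_implies_Suc by blast
 have h: "h i :.P" using h_closed[OF i] .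
 have "yg i [^].W n**.W xg i = yg i [^].W k**.W cf (ta i (h i))" using y YX[OF i] by (simp add: k W.m_assoc)
 also have "... = cf ((ta i ^^ n) (h i))**.W yg i [^].W k" using yk[OF ta_closed[OF i h]] by (simp add: k funpow_swap1)
 also have "... = xg i**.W (yg i**.W yg i [^].W k)" using id[OF h] XY[OF i] y by (simp flip: W.m_assoc)
 also have "yg i**.W yg i [^].W k = yg i [^].W n" using W.nat_pow_comm[of "yg i" 1 k] y by (simp add: k)
 finally show "yg i [^].W n**.W xg i = xg i**.W yg i [^].W n" .
qed

end

lemma dvd_prod_of_coprime:
 fixes x :: int and n :: "nat => nat"
 assumes "!!i j. i < M ==> j < M ==> i ~= j ==> coprime (n i) (n j)" "!!i. i < M ==> int (n i) dvd x"
 shows "int (\<Prod>i<M. n i) dvd x"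
 using assms
proof (induction M)
 case (Suc M)
 have "coprime (\<Prod>i<M. n i) (n M)" using Suc.prems(1) by (intro prod_coprime_left) auto
 hence "coprime (int (\<Prod>i<M. n i)) (int (n M))" by (rule coprime_int_iff[THEN iffD2])
 hence "int (\<Prod>i<M. n i) * int (n M) dvd x" using Suc by (intro divides_mult) auto
 thus ?case by simp
qed simp

text \<open>The linear projection onto the span of the torus monomials with exponent in
  \<open>C\<close>.\<close>

definition res :: "('k, 'e) ring_scheme => expo set => (expo => 'k) => expo => 'k"
 where "res K C f = (%g. if g : C then f g else 0:.K)"

locale coprime_gwa = weyl_family K s m q \<sigma> h
 for K :: "('k, 'e) ring_scheme" (structure) and s m q \<sigma> h +
 assumes s1: "s = 1" and n_pos: "i < m 0 ==> 0 < nn 0 i"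
 and n_cop: "i < m 0 ==> j < m 0 ==> i ~= j ==> coprime (nn 0 i) (nn 0 j)"
begin

abbreviation W where "W == A 0"
abbreviation Ph where "Ph == vp 0"
abbreviation b where "b == mon 0"

lemma s0: "0 < s" using s1 by simp

sublocale G: qgwa K "m 0" "q 0" "\<sigma> 0" "h 0" using qgwa[OF s0] .
sublocale low_basis K s m q \<sigma> h W Ph b "%l. cfl l (tp 1)" "%l. xgl l 0" by (rule gwa_low_basis[OF s1])
sublocale D: noncomm_domain W
 by (intro noncomm_domain.intro noncomm_domain_axioms.intro G.W.ring_axioms B_nontrivial B_integral)

definition N where "N = (\<Prod>i<m 0. nn 0 i)"
definition G0 where "G0 = {g. int N dvd lkt g 0 & (ALL i<m 0. int (nn 0 i) dvd lkx g 0 i)}"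
abbreviation rs where "rs == res K"

lemma N_pos: "0 < N" unfolding N_def using n_pos by (intro prod_pos) auto
lemma nn_dvd_N: "i < m 0 ==> nn 0 i dvd N" unfolding N_def by (intro dvd_prodI) auto

lemma N_dvd: "(!!i. i < m 0 ==> int (nn 0 i) dvd x) ==> int N dvd x"
 unfolding N_def by (rule dvd_prod_of_coprime) (use n_cop in auto)

lemma G0_add: "g : G0 ==> g + d : G0 \<longleftrightarrow> d : G0"
 by (auto simp: G0_def lk dvd_add_right_iff)

lemma G0_ops: "g : G0 ==> d : G0 ==> g + d : G0" "g : G0 ==> - g : G0" "0 : G0"
 by (auto simp: G0_def lk)

lemma cc_dvd: assumes "!!i. i < m 0 ==> int (nn 0 i) dvd lkx g 0 i * lkt d 0" shows "cc g d = 1:"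
 unfolding cc_def Uk_facts(3)[symmetric]
proof (rule Uk.finprod_one_eqI)
 fix p assume "p : Ix"
 hence "fst p = 0" "snd p < m 0" unfolding Ix_def by (auto simp: s1)
 thus "q (fst p) (snd p) [^].Uk (lkx g (fst p) (snd p) * lkt d (fst p)) = 1:.Uk"
 using q_pow_eq_one[OF s0, of "snd p"] assms[of "snd p"] by (simp add: Uk_facts(3))
qed

lemma cc_G0: assumes "g : G0" shows "cc g d = 1:" "cc d g = 1:"
proof -
 have "int (nn 0 i) dvd lkt g 0" if "i < m 0" for i
 by (rule dvd_trans[OF of_nat_dvd_iff[THEN iffD2, OF nn_dvd_N[OF that]]]) (use assms in \<open>simp add: G0_def\<close>)
 thus "cc g d = 1:" "cc d g = 1:" using assms by (auto intro!: cc_dvd simp: G0_def)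
qed

lemma rs_closed [simp]: "f :.L ==> rs C f :.L"
 unfolding T.T.in_L_iff res_def by (auto elim: finite_subset[rotated])

lemma rs_add: "rs C (f +:.L g) = rs C f +:.L rs C g"
 by (auto simp: res_def T.T.L_add)

lemma rs_eq: "(!!g. f g ~= 0: ==> g : C) ==> rs C f = f"
 by (auto simp: res_def fun_eq_iff) metis

lemma rs_none: "(!!g. f g ~= 0: ==> g \<notin> C) ==> rs C f = 0:.L"
 by (auto simp: res_def T.T.L_zero fun_eq_iff)

lemma rs_zero: "rs C 0:.L = 0:.L" by (rule rs_none) (simp add: T.T.L_zero)

lemma rs_supp: "rs C f g ~= 0: ==> g : C & f g ~= 0:" by (auto simp: res_def split: if_splits)

lemma rs_split: assumes "f :.L" shows "rs C f +:.L rs (- C) f = f"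
 using T.T.L_value[OF assms] by (auto simp: res_def T.T.L_add fun_eq_iff)

lemma mult_support: assumes "f :.L" "g :.L" "(f**.L g) x ~= 0:"
 obtains a c where "f a ~= 0:" "g c ~= 0:" "x = a + c"
 using T.T.L_mult_support[OF assms] by auto

text \<open>All exponents of \<open>u\<close> shift \<open>C\<close> into \<open>C'\<close> and its
  complement into the complement. So in the product with the part of \<open>f\<close> outside
  \<open>C\<close> nothing lands in \<open>C'\<close>.\<close>

lemma rs_mult:
 assumes u: "u :.L" and f: "f :.L"
 shows "(!!a c. u a ~= 0: ==> a + c : C' \<longleftrightarrow> c : C) ==> rs C' (u**.L f) = u**.L rs C f"
 and "(!!a c. u a ~= 0: ==> c + a : C' \<longleftrightarrow> c : C) ==> rs C' (f**.L u) = rs C f**.L u"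
proof -
 note R = rs_closed[OF f]
 assume c: "!!a c. u a ~= 0: ==> a + c : C' \<longleftrightarrow> c : C"
 have "u**.L f = u**.L rs C f +:.L u**.L rs (- C) f"
 using rs_split[OF f, of C] T.T.L.r_distr[OF R R u, of C "- C"] by simp
 hence "rs C' (u**.L f) = rs C' (u**.L rs C f) +:.L rs C' (u**.L rs (- C) f)" by (simp add: rs_add)
 moreover have "rs C' (u**.L rs C f) = u**.L rs C f"
 by (rule rs_eq) (metis mult_support[OF u R] rs_supp c)
 moreover have "rs C' (u**.L rs (- C) f) = 0:.L"
 by (rule rs_none) (metis mult_support[OF u R] rs_supp c ComplD)
 ultimately show "rs C' (u**.L f) = u**.L rs C f" using u f by simp
next
 note R = rs_closed[OF f]
 assume c: "!!a c. u a ~= 0: ==> c + a : C' \<longleftrightarrow> c : C"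
 have "f**.L u = rs C f**.L u +:.L rs (- C) f**.L u"
 using rs_split[OF f, of C] T.T.L.l_distr[OF R R u, of C "- C"] by simp
 hence "rs C' (f**.L u) = rs C' (rs C f**.L u) +:.L rs C' (rs (- C) f**.L u)" by (simp add: rs_add)
 moreover have "rs C' (rs C f**.L u) = rs C f**.L u"
 by (rule rs_eq) (metis mult_support[OF R u] rs_supp c)
 moreover have "rs C' (rs (- C) f**.L u) = 0:.L"
 by (rule rs_none) (metis mult_support[OF R u] rs_supp c ComplD)
 ultimately show "rs C' (f**.L u) = rs C f**.L u" using u f by simp
qed

definition L0 where "L0 = {f : car L. ALL g. f g ~= 0: --> g : G0}"

lemma L0_car: "f : L0 ==> f :.L" and L0_supp: "f : L0 ==> f g ~= 0: ==> g : G0"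
 by (auto simp: L0_def)

lemma rs_L0: "f :.L ==> rs G0 f : L0" using rs_supp by (auto simp: L0_def)

lemma L0_rs: "f : L0 ==> rs G0 f = f" by (rule rs_eq) (simp add: L0_def)

lemma sg_comm: assumes "y :.L" "g : G0" "r :.K" shows "sg g r**.L y = y**.L sg g r"
proof
 fix z
 have "(sg g r**.L y) (g + (z - g)) = (y**.L sg g r) ((z - g) + g)"
 unfolding T.L_mult_sg(1)[OF assms(1,3)] T.L_mult_sg(2)[OF assms(1,3)] using cc_G0[OF assms(2)] T.T.L_value[OF assms(1)] assms(3)
 by (simp add: m_comm)
 thus "(sg g r**.L y) z = (y**.L sg g r) z" by simp
qed

lemma L0_comm: assumes "f : L0" "y :.L" shows "f**.L y = y**.L f"
proof -
 have "rs G0 f**.L y = y**.L rs G0 f" if "f :.L" for f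
 using that
 proof (induction rule: T.T.L_induct)
 case zero
 thus ?case using assms by (simp add: rs_zero)
 next
 case (single x r)
 have "rs G0 (sg x r) = (if x : G0 then sg x r else 0:.L)" by (auto simp: res_def single_def T.T.L_zero fun_eq_iff)
 thus ?case using assms(2) sg_comm single by auto
 next
 case (add f g)
 thus ?case using assms(2) by (simp add: rs_add T.T.L.l_distr T.T.L.r_distr)
 qed
 thus ?thesis using L0_rs[OF assms(1)] L0_car[OF assms(1)] by metis
qed

text \<open>Lattice exponents have trivial cocycle with all others. Conversely, commuting with t
  makes n_i divide the x_i-exponents (\<open>cc_tk_dvd\<close>), and commuting with each x_i makes
  every n_i, hence their product \<open>N\<close>, divide the t-exponent.\<close>

lemma central_iff: assumes x: "x :.W" shows "x : car D.Z \<longleftrightarrow> Ph x : L0"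
proof
 assume "Ph x : L0"
 hence "x**.W y = y**.W x" if "y :.W" for y
 using L0_comm[of "Ph x" "Ph y"] Ph_closed x that by (intro Ph_inj) (auto simp: alg_hom_mult[OF Ph])
 thus "x :.D.Z" using x by (simp add: D.Z_iff)
next
 assume z: "x :.D.Z"
 have comm: "Ph x**.L sg d 1: = sg d 1:**.L Ph x" if "y :.W" "Ph y = sg d 1:" for y d
 using D.Z_comm[OF z that(1)] alg_hom_mult[OF Ph x that(1)] alg_hom_mult[OF Ph that(1) x] that(2) by simp
 have cc_eq: "cc g d = cc d g" if "y :.W" "Ph y = sg d 1:" "Ph x g ~= 0:" for y d g
 using T.normal_coeff[OF Ph_closed[OF x] one_closed one_closed comm[OF that(1,2)] that(3)] by simp
 have "g : G0" if g: "Ph x g ~= 0:" for g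
 proof -
 have "cc g (tk 0 1) = 1:" using cc_eq[OF tB_closed[OF s0] Ph_tB[OF s0] g] by simp
 hence a: "int (nn 0 i) dvd lkx g 0 i" if "i < m 0" for i using cc_tk_dvd[OF s0 that] n_cop that by blast
 have "int (nn 0 i) dvd lkt g 0" if i: "i < m 0" for i
 proof -
 have "cc (xk 0 i 1) g = 1:" using cc_eq[OF _ vp(3)[OF s0 i] g] i by simp
 thus ?thesis unfolding cc_xk_left[OF s0 i] q_pow_eq_one[OF s0 i] by simp
 qed
 thus ?thesis using a N_dvd by (auto simp: G0_def)
 qed
 thus "Ph x : L0" using Ph_closed[OF x] by (auto simp: L0_def)
qed

lemma L0_mult: assumes "f : L0" "g : L0" shows "f**.L g : L0"
 using assms mult_support[OF L0_car[OF assms(1)] L0_car[OF assms(2)]] G0_ops(1) unfolding L0_def by (smt (verit) T.T.L.m_closed mem_Collect_eq)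

lemma L0_sg: "g : G0 ==> r :.K ==> sg g r : L0"
 using T.sg_closed[of r g] unfolding L0_def by (simp add: single_def)

lemma L0_pow: "f : L0 ==> f [^].L (n::nat) : L0"
 by (induction n) (auto simp: L0_mult T.T.L_one intro!: L0_sg G0_ops)

lemma nat_pow_q: "i < m 0 ==> q 0 i [^] nn 0 i = 1:"
 using q_pow_eq_one[OF s0, of i "int (nn 0 i)"] q_pow[OF s0, of i "nn 0 i"] by simp

lemma sg_xk_pow: "sg (xk 0 n 1) 1: [^].L (k::nat) = sg (xk 0 n (int k)) 1:"
 by (induction k) (simp_all add: T.T.L_one sg_one_mult flip: single_add, simp add: add.commute)

text \<open>The power of x_i is a torus monomial in the lattice. For y_i the support is not
  explicit, so the power is first shown to be central, by checking that its centralizer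
  \<open>?C\<close> contains the generators, and \<open>central_iff\<close> then gives the
  support.\<close>

lemma zz_L0: "n <= m 0 ==> (!!i. i < n ==> int (nn 0 i) dvd a i) ==> Ph (G.zz n a) : L0"
proof (induction n)
 case 0
 show ?case using alg_hom_one[OF Ph] by (simp add: T.T.L_one L0_sg G0_ops)
next
 case (Suc n)
 hence n: "n < m 0" by simp
 have car: "G.xg n :.W" "G.yg n :.W" using n by auto
 have pw: "Ph (x [^].W k) = Ph x [^].L k" if "x :.W" for x and k :: nat using alg_hom_pow[OF Ph G.W.ring_axioms that] .
 obtain c where c: "a n = int (nn 0 n) * c" using Suc.prems(2)[of n] by (auto elim: dvdE)
 have x: "Ph (G.xg n [^].W nn 0 n) : L0"
 proof -
 have "Ph (G.xg n [^].W nn 0 n) = sg (xk 0 n (int (nn 0 n))) 1:" using pw[OF car(1)] vp(3)[OF s0 n] sg_xk_pow by simp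
 thus ?thesis by (auto intro!: L0_sg simp: G0_def lk)
 qed
 have y: "Ph (G.yg n [^].W nn 0 n) : L0"
 proof -
 have "G.yg n [^].W nn 0 n :.D.Z"
 proof -
 let ?u = "G.yg n [^].W nn 0 n"
 let ?C = "{w : car W. ?u**.W w = w**.W ?u}"
 have u: "?u :.W" using car by simp
 have mult: "v**.W w : ?C" if vw: "v : ?C" "w : ?C" for v w
 proof -
 have "?u**.W (v**.W w) = (v**.W ?u)**.W w" using vw u G.W.m_assoc[of ?u v w] by simp
 also have "... = (v**.W w)**.W ?u" using vw u G.W.m_assoc[of v ?u w] G.W.m_assoc[of v w ?u] by simp
 finally show ?thesis using vw by simp
 qed
 have gens: "G.xg i : ?C" "G.yg i : ?C" if i: "i < m 0" for i
 proof -
 have c: "G.xg i :.W" "G.yg i :.W" using i by auto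
 have "G.yg n**.W G.yg i = G.yg i**.W G.yg n" using G.YY[OF n i] .
 thus "G.yg i : ?C" using G.W.group_commutes_pow[of "G.yg n" "G.yg i"] car c by simp
 show "G.xg i : ?C"
 proof (cases "i = n")
 case True
 thus ?thesis using G.yg_pow_central(2)[OF n nat_pow_q[OF n] n_pos[OF n]] c by simp
 next
 case False
 have "G.yg n**.W G.xg i = G.xg i**.W G.yg n" using G.XY_comm[OF i n False] by simp
 thus ?thesis using G.W.group_commutes_pow[of "G.yg n" "G.xg i"] car c by simp
 qed
 qed
 have one: "1:.W : ?C" using u by simp
 have pow: "x [^].W (k::nat) : ?C" if "x : ?C" for x k
 proof (induction k)
 case 0
 show ?case using one by simp
 next
 case (Suc k)
 show ?case using mult[OF Suc that] by simp
 qed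
 have zzC: "G.zz j a : ?C" if "j <= m 0" for j a
 using that
 proof (induction j)
 case 0
 show ?case using one by simp
 next
 case (Suc j)
 have "G.zp j (a j) : ?C" using pow gens[of j] Suc.prems by (auto simp: G.zp_def)
 thus ?case using mult[of "G.zz j a" "G.zp j (a j)"] Suc by simp
 qed
 have cfC: "cfl 0 p : ?C" if "p :.P" for p
 using G.yg_pow_central(1)[OF n nat_pow_q[OF n] n_pos[OF n] that] that by simp
 have bC: "b r : ?C" for r unfolding mon_def by (rule mult[OF cfC zzC]) auto
 have "w : ?C" if "w :.W" for w
 using b_span[OF that]
 proof (induction rule: lspan.induct)
 case (step k v w)
 have "v : ?C" using step bC by blast
 thus ?case using step u by (simp add: G.W.l_distr G.W.r_distr G.W.smult_mult_left G.W.smult_mult_right)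
 qed (use u in simp)
 thus ?thesis using u by (auto simp: D.Z_iff)
 qed
 thus ?thesis using central_iff car by simp
 qed
 have "Ph (G.zp n (a n)) : L0"
 proof (cases "0 <= c")
 case True
 have "nat (a n) = nn 0 n * nat c" using True by (simp add: c nat_mult_distrib)
 hence "Ph (G.zp n (a n)) = Ph (G.xg n [^].W nn 0 n) [^].L nat c"
 using True car pw[of "G.xg n [^].W nn 0 n" "nat c"] G.W.nat_pow_pow[OF car(1), of "nn 0 n" "nat c"] by (simp add: G.zp_def c)
 thus ?thesis using L0_pow[OF x] by simp
 next
 case False
 have "0 < nn 0 n" using n_pos[OF n] .
 hence "a n < 0" "nat (- a n) = nn 0 n * nat (- c)" using False by (auto simp: c mult_pos_neg nat_mult_distrib simp flip: mult_minus_right)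
 hence "Ph (G.zp n (a n)) = Ph (G.yg n [^].W nn 0 n) [^].L nat (- c)"
 using car pw[of "G.yg n [^].W nn 0 n" "nat (- c)"] G.W.nat_pow_pow[OF car(2), of "nn 0 n" "nat (- c)"] by (simp add: G.zp_def)
 thus ?thesis using L0_pow[OF y] by simp
 qed
 thus ?case using Suc n L0_mult alg_hom_mult[OF Ph, of "G.zz n a" "G.zp n (a n)"] by simp
qed

lemma b_degree: assumes "r : R" "Ph (b r) g ~= 0:" shows "lkx g 0 i = lkx r 0 i" "lkt (lowr r) 0 <= lkt g 0"
 using b_low[OF assms(1)] assms(2) unfolding T.low_at_def lq_def by auto

lemma Ph_t: "Ph (cfl 0 (tp k)) = sg (tk 0 (int k)) 1:"
 using vp(2)[OF s0, of "tp k"] pt(2)[of 0 k] by simp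

text \<open>The x-part of such a monomial is a lattice element by \<open>zz_L0\<close>, so the
  t-exponents of its image vary only by multiples of \<open>N\<close>.\<close>

lemma b_class:
 assumes r: "r : R" and d: "!!i. i < m 0 ==> int (nn 0 i) dvd lkx r 0 i" and g: "Ph (b r) g ~= 0:"
 shows "int N dvd lkt g 0 - lkt r 0"
proof -
 have "Ph (b r) = sg (tk 0 (lkt r 0)) 1:**.L Ph (G.zz (m 0) (%i. lkx r 0 i))"
 using alg_hom_mult[OF Ph] R_ge[OF r, of 0] by (simp add: mon_def Ph_t)
 then obtain a c where "sg (tk 0 (lkt r 0)) 1: a ~= 0:" "Ph (G.zz (m 0) (%i. lkx r 0 i)) c ~= 0:" "g = a + c"
 using mult_support[OF _ L0_car[OF zz_L0[OF order_refl d]], of "sg (tk 0 (lkt r 0)) 1:" g] g by auto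
 hence "a = tk 0 (lkt r 0)" "c : G0" "g = a + c" using L0_supp[OF zz_L0[OF order_refl d]] by (auto simp: single_def split: if_splits)
 thus ?thesis by (simp add: lk G0_def)
qed

text \<open>If the image of each basis monomial lies entirely inside or entirely outside
  \<open>C\<close>, the projection just selects basis monomials and so does not leave the
  algebra.\<close>

lemma restriction:
 assumes x: "x :.W" and C: "!!r g g'. r : R ==> Ph (b r) g ~= 0: ==> Ph (b r) g' ~= 0: ==> g : C \<longleftrightarrow> g' : C"
 shows "EX y:lspan K W (b ` {r : R. lowr r : C}). Ph y = rs C (Ph x)"
 using b_span[OF x]
proof (induction rule: lspan.induct)
 case zero
 thus ?case using alg_hom_zero[OF Ph G.W.ring_axioms T.T.L.ring_axioms] by (intro bexI[OF _ lspan.zero]) (simp add: rs_zero)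
next
 case (step k v x)
 let ?S = "b ` {r : R. lowr r : C}"
 have S: "?S <= car W" using b_closed by auto
 have xc: "x :.W" using lspan_closed[OF B step(3) b_img] .
 obtain r where r: "r : R" "v = b r" using step(2) by blast
 have vc: "v :.W" using r b_closed by simp
 obtain y where y: "y : lspan K W ?S" "Ph y = rs C (Ph x)" using step(4) by blast
 have yc: "y :.W" using lspan_closed[OF B y(1) S] .
 have e: "rs C (Ph (k *:.W v +:.W x)) = k *:.L rs C (Ph v) +:.L Ph y"
 using step(1) vc xc by (auto simp: alg_hom_add[OF Ph] alg_hom_smult[OF Ph] rs_add y(2)) (auto simp: res_def T.T.L_smult T.T.L_add fun_eq_iff)
 have lr: "Ph (b r) (lowr r) ~= 0:" using b_low[OF r(1)] by (simp add: T.low_at_def)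
 show ?case
 proof (cases "lowr r : C")
 case True
 have "rs C (Ph v) = Ph v" unfolding r(2) by (rule rs_eq) (use C[OF r(1) _ lr] True in blast)
 hence "Ph (k *:.W v +:.W y) = rs C (Ph (k *:.W v +:.W x))"
 unfolding e using step(1) vc yc by (simp add: alg_hom_add[OF Ph] alg_hom_smult[OF Ph])
 thus ?thesis using True r by (intro bexI[of _ "k *:.W v +:.W y"] lspan.step[OF step(1) _ y(1)]) auto
 next
 case False
 have "rs C (Ph v) = 0:.L" unfolding r(2) by (rule rs_none) (use C[OF r(1) _ lr] False in blast)
 hence "Ph y = rs C (Ph (k *:.W v +:.W x))" unfolding e using step(1) Ph_closed[OF yc] by (simp add: T.T.L.smult_r_null)
 thus ?thesis using y(1) by blast
 qed
qed

definition pi where "pi x = (THE y. y :.W & Ph y = rs G0 (Ph x))"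

text \<open>When the x-exponents of a monomial lie in the lattice, \<open>b_class\<close> puts all
  its exponents on the same side; otherwise none is in the lattice. So the torus projection
  restricts to the algebra, and its values are central by \<open>central_iff\<close>.\<close>

lemma pi: assumes x: "x :.W" shows "pi x :.D.Z" "Ph (pi x) = rs G0 (Ph x)"
proof -
 have G0_iff: "g : G0 \<longleftrightarrow> g' : G0" if r: "r : R" and g: "Ph (b r) g ~= 0:" "Ph (b r) g' ~= 0:" for r g g'
 proof (cases "ALL i<m 0. int (nn 0 i) dvd lkx r 0 i")
 case True
 have "int N dvd (lkt g 0 - lkt r 0) - (lkt g' 0 - lkt r 0)" by (rule dvd_diff[OF b_class[OF r _ g(1)] b_class[OF r _ g(2)]]) (use True in auto)
 hence "int N dvd lkt g 0 - lkt g' 0" by simp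
 from dvd_add_right_iff[OF this, of "lkt g' 0"] have "int N dvd lkt g 0 \<longleftrightarrow> int N dvd lkt g' 0" by simp
 thus ?thesis using b_degree(1)[OF r g(1)] b_degree(1)[OF r g(2)] by (simp add: G0_def)
 next
 case False
 thus ?thesis using b_degree(1)[OF r g(1)] b_degree(1)[OF r g(2)] by (auto simp: G0_def)
 qed
 have sub: "b ` {r : R. lowr r : G0} <= car W" using b_closed by auto
 obtain y where y: "y : lspan K W (b ` {r : R. lowr r : G0})" "Ph y = rs G0 (Ph x)" using restriction[OF x, of G0] G0_iff by blast
 have "y :.W" using lspan_closed[OF B y(1) sub] .
 hence "EX! y. y :.W & Ph y = rs G0 (Ph x)" using y(2) Ph_inj by (intro ex1I[of _ y]) auto
 from theI'[OF this] have p: "pi x :.W" "Ph (pi x) = rs G0 (Ph x)" by (auto simp: pi_def)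
 thus "pi x :.D.Z" "Ph (pi x) = rs G0 (Ph x)" using central_iff rs_L0[OF Ph_closed[OF x]] by auto
qed

lemma Z_L0: "z :.D.Z ==> Ph z : L0" using central_iff D.Z_car by blast

lemma pi_mult: assumes "z :.D.Z" "x :.W" shows "pi (z**.W x) = z**.W pi x"
proof (rule Ph_inj)
 have zc: "z :.W" using D.Z_car[OF assms(1)] .
 thus "pi (z**.W x) :.W" "z**.W pi x :.W" using pi assms D.Z_car by auto
 have "rs G0 (Ph z**.L Ph x) = Ph z**.L rs G0 (Ph x)"
 by (rule rs_mult(1)) (use assms zc Ph_closed G0_add L0_supp[OF Z_L0[OF assms(1)]] in auto)
 thus "Ph (pi (z**.W x)) = Ph (z**.W pi x)" using pi assms zc D.Z_car by (simp add: alg_hom_mult[OF Ph])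
qed

lemma pi_add: assumes "x :.W" "y :.W" shows "pi (x +:.W y) = pi x +:.W pi y"
proof (rule Ph_inj)
 show "Ph (pi (x +:.W y)) = Ph (pi x +:.W pi y)"
 using assms pi[OF assms(1)] pi[OF assms(2)] pi(2)[of "x +:.W y"] D.Z_car by (simp add: alg_hom_add[OF Ph] rs_add)
qed (use pi assms D.Z_car in auto)

lemma pi_zero: assumes "x :.W" "!!g. Ph x g ~= 0: ==> g \<notin> G0" shows "pi x = 0:.W"
 using rs_none[OF assms(2)] pi[OF assms(1)] Ph_eq_zero D.Z_car by auto

lemma pi_central: "z :.D.Z ==> pi z = z"
 using pi[of z] L0_rs[OF Z_L0] D.Z_car by (intro Ph_inj) auto

end

section \<open>The rank and the regular trace\<close>

context coprime_gwa
begin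

abbreviation tw where "tw k == cfl 0 (tp k)"
text \<open>The a-th power of the product of all y_i with i in \<open>Y\<close> and all x_i with i
  outside \<open>Y\<close>. For empty \<open>Y\<close> the image is a torus monomial
  (\<open>Ph_ze\<close>).\<close>

definition ze where "ze Y a = G.zz (m 0) (%i. if i : Y then - int a else int a)"

lemma ze_closed [simp]: "ze Y a :.W" and tw_closed: "tw k :.W" by (simp_all add: ze_def)

lemma tw_add: "tw j**.W tw k = tw (j + k)" using G.cf_mult[of "tp j" "tp k"] G.tp_add[of j k] by simp

lemma ze_add: "ze Y a**.W ze Y c = ze Y (a + c)"
 unfolding ze_def by (subst G.zz_add) (auto intro!: G.zz_cong)

lemma ze_central: "N dvd a ==> ze Y a :.D.Z"
 using nn_dvd_N unfolding central_iff[OF ze_closed] unfolding ze_def by (intro zz_L0) (auto intro: dvd_trans)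

lemma tw_central: "N dvd k ==> tw k :.D.Z"
 unfolding central_iff[OF tw_closed] Ph_t using nn_dvd_N by (intro L0_sg) (auto simp: G0_def lk)

lemma Ph_ze: "Ph (ze {} a) = sg (\<Sum>i<m 0. xk 0 i (int a)) 1:"
proof -
 have "Ph (G.zz n (%i. int a)) = sg (\<Sum>i<n. xk 0 i (int a)) 1:" if "n <= m 0" for n
 using that
 proof (induction n)
 case 0
 show ?case using alg_hom_one[OF Ph] by (simp add: T.T.L_one)
 next
 case (Suc n)
 have "Ph (G.zp n (int a)) = sg (xk 0 n (int a)) 1:"
 using Suc.prems alg_hom_pow[OF Ph G.W.ring_axioms, of "G.xg n" a] vp(3)[OF s0, of n] sg_xk_pow by (simp add: G.zp_def)
 thus ?case using Suc alg_hom_mult[OF Ph, of "G.zz n (%i. int a)" "G.zp n (int a)"] by (simp add: sg_one_mult)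
 qed
 thus ?thesis by (simp add: ze_def)
qed

text \<open>Coset representatives modulo the lattice. The number r below N^2 encodes a common
  x-exponent \<open>r div N\<close> and a t-residue \<open>r mod N\<close>. The parameter
  \<open>C\<close> tilts the t-exponent: 0 gives the exponents of the basis \<open>v\<close>, and
  \<open>cY Y\<close> makes the weight nu_Y of the representative equal to
  \<open>r mod N\<close>.\<close>

definition ga :: "int => nat => expo"
 where "ga C r = tk 0 (int (r mod N) - int (r div N) * C) + (\<Sum>i<m 0. xk 0 i (int (r div N)))"

lemma ga_lk: "lkt (ga C r) 0 = int (r mod N) - int (r div N) * C" "i < m 0 ==> lkx (ga C r) 0 i = int (r div N)"
 by (simp_all add: ga_def lookup_sum lk)

text \<open>As the n_i are pairwise coprime, one number below \<open>N\<close> has the prescribed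
  residue modulo each of them, so equal x-exponents suffice. The t-residue is then adjusted for the
  tilt.\<close>

lemma class_exists: "EX r<N * N. g - ga C r : G0"
proof -
 obtain x where x: "ALL i:{..<m 0}. x mod nn 0 i = nat (lkx g 0 i mod int (nn 0 i)) mod nn 0 i"
 using chinese_remainder_nat[of "{..<m 0}" "nn 0" "%i. nat (lkx g 0 i mod int (nn 0 i))"] n_cop
 by (auto simp: unique_euclidean_semiring_class.cong_def)
 define av where "av = x mod N"
 define k where "k = nat ((lkt g 0 + int av * C) mod int N)"
 have k: "k < N" "int k = (lkt g 0 + int av * C) mod int N" and av: "av < N" using N_pos by (auto simp: k_def av_def nat_less_iff)
 let ?r = "av * N + k"
 have r: "?r mod N = k" "?r div N = av" using k by auto
 have "Suc av * N <= N * N" using av by (intro mult_le_mono1) simp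
 hence "?r < N * N" using k(1) by simp
 moreover have "int (nn 0 i) dvd lkx g 0 i - int av" if i: "i < m 0" for i
 proof -
 have "av mod nn 0 i = nat (lkx g 0 i mod int (nn 0 i)) mod nn 0 i"
 using x i nn_dvd_N[OF i] by (simp add: av_def mod_mod_cancel)
 hence "int av mod int (nn 0 i) = lkx g 0 i mod int (nn 0 i)" using n_pos[OF i] by (simp flip: of_nat_mod add: nat_mod_distrib[symmetric]) (simp add: of_nat_mod)
 thus ?thesis by (metis mod_eq_dvd_iff)
 qed
 moreover have "int N dvd lkt g 0 - (int k - int av * C)"
 proof -
 have "int N dvd (lkt g 0 + int av * C) - (lkt g 0 + int av * C) mod int N" by (rule dvd_minus_mod)
 thus ?thesis unfolding k(2)[symmetric] by (simp add: algebra_simps)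
 qed
 ultimately show ?thesis by (intro exI[of _ ?r]) (simp add: G0_def lookup_minus ga_lk r k(1))
qed

lemma class_unique:
 assumes "r < N * N" "r' < N * N" "g - ga C r : G0" "g - ga C r' : G0" shows "r = r'"
proof -
 have "(g - ga C r) + - (g - ga C r') : G0" using assms G0_ops by blast
 hence d: "ga C r' - ga C r : G0" by simp
 have small: "x = y" if "int N dvd int x - int y" "x < N" "y < N" for x y
 proof (rule ccontr)
 assume "x ~= y"
 hence "\<bar>int N\<bar> <= \<bar>int x - int y\<bar>" using that(1) by (intro dvd_imp_le_int) auto
 thus False using that(2,3) by linarith
 qed
 have "int N dvd int (r' div N) - int (r div N)" using d by (intro N_dvd) (auto simp: G0_def lookup_minus ga_lk)
 hence e: "r' div N = r div N" using assms less_mult_imp_div_less by (intro small) auto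
 have "int N dvd int (r' mod N) - int (r mod N)" using d by (simp add: G0_def lookup_minus ga_lk e)
 hence "r' mod N = r mod N" using N_pos by (intro small) auto
 thus ?thesis using e div_mult_mod_eq[of r N] div_mult_mod_eq[of r' N] by simp
qed

definition cls where "cls C r = {g. g - ga C r : G0}"

lemma L_finsum_value: "finite J ==> F : J \<rightarrow> car L ==> (++.L r:J. F r) g = (++r:J. F r g)"
proof (induction J rule: finite_induct)
 case (insert a J)
 have v: "F r g :.K" if "r : insert a J" for r using insert.prems that by (auto intro: T.T.L_value)
 show ?case using insert v T.T.L.finsum_insert[of J a F] by (simp add: T.T.L_add Pi_iff)
qed (simp add: T.T.L_zero)

lemma rs_partition: assumes f: "f :.L" shows "(++.L r:{..<N * N}. rs (cls C r) f) = f"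
proof
 fix g
 have fg: "f g :.K" using T.T.L_value[OF f] .
 obtain p where p: "p < N * N" "g - ga C p : G0" using class_exists by blast
 have u: "g : cls C r \<longleftrightarrow> p = r" if "r < N * N" for r
 using class_unique[OF p(1) that p(2)] p(2) by (auto simp: cls_def)
 have "(++.L r:{..<N * N}. rs (cls C r) f) g = (++r:{..<N * N}. rs (cls C r) f g)" using f by (intro L_finsum_value) auto
 also have "... = (++r:{..<N * N}. if p = r then f g else 0:)"
 using u fg by (intro finsum_cong') (auto simp: res_def)
 also have "... = f g" using p(1) fg finsum_singleton[of p "{..<N * N}" "%_. f g"] by auto
 finally show "(++.L r:{..<N * N}. rs (cls C r) f) g = f g" .
qed

text \<open>The monomials \<open>v\<close> represent the classes, and \<open>v'\<close> complements
  them: in both orders the product of \<open>v r\<close> and \<open>v' r\<close> is the central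
  element \<open>DD\<close>. Factors occur in opposite order so that the inner ones merge.\<close>

definition v where "v r = tw (r mod N)**.W ze {} (r div N)"
definition v' where "v' r = ze {} (N - r div N)**.W tw (N - r mod N)"
definition DD where "DD = tw N**.W ze {} N"

lemma v_closed: "v r :.W" "v' r :.W" using tw_closed by (simp_all add: v_def v'_def)

lemma DD: "DD :.D.Z" unfolding DD_def by (rule D.Z_closed(3)) (simp_all add: tw_central ze_central)

lemma div_less: "r < N * N ==> r div N < N" by (rule less_mult_imp_div_less)

lemma v_v': assumes "r < N * N" shows "v' r**.W v r = DD" "v r**.W v' r = DD"
proof -
 have tN: "tw N :.W" "ze {} N :.W" and c: "tw N :.D.Z" "ze {} N :.D.Z" by (simp_all add: tw_closed tw_central ze_central)
 have k: "N - r mod N + r mod N = N" "r mod N + (N - r mod N) = N" "N - r div N + r div N = N" "r div N + (N - r div N) = N"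
 using N_pos div_less[OF assms] by (simp_all add: less_imp_le)
 have "v' r**.W v r = ze {} (N - r div N)**.W ((tw (N - r mod N)**.W tw (r mod N))**.W ze {} (r div N))"
 using tw_closed by (simp add: v_def v'_def G.W.m_assoc)
 also have "... = (tw N**.W ze {} (N - r div N))**.W ze {} (r div N)"
 unfolding tw_add k using tN by (simp add: D.Z_comm[OF c(1) ze_closed] G.W.m_assoc)
 finally show "v' r**.W v r = DD" using tN by (simp add: DD_def ze_add k G.W.m_assoc)
 have "v r**.W v' r = tw (r mod N)**.W ((ze {} (r div N)**.W ze {} (N - r div N))**.W tw (N - r mod N))"
 using tw_closed by (simp add: v_def v'_def G.W.m_assoc)
 also have "... = (tw (r mod N)**.W tw (N - r mod N))**.W ze {} N"
 unfolding ze_add k D.Z_comm[OF c(2) tw_closed] using tw_closed by (simp add: G.W.m_assoc)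
 finally show "v r**.W v' r = DD" by (simp add: DD_def tw_add k)
qed

lemma Ph_v: "Ph (v r) = sg (ga 0 r) 1:"
 using alg_hom_mult[OF Ph tw_closed ze_closed] by (simp add: v_def Ph_t Ph_ze sg_one_mult ga_def)

lemma Ph_v': assumes "r < N * N" obtains a k where "k :.K" "Ph (v' r) = sg a k" "a + ga 0 r : G0"
proof (rule that)
 let ?a = "(\<Sum>i<m 0. xk 0 i (int (N - r div N))) + tk 0 (int (N - r mod N))"
 show "Ph (v' r) = sg ?a (cc (\<Sum>i<m 0. xk 0 i (int (N - r div N))) (tk 0 (int (N - r mod N))))"
 using alg_hom_mult[OF Ph ze_closed tw_closed] by (simp add: v'_def Ph_t Ph_ze sg_one_mult)
 show "?a + ga 0 r : G0" using N_pos div_less[OF assms] nn_dvd_N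
 by (simp add: G0_def lookup_add ga_lk lookup_sum lk of_nat_diff less_imp_le)
qed simp

lemma finsum_Ph: "f : J \<rightarrow> car W ==> Ph (++.W i:J. f i) = (++.L i:J. Ph (f i))"
 by (rule alg_hom_finsum[OF Ph G.W.assoc_algebra_axioms T.T.L.assoc_algebra_axioms])

text \<open>Multiplying by \<open>v' r\<close> moves exactly the class of \<open>v r\<close> into
  the lattice, so the projection of x v'_r picks the component of \<open>x\<close> in that class,
  and the factor \<open>v r\<close> restores it up to \<open>DD\<close>. Summing over all classes
  gives \<open>DD\<close> times \<open>x\<close>.\<close>

lemma dual: "dual_basis W (N * N) v (%r x. pi (x**.W v' r)) DD"
proof (intro dual_basis.intro center_localization.intro dual_basis_axioms.intro D.noncomm_domain_axioms)
 show "v r :.W" for r by (rule v_closed)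
 show "pi (x**.W v' r) :.D.Z" if "x :.W" for r x using that v_closed pi by simp
 show "pi ((x +:.W y)**.W v' r) = pi (x**.W v' r) +:.W pi (y**.W v' r)" if "x :.W" "y :.W" for r x y
 using that v_closed by (simp add: G.W.l_distr pi_add)
 show "pi (z**.W x**.W v' r) = z**.W pi (x**.W v' r)" if "z :.D.Z" "x :.W" for r z x
 using that v_closed D.Z_car by (simp add: G.W.m_assoc pi_mult)
 show "DD :.D.Z" by (rule DD)
 have DDn: "Ph DD = sg (tk 0 (int N) + (\<Sum>i<m 0. xk 0 i (int N))) 1:"
 using alg_hom_mult[OF Ph tw_closed ze_closed] by (simp add: DD_def Ph_t Ph_ze sg_one_mult)
 thus "DD ~= 0:.W" using alg_hom_zero[OF Ph G.W.ring_axioms T.T.L.ring_axioms] T.sg_nonzero one_not_zero by metis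
 show "pi (v r'**.W v' r) = (if r' = r then DD else 0:.W)" if r: "r < N * N" "r' < N * N" for r r'
 proof (cases "r' = r")
 case True
 thus ?thesis using v_v'(2)[OF r(1)] pi_central[OF DD] by simp
 next
 case False
 obtain a k where a: "k :.K" "Ph (v' r) = sg a k" "a + ga 0 r : G0" using Ph_v'[OF r(1)] .
 have "ga 0 r' + a \<notin> G0"
 proof
 assume "ga 0 r' + a : G0"
 hence "(ga 0 r' + a) + - (a + ga 0 r) : G0" using a(3) G0_ops by blast
 thus False using class_unique[OF r(2,1), of "ga 0 r'" 0] G0_ops(3) False by simp
 qed
 moreover have "Ph (v r'**.W v' r) = sg (ga 0 r' + a) (cc (ga 0 r') a**(1:**k))"
 using alg_hom_mult[OF Ph v_closed] a T.sg_mult[of \<one> k] by (simp add: Ph_v)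
 ultimately have "pi (v r'**.W v' r) = 0:.W" using v_closed by (intro pi_zero) (auto simp: single_def split: if_splits)
 thus ?thesis using False by simp
 qed
 fix x assume x: "x :.W"
 have t: "Ph (pi (x**.W v' r)**.W v r) = rs (cls 0 r) (Ph x)**.L Ph DD" if r: "r < N * N" for r
 proof -
 obtain a k where a: "k :.K" "Ph (v' r) = sg a k" "a + ga 0 r : G0" using Ph_v'[OF r] .
 have xv: "x**.W v' r :.W" using x v_closed by simp
 have "Ph (pi (x**.W v' r)) = rs G0 (Ph x**.L Ph (v' r))" using pi(2)[OF xv] alg_hom_mult[OF Ph x v_closed(2)] by simp
 also have "... = rs (cls 0 r) (Ph x)**.L Ph (v' r)"
 proof (rule rs_mult(2))
 fix e c assume "Ph (v' r) e ~= 0:"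
 hence "e = a" by (auto simp: a(2) single_def split: if_splits)
 thus "c + e : G0 \<longleftrightarrow> c : cls 0 r" using G0_add[OF a(3), of "c - ga 0 r"] by (simp add: cls_def algebra_simps)
 qed (use Ph_closed x v_closed in auto)
 finally have "Ph (pi (x**.W v' r)**.W v r) = rs (cls 0 r) (Ph x)**.L Ph (v' r)**.L Ph (v r)"
 using alg_hom_mult[OF Ph D.Z_car[OF pi(1)[OF xv]] v_closed(1)] by simp
 also have "... = rs (cls 0 r) (Ph x)**.L Ph (v' r**.W v r)"
 using Ph_closed x v_closed alg_hom_mult[OF Ph v_closed(2) v_closed(1)] by (simp add: T.T.L.m_assoc)
 finally show ?thesis unfolding v_v'(1)[OF r] .
 qed
 have c: "(%r. pi (x**.W v' r)**.W v r) : {..<N * N} \<rightarrow> car W" using x v_closed pi(1) D.Z_car by auto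
 have DDc: "Ph DD :.L" using Ph_closed DD D.Z_car by blast
 show "DD**.W x = (++.W r:{..<N * N}. pi (x**.W v' r)**.W v r)"
 proof (rule Ph_inj)
 have "Ph (++.W r:{..<N * N}. pi (x**.W v' r)**.W v r) = (++.L r:{..<N * N}. rs (cls 0 r) (Ph x)**.L Ph DD)"
 unfolding finsum_Ph[OF c] using t Ph_closed[OF x] DDc by (intro T.T.L.finsum_cong') auto
 also have "... = (++.L r:{..<N * N}. rs (cls 0 r) (Ph x))**.L Ph DD"
 using Ph_closed[OF x] DDc by (intro T.T.L.finsum_ldistr[symmetric]) auto
 also have "... = Ph DD**.L Ph x" unfolding rs_partition[OF Ph_closed[OF x]] using L0_comm[OF Z_L0[OF DD] Ph_closed[OF x]] by simp
 finally show "Ph (DD**.W x) = Ph (++.W r:{..<N * N}. pi (x**.W v' r)**.W v r)"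
 using alg_hom_mult[OF Ph D.Z_car[OF DD] x] by simp
 qed (use x DD D.Z_car c G.W.finsum_closed in auto)
qed

lemma rank: "center_rank W = N * N"
 by (rule dual_basis.center_rank_eq[OF dual])

text \<open>Since v_r v'_r is the central \<open>DD\<close>, each diagonal entry is the projection
  of \<open>DD\<close> times \<open>x\<close>, the same for all r.\<close>

lemma trace_value: assumes x: "x :.W"
 shows "regular_trace W x = center_embedding W (add_pow D.Z (N * N) (pi x))"
proof (rule dual_basis.regular_trace_eq[OF dual x pi(1)[OF x]])
 fix r assume "r < N * N"
 hence "x**.W v r**.W v' r = DD**.W x" using x v_closed v_v'(2) D.Z_comm[OF DD x] by (simp add: G.W.m_assoc)
 thus "pi (x**.W v r**.W v' r) = DD**.W pi x" using pi_mult[OF DD x] by simp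
qed

text \<open>Each monomial is a central one times one with exponents in a bounded box, and scalars of
  the field act through the center.\<close>

lemma finitely_generated: "fin_gen_module D.Z (over_center W)"
proof -
 have CL: "center_localization W" by (intro center_localization.intro D.noncomm_domain_axioms)
 note oc_ops = center_localization.oc_ops[OF CL]
 interpret oc: assoc_algebra D.Z "over_center W" by (rule center_localization.oc_algebra[OF CL])
 let ?E = "{..<N} \<times> ({..<m 0} \<rightarrow>\<^sub>E {- int N..int N})"
 define F where "F e = tw (fst e)**.W G.zz (m 0) (snd e)" for e
 define S where "S = F ` ?E"
 have Fc: "F e :.W" for e using tw_closed by (simp add: F_def)
 have Sc: "S <= car W" unfolding S_def by (rule image_subsetI) (rule Fc)
 have fin: "finite S" unfolding S_def by (intro finite_imageI finite_cartesian_product finite_PiE) auto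
 have dec: "EX z:car D.Z. EX y:S. b r = z**.W y" if r: "r : R" for r
 proof -
 let ?j = "nat (lkt r 0)" and ?a = "%i. lkx r 0 i"
 \<comment> \<open>Remainders are taken of absolute values, so that quotient part and remainder have
   the sign of the exponent. \<open>zz_add\<close> splits a monomial only without mixing x_i and
   y_i.\<close>
 define a1 where "a1 i = sgn (?a i) * (\<bar>?a i\<bar> mod int (nn 0 i))" for i
 define a0 where "a0 i = sgn (?a i) * (int (nn 0 i) * (\<bar>?a i\<bar> div int (nn 0 i)))" for i
 have sum: "a0 i + a1 i = ?a i" for i
 unfolding a0_def a1_def distrib_left[symmetric] by (simp add: sgn_mult_abs)
 have sgn: "0 <= a0 i * a1 i" if i: "i < m 0" for i
 proof -
 have "0 < int (nn 0 i)" using n_pos[OF i] by simp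
 hence "0 <= int (nn 0 i) * (\<bar>?a i\<bar> div int (nn 0 i)) * (\<bar>?a i\<bar> mod int (nn 0 i))"
 by (intro mult_nonneg_nonneg) (auto simp: pos_imp_zdiv_nonneg_iff)
 moreover have "a0 i * a1 i = (sgn (?a i) * sgn (?a i)) * (int (nn 0 i) * (\<bar>?a i\<bar> div int (nn 0 i)) * (\<bar>?a i\<bar> mod int (nn 0 i)))"
 by (simp only: a0_def a1_def mult.assoc mult.left_commute)
 ultimately show ?thesis by (simp only: zero_le_square mult_nonneg_nonneg)
 qed
 let ?a1 = "restrict a1 {..<m 0}"
 have z1: "G.zz (m 0) a1 = G.zz (m 0) ?a1" by (rule G.zz_cong) simp
 have a1b: "?a1 : {..<m 0} \<rightarrow>\<^sub>E {- int N..int N}"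
 proof (intro restrict_PiE_iff[THEN iffD2] ballI)
 fix i assume "i : {..<m 0}"
 hence i: "i < m 0" by simp
 have "nn 0 i <= N" using nn_dvd_N[OF i] N_pos by (rule dvd_imp_le)
 moreover have "\<bar>?a i\<bar> mod int (nn 0 i) < int (nn 0 i)" "0 <= \<bar>?a i\<bar> mod int (nn 0 i)" using n_pos[OF i] by simp_all
 ultimately have "\<bar>?a i\<bar> mod int (nn 0 i) <= int N" "0 <= \<bar>?a i\<bar> mod int (nn 0 i)" by linarith+
 thus "a1 i : {- int N..int N}" unfolding a1_def sgn_if by auto
 qed
 have z0: "G.zz (m 0) a0 :.D.Z" using zz_L0[of "m 0" a0] by (subst central_iff) (auto simp: a0_def)
 have t0: "tw (N * (?j div N)) :.D.Z" by (rule tw_central) simp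
 have "b r = tw (N * (?j div N) + ?j mod N)**.W (G.zz (m 0) a0**.W G.zz (m 0) a1)"
 unfolding mon_def using G.zz_add[of "m 0" a0 a1] sgn by (simp add: sum)
 also have "... = tw (N * (?j div N))**.W (tw (?j mod N)**.W G.zz (m 0) a0)**.W G.zz (m 0) a1"
 unfolding tw_add[symmetric] using tw_closed by (simp add: G.W.m_assoc)
 also have "tw (?j mod N)**.W G.zz (m 0) a0 = G.zz (m 0) a0**.W tw (?j mod N)" using D.Z_comm[OF z0 tw_closed] by simp
 also have "tw (N * (?j div N))**.W (G.zz (m 0) a0**.W tw (?j mod N))**.W G.zz (m 0) a1 =
 (tw (N * (?j div N))**.W G.zz (m 0) a0)**.W F (?j mod N, ?a1)"
 unfolding F_def z1 using tw_closed by (simp add: G.W.m_assoc)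
 finally have e: "b r = (tw (N * (?j div N))**.W G.zz (m 0) a0)**.W F (?j mod N, ?a1)" .
 have "F (?j mod N, ?a1) : S" unfolding S_def by (rule imageI) (use a1b N_pos in simp)
 thus ?thesis using e D.Z_closed(3)[OF t0 z0] by (intro bexI)
 qed
 have k_Z: "k *:.W z :.D.Z" if "k :.K" "z :.D.Z" for k z
 unfolding D.Z_iff
 proof (intro conjI ballI)
 show "k *:.W z :.W" using that D.Z_car by simp
 fix x assume x: "x :.W"
 show "(k *:.W z)**.W x = x**.W (k *:.W z)"
 unfolding G.W.smult_mult_left[OF that(1) D.Z_car[OF that(2)] x] G.W.smult_mult_right[OF that(1) x D.Z_car[OF that(2)]] D.Z_comm[OF that(2) x] ..
 qed
 have span: "x : lspan D.Z (over_center W) S" if "x :.W" for x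
 using b_span[OF that]
 proof (induction rule: lspan.induct)
 case zero
 show ?case using lspan.zero[of "over_center W" D.Z S] by (simp add: oc_ops)
 next
 case (step k y x)
 obtain r where r: "r : R" "y = b r" using step(2) by blast
 obtain z e where ze: "z :.D.Z" "e : S" "y = z**.W e" using dec[OF r(1)]
 by (elim bexE) (rule that, assumption, assumption, simp add: r(2))
 have "k *:.W y = (k *:.W z)**.W e" unfolding ze(3) using G.W.smult_mult_left[OF step(1) D.Z_car[OF ze(1)]] ze(2) Sc by auto
 thus ?case using lspan.step[OF k_Z[OF step(1) ze(1)] ze(2) step(4)] by (simp add: oc_ops)
 qed
 show ?thesis
 unfolding fin_gen_module_def
 proof (intro exI[of _ S] conjI ballI)
 show "S <= car (over_center W)" using Sc by (simp add: oc_ops)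
 fix x assume "x :.(over_center W)"
 hence x: "x : lspan D.Z (over_center W) ((%s. s) ` S)" using span by (simp add: oc_ops)
 obtain T k where T: "finite T" "T <= S" "k : T \<rightarrow> car D.Z" "x = (++.(over_center W) i:T. k i *:.(over_center W) i)"
 using lspan_finsum[OF oc.assoc_algebra_axioms x] Sc by (auto simp: oc_ops(1))
 let ?c = "%s. if s : T then k s else 0:.D.Z"
 have "(++.(over_center W) i:T. k i *:.(over_center W) i) = (++.(over_center W) s:S. ?c s *:.(over_center W) s)"
 proof (rule oc.add.finprod_mono_neutral_cong_left[OF fin T(2)])
 have sc: "s :.(over_center W)" if "s : S" for s using that Sc by (auto simp: oc_ops(1))
 show "?c s *:.(over_center W) s = 0:.(over_center W)" if "s : S - T" for s using that oc.smult_l_null[OF sc, of s] by simp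
 show "(%s. ?c s *:.(over_center W) s) : S \<rightarrow> car (over_center W)"
 using sc T(3) by (intro funcsetI oc.smult_closed) auto
 qed simp
 thus "EX c:S \<rightarrow> car D.Z. x = (++.(over_center W) s:S. c s *:.(over_center W) s)"
 using T by (intro bexI[of _ ?c]) auto
 qed (rule fin)
qed

lemma setting: "discriminant_setting W"
 unfolding discriminant_setting_def
proof (intro conjI finitely_generated)
 show "prime_ring W"
 unfolding prime_ring_def
 proof (intro conjI ballI impI G.W.ring_axioms B_nontrivial)
 fix a c assume ac: "a :.W" "c :.W" "ALL r:car W. a**.W r**.W c = 0:.W"
 hence "a**.W 1:.W**.W c = 0:.W" by blast
 thus "a = 0:.W | c = 0:.W" using ac B_integral[of a c] by simp
 qed
 interpret Z: domain D.Z by (rule D.Z_domain)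
 show "regular_trace W ` car W <= center_embedding W ` car D.Z"
 using pi(1) by (auto simp: trace_value intro!: imageI Z.add.nat_pow_closed)
qed

end

section \<open>The discriminant ideal\<close>

lemma (in center_localization) embedding:
 "center_embedding W : ring_hom Z F" "inj_on (center_embedding W) (car Z)" "cring F"
proof -
 have e: "center_embedding W = (%z. CZ.fr z 1:)" by (simp add: fun_eq_iff center_embedding_def fraction_eq)
 show "center_embedding W : ring_hom Z F" unfolding e by (rule emb_ring_hom)
 show "inj_on (center_embedding W) (car Z)" unfolding e using CZ.fr_embedding(2) by (simp add: Z_ops(3))
 show "cring F" by (rule F.is_cring)
qed

text \<open>The points \<open>q ^ k\<close> with \<open>k < n\<close> are distinct, and \<open>n = 0\<close> would make every polynomial of degree less than
 \<open>n\<close> have sum zero over them.\<close>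

lemma (in field) primitive_root_order_nonzero:
 assumes q: "q :.R" "q [^] (n::nat) = 1:" and n: "0 < n" and prim: "!!k. 0 < k ==> k < n ==> q [^] (k::nat) ~= 1:"
 shows "add_pow R n 1: ~= 0:"
proof
 assume z: "add_pow R n 1: = 0:"
 \<comment> \<open>Values at q^k of the polynomial of degree \<open>s\<close> vanishing at q, ...,
   q^s. Raising \<open>s\<close> by one trades a degree j + 1 against j, which drives the induction
   for \<open>S\<close>.\<close>
 define f where "f s k = (\<Otimes>l\<in>{..<s}. q [^] k \<ominus> q [^] Suc l)" for s k :: nat
 have qc: "q [^] k :.R" for k :: nat using q by simp
 have fc: "f s k :.R" for s k unfolding f_def using qc q(1) by (intro finprod_closed) auto
 have fS: "f (Suc s) k = (q [^] k \<ominus> q [^] Suc s)**f s k" for s k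
 unfolding f_def lessThan_Suc using qc q(1) by (intro finprod_insert) auto
 have tc: "(q [^] k) [^] j**f s k :.R" for k j s :: nat using qc fc by simp
 have S: "(++k:{..<n}. (q [^] k) [^] j**f s k) = 0:" if "j + s < n" for j s :: nat
 using that
 proof (induction s arbitrary: j)
 case 0
 have f0: "f 0 k = 1:" for k by (simp add: f_def)
 show ?case
 proof (cases "j = 0")
 case True
 have "(++k:{..<n}. 1:) = add_pow R n 1:" using add.finprod_const[of \<one> "{..<n}"] by simp
 thus ?thesis using z by (simp add: True f0)
 next
 case False
 let ?x = "q [^] j"
 have x: "?x :.R" "?x ~= 1:" using prim[of j] False 0 qc by auto
 have g: "(?x \<ominus> 1:)**(++k:{..<i}. ?x [^] k) = ?x [^] i \<ominus> 1:" for i :: nat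
 proof (induction i)
 case (Suc i)
 have s: "(++k:{..<i}. ?x [^] k) :.R" using x by (intro finsum_closed) auto
 have "(++k:{..<Suc i}. ?x [^] k) = ?x [^] i +: (++k:{..<i}. ?x [^] k)"
 unfolding lessThan_Suc using x by (intro finsum_insert) auto
 hence "(?x \<ominus> 1:)**(++k:{..<Suc i}. ?x [^] k) = (?x \<ominus> 1:)**?x [^] i +: (?x [^] i \<ominus> 1:)"
 using s x Suc by (simp add: r_distr)
 also have "... = (?x**?x [^] i \<ominus> ?x [^] i) +: (?x [^] i \<ominus> 1:)" using x by (simp add: a_minus_def l_distr l_minus)
 also have "... = ?x**?x [^] i \<ominus> 1:" using x by (simp add: a_minus_def a_assoc r_neg1)
 finally show ?case using x by (simp add: nat_pow_Suc m_comm)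
 qed (use x in \<open>simp add: a_minus_def r_neg\<close>)
 have "?x [^] n = (q [^] n) [^] j" by (simp only: nat_pow_pow[OF q(1)] mult.commute)
 hence "(?x \<ominus> 1:)**(++k:{..<n}. ?x [^] k) = 0:" unfolding g q(2) by (simp add: a_minus_def r_neg nat_pow_one)
 moreover have "?x \<ominus> 1: ~= 0:" using x by simp
 moreover have "(++k:{..<n}. ?x [^] k) :.R" using x by (intro finsum_closed) auto
 ultimately have "(++k:{..<n}. ?x [^] k) = 0:" using integral[of "?x \<ominus> 1:"] x by auto
 moreover have "(++k:{..<n}. (q [^] k) [^] j**f 0 k) = (++k:{..<n}. ?x [^] k)"
 using q by (intro finsum_cong') (auto simp: f0 nat_pow_pow mult.commute)
 ultimately show ?thesis by simp
 qed
 next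
 case (Suc s)
 let ?a = "q [^] Suc s"
 have "(q [^] k) [^] j**f (Suc s) k = (q [^] k) [^] Suc j**f s k +: (\<ominus> ?a)**((q [^] k) [^] j**f s k)" for k
 proof -
 have "(q [^] k) [^] j**f (Suc s) k = (q [^] k) [^] j**(q [^] k**f s k) +: (q [^] k) [^] j**(\<ominus> ?a**f s k)"
 unfolding fS a_minus_def using qc fc qc[of "Suc s"] by (simp add: l_distr r_distr)
 thus ?thesis using qc fc qc[of "Suc s"] nat_pow_Suc[of "q [^] k" j] by (simp add: m_ac)
 qed
 hence "(++k:{..<n}. (q [^] k) [^] j**f (Suc s) k) =
 (++k:{..<n}. (q [^] k) [^] Suc j**f s k +: (\<ominus> ?a)**((q [^] k) [^] j**f s k))" by simp
 also have "... = (++k:{..<n}. (q [^] k) [^] Suc j**f s k) +: (++k:{..<n}. (\<ominus> ?a)**((q [^] k) [^] j**f s k))"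
 using qc fc q(1) by (intro finsum_addf) (auto)
 also have "(++k:{..<n}. (\<ominus> ?a)**((q [^] k) [^] j**f s k)) = (\<ominus> ?a)**(++k:{..<n}. (q [^] k) [^] j**f s k)"
 using qc fc q(1) by (intro finsum_rdistr[symmetric]) (auto)
 finally show ?case using Suc.IH[of j] Suc.IH[of "Suc j"] Suc.prems qc[of "Suc s"] by (simp)
 qed
 have f_zero: "f (n - 1) k = 0:" if "0 < k" "k < n" for k
 proof -
 have "f (n - 1) k = (\<Otimes>l\<in>insert (k - 1) ({..<n - 1} - {k - 1}). q [^] k \<ominus> q [^] Suc l)"
 unfolding f_def using that by (intro arg_cong[of _ _ "finprod R _"]) auto
 also have "... = (q [^] k \<ominus> q [^] Suc (k - 1))**(\<Otimes>l\<in>{..<n - 1} - {k - 1}. q [^] k \<ominus> q [^] Suc l)"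
 using qc q(1) by (intro finprod_insert) (auto)
 also have "q [^] k \<ominus> q [^] Suc (k - 1) = 0:" using that qc by (simp add: a_minus_def r_neg del: nat_pow_Suc)
 also have "0:**(\<Otimes>l\<in>{..<n - 1} - {k - 1}. q [^] k \<ominus> q [^] Suc l) = 0:"
 using qc q(1) by (intro l_null finprod_closed) auto
 finally show ?thesis .
 qed
 have nonzero: "f s 0 ~= 0:" if "s < n" for s
 using that
 proof (induction s)
 case 0
 show ?case by (simp add: f_def)
 next
 case (Suc s)
 have "q [^] (0 ::nat) \<ominus> q [^] Suc s ~= 0:" using prim[of "Suc s"] Suc.prems qc[of "Suc s"] by simp
 thus ?case using Suc fS[of s 0] integral[of "q [^] (0 ::nat) \<ominus> q [^] Suc s" "f s 0"] fc qc[of "Suc s"] by (auto)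
 qed
 \<comment> \<open>The polynomial of degree n - 1 vanishing at all points except 1: its sum over the
   points is a single nonzero value.\<close>
 have "(++k:{..<n}. (q [^] k) [^] (0 ::nat)**f (n - 1) k) = (++k:{..<n}. if 0 = k then f (n - 1) k else 0:)"
 using f_zero fc by (intro finsum_cong') auto
 also have "... = f (n - 1) 0" using n fc by (intro finsum_singleton) auto
 finally show False using S[of 0 "n - 1"] nonzero[of "n - 1"] n by simp
qed

context coprime_gwa
begin

lemma N_one_nonzero: "add_pow K N 1: ~= 0:"
proof -
 have prod: "add_pow K (a * c) 1: = add_pow K a 1:**add_pow K c 1:" for a c :: nat
 proof (induction a)
 case (Suc a)
 have "add_pow K (Suc a * c) 1: = add_pow K c 1: +: add_pow K (a * c) 1:" using add.nat_pow_mult[of \<one> c "a * c"] by simp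
 thus ?case using Suc add.nat_pow_closed[of \<one>] by (simp add: l_distr a_comm)
 qed (use add.nat_pow_closed[of \<one>] in simp)
 have one: "add_pow K (nn 0 i) 1: ~= 0:" if i: "i < m 0" for i
 proof (rule primitive_root_order_nonzero)
 show "q 0 i :.K" "q 0 i [^] nn 0 i = 1:" "0 < nn 0 i" using G.q_props(1)[OF i] nat_pow_q[OF i] n_pos[OF i] .
 show "q 0 i [^] k ~= 1:" if "0 < k" "k < nn 0 i" for k
 using q_pow_eq_one[OF s0 i, of "int k"] q_pow[OF s0 i, of k] that nat_dvd_not_less[of k "nn 0 i"] by auto
 qed
 have "add_pow K (\<Prod>i<n. nn 0 i) 1: ~= 0:" if "n <= m 0" for n
 using that
 proof (induction n)
 case (Suc n)
 have "add_pow K (\<Prod>i<n. nn 0 i) 1:**add_pow K (nn 0 n) 1: ~= 0:"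
 using Suc one[of n] integral[of "add_pow K (\<Prod>i<n. nn 0 i) 1:" "add_pow K (nn 0 n) 1:"] add.nat_pow_closed[of \<one>] by auto
 thus ?case by (simp add: prod)
 qed (use add.nat_pow_closed[of \<one>] in simp)
 thus ?thesis unfolding N_def by simp
qed

text \<open>Weight 1 for t, weight \<open>co 0 i\<close> for x_i with i in \<open>Y\<close>, and 0
  for the other x_i. The least exponent of y_i then has weight 0 for i in \<open>Y\<close>, which is
  why this measures t-degrees after the exchange of x_i and y_i. \<open>cY Y\<close> is the weight
  of x_1 ... x_m.\<close>

definition nu where "nu Y g = lkt g 0 + (\<Sum>i\<in>{..<m 0} \<inter> Y. co 0 i * lkx g 0 i)"
definition cY where "cY Y = (\<Sum>i\<in>{..<m 0} \<inter> Y. co 0 i)"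

lemma nu_add: "nu Y (g + d) = nu Y g + nu Y d" and nu_diff: "nu Y (g - d) = nu Y g - nu Y d"
 by (simp_all add: nu_def lk distrib_left right_diff_distrib sum.distrib sum_subtractf)

text \<open>For each j the order n_j divides the i-th summand: for j = i through the x-exponent, for
  j different from i through \<open>nn_dvd_co\<close>. Hence so does their product
  \<open>N\<close>.\<close>

lemma nu_G0: assumes "g : G0" shows "int N dvd nu Y g"
proof -
 have "int N dvd co 0 i * lkx g 0 i" if i: "i < m 0" for i
 proof (rule N_dvd)
 show "int (nn 0 j) dvd co 0 i * lkx g 0 i" if "j < m 0" for j
 using nn_dvd_co[OF s0 i that] assms that by (cases "i = j") (auto simp: G0_def)
 qed
 thus ?thesis using assms unfolding nu_def by (intro dvd_add dvd_sum) (auto simp: G0_def)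
qed

lemma nu_ga: "nu Y (ga (cY Y) r) = int (r mod N)"
 by (simp add: nu_def ga_lk cY_def sum_distrib_left mult.commute)

text \<open>A negative degree k in x_i brings the t-degree -k \<open>co 0 i\<close>, which
  compensates the weight k \<open>co 0 i\<close> it may contribute. Further exponents in the image
  of a monomial have only larger t-exponents.\<close>

lemma nu_Ph: assumes "x :.W" "Ph x g ~= 0:" shows "0 <= nu Y g"
 using b_span[OF assms(1)] assms(2)
proof (induction arbitrary: g rule: lspan.induct)
 case zero
 thus ?case using alg_hom_zero[OF Ph G.W.ring_axioms T.T.L.ring_axioms] by (simp add: T.T.L_zero)
next
 case (step k y x)
 obtain r where r: "r : R" "y = b r" using step(2) by blast
 have c: "y :.W" "x :.W" using r b_closed lspan_closed[OF B step(3) b_img] by auto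
 have "Ph (k *:.W y +:.W x) g = k**Ph y g +: Ph x g"
 using step(1) c by (simp add: alg_hom_add[OF Ph] alg_hom_smult[OF Ph] T.T.L_add T.T.L_smult)
 then consider "Ph x g ~= 0:" | "Ph (b r) g ~= 0:" using step(1,5) r(2) by fastforce
 thus ?case
 proof cases
 case 2
 have "lkt r 0 + (\<Sum>i<m 0. max 0 (- lkx r 0 i) * co 0 i) <= lkt g 0" using b_degree(2)[OF r(1) 2] s0 by (simp add: lowr_lkt dl_def)
 moreover have "(\<Sum>i\<in>{..<m 0} \<inter> Y. co 0 i * lkx g 0 i) = (\<Sum>i<m 0. if i : Y then co 0 i * lkx r 0 i else 0)"
 using b_degree(1)[OF r(1) 2] by (simp add: sum.inter_restrict)
 moreover have "0 <= (\<Sum>i<m 0. max 0 (- lkx r 0 i) * co 0 i) + (\<Sum>i<m 0. if i : Y then co 0 i * lkx r 0 i else 0)"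
 unfolding sum.distrib[symmetric]
 proof (rule sum_nonneg)
 fix i assume "i : {..<m 0}"
 have "0 <= co 0 i" by (simp add: co_def)
 hence "0 <= co 0 i * (max 0 (- lkx r 0 i) + lkx r 0 i)" "0 <= max 0 (- lkx r 0 i) * co 0 i" by (auto intro!: mult_nonneg_nonneg)
 thus "0 <= max 0 (- lkx r 0 i) * co 0 i + (if i : Y then co 0 i * lkx r 0 i else 0)" by (auto simp: algebra_simps)
 qed
 ultimately show ?thesis using R_ge[OF r(1), of 0] unfolding nu_def by linarith
 qed (use step.IH in blast)
qed

abbreviation LR where "LR == L\<lparr>carrier := L0\<rparr>"

lemma LR_cring: "cring LR"
proof -
 have "subring L0 L"
 proof (rule T.T.L.subringI)
 show "L0 <= car L" using L0_car by blast
 show "1:.L : L0" by (simp add: T.T.L_one L0_sg G0_ops)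
 show "\<ominus>.L f : L0" if "f : L0" for f
 proof -
 have "\<ominus>.L f = (\<ominus> 1:) *:.L f" using T.T.L.smult_l_minus[of \<one> f] L0_car[OF that] by simp
 moreover have "f g ~= 0:" if "((\<ominus> 1:) *:.L f) g ~= 0:" for g using that by (auto simp: T.T.L_smult)
 ultimately show ?thesis using L0_supp[OF that] T.T.L.smult_closed[OF _ L0_car[OF that], of "\<ominus> 1:"] by (simp add: L0_def)
 qed
 show "f +:.L g : L0" if fg: "f : L0" "g : L0" for f g
 proof -
 have "f x ~= 0: | g x ~= 0:" if "(f +:.L g) x ~= 0:" for x using that by (auto simp: T.T.L_add)
 thus ?thesis using fg T.T.L.a_closed[OF L0_car[OF fg(1)] L0_car[OF fg(2)]] unfolding L0_def by blast
 qed
 qed (rule L0_mult)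
 hence "ring LR" by (rule T.T.L.subring_is_ring)
 then interpret S: ring LR .
 show ?thesis
 by (intro cring.intro S.ring_axioms comm_monoid.intro S.monoid_axioms comm_monoid_axioms.intro) (simp add: L0_comm L0_car)
qed

sublocale S: cring LR by (rule LR_cring)

definition VI where "VI Y d = {f : L0. ALL g. f g ~= 0: --> d <= nu Y g}"

lemma VI_L0: "f : VI Y d ==> f : L0" by (simp add: VI_def)

lemma VI_ops: "0:.L : VI Y d" "1:.L : VI Y 0" "f : VI Y d ==> g : VI Y d ==> f +:.L g : VI Y d"
 "f : VI Y d ==> \<ominus>.LR f : VI Y d" "f : VI Y d ==> g : VI Y e ==> f**.L g : VI Y (d + e)"
proof -
 have "0:.L : L0" "1:.L : L0" using S.zero_closed S.one_closed by auto
 thus "0:.L : VI Y d" "1:.L : VI Y 0" by (auto simp: VI_def T.T.L_zero T.T.L_one single_def nu_def split: if_splits)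
 show ad: "f +:.L g : VI Y d" if "f : VI Y d" "g : VI Y d" for f g
 proof -
 have "f x ~= 0: | g x ~= 0:" if "(f +:.L g) x ~= 0:" for x using that by (auto simp: T.T.L_add)
 moreover have "f +:.L g : L0" using S.a_closed[of f g] that VI_L0 by simp
 ultimately show ?thesis using that unfolding VI_def by blast
 qed
 show "f**.L g : VI Y (d + e)" if f: "f : VI Y d" and g: "g : VI Y e" for f g e
 unfolding VI_def
 proof (intro CollectI conjI allI impI)
 show "f**.L g : L0" using f g L0_mult VI_L0 by blast
 fix x assume "(f**.L g) x ~= 0:"
 then obtain a c where ac: "f a ~= 0:" "g c ~= 0:" "x = a + c"
 using mult_support L0_car VI_L0 f g by metis
 hence "d <= nu Y a" "e <= nu Y c" using f g by (auto simp: VI_def)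
 thus "d + e <= nu Y x" by (simp add: ac(3) nu_add)
 qed
 show "\<ominus>.LR f : VI Y d" if f: "f : VI Y d"
 proof -
 have m: "\<ominus>.LR f : L0" using S.a_inv_closed[of f] VI_L0[OF f] by simp
 have "f +:.L \<ominus>.LR f = 0:.L" using S.r_neg[of f] VI_L0[OF f] by simp
 hence "f g +: (\<ominus>.LR f) g = 0:" for g by (simp add: T.T.L_add T.T.L_zero fun_eq_iff)
 hence "f g ~= 0:" if "(\<ominus>.LR f) g ~= 0:" for g using that T.T.L_value[OF L0_car[OF m], of g] by (metis l_zero)
 thus ?thesis using f m by (auto simp: VI_def)
 qed
qed

lemma VI_sum: "finite J ==> (!!i. i : J ==> F i : VI Y d) ==> (++.LR i:J. F i) : VI Y d"
proof (induction J rule: finite_induct)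
 case (insert a J)
 hence "(++.LR i:insert a J. F i) = F a +:.L (++.LR i:J. F i)" using VI_L0 by (subst S.finsum_insert) auto
 thus ?case using insert VI_ops(3) by simp
qed (simp add: VI_ops(1))

lemma VI_prod: "finite J ==> (!!i. i : J ==> F i : VI Y (d i)) ==> (\<Otimes>.LR i\<in>J. F i) : VI Y (\<Sum>i\<in>J. d i)"
proof (induction J rule: finite_induct)
 case (insert a J)
 hence "(\<Otimes>.LR i\<in>insert a J. F i) = F a**.L (\<Otimes>.LR i\<in>J. F i)" using VI_L0 by (subst S.finprod_insert) auto
 thus ?case using insert VI_ops(5) by simp
qed (simp add: VI_ops(2))

lemma LR_finsum: "finite J ==> F : J \<rightarrow> L0 ==> (++.LR i:J. F i) = (++.L i:J. F i)"
proof (induction J rule: finite_induct)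
 case (insert a J)
 have "(++.LR i:insert a J. F i) = F a +:.L (++.LR i:J. F i)" using insert by (subst S.finsum_insert) (auto simp: Pi_iff)
 moreover have "(++.L i:insert a J. F i) = F a +:.L (++.L i:J. F i)" using insert L0_car by (subst T.T.L.finsum_insert) (auto simp: Pi_iff)
 ultimately show ?case using insert by simp
qed simp

lemma rs_finsum: "finite J ==> F : J \<rightarrow> car L ==> rs C (++.L i:J. F i) = (++.L i:J. rs C (F i))"
proof (induction J rule: finite_induct)
 case (insert a J)
 thus ?case by (subst (1 2) T.T.L.finsum_insert) (auto simp: rs_add Pi_iff)
qed (simp add: rs_zero)

definition kN where "kN = add_pow K (N * N) 1:"

lemma kN: "kN :.K" by (simp add: kN_def)

lemma add_pow_center: assumes y: "y :.D.Z" shows "add_pow D.Z (n::nat) y = add_pow K n 1: *:.W y"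
proof -
 interpret Z: domain D.Z by (rule D.Z_domain)
 have yc: "y :.W" using D.Z_car[OF y] .
 show ?thesis
 proof (induction n)
 case 0
 thus ?case using yc by (simp add: D.Z_ops(4) G.W.smult_l_null)
 next
 case (Suc n)
 thus ?case using yc add.nat_pow_closed[of \<one> n] by (simp add: D.Z_ops(5) G.W.smult_l_distr)
 qed
qed

abbreviation det where "det u u' == ring_det D.Z (N * N) (%i j. add_pow D.Z (N * N) (pi (u i**.W u' j)))"

text \<open>Weights of lattice exponents are multiples of \<open>N\<close>, so a weight of at least
  \<open>r mod N\<close> is a weight of at least \<open>ee r\<close>. Of the N^2 classes, N (N - 1)
  have nonzero residue, which makes the total \<open>dd\<close>.\<close>

definition ee :: "nat => nat" where "ee r = (if r mod N = 0 then 0 else N)"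
definition dd where "dd = N * (N * (N - 1))"

lemma sum_ee: "(\<Sum>r<N * N. ee r) = dd"
proof -
 have "(\<Sum>r\<in>{k * N..<k * N + N}. ee r) = N * (N - 1)" for k
 proof -
 have "(\<Sum>r\<in>{k * N..<k * N + N}. ee r) = (\<Sum>j\<in>{0..<N}. ee (j + k * N))"
 using sum.shift_bounds_nat_ivl[of ee 0 "k * N" N] by (simp add: add.commute)
 also have "... = (\<Sum>j\<in>{0..<N}. if j = 0 then 0 else N)" by (intro sum.cong) (auto simp: ee_def)
 also have "... = (\<Sum>j\<in>{0..<N} - {0}. N)" using N_pos by (subst sum.remove[of _ 0]) (auto intro: sum.cong)
 finally show ?thesis using N_pos by simp
 qed
 hence "(\<Sum>k<N. \<Sum>r\<in>{k * N..<k * N + N}. ee r) = dd" by (simp add: dd_def)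
 thus ?thesis by (simp add: sum.nat_group)
qed

lemma Ph_ring_hom: "Ph : ring_hom D.Z LR"
 using Z_L0 D.Z_car alg_hom_mult[OF Ph] alg_hom_add[OF Ph] alg_hom_one[OF Ph] by (auto simp: ring_hom_def D.Z_ops(2,3,5))

text \<open>Splitting the left arguments into classes factors the trace matrix as \<open>Xm\<close>
  times \<open>Bm\<close>, with entries in the commutative ring of lattice elements.
  \<open>Xm\<close> has weights at least 0 and row r of \<open>Bm\<close> weights at least
  \<open>ee r\<close>. In the row expansion a repeated row gives zero, and otherwise all rows occur
  once, with total weight at least \<open>dd\<close>.\<close>

lemma det_bound:
 assumes u: "u : {..<N * N} \<rightarrow> car W" "u' : {..<N * N} \<rightarrow> car W"
 shows "Ph (det u u') : VI Y (int dd)"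
proof -
 interpret Z: domain D.Z by (rule D.Z_domain)
 let ?w = "N * N" and ?C = "cY Y"
 let ?g = "ga ?C"
 define E where "E r = sg (?g r) 1:" for r
 \<comment> \<open>The class component of \<open>u i\<close> divided by the monomial of its class
   representative; the cocycle value in the coefficient makes \<open>X0E\<close> an exact
   identity.\<close>
 define X0 where "X0 i r = rs (cls ?C r) (Ph (u i))**.L sg (- ?g r) (cc (?g r) (?g r))" for i r
 define Xm where "Xm i r = kN *:.L X0 i r" for i r
 define Bm where "Bm r j = rs G0 (E r**.L Ph (u' j))" for r j
 have uc: "i < ?w ==> u i :.W" "i < ?w ==> u' i :.W" for i using u by auto
 have Uc: "i < ?w ==> Ph (u i) :.L" "i < ?w ==> Ph (u' i) :.L" for i using uc Ph_closed by auto
 have Ec: "E r :.L" for r by (simp add: E_def)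
 have X0E: "X0 i r**.L E r = rs (cls ?C r) (Ph (u i))" if "i < ?w" for i r
 proof -
 have "cc (- ?g r) (?g r)**cc (?g r) (?g r) = 1:" using T.c_add_left[of "- ?g r" "?g r" "?g r"] by simp
 hence "sg (- ?g r) (cc (?g r) (?g r))**.L E r = 1:.L" by (simp add: E_def T.sg_mult T.T.L_one)
 thus ?thesis using Uc(1)[OF that] Ec by (simp add: X0_def T.T.L.m_assoc)
 qed
 have X0V: "X0 i r : VI Y 0" if i: "i < ?w" for i r
 unfolding VI_def L0_def
 proof (intro CollectI conjI allI impI)
 show "X0 i r :.L" using Uc(1)[OF i] by (simp add: X0_def)
 fix g assume "X0 i r g ~= 0:"
 then obtain a c where a: "rs (cls ?C r) (Ph (u i)) a ~= 0:" "sg (- ?g r) (cc (?g r) (?g r)) c ~= 0:" "g = a + c"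
 unfolding X0_def using Uc(1)[OF i] by (elim mult_support[rotated 2]) auto
 have g: "g = a - ?g r" using a(2,3) by (auto simp: single_def split: if_splits)
 have a1: "a : cls ?C r" "Ph (u i) a ~= 0:" using rs_supp[OF a(1)] by auto
 thus G: "g : G0" by (simp add: g cls_def)
 have "nu Y g = nu Y a - int (r mod N)" unfolding g by (simp add: nu_diff nu_ga)
 moreover have "0 <= nu Y a" using nu_Ph[OF uc(1)[OF i] a1(2)] .
 moreover have "int (r mod N) < int N" using N_pos by simp
 \<comment> \<open>Division by the representative may cost up to N - 1, but the result is a lattice
   exponent, whose weight is a multiple of \<open>N\<close>; so the weight cannot be
   negative.\<close>
 ultimately have lt: "- int N < nu Y g" by linarith
 obtain t where t: "nu Y g = int N * t" using nu_G0[OF G, of Y] by (auto elim: dvdE)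
 have "- 1 < t" using lt N_pos unfolding t by (metis mult.right_neutral mult_less_cancel_left_pos mult_minus_right of_nat_0_less_iff)
 thus "0 <= nu Y g" unfolding t by simp
 qed
 have kX: "X0 i r g ~= 0:" if "kN**X0 i r g ~= 0:" for i r g using that kN by (metis r_null)
 have XV: "Xm i r : VI Y 0" if "i < ?w" for i r
 using kX X0V[OF that, of r] T.T.L.smult_closed[OF kN, of "X0 i r"] kN by (auto simp: Xm_def VI_def L0_def T.T.L_smult)
 have BV: "Bm r j : VI Y (int (ee r))" if j: "j < ?w" for r j
 unfolding VI_def
 proof (intro CollectI conjI allI impI)
 show "Bm r j : L0" unfolding Bm_def by (rule rs_L0) (use Uc(2)[OF j] Ec in simp)
 fix g assume "Bm r j g ~= 0:"
 hence g: "g : G0" "(E r**.L Ph (u' j)) g ~= 0:" using rs_supp unfolding Bm_def by blast+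
 obtain a c where a: "E r a ~= 0:" "Ph (u' j) c ~= 0:" "g = a + c" using mult_support[OF Ec Uc(2)[OF j] g(2)] .
 have "a = ?g r" using a(1) by (auto simp: E_def single_def split: if_splits)
 hence ge: "int (r mod N) <= nu Y g" using nu_Ph[OF uc(2)[OF j] a(2), of Y] by (simp add: a(3) nu_add nu_ga)
 show "int (ee r) <= nu Y g"
 proof (cases "r mod N = 0")
 case False
 hence "int N <= nu Y g" using nu_G0[OF g(1), of Y] ge by (intro zdvd_imp_le) auto
 thus ?thesis using False by (simp add: ee_def)
 qed (use ge in \<open>simp add: ee_def\<close>)
 qed
 have XL: "i < ?w ==> Xm i r : L0" "j < ?w ==> Bm r j : L0" for i j r using XV BV VI_L0 by blast+
 have entry: "Ph (add_pow D.Z ?w (pi (u i**.W u' j))) = (++.LR r:{..<?w}. Xm i r**.LR Bm r j)" if i: "i < ?w" and j: "j < ?w" for i j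
 proof -
 have uu: "u i**.W u' j :.W" using uc i j by simp
 have "Ph (add_pow D.Z ?w (pi (u i**.W u' j))) = kN *:.L rs G0 (Ph (u i)**.L Ph (u' j))"
 using add_pow_center[OF pi(1)[OF uu]] alg_hom_smult[OF Ph kN D.Z_car[OF pi(1)[OF uu]]] pi(2)[OF uu] alg_hom_mult[OF Ph uc(1)[OF i] uc(2)[OF j]]
 by (simp add: kN_def)
 also have "Ph (u i)**.L Ph (u' j) = (++.L r:{..<?w}. rs (cls ?C r) (Ph (u i)))**.L Ph (u' j)" by (simp add: rs_partition[OF Uc(1)[OF i]])
 also have "... = (++.L r:{..<?w}. rs (cls ?C r) (Ph (u i))**.L Ph (u' j))" using Uc i j by (intro T.T.L.finsum_ldistr) auto
 also have "rs G0 ... = (++.L r:{..<?w}. rs G0 (rs (cls ?C r) (Ph (u i))**.L Ph (u' j)))" using Uc i j by (intro rs_finsum) auto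
 also have "kN *:.L ... = (++.L r:{..<?w}. kN *:.L rs G0 (rs (cls ?C r) (Ph (u i))**.L Ph (u' j)))"
 using Uc i j kN by (intro T.T.L.finsum_smult_ldistr) auto
 also have "... = (++.L r:{..<?w}. Xm i r**.L Bm r j)"
 proof (rule T.T.L.finsum_cong')
 show "(%r. Xm i r**.L Bm r j) : {..<?w} \<rightarrow> car L" using XL i j L0_car by auto
 fix r
 note x0 = X0V[OF i, of r, THEN VI_L0]
 have "rs G0 (X0 i r**.L (E r**.L Ph (u' j))) = X0 i r**.L Bm r j"
 unfolding Bm_def by (rule rs_mult(1)) (use L0_car[OF x0] L0_supp[OF x0] G0_add Ec Uc(2)[OF j] in auto)
 hence "rs G0 (rs (cls ?C r) (Ph (u i))**.L Ph (u' j)) = X0 i r**.L Bm r j"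
 unfolding X0E[OF i, symmetric] using L0_car[OF x0] Ec Uc(2)[OF j] by (simp add: T.T.L.m_assoc)
 thus "kN *:.L rs G0 (rs (cls ?C r) (Ph (u i))**.L Ph (u' j)) = Xm i r**.L Bm r j"
 unfolding Xm_def using T.T.L.smult_mult_left[OF kN L0_car[OF x0] L0_car[OF XL(2)[OF j]]] by simp
 qed simp
 also have "... = (++.LR r:{..<?w}. Xm i r**.L Bm r j)" using XL i j L0_mult by (intro LR_finsum[symmetric]) auto
 finally show ?thesis by simp
 qed
 have pz: "add_pow D.Z ?w (pi (u i**.W u' j)) :.D.Z" if "i < ?w" "j < ?w" for i j
 using uc that pi(1) by (intro Z.add.nat_pow_closed) simp
 have "Ph (det u u') = ring_det LR ?w (%i j. Ph (add_pow D.Z ?w (pi (u i**.W u' j))))"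
 by (rule ring_det_hom[OF Z.is_cring LR_cring Ph_ring_hom pz])
 also have "... = ring_det LR ?w (%i j. ++.LR r:{..<?w}. Xm i r**.LR Bm r j)"
 using XL L0_mult by (intro S.det_cong entry) (auto intro!: S.finsum_closed[simplified])
 also have "... = (++.LR rh:({..<?w} \<rightarrow>\<^sub>E {..<?w}). (\<Otimes>.LR i\<in>{..<?w}. Xm i (rh i))**.LR ring_det LR ?w (%i j. Bm (rh i) j))"
 using XL by (intro S.det_row_expansion) auto
 also have "... : VI Y (int dd)"
 proof (rule VI_sum)
 fix rh assume rh: "rh : {..<?w} \<rightarrow>\<^sub>E {..<?w}"
 have 1: "(\<Otimes>.LR i\<in>{..<?w}. Xm i (rh i)) : VI Y 0" using VI_prod[of "{..<?w}" "%i. Xm i (rh i)" Y "%_. 0"] XV by simp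
 have 2: "ring_det LR ?w (%i j. Bm (rh i) j) : VI Y (int dd)"
 proof (cases "inj_on rh {..<?w}")
 case True
 hence "bij_betw rh {..<?w} {..<?w}" using rh endo_inj_surj[of "{..<?w}" rh] by (auto simp: bij_betw_def)
 hence "(\<Sum>i<?w. ee (rh i)) = dd" using sum_ee sum.reindex_bij_betw[of rh "{..<?w}" "{..<?w}" ee] by simp
 hence s: "(\<Sum>i<?w. int (ee (rh i))) = int dd" by (simp flip: of_nat_sum)
 have "(\<Otimes>.LR i\<in>{..<?w}. Bm (rh i) (p i)) : VI Y (int dd)" if p: "p permutes {..<?w}" for p
 using VI_prod[of "{..<?w}" "%i. Bm (rh i) (p i)" Y "%i. int (ee (rh i))"] BV permutes_in_image[OF p] unfolding s by auto
 thus ?thesis unfolding ring_det_def by (intro VI_sum) (auto simp: finite_permutations VI_ops(4))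
 next
 case False
 then obtain i i' where "i < ?w" "i' < ?w" "i ~= i'" "rh i = rh i'" by (auto simp: inj_on_def)
 hence "ring_det LR ?w (%i j. Bm (rh i) j) = 0:.LR" using XL(2) by (intro S.det_equal_rows[of _ _ i i']) auto
 thus ?thesis using VI_ops(1) by simp
 qed
 show "(\<Otimes>.LR i\<in>{..<?w}. Xm i (rh i))**.LR ring_det LR ?w (%i j. Bm (rh i) j) : VI Y (int dd)"
 using VI_ops(5)[OF 1 2] by simp
 qed (simp add: finite_PiE)
 finally show ?thesis .
qed

text \<open>The pattern \<open>Y\<close> is fitted to each index separately: with the negative
  x-exponents in \<open>Y\<close>, the weight of the least exponent is exactly the t-exponent of the
  index. So all monomials needed for \<open>z\<close> contain t^dd; the quotient is central because
  t^dd is and cancels.\<close>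

lemma divisible_of_bounds:
 assumes z: "z :.D.Z" and V: "!!Y. Ph z : VI Y (int dd)"
 shows "EX c:car D.Z. z = tw dd**.W c"
proof -
 have zc: "z :.W" using D.Z_car[OF z] .
 have t: "tw dd :.D.Z" by (rule tw_central) (simp add: dd_def)
 let ?Q = "%r. int dd <= lkt r 0"
 have "z : lspan K W (b ` {r : R. ?Q r})"
 proof (rule span_of_support[OF zc])
 fix r assume r: "r : R" "Ph z (lowr r) ~= 0:"
 \<comment> \<open>For this choice the weights of the x cancel the shift \<open>dl\<close>.\<close>
 let ?Y = "{i. lkx r 0 i < 0}"
 have "int dd <= nu ?Y (lowr r)" using V r(2) by (auto simp: VI_def)
 moreover have "(\<Sum>i\<in>{..<m 0} \<inter> ?Y. co 0 i * lkx r 0 i) = (\<Sum>i<m 0. - (max 0 (- lkx r 0 i) * co 0 i))"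
 by (subst sum.inter_restrict) (auto intro!: sum.cong)
 ultimately show "?Q r" using s0 by (simp add: nu_def lowr_lkt dl_def sum_negf)
 qed (auto simp: lq_def intro: order_trans)
 moreover have "EX w:car W. y = tw dd**.W w" if yb: "y : b ` {r : R. ?Q r}" for y
 proof -
 obtain r where r: "y = b r" "?Q r" using yb by blast
 have "nat (lkt r 0) = dd + (nat (lkt r 0) - dd)" using r(2) by simp
 hence "tw (nat (lkt r 0)) = tw dd**.W tw (nat (lkt r 0) - dd)" using tw_add[of dd "nat (lkt r 0) - dd"] by simp
 hence "y = tw dd**.W (tw (nat (lkt r 0) - dd)**.W G.zz (m 0) (%i. lkx r 0 i))"
 unfolding r(1) mon_def using tw_closed by (simp add: G.W.m_assoc)
 thus ?thesis using tw_closed by (intro bexI) auto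
 qed
 moreover have "b ` {r : R. ?Q r} <= car W" using b_closed by auto
 ultimately obtain c where c: "c :.W" "z = tw dd**.W c" using left_multiples[OF tw_closed] by meson
 have nz: "tw dd ~= 0:.W" using Ph_t[of dd] T.sg_nonzero one_not_zero alg_hom_zero[OF Ph G.W.ring_axioms T.T.L.ring_axioms] by metis
 have "c**.W y = y**.W c" if y: "y :.W" for y
 proof -
 have "tw dd**.W (c**.W y) = y**.W (tw dd**.W c)"
 using D.Z_comm[OF z y] c tw_closed y by (simp add: G.W.m_assoc)
 also have "... = tw dd**.W (y**.W c)" using D.Z_comm[OF t y] c tw_closed[of dd] y by (simp flip: G.W.m_assoc)
 finally have "tw dd**.W (c**.W y \<ominus>.W y**.W c) = 0:.W"
 using c y tw_closed[of dd] by (simp add: a_minus_def G.W.r_distr G.W.r_minus G.W.r_neg)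
 thus ?thesis using B_integral[OF tw_closed, of "c**.W y \<ominus>.W y**.W c"] nz c y by auto
 qed
 thus ?thesis using c by (auto simp: D.Z_iff)
qed

end

section \<open>The reflexive hull of the discriminant ideal\<close>

context coprime_gwa
begin

lemma ze_degree: assumes "Ph (G.zz (m 0) f) g ~= 0:" "i < m 0" shows "lkx g 0 i = f i"
proof -
 have "lq (\<Sum>i<m 0. zlow 0 i (f i)) g" using low_zz[OF s0 order_refl, of f] assms(1) by (simp add: T.low_at_def)
 hence "lkx (\<Sum>i<m 0. zlow 0 i (f i)) 0 i = lkx g 0 i" by (simp add: lq_def)
 thus ?thesis using assms(2) by (simp add: zlow_def lookup_sum lk sum.distrib)
qed

lemma tw_supp: "Ph (tw k) g ~= 0: ==> g = tk 0 (int k)"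
 by (auto simp: Ph_t single_def split: if_splits)

lemma nonzero: "Ph x g ~= 0: ==> x ~= 0:.W"
 using alg_hom_zero[OF Ph G.W.ring_axioms T.T.L.ring_axioms] by (auto simp: T.T.L_zero)

lemma tw_nz: "tw k ~= 0:.W" using nonzero[of "tw k" "tk 0 (int k)"] by (simp add: Ph_t single_def)

lemma ze_nz: "ze Y a ~= 0:.W"
 using nonzero low_zz[OF s0 order_refl, of "%i. if i : Y then - int a else int a"] unfolding ze_def T.low_at_def by blast

text \<open>Dual families adapted to the pattern \<open>Y\<close>. In contrast to \<open>v'\<close>,
  the t-exponent in \<open>uv\<close> is reduced modulo \<open>N\<close>: residue 0 is paired with 0
  and not with \<open>N\<close>. The diagonal value is thus t^(ee r) times z_Y^N, meeting the lower
  bound for the weight.\<close>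

definition uu where "uu Y r = tw (r mod N)**.W ze Y (r div N)"
definition uv where "uv Y r = ze Y (N - r div N)**.W tw ((N - r mod N) mod N)"

lemma uu_closed: "uu Y r :.W" "uv Y r :.W" using tw_closed by (simp_all add: uu_def uv_def)

lemma small_multiple: "int N dvd int x - int y ==> x < N ==> y < N ==> x = y"
 using dvd_imp_le_int[of "int x - int y" "int N"] by (cases "x = y") auto

text \<open>If the x-classes differ, the x-exponents of the product leave the lattice. If they
  agree, the product is a power of t times the central z_Y^N, and it is in the lattice only for
  equal t-residues.\<close>

lemma pi_diag:
 assumes r: "r < N * N" "r' < N * N"
 shows "pi (uu Y r**.W uv Y r') = (if r = r' then tw (ee r)**.W ze Y N else 0:.W)"
proof -
 let ?k = "r mod N" and ?av = "r div N" and ?k' = "(N - r' mod N) mod N" and ?\<beta> = "N - r' div N"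
 have P: "uu Y r**.W uv Y r' = tw ?k**.W (ze Y (?av + ?\<beta>)**.W tw ?k')"
 unfolding uu_def uv_def ze_add[symmetric] using tw_closed by (simp add: G.W.m_assoc)
 have Pc: "uu Y r**.W uv Y r' :.W" using uu_closed by simp
 have supp: "EX c. Ph (ze Y (?av + ?\<beta>)) c ~= 0: & g = tk 0 (int ?k) + (c + tk 0 (int ?k'))" if g: "Ph (uu Y r**.W uv Y r') g ~= 0:" for g
 proof -
 have "(Ph (tw ?k)**.L (Ph (ze Y (?av + ?\<beta>))**.L Ph (tw ?k'))) g ~= 0:"
 using g tw_closed unfolding P by (simp add: alg_hom_mult[OF Ph])
 note * = mult_support[OF _ _ this]
 note cl = Ph_closed[OF tw_closed] Ph_closed[OF ze_closed]
 obtain a d where a: "Ph (tw ?k) a ~= 0:" "(Ph (ze Y (?av + ?\<beta>))**.L Ph (tw ?k')) d ~= 0:" "g = a + d"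
 using *[OF cl(1) T.T.L.m_closed[OF cl(2,1)]] .
 obtain c e where "Ph (ze Y (?av + ?\<beta>)) c ~= 0:" "Ph (tw ?k') e ~= 0:" "d = c + e"
 using mult_support[OF cl(2,1) a(2)] .
 thus ?thesis using a tw_supp by blast
 qed
 have lt: "?av < N" "r' div N < N" "?k < N" "r' mod N < N" using r div_less N_pos by auto
 show ?thesis
 proof (cases "?av = r' div N")
 case False
 have "g \<notin> G0" if g: "Ph (uu Y r**.W uv Y r') g ~= 0:" for g
 proof
 assume G: "g : G0"
 obtain c where c: "Ph (ze Y (?av + ?\<beta>)) c ~= 0:" "g = tk 0 (int ?k) + (c + tk 0 (int ?k'))" using supp[OF g] by blast
 have "int N dvd int (?av + ?\<beta>)"
 proof (rule N_dvd)
 fix i assume i: "i < m 0"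
 have "int (nn 0 i) dvd lkx c 0 i" using G i by (simp add: c(2) G0_def lk)
 thus "int (nn 0 i) dvd int (?av + ?\<beta>)" using ze_degree[OF c(1)[unfolded ze_def] i] by (metis dvd_minus_iff)
 qed
 hence "int N dvd int (?av + ?\<beta>) - int N" by (rule dvd_diff) simp
 moreover have "int (?av + ?\<beta>) - int N = int ?av - int (r' div N)" using lt(2) by (simp add: of_nat_diff)
 ultimately show False using small_multiple[OF _ lt(1,2)] False by simp
 qed
 thus ?thesis using pi_zero[OF Pc] False by auto
 next
 case True
 have ab: "?av + ?\<beta> = N" using True lt by simp
 have zN: "ze Y N :.D.Z" by (rule ze_central) simp
 have P': "uu Y r**.W uv Y r' = tw (?k + ?k')**.W ze Y N"
 unfolding P ab D.Z_comm[OF zN tw_closed] tw_add[symmetric] using tw_closed by (simp add: G.W.m_assoc)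
 show ?thesis
 proof (cases "r = r'")
 case eq: True
 have "?k + ?k' = ee r" using lt(3) by (cases "?k = 0") (auto simp: eq ee_def)
 hence "uu Y r**.W uv Y r' = tw (ee r)**.W ze Y N" using P' by simp
 moreover have "tw (ee r)**.W ze Y N :.D.Z" by (rule D.Z_closed(3)[OF tw_central zN]) (simp add: ee_def)
 ultimately show ?thesis using pi_central eq by simp
 next
 case ne: False
 have kk: "?k ~= r' mod N" using True ne div_mult_mod_eq[of r N] div_mult_mod_eq[of r' N] by metis
 have "g \<notin> G0" if g: "Ph (uu Y r**.W uv Y r') g ~= 0:" for g
 proof
 assume G: "g : G0"
 obtain c where c: "Ph (ze Y N) c ~= 0:" "g = tk 0 (int ?k) + (c + tk 0 (int ?k'))" using supp[OF g] unfolding ab by blast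
 have "int N dvd lkt c 0" using L0_supp[OF Z_L0[OF zN] c(1)] by (simp add: G0_def)
 moreover have "int N dvd int ?k + (lkt c 0 + int ?k')" using G by (simp add: c(2) G0_def lk)
 ultimately have "int N dvd (int ?k + (lkt c 0 + int ?k')) - lkt c 0" by (intro dvd_diff)
 hence "int N dvd int (?k + ?k')" by simp
 hence d: "N dvd ?k + ?k'" by (rule of_nat_dvd_iff[THEN iffD1])
 show False
 proof (cases "r' mod N = 0")
 case True
 hence "N dvd ?k" using d by simp
 thus False using kk True lt(3) by (auto dest: nat_dvd_not_less)
 next
 case False
 hence "?k' = N - r' mod N" using lt by simp
 hence "int N dvd int (?k + (N - r' mod N))" using d by (simp only: of_nat_dvd_iff)
 moreover have "int (?k + (N - r' mod N)) - int N = int ?k - int (r' mod N)" using lt(4) by (simp add: of_nat_diff)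
 ultimately have "int N dvd int ?k - int (r' mod N)" by (metis dvd_diff dvd_refl)
 thus False using small_multiple[OF _ lt(3,4)] kk by simp
 qed
 qed
 thus ?thesis using pi_zero[OF Pc] ne by simp
 qed
 qed
qed

text \<open>The product of the diagonal values: z_Y occurs \<open>N\<close> times in each of the N^2
  rows, whence the cube.\<close>

definition MY where "MY Y = tw dd**.W ze Y (N * (N * N))"

lemma dd_central: "tw dd :.D.Z" by (rule tw_central) (simp add: dd_def)
lemma zw_central: "ze Y (N * (N * N)) :.D.Z" by (rule ze_central) simp
lemma MY_central: "MY Y :.D.Z" unfolding MY_def by (rule D.Z_closed(3)[OF dd_central zw_central])

lemma scalar_central: assumes k: "k :.K" and z: "z :.D.Z" shows "k *:.W z :.D.Z"
proof -
 have "Ph z g ~= 0:" if "k**Ph z g ~= 0:" for g using that k by (metis r_null)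
 hence "k *:.L Ph z : L0"
 using T.T.L.smult_closed[OF k L0_car[OF Z_L0[OF z]]] L0_supp[OF Z_L0[OF z]] unfolding L0_def by (simp add: T.T.L_smult)
 thus ?thesis
 using central_iff[OF G.W.smult_closed[OF k D.Z_car[OF z]]] alg_hom_smult[OF Ph k D.Z_car[OF z]] by simp
qed

lemma det_value: "det (uu Y) (uv Y) = (kN [^] (N * N)) *:.W MY Y"
proof -
 interpret Z: domain D.Z by (rule D.Z_domain)
 let ?x = "%r. tw (ee r)**.W ze Y N"
 have xc: "?x r :.D.Z" for r by (rule D.Z_closed(3)[OF tw_central ze_central]) (simp_all add: ee_def)
 have zero: "0:.W = 0:.D.Z" by (simp add: D.Z_ops)
 have a: "add_pow D.Z (N * N) (?x r) = kN *:.W ?x r" for r unfolding kN_def by (rule add_pow_center[OF xc])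
 have "det (uu Y) (uv Y) = (\<Otimes>.D.Z r\<in>{..<N * N}. add_pow D.Z (N * N) (pi (uu Y r**.W uv Y r)))"
 proof (rule Z.det_diagonal)
 show "add_pow D.Z (N * N) (pi (uu Y i**.W uv Y j)) :.D.Z" for i j
 using pi(1) uu_closed by (intro Z.add.nat_pow_closed) simp
 show "add_pow D.Z (N * N) (pi (uu Y i**.W uv Y j)) = 0:.D.Z" if "i < N * N" "j < N * N" "i ~= j" for i j
 using pi_diag[OF that(1,2), of Y] that(3) by (simp add: zero)
 qed
 also have "... = (\<Otimes>.D.Z r\<in>{..<N * N}. kN *:.W ?x r)"
 using pi_diag a scalar_central[OF kN xc] by (intro Z.finprod_cong') auto
 also have "... = (kN [^] (N * N)) *:.W (tw (\<Sum>r<N * N. ee r)**.W ze Y (N * (N * N)))"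
 proof -
 have "(\<Otimes>.D.Z r\<in>{..<n}. kN *:.W ?x r) = (kN [^] n) *:.W (tw (\<Sum>r<n. ee r)**.W ze Y (N * n))" for n
 proof (induction n)
 case 0
 have "ze Y 0 = G.zz (m 0) (%j. 0)" unfolding ze_def by (rule G.zz_cong) simp
 hence "ze Y 0 = 1:.W" using G.zz_single[of "m 0" "m 0" 0] by simp
 moreover have "tw 0 = 1:.W" using G.cf_one by (simp add: UPK.monom_one)
 ultimately show ?case by (simp add: D.Z_ops(3))
 next
 case (Suc n)
 let ?t = "tw (\<Sum>r<n. ee r)" and ?z = "ze Y (N * n)"
 have tc: "?t :.W" "tw (ee n) :.W" by (rule tw_closed)+
 have kc: "kN [^] n :.K" using kN by simp
 have tz: "?t**.W ?z :.W" using tc by simp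
 have xW: "?x n :.W" using D.Z_car[OF xc] .
 have "(\<Otimes>.D.Z r\<in>{..<Suc n}. kN *:.W ?x r) = (kN *:.W ?x n)**.W ((kN [^] n) *:.W (?t**.W ?z))"
 unfolding lessThan_Suc using scalar_central[OF kN xc] Suc by (subst Z.finprod_insert) (auto simp: D.Z_ops(2))
 also have "... = kN *:.W ((kN [^] n) *:.W (?x n**.W (?t**.W ?z)))"
 using tc by (simp only: G.W.smult_mult_left[OF kN xW G.W.smult_closed[OF kc tz]] G.W.smult_mult_right[OF kc xW tz])
 also have "... = (kN [^] Suc n) *:.W (?x n**.W (?t**.W ?z))"
 unfolding nat_pow_Suc m_comm[OF kc kN] using kN kc xW tc by (intro G.W.smult_assoc1[symmetric]) auto
 also have "?x n**.W (?t**.W ?z) = tw (ee n)**.W (ze Y N**.W ?t)**.W ?z" using tc by (simp add: G.W.m_assoc)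
 also have "ze Y N**.W ?t = ?t**.W ze Y N" by (rule D.Z_comm[OF ze_central tw_closed]) simp
 also have "tw (ee n)**.W (?t**.W ze Y N)**.W ?z = (tw (ee n)**.W ?t)**.W (ze Y N**.W ?z)"
 using tc by (simp add: G.W.m_assoc)
 finally show ?case by (simp add: tw_add ze_add add.commute)
 qed
 thus ?thesis .
 qed
 finally show ?thesis unfolding sum_ee MY_def .
qed

abbreviation MD where "MD == modified_discriminant_ideal W"
abbreviation gens where "gens == {z : car D.Z. EX u u'. u : {..<N * N} \<rightarrow> car W & inj_on u {..<N * N} &
 u' : {..<N * N} \<rightarrow> car W & inj_on u' {..<N * N} & z = det u u'}"

lemma det_center: assumes "u : {..<N * N} \<rightarrow> car W" "u' : {..<N * N} \<rightarrow> car W" shows "det u u' :.D.Z"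
proof -
 interpret Z: domain D.Z by (rule D.Z_domain)
 show ?thesis using assms pi(1) by (intro Z.det_closed Z.add.nat_pow_closed) (auto simp: Pi_iff)
qed

text \<open>The traces are images of central elements under an injective ring homomorphism, and
  determinants commute with homomorphisms, so the determinants may be formed in the center
  itself.\<close>

lemma MD_eq: "MD = Idl\<^bsub>D.Z\<^esub> gens"
proof -
 have CL: "center_localization W" by (intro center_localization.intro D.noncomm_domain_axioms)
 note E = center_localization.embedding[OF CL]
 interpret Z: domain D.Z by (rule D.Z_domain)
 interpret F: cring "center_field W" by (rule E(3))
 have *: "center_embedding W z = ring_det (center_field W) (N * N) (%i j. regular_trace W (u i**.W u' j)) \<longleftrightarrow> z = det u u'"
 if z: "z :.D.Z" and u: "u : {..<N * N} \<rightarrow> car W" "u' : {..<N * N} \<rightarrow> car W" for z u u'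
 proof -
 have a: "add_pow D.Z (N * N) (pi (u i**.W u' j)) :.D.Z" if "i < N * N" "j < N * N" for i j
 using u that pi(1) by (intro Z.add.nat_pow_closed) (auto simp: Pi_iff)
 have "ring_det (center_field W) (N * N) (%i j. regular_trace W (u i**.W u' j)) =
 ring_det (center_field W) (N * N) (%i j. center_embedding W (add_pow D.Z (N * N) (pi (u i**.W u' j))))"
 using u a ring_hom_closed[OF E(1)] by (intro F.det_cong trace_value) (auto simp: Pi_iff)
 also have "... = center_embedding W (det u u')" by (rule ring_det_hom[OF Z.is_cring E(3,1) a, symmetric])
 finally show ?thesis using inj_on_eq_iff[OF E(2) z det_center[OF u]] by simp
 qed
 have "gens = {z : car D.Z. EX u u'. u : {..<N * N} \<rightarrow> car W & inj_on u {..<N * N} & u' : {..<N * N} \<rightarrow> car W & inj_on u' {..<N * N} &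
 center_embedding W z = ring_det (center_field W) (N * N) (%i j. regular_trace W (u i**.W u' j))}"
 by (intro Collect_cong conj_cong refl ex_cong1) (rule *[symmetric]; assumption)
 thus ?thesis unfolding modified_discriminant_ideal_def rank Let_def by simp
qed

text \<open>The bounds for all patterns give divisibility of the generators by t^dd. The scalar in
  \<open>det_value\<close> is a power of N^2, nonzero because each n_i is the order of a root of
  unity in the field (\<open>N_one_nonzero\<close>), so it can be divided out.\<close>

lemma MD_facts: "ideal MD D.Z" "x : MD ==> EX c:car D.Z. x = tw dd**.W c" "MY Y : MD"
proof -
 interpret Z: domain D.Z by (rule D.Z_domain)
 have sub: "gens <= car D.Z" by blast
 show I: "ideal MD D.Z" unfolding MD_eq by (rule Z.genideal_ideal[OF sub])
 have "gens <= PIdl\<^bsub>D.Z\<^esub> (tw dd)"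
 proof
 fix z assume "z : gens"
 then obtain u u' where u: "u : {..<N * N} \<rightarrow> car W" "u' : {..<N * N} \<rightarrow> car W" "z = det u u'" by blast
 obtain c where c: "c :.D.Z" "z = tw dd**.W c"
 using divisible_of_bounds[OF det_center[OF u(1,2)] det_bound[OF u(1,2)]] u(3) by blast
 thus "z : PIdl\<^bsub>D.Z\<^esub> (tw dd)" using D.Z_comm[OF c(1) tw_closed] unfolding cgenideal_def D.Z_ops(2) by auto
 qed
 hence "MD <= PIdl\<^bsub>D.Z\<^esub> (tw dd)" unfolding MD_eq by (rule Z.genideal_minimal[OF Z.cgenideal_ideal[OF dd_central]])
 then obtain c where "c :.D.Z" "x = c**.W tw dd" if "x : MD"
 unfolding cgenideal_def D.Z_ops(2) by blast
 thus "EX c:car D.Z. x = tw dd**.W c" if "x : MD" using that D.Z_comm[OF _ tw_closed[of dd]] by metis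
 have k: "kN [^] (N * N) :.K" "kN [^] (N * N) ~= 0:"
 proof -
 have "add_pow K (N * n) 1: = add_pow K N 1:**add_pow K n 1:" for n
 using add.nat_pow_pow[of \<one> N n] add_pow_ldistr[of \<one> "add_pow K n 1:" N] add.nat_pow_closed[of \<one>] by (simp add: mult.commute)
 hence "kN ~= 0:" using N_one_nonzero integral[of "add_pow K N 1:" "add_pow K N 1:"] add.nat_pow_closed[of \<one>] by (auto simp: kN_def)
 hence "kN [^] n ~= 0:" for n :: nat using kN integral[of "kN [^] _" kN] by (induction n) auto
 thus "kN [^] (N * N) ~= 0:" "kN [^] (N * N) :.K" using kN by auto
 qed
 let ?i = "inv (kN [^] (N * N))"
 have i: "?i :.K" "?i**kN [^] (N * N) = 1:" using k field_Units by (auto intro!: Units_l_inv)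
 have diag_nz: "tw (ee r)**.W ze Y N ~= 0:.W" for r using B_integral[OF tw_closed ze_closed] tw_nz ze_nz by blast
 \<comment> \<open>Two equal members would make a zero off-diagonal projection equal to a nonzero
   diagonal one.\<close>
 have inj: "inj_on (uu Y) {..<N * N}" "inj_on (uv Y) {..<N * N}"
 using pi_diag[of _ _ Y] diag_nz by (auto intro!: inj_onI) metis+
 have "det (uu Y) (uv Y) : gens" using inj uu_closed det_center[of "uu Y" "uv Y"] by blast
 hence "det (uu Y) (uv Y) : MD" unfolding MD_eq using Z.genideal_self[OF sub] by blast
 hence "(?i *:.W 1:.W)**.D.Z det (uu Y) (uv Y) : MD"
 by (rule ideal.I_l_closed[OF I]) (rule scalar_central[OF i(1) D.Z_closed(1)])
 also have "(?i *:.W 1:.W)**.D.Z det (uu Y) (uv Y) = ?i *:.W ((kN [^] (N * N)) *:.W MY Y)"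
 using i(1) k(1) D.Z_car[OF MY_central] unfolding det_value D.Z_ops(2) by (simp add: G.W.smult_mult_left)
 also have "... = MY Y" using i k(1) D.Z_car[OF MY_central] by (simp flip: G.W.smult_assoc1)
 finally show "MY Y : MD" .
qed

text \<open>Monomials whose x_i-degree minus \<open>e\<close> has the sign of \<open>e\<close>
  factor as a monomial times the power \<open>G.zp i e\<close>, by \<open>zz_add\<close>. So the
  quotient exists in the algebra for that part of \<open>s'\<close> whose x_i-degrees have the sign
  of \<open>e\<close>.\<close>

lemma half_quotient:
 assumes i: "i < m 0" and s: "s' :.L" and y: "y :.W" "s'**.L Ph (G.zp i e) = Ph y"
 and Pd: "!!a. Pd a ==> 0 <= a * e"
 shows "EX c:car W. Ph c = rs {g. Pd (lkx g 0 i)} s'"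
proof -
 let ?z = "G.zp i e" and ?f = "%j. if j = i then e else 0"
 have zz: "G.zz (m 0) ?f = ?z" using G.zz_single[of "m 0" i e] i by simp
 have zc: "?z :.W" using i by simp
 have deg: "lkx g 0 i = e" if "Ph ?z g ~= 0:" for g using ze_degree[of ?f g i] that zz i by simp
 let ?C = "{g. Pd (lkx g 0 i - e)}"
 obtain x where x: "x : lspan K W (b ` {r : R. lowr r : ?C})" "Ph x = rs ?C (Ph y)"
 using restriction[OF y(1), of ?C] b_degree(1) by fastforce
 have base: "EX c:car W. b r = c**.W ?z" if r: "r : R" "lowr r : ?C" for r
 proof -
 let ?a = "%j. lkx r 0 j - ?f j"
 have "G.zz (m 0) ?a**.W ?z = G.zz (m 0) (%j. ?a j + ?f j)"
 unfolding zz[symmetric] using Pd[of "lkx r 0 i - e"] r(2) by (intro G.zz_add) auto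
 also have "(%j. ?a j + ?f j) = (%j. lkx r 0 j)" by auto
 finally have "b r = (tw (nat (lkt r 0))**.W G.zz (m 0) ?a)**.W ?z"
 unfolding mon_def using tw_closed zc by (simp add: G.W.m_assoc)
 thus ?thesis using tw_closed by (intro bexI) auto
 qed
 have "EX c:car W. x = c**.W ?z" using x(1)
 proof (induction rule: lspan.induct)
 case zero
 show ?case using zc by (intro bexI[of _ "0:.W"]) auto
 next
 case (step k u x)
 obtain c where c: "c :.W" "u = c**.W ?z" using base step(2) by blast
 obtain d where d: "d :.W" "x = d**.W ?z" using step(4) by blast
 have "k *:.W u +:.W x = (k *:.W c +:.W d)**.W ?z"
 using step(1) c d zc by (simp add: G.W.smult_mult_left G.W.l_distr)
 thus ?case using G.W.a_closed[OF G.W.smult_closed[OF step(1) c(1)] d(1)] by blast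
 qed
 then obtain c where c: "c :.W" "x = c**.W ?z" by blast
 have "rs ?C (s'**.L Ph ?z) = rs {g. Pd (lkx g 0 i)} s'**.L Ph ?z"
 using s Ph_closed[OF zc] deg by (intro rs_mult(2)) (auto simp: lk)
 hence "Ph c**.L Ph ?z = rs {g. Pd (lkx g 0 i)} s'**.L Ph ?z"
 using x(2) c alg_hom_mult[OF Ph c(1) zc] y(2) by simp
 moreover have "Ph ?z ~= 0:.L"
 using low_zz[OF s0 order_refl, of ?f] zz by (auto simp: T.low_at_def T.T.L_zero)
 ultimately have "Ph c = rs {g. Pd (lkx g 0 i)} s'"
 using T.L_rcancel[of "Ph c" "rs {g. Pd (lkx g 0 i)} s'" "Ph ?z"] Ph_closed[OF c(1)] Ph_closed[OF zc] s by simp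
 thus ?thesis using c(1) by blast
qed

text \<open>The indices are removed one at a time, the last one first. For a fixed pattern on the
  earlier indices, both signs at index \<open>n\<close> are available, and each of them recovers one
  half of the element.\<close>

lemma quotient_descent:
 assumes "n <= m 0" "s' :.L" "!!Y. s'**.L Ph (G.zz n (%i. if i : Y then - int p else int p)) : Ph ` car W"
 shows "s' : Ph ` car W"
 using assms
proof (induction n arbitrary: s')
 case 0
 thus ?case using alg_hom_one[OF Ph] by simp
next
 case (Suc n)
 have n: "n < m 0" using Suc.prems by simp
 show ?case
 proof (rule Suc.IH[OF less_imp_le[OF n] Suc.prems(2)])
 fix Y
 let ?zY = "%Y n. G.zz n (%i. if i : Y then - int p else int p)"
 let ?t = "s'**.L Ph (?zY Y n)"
 have zc: "?zY Y n :.W" "G.zp n e :.W" for e using n by auto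
 have tc: "?t :.L" using Suc.prems(2) Ph_closed[OF zc(1)] by simp
 have step: "EX y:car W. ?t**.L Ph (G.zp n (if n : Y' then - int p else int p)) = Ph y"
 if Y': "!!i. i < n ==> i : Y' \<longleftrightarrow> i : Y" for Y'
 proof -
 let ?e = "if n : Y' then - int p else int p"
 have "?zY Y' (Suc n) = ?zY Y n**.W G.zp n ?e" using G.zz_cong[of n "%i. if i : Y' then - int p else int p" "%i. if i : Y then - int p else int p"] Y' by simp
 hence "?t**.L Ph (G.zp n ?e) = s'**.L Ph (?zY Y' (Suc n))"
 using Suc.prems(2) Ph_closed zc alg_hom_mult[OF Ph zc] by (simp add: T.T.L.m_assoc)
 thus ?thesis using Suc.prems(3)[of Y'] by auto
 qed
 \<comment> \<open>The power of x_n handles the nonnegative degrees in x_n, the power of y_n below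
   the negative ones; the two restrictions add up to the element.\<close>
 obtain y where y: "y :.W" "?t**.L Ph (G.zp n (int p)) = Ph y" using step[of "Y - {n}"] by auto
 obtain y' where y': "y' :.W" "?t**.L Ph (G.zp n (- int p)) = Ph y'" using step[of "insert n Y"] by auto
 obtain c where c: "c :.W" "Ph c = rs {g. 0 <= lkx g 0 n} ?t"
 using half_quotient[OF n tc y, of "%a. 0 <= a"] by auto
 obtain c' where c': "c' :.W" "Ph c' = rs {g. lkx g 0 n < 0} ?t"
 using half_quotient[OF n tc y', of "%a. a < 0"] by (auto simp: mult_nonpos_nonneg)
 have "- {g. 0 <= lkx g 0 n} = {g. lkx g 0 n < 0}" by auto
 hence "?t = Ph (c +:.W c')" using rs_split[OF tc, of "{g. 0 <= lkx g 0 n}"] c c' by (simp add: alg_hom_add[OF Ph])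
 thus "?t : Ph ` car W" using c(1) c'(1) by simp
 qed
qed

text \<open>For a linear form \<open>f\<close>, the symmetry x f(y) = y f(x) makes f(MY Y) the
  product of one torus element \<open>s'\<close> with a power of z_Y, for every \<open>Y\<close>.
  Descent puts \<open>s'\<close> into the algebra, and the same symmetry shows that t^dd
  \<open>f\<close> is multiplication by \<open>s'\<close>, as the criterion for a principal hull
  requires.\<close>

lemma hull: "reflexive_hull D.Z MD = PIdl\<^bsub>D.Z\<^esub> (tw dd)"
proof -
 interpret Z: domain D.Z by (rule D.Z_domain)
 interpret I: ideal MD D.Z by (rule MD_facts(1))
 have mW: "x**.D.Z y = x**.W y" for x y by (simp add: D.Z_ops(2))
 show ?thesis
 proof (rule Z.reflexive_hull_principal[OF MD_facts(1) dd_central])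
 show "tw dd ~= 0:.D.Z" using tw_nz by (simp add: D.Z_ops(4))
 show "EX c:car D.Z. x = tw dd**.D.Z c" if "x : MD" for x using MD_facts(2)[OF that] by (simp add: mW)
 show "MY {} : MD" by (rule MD_facts(3))
 show "MY {} ~= 0:.D.Z" unfolding MY_def D.Z_ops(4) using B_integral[OF tw_closed ze_closed] tw_nz ze_nz by blast
 fix f assume "f : module_hom D.Z (ideal_module D.Z MD) (with_smult D.Z (\<otimes>.D.Z))"
 hence f: "f : MD \<rightarrow> car D.Z" "!!c x. c :.D.Z ==> x : MD ==> f (c**.W x) = c**.W f x"
 by (auto simp: module_hom_def ideal_module_def with_smult_def mW)
 have swap: "x**.W f y = y**.W f x" if "x : MD" "y : MD" for x y
 using f(2)[OF I.Icarr[OF that(1)] that(2)] f(2)[OF I.Icarr[OF that(2)] that(1)] D.Z_comm[OF I.Icarr[OF that(1)] D.Z_car[OF I.Icarr[OF that(2)]]] by simp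
 define y where "y Y = f (MY Y)" for Y
 have yc: "y Y :.D.Z" for Y using f(1) MD_facts(3) by (auto simp: y_def)
 have sw: "Ph (MY {}**.W y Y) = Ph (MY Y**.W y {})" for Y using swap[OF MD_facts(3)[of "{}"] MD_facts(3)[of Y]] by (simp only: y_def)
 let ?X = "\<Sum>i<m 0. xk 0 i (int (N * (N * N)))"
 \<comment> \<open>For the empty pattern the power of z_Y is a torus monomial and can be inverted;
   the lattice keeps the quotient among the central elements.\<close>
 define s' where "s' = Ph (y {})**.L sg (- ?X) 1:"
 have z0: "Ph (ze {} (N * (N * N))) = sg ?X 1:" by (rule Ph_ze)
 have XG: "?X : G0" using Z_L0[OF zw_central, of "{}"] L0_supp[of _ ?X] unfolding z0 by (simp add: single_def)
 have s'0: "s' : L0" unfolding s'_def by (rule L0_mult[OF Z_L0[OF yc] L0_sg]) (use XG G0_ops in auto)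
 have y0L: "Ph (y {}) = s'**.L Ph (ze {} (N * (N * N)))"
 proof -
 have "sg (- ?X) 1:**.L sg ?X 1: = 1:.L" using cc_G0(2)[OF XG] by (simp add: sg_one_mult T.T.L_one)
 thus ?thesis unfolding z0 s'_def using L0_car[OF Z_L0[OF yc]] by (simp add: T.T.L.m_assoc)
 qed
 have "s'**.L Ph (ze Y (N * (N * N))) = Ph (y Y)" for Y
 proof -
 let ?t = "Ph (tw dd)" and ?z = "Ph (ze Y (N * (N * N)))" and ?o = "Ph (ze {} (N * (N * N)))"
 have L: "?t : L0" "?z : L0" "?o : L0" "Ph (y Y) : L0" using Z_L0 dd_central zw_central yc by auto
 have "?t**.L ?o**.L Ph (y Y) = ?t**.L ?z**.L Ph (y {})"
 using sw[of Y] D.Z_car[OF yc] tw_closed unfolding MY_def by (simp add: alg_hom_mult[OF Ph])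
 hence eq: "(?t**.L ?o)**.L Ph (y Y) = (?t**.L ?o)**.L (s'**.L ?z)"
 unfolding y0L using S.m_assoc[of ?t ?z "s'**.L ?o"] S.m_lcomm[of ?z s' ?o] S.m_comm[of ?z ?o] S.m_lcomm[of ?o s' ?z] S.m_assoc[of ?t ?o "s'**.L ?z"] L s'0 L0_mult by simp
 have nz: "?t**.L ?o ~= 0:.L"
 using T.L_integral[OF L0_car[OF L(1)] L0_car[OF L(3)]] Ph_eq_zero[OF tw_closed] Ph_eq_zero[OF ze_closed] tw_nz ze_nz by auto
 show ?thesis
 using T.L_lcancel[OF L0_car[OF L(4)] L0_car[OF L0_mult[OF s'0 L(2)]] L0_car[OF L0_mult[OF L(1,3)]] nz eq, symmetric] .
 qed
 hence "s' : Ph ` car W"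
 using D.Z_car[OF yc] by (intro quotient_descent[OF order_refl L0_car[OF s'0], of "N * (N * N)"]) (auto simp: ze_def)
 then obtain c where c: "c :.W" "s' = Ph c" by blast
 have cZ: "c :.D.Z" using central_iff[OF c(1)] s'0 c(2) by simp
 have y0: "y {} = c**.W ze {} (N * (N * N))"
 by (rule Ph_inj) (use y0L c D.Z_car[OF yc] alg_hom_mult[OF Ph c(1) ze_closed] in auto)
 show "EX c:car D.Z. ALL x:MD. tw dd**.D.Z f x = c**.D.Z x"
 proof (intro bexI[of _ c] ballI cZ)
 fix x assume x: "x : MD"
 let ?o = "ze {} (N * (N * N))"
 have cs: "x :.D.Z" "f x :.D.Z" "?o :.D.Z" "tw dd :.D.Z" using I.Icarr[OF x] f(1) x zw_central dd_central by auto
 have "(tw dd**.D.Z ?o)**.D.Z f x = x**.D.Z (c**.D.Z ?o)"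
 using swap[OF MD_facts(3)[of "{}"] x] y0 unfolding y_def MY_def mW by simp
 hence "?o**.D.Z (tw dd**.D.Z f x) = ?o**.D.Z (c**.D.Z x)"
 using cs cZ by (simp add: Z.m_ac)
 thus "tw dd**.D.Z f x = c**.D.Z x"
 using Z.m_lcancel[of ?o "tw dd**.D.Z f x" "c**.D.Z x"] cs cZ ze_nz by (simp add: D.Z_ops(4))
 qed
 qed
qed

lemma discriminant: "is_R_discriminant W d \<longleftrightarrow> d :.D.Z & PIdl\<^bsub>D.Z\<^esub> d = PIdl\<^bsub>D.Z\<^esub> (tw dd)"
 using hull setting unfolding is_R_discriminant_def by auto

lemma part_one:
 "EX n::nat. center_rank W = n\<^sup>2 & (EX d. is_R_discriminant W d) &
 (ALL d. is_R_discriminant W d --> eq_up_to_unit D.Z d (tw 1 [^].W (n\<^sup>2 * (n - 1))))"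
proof (intro exI[of _ N] conjI allI impI)
 interpret Z: domain D.Z by (rule D.Z_domain)
 show "center_rank W = N\<^sup>2" by (simp add: rank power2_eq_square)
 show "EX d. is_R_discriminant W d" using discriminant dd_central by blast
 have "tw 1 [^].W k = tw k" for k :: nat
 proof (induction k)
 case 0
 show ?case using G.cf_one by (simp add: UPK.monom_one)
 next
 case (Suc k)
 thus ?case using tw_add[of k 1] by simp
 qed
 hence t: "tw 1 [^].W (N\<^sup>2 * (N - 1)) = tw dd" by (simp add: dd_def power2_eq_square mult.assoc)
 fix d assume d: "is_R_discriminant W d"
 hence dc: "d :.D.Z" and e: "PIdl\<^bsub>D.Z\<^esub> d = PIdl\<^bsub>D.Z\<^esub> (tw dd)" using discriminant by auto
 have "d \<sim>.D.Z tw dd" using Z.associated_iff_same_ideal[OF dc dd_central] e by simp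
 then obtain c where "c : Units D.Z" "d = c**.D.Z tw dd" using Z.ring_associated_iff[OF dc dd_central] by auto
 thus "eq_up_to_unit D.Z d (tw 1 [^].W (N\<^sup>2 * (N - 1)))" unfolding eq_up_to_unit_def t by blast
qed

end

lemma coprime_gwa_of_data:
 assumes K: "field K" and d: "coprime_quantum_gwa_data K m q \<sigma> h"
 shows "coprime_gwa K 1 (%_. m) (%_. q) (%_. \<sigma>) (%_. h)"
proof -
 have qd: "quantum_gwa_data K m q \<sigma> h" using d by (simp add: coprime_quantum_gwa_data_def)
 interpret weyl_family K 1 "%_. m" "%_. q" "%_. \<sigma>" "%_. h" by (intro weyl_family.intro weyl_family_axioms.intro K qd)
 have Q: "qgwa K m q \<sigma> h" using qgwa[of 0] by simp
 show ?thesis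
 proof (intro coprime_gwa.intro coprime_gwa_axioms.intro weyl_family_axioms refl)
 show "0 < nn 0 i" if "i < m" for i
 using qgwa.ord_ge_2[OF Q that] d that unfolding nn_def coprime_quantum_gwa_data_def by fastforce
 show "coprime (nn 0 i) (nn 0 j)" if "i < m" "j < m" "i ~= j" for i j
 using qgwa.aut_order_eq[OF Q that(1)] qgwa.aut_order_eq[OF Q that(2)] d that
 unfolding nn_def coprime_quantum_gwa_data_def by metis
 qed
qed

theorem theorem0p8:
  fixes K :: "('k, 'e) ring_scheme"
  assumes "field K"
  shows
    "(\<forall>m q \<sigma> h. coprime_quantum_gwa_data K m q \<sigma> h \<longrightarrow>
        (let W = gwa K (UP K) m \<sigma> h; t = gwa_coef K (UP K) m \<sigma> h (var_t K) in
          \<exists>n::nat. center_rank W = n\<^sup>2 \<and>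
            (\<exists>d. is_R_discriminant W d) \<and>
            (\<forall>d. is_R_discriminant W d \<longrightarrow>
               eq_up_to_unit (center W) d (t [^]\<^bsub>W\<^esub> (n\<^sup>2 * (n - 1))))))
     \<and>
     (char_zero K \<longrightarrow>
        (\<forall>(s::nat) m q \<sigma> h.
          (\<forall>l<s.
             (coprime_quantum_gwa_data K (m l) (q l) (\<sigma> l) (h l) \<or>
              (m l = 1 \<and> quantum_gwa_data K (m l) (q l) (\<sigma> l) (h l) \<and> root_of_unity K (q l 0))) \<and>
             (\<forall>i<m l. h l i \<notin> {monom (UP K) c 0 | c. c \<in> carrier K})) \<longrightarrow>
          cancellative TYPE('b) K
            (tensor_family K {..<s} (\<lambda>l. gwa K (UP K) (m l) (\<sigma> l) (h l)))))"
proof (intro conjI impI allI, goal_cases)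
  case (1 m q \<sigma> h)
  interpret coprime_gwa K 1 "\<lambda>_. m" "\<lambda>_. q" "\<lambda>_. \<sigma>" "\<lambda>_. h" by (rule coprime_gwa_of_data[OF assms 1])
  show ?case using part_one by (simp only: Let_def var_t_def)
next
  case (2 s m q \<sigma> h)
  show ?case by (rule quantum_tensor_cancellative[where q = q, OF assms 2(1)]) (use 2(2) in blast)
qed

end
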